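(* Let $1<p<\infty$ and $\omega\in\widehat{\mathcal{D}}$, and let $\nu$ be a radial weight on $\mathbb{D}$. Then the following statements are equivalent: (i) $P^+_\omega:L^p_\nu\to L^p_\nu$ is bounded; (ii) $D_p(\omega,\nu)<\infty$ and $\nu\in\mathcal{M}$; (iii) $A_p(\omega,\nu)<\infty$ and $\nu\in\mathcal{M}$; (iv) $M_p(\omega,\nu)<\infty$ and $\nu\in\mathcal{M}$.
   Context: Let $\mathbb{D}=\{z\in\mathbb{C}:|z|<1\}$, let $dA=\frac{dx\,dy}{\pi}$ be normalized area measure on $\mathbb{D}$, and let $\mathcal{H}(\mathbb{D})$ be the space of analytic functions in $\mathbb{D}$. A radial weight is a non-negative function $\omega\in L^1(\mathbb{D})$ with $\omega(z)=\omega(|z|)$ for all $z\in\mathbb{D}$; throughout it is assumed that $\widehat{\omega}(z)=\int_{|z|}^1\omega(s)\,ds>0$ for all $z\in\mathbb{D}$. For $0<p<\infty$, $L^p_\omega$ is the space of complex-valued measurable $f$ on $\mathbb{D}$ with $\|f\|_{L^p_\omega}^p=\int_{\mathbb{D}}|f|^p\omega\,dA<\infty$, and $A^p_\omega=L^p_\omega\cap\mathcal{H}(\mathbb{D})$. $B^\omega_z\in A^2_\omega$ denotes the reproducing kernel of $A^2_\omega$ at $z\in\mathbb{D}$: $f(z)=\int_{\mathbb{D}}f(\zeta)\overline{B^\omega_z(\zeta)}\omega(\zeta)\,dA(\zeta)$ for all $f\in A^2_\omega$. Equivalently $B^\omega_z(\zeta)=\sum_{n=0}^\infty\frac{(\overline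 z\zeta)^n}{2\omega_{2n+1}}$, where $\omega_x=\int_0^1r^x\omega(r)\,dr$. The maximal Bergman projection is $$P^+_\omega(f)(z)=\int_{\mathbb{D}}f(\zeta)|B^\omega_z(\zeta)|\,\omega(\zeta)\,dA(\zeta),\quad z\in\mathbb{D}.$$ Boundedness of $P^+_\omega:L^p_\nu\to L^p_\nu$ means that $P^+_\omega(f)$ is well defined for every $f\in L^p_\nu$ and $\|P^+_\omega(f)\|_{L^p_\nu}\le C\|f\|_{L^p_\nu}$ for some constant $C$. Classes of radial weights: $\omega\in\widehat{\mathcal{D}}$ if there is $C>0$ such that $\widehat\omega(r)\le C\widehat\omega\left(\frac{1+r}2\right)$ for all $r$ sufficiently close to $1$; $\omega\in\mathcal{M}$ if there are $C>1$ and $K>1$ such that $\omega_x\ge C\omega_{Kx}$ for all $x\ge1$. Further, $p'=\frac p{p-1}$, $\sigma=\left(\frac{\omega}{\nu^{1/p}}\right)^{p'}=\frac{\omega^{\frac p{p-1}}}{\nu^{\frac1{p-1}}}$ (with $\sigma=0$ where $\omega=\nu=0$ and $\sigma=\infty$ where $\nu=0<\omega$), and, with $\mathbb{N}=\{1,2,\dots\}$ and moments $\nu_x,\sigma_x$ defined as for $\omega$ (possibly $+\infty$ for $\sigma$), $$D_p(\omega,\nu)=\sup_{n\in\mathbb{N}\cup\{0\}}\frac{(\nu_{np+1})^{\frac1p}(\sigma_{np'+1})^{\frac1{p'}}}{\omega_{2n+1}},\qquad A_p(\omega,\nu)=\sup_{0\le r<1}\frac{\left(\int_r^1\nu(t)t\,dt\right)^{\frac1p}\left(\int_r^1\sigma(t)t\,dt\right)^{\frac1{p'}}}{\int_r^1\omega(t)t\,dt},$$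 $$M_p(\omega,\nu)=\sup_{0\le r<1}\left(\int_0^r\frac{\nu(s)s}{\left(\int_s^1\omega(t)t\,dt\right)^p}\,ds+1\right)^{\frac1p}\left(\int_r^1\sigma(t)t\,dt\right)^{\frac1{p'}}.$$ *)

theory Defs
  imports "HOL-Complex_Analysis.Complex_Analysis"
begin

abbreviation unit_disc :: "complex set" where
  "unit_disc \<equiv> ball 0 1"

definition dA :: "complex measure" where
  "dA = density (lebesgue_on unit_disc) (\<lambda>_. ennreal (1 / pi))"

(* Only exponents a > 0 are used. *)
definition ennpowr :: "ennreal \<Rightarrow> real \<Rightarrow> ennreal" where
  "ennpowr x a = (if x = \<infinity> then \<infinity> else ennreal (enn2real x powr a))"

definition conj_exp :: "real \<Rightarrow> real" where
  "conj_exp p = p / (p - 1)"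

(* The integral is taken in [0,\<infinity>]: \<omega> \<in> L^1(dA) only makes r \<omega>(r) integrable,
   so the value at z = 0 may be infinite. *)
definition hat :: "(complex \<Rightarrow> real) \<Rightarrow> complex \<Rightarrow> ennreal" where
  "hat w z = (\<integral>\<^sup>+s\<in>{norm z..<1}. ennreal (w (of_real s)) \<partial>lebesgue)"

(* Only the values on the unit disc matter. The positivity of the tail integrals is the
   standing assumption on every radial weight. *)
definition radial_weight :: "(complex \<Rightarrow> real) \<Rightarrow> bool" where
  "radial_weight w \<longleftrightarrow>
     (\<forall>z\<in>unit_disc. w z \<ge> 0) \<and>
     integrable dA w \<and>
     (\<forall>z\<in>unit_disc. w z = w (of_real (norm z))) \<and>
     (\<forall>z\<in>unit_disc. hat w z > 0)"

(* Moments and tail integrals are defined for [0,\<infinity>]-valued functions because they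
   are also applied to \<sigma>, which may take the value \<infinity>. *)
definition moment :: "(complex \<Rightarrow> ennreal) \<Rightarrow> real \<Rightarrow> ennreal" where
  "moment g x = (\<integral>\<^sup>+r\<in>{0..<1}. ennreal (r powr x) * g (of_real r) \<partial>lebesgue)"

definition tail :: "(complex \<Rightarrow> ennreal) \<Rightarrow> real \<Rightarrow> ennreal" where
  "tail g r = (\<integral>\<^sup>+t\<in>{r..<1}. g (of_real t) * ennreal t \<partial>lebesgue)"

definition Dhat :: "(complex \<Rightarrow> real) set" where
  "Dhat = {w. radial_weight w \<and>
     (\<exists>C>0. \<forall>\<^sub>F r in at_left (1::real).
        hat w (of_real r) \<le> ennreal C * hat w (of_real ((1 + r) / 2)))}"

definition classM :: "(complex \<Rightarrow> real) set" where
  "classM = {w. radial_weight w \<and>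
     (\<exists>C>1. \<exists>K>1. \<forall>x\<ge>1.
        moment (\<lambda>z. ennreal (w z)) x \<ge> ennreal C * moment (\<lambda>z. ennreal (w z)) (K * x))}"

definition Lp_norm :: "real \<Rightarrow> (complex \<Rightarrow> real) \<Rightarrow> (complex \<Rightarrow> complex) \<Rightarrow> ennreal" where
  "Lp_norm p w f = ennpowr (\<integral>\<^sup>+z. ennreal (norm (f z) powr p * w z) \<partial>dA) (1 / p)"

definition Lp :: "real \<Rightarrow> (complex \<Rightarrow> real) \<Rightarrow> (complex \<Rightarrow> complex) set" where
  "Lp p w = {f \<in> borel_measurable dA. Lp_norm p w f < \<infinity>}"

definition Bergman_space :: "real \<Rightarrow> (complex \<Rightarrow> real) \<Rightarrow> (complex \<Rightarrow> complex) set" where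
  "Bergman_space p w = Lp p w \<inter> {f. f holomorphic_on unit_disc}"

definition is_reproducing_kernel ::
    "(complex \<Rightarrow> real) \<Rightarrow> complex \<Rightarrow> (complex \<Rightarrow> complex) \<Rightarrow> bool" where
  "is_reproducing_kernel w z B \<longleftrightarrow>
     B \<in> Bergman_space 2 w \<and>
     (\<forall>f \<in> Bergman_space 2 w. f z = (\<integral>\<zeta>. f \<zeta> * cnj (B \<zeta>) * of_real (w \<zeta>) \<partial>dA))"

(* SOME instead of THE: the kernel is unique as a function on the unit disc, but its
   values outside the disc are unconstrained. *)
definition Bergman_kernel :: "(complex \<Rightarrow> real) \<Rightarrow> complex \<Rightarrow> complex \<Rightarrow> complex" where
  "Bergman_kernel w z = (SOME B. is_reproducing_kernel w z B)"

definition Pplus_integrand ::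
    "(complex \<Rightarrow> real) \<Rightarrow> (complex \<Rightarrow> complex) \<Rightarrow> complex \<Rightarrow> complex \<Rightarrow> complex" where
  "Pplus_integrand w f z \<zeta> = f \<zeta> * of_real (norm (Bergman_kernel w z \<zeta>)) * of_real (w \<zeta>)"

definition Pplus :: "(complex \<Rightarrow> real) \<Rightarrow> (complex \<Rightarrow> complex) \<Rightarrow> complex \<Rightarrow> complex" where
  "Pplus w f z = (\<integral>\<zeta>. Pplus_integrand w f z \<zeta> \<partial>dA)"

(* The integrability clause says that P^+(f) is well defined (the integral of a
   non-integrable function is 0 by convention). *)
definition Pplus_bounded :: "real \<Rightarrow> (complex \<Rightarrow> real) \<Rightarrow> (complex \<Rightarrow> real) \<Rightarrow> bool" where
  "Pplus_bounded p w v \<longleftrightarrow>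
     (\<exists>C::real. \<forall>f \<in> Lp p v.
        (\<forall>z\<in>unit_disc. integrable dA (Pplus_integrand w f z)) \<and>
        Pplus w f \<in> Lp p v \<and>
        Lp_norm p v (Pplus w f) \<le> ennreal C * Lp_norm p v f)"

definition sigma_weight ::
    "real \<Rightarrow> (complex \<Rightarrow> real) \<Rightarrow> (complex \<Rightarrow> real) \<Rightarrow> complex \<Rightarrow> ennreal" where
  "sigma_weight p w v z =
     (if v z = 0 then (if w z = 0 then 0 else \<infinity>)
      else ennreal ((w z / v z powr (1 / p)) powr conj_exp p))"

(* For radial weights the products below never have the form 0 * \<infinity>, and the
   denominators lie strictly between 0 and \<infinity>. *)
definition D_const :: "real \<Rightarrow> (complex \<Rightarrow> real) \<Rightarrow> (complex \<Rightarrow> real) \<Rightarrow> ennreal" where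
  "D_const p w v =
     (SUP n::nat.
        ennpowr (moment (\<lambda>z. ennreal (v z)) (real n * p + 1)) (1 / p) *
        ennpowr (moment (sigma_weight p w v) (real n * conj_exp p + 1)) (1 / conj_exp p) /
        moment (\<lambda>z. ennreal (w z)) (2 * real n + 1))"

definition A_const :: "real \<Rightarrow> (complex \<Rightarrow> real) \<Rightarrow> (complex \<Rightarrow> real) \<Rightarrow> ennreal" where
  "A_const p w v =
     (SUP r\<in>{0..<1}.
        ennpowr (tail (\<lambda>z. ennreal (v z)) r) (1 / p) *
        ennpowr (tail (sigma_weight p w v) r) (1 / conj_exp p) /
        tail (\<lambda>z. ennreal (w z)) r)"

definition M_const :: "real \<Rightarrow> (complex \<Rightarrow> real) \<Rightarrow> (complex \<Rightarrow> real) \<Rightarrow> ennreal" where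
  "M_const p w v =
     (SUP r\<in>{0..<1}.
        ennpowr
          ((\<integral>\<^sup>+s\<in>{0..r}. ennreal (v (of_real s) * s) /
              ennpowr (tail (\<lambda>z. ennreal (w z)) s) p \<partial>lebesgue) + 1) (1 / p) *
        ennpowr (tail (sigma_weight p w v) r) (1 / conj_exp p))"

end

theory Submission imports Defs begin

text \<open>
  Write T for the tail mass of a weight near the boundary, as a measure on [0, 1). The kernel is a power
  series with positive coefficients c(n), reciprocal to moments of \<omega>, so for radial arguments only the
  circle means k of its modulus matter. From below, k(r) dominates each c(n) r^n and, by pairing the
  kernel with the sawtooth function, also the sum of c(n) r^n / n. From above, Parseval and
  Cauchy--Schwarz bound the mean of K(r e^(i theta)) - K(r^L e^(i theta)) by a multiple of 1 / T(r), and iterating this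
  yields k(r) \<le> C / T(r) as soon as T decays geometrically along r, r^L, r^(L^2), ....

  Necessity: truncations of the radial function extremal in Hoelder's inequality give the D-condition, and
  the logarithmic lower bound for k on functions constant in the angle forces the moments of \<omega>,
  hence by duality those of \<nu>, to decay. Conversely the one-dimensional conditions are compared by moment and layer-cake
  estimates: balance and doubling of \<omega> make all three weights doubling, decay of the moments of \<nu> makes
  them reverse doubling, and the Schur test with powers of the tails of \<nu> and \<sigma> proves boundedness.
\<close>

section \<open>Measures on the unit interval\<close>

text \<open>The scale is that of exponents rather than distances: the point
  \<open>exp (- 1 / y)\<close> is matched with the moment of order y, so passing from r to
  \<open>r powr L\<close> divides y by L. Doubling, reverse doubling and decay of moments then live
  on one scale, which also fits the powers r^n in the kernel. In one dimension the three weights are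
  tied together only by Hoelder's inequality for bounded functions. It is symmetric under exchanging
  (p, \<nu>) with (p', \<sigma>), so each estimate for \<nu> has a dual for \<sigma>. An obstacle is
  that \<sigma> may be infinite: finiteness of its mass has to be extracted from each condition
  beforehand, from a single term of the supremum in (ii)-(iv) and from truncated test functions in
  (i). Another is that a weight is only Lebesgue measurable on the disc, where a radius is a null
  set; averaging over circles supplies a Borel profile. Condition (ii) gives (iii) outright; the way
  back to boundedness and the comparison with (iv) use the decay of the moments of \<nu>.\<close>

lemma ennreal_le_suminf: "f j \<le> suminf f" for f :: "nat \<Rightarrow> ennreal"
  using sum_le_suminf[OF summableI, of "{j}" f] by simp

text \<open>Concentration almost everywhere, instead of restriction to a smaller space, keeps Borel
  functions on the whole line measurable.\<close>

definition interval_measure :: "real measure \<Rightarrow> bool" where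
  "interval_measure M \<longleftrightarrow> finite_measure M \<and> sets M = sets borel \<and> (AE s in M. 0 < s \<and> s < 1)"

definition upper_mass :: "real measure \<Rightarrow> real \<Rightarrow> real" where
  "upper_mass M r = measure M {r..}"

text \<open>It is applied to measures s w(s) ds, so order y here is the moment of index y + 1 in the
  theorem.\<close>

definition power_moment :: "real measure \<Rightarrow> real \<Rightarrow> real" where
  "power_moment M y = (\<integral>s. s powr y \<partial>M)"

definition thick :: "real measure \<Rightarrow> bool" where
  "thick M \<longleftrightarrow> (\<forall>r<1. 0 < upper_mass M r)"

text \<open>Both \<open>sqrt r\<close> and (1 + r) / 2 roughly halve the distance to 1, but the root
  is the one that acts on exponents.\<close>

definition doubling :: "real measure \<Rightarrow> bool" where
  "doubling M \<longleftrightarrow> (\<exists>C>0. \<forall>r. 0 < r \<and> r < 1 \<longrightarrow> upper_mass M r \<le> C * upper_mass M (sqrt r))"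

definition reverse_doubling :: "real measure \<Rightarrow> bool" where
  "reverse_doubling M \<longleftrightarrow> (\<exists>q L r0. 0 < q \<and> q < 1 \<and> 1 < L \<and> 0 < r0 \<and> r0 < 1 \<and>
     (\<forall>r. r0 \<le> r \<and> r < 1 \<longrightarrow> upper_mass M r \<le> q * upper_mass M (r powr L)))"

text \<open>The inequality of the class M for x = y + 1, with q = 1 / C; the shift of the order by
  one turns K x into K (y + 1) - 1.\<close>

definition moment_decay :: "real measure \<Rightarrow> bool" where
  "moment_decay M \<longleftrightarrow> (\<exists>q K. 0 < q \<and> q < 1 \<and> 1 < K \<and>
     (\<forall>y\<ge>0. power_moment M (K * (y + 1) - 1) \<le> q * power_moment M y))"

section \<open>Tails and moments of a single measure\<close>

context
  fixes M :: "real measure"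
  assumes M: "interval_measure M"
begin

lemma interval_measure_simps [measurable_cong]: "sets M = sets borel"
  using M by (simp add: interval_measure_def)

lemma borel_measurable_interval_measure [simp]: "borel_measurable M = borel_measurable borel"
  by (rule measurable_cong_sets) (simp_all add: interval_measure_simps)

lemma space_interval_measure [simp]: "space M = UNIV"
  using sets_eq_imp_space_eq[OF interval_measure_simps] by simp

lemma AE_interval_measure: "AE s in M. 0 < s \<and> s < 1"
  using M by (simp add: interval_measure_def)

interpretation finite_measure M
  using M by (simp add: interval_measure_def)

lemma upper_mass_nonneg [simp]: "0 \<le> upper_mass M r"
  by (simp add: upper_mass_def)

lemma upper_mass_antimono: "r \<le> s \<Longrightarrow> upper_mass M s \<le> upper_mass M r"
  unfolding upper_mass_def by (rule finite_measure_mono) auto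

lemma borel_measurable_upper_mass [measurable]: "upper_mass M \<in> borel_measurable borel"
proof -
  have "(\<lambda>r. - upper_mass M r) \<in> borel_measurable borel"
    by (rule borel_measurable_mono) (auto simp: mono_def intro: upper_mass_antimono)
  then show ?thesis by simp
qed

lemma integrable_bounded_interval:
  fixes f :: "real \<Rightarrow> real"
  assumes [measurable]: "f \<in> borel_measurable borel"
    and "\<And>s. 0 < s \<Longrightarrow> s < 1 \<Longrightarrow> \<bar>f s\<bar> \<le> B"
  shows "integrable M f"
proof (rule integrable_const_bound[where B = B])
  show "AE s in M. norm (f s) \<le> B"
    using AE_interval_measure by eventually_elim (use assms in auto)
qed measurable

lemma integrable_powr_interval [simp]: "0 \<le> y \<Longrightarrow> integrable M (\<lambda>s. s powr y)"
  by (rule integrable_bounded_interval[where B = 1]) (auto simp: powr_le1)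

lemma power_moment_nonneg [simp]: "0 \<le> power_moment M y"
  unfolding power_moment_def by (rule integral_nonneg_AE) auto

lemma power_moment_antimono:
  assumes "0 \<le> x" "x \<le> y"
  shows "power_moment M y \<le> power_moment M x"
  unfolding power_moment_def
proof (rule integral_mono_AE)
  show "AE s in M. s powr y \<le> s powr x"
    using AE_interval_measure by eventually_elim (use assms in \<open>auto intro: powr_mono'\<close>)
qed (use assms in auto)

text \<open>Chebyshev's inequality for the increasing function s^y.\<close>

lemma power_moment_ge:
  assumes "0 \<le> r" "0 \<le> y"
  shows "r powr y * upper_mass M r \<le> power_moment M y"
proof -
  have "r powr y * upper_mass M r = (\<integral>s. r powr y * indicator {r..} s \<partial>M)"
    by (simp add: upper_mass_def)
  also have "\<dots> \<le> power_moment M y"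
    unfolding power_moment_def
  proof (rule integral_mono_AE)
    show "AE s in M. r powr y * indicator {r..} s \<le> s powr y"
      using AE_interval_measure
      by eventually_elim (use assms in \<open>auto simp: indicator_def intro: powr_mono2\<close>)
    show "integrable M (\<lambda>s. r powr y * indicator {r..} s)"
      by (rule integrable_bounded_interval[where B = "r powr y"]) (auto simp: indicator_def)
  qed (use assms in auto)
  finally show ?thesis .
qed

lemma power_moment_zero: "power_moment M 0 = upper_mass M 0"
proof -
  have "power_moment M 0 = (\<integral>s. indicator {0..} s \<partial>M)"
    unfolding power_moment_def
  proof (rule integral_cong_AE)
    show "AE s in M. s powr 0 = indicator {0..} s"
      using AE_interval_measure by eventually_elim auto
  qed auto
  then show ?thesis by (simp add: upper_mass_def)
qed

text \<open>At \<open>exp (- 1 / y)\<close> the power of order y is exactly 1 / e, which is the loss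
  in Chebyshev's inequality.\<close>

lemma upper_mass_le_power_moment:
  assumes "0 < y"
  shows "upper_mass M (exp (- 1 / y)) \<le> exp 1 * power_moment M y"
proof -
  have "exp (- 1) * upper_mass M (exp (- 1 / y)) \<le> power_moment M y"
    using power_moment_ge[of "exp (-1/y)" y] assms by (simp add: exp_powr_real)
  then have "exp 1 * (exp (- 1) * upper_mass M (exp (- 1 / y))) \<le> exp 1 * power_moment M y"
    by (intro mult_left_mono) auto
  then show ?thesis by (simp add: mult.assoc[symmetric] flip: exp_add)
qed

text \<open>Levels l of s^y are used, not levels of s. The measure dl then does not depend on y, and
  a doubling inequality holding at every level passes to moments of orders y and 2 y.\<close>

lemma nn_integral_powr_layer_cake:
  assumes y: "0 < y"
  shows "ennreal (power_moment M y) =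
    (\<integral>\<^sup>+l. ennreal (upper_mass M (l powr (1 / y)) * indicator {0<..<1} l) \<partial>lborel)"
proof -
  interpret pair_sigma_finite M lborel ..
  have "ennreal (power_moment M y) = (\<integral>\<^sup>+s. ennreal (s powr y) \<partial>M)"
    unfolding power_moment_def
    by (subst nn_integral_eq_integral) (use y in auto)
  also have "\<dots> = (\<integral>\<^sup>+s. (\<integral>\<^sup>+l. indicator {(s,l). 0 < l \<and> l < 1 \<and> l powr (1/y) \<le> s} (s,l) \<partial>lborel) \<partial>M)"
  proof (rule nn_integral_cong_AE)
    show "AE s in M. ennreal (s powr y) = (\<integral>\<^sup>+l. indicator {(s,l). 0 < l \<and> l < 1 \<and> l powr (1/y) \<le> s} (s,l) \<partial>lborel)"
      using AE_interval_measure
    proof eventually_elim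
      fix s :: real assume s: "0 < s \<and> s < 1"
      have "(l powr (1/y) \<le> s) = (l \<le> s powr y)" if "0 < l" for l
      proof -
        have "(l powr (1/y) \<le> s) = ((l powr (1/y)) powr y \<le> s powr y)"
        proof
          assume "l powr (1/y) \<le> s" then show "(l powr (1/y)) powr y \<le> s powr y"
            using y by (intro powr_mono2) auto
        next
          assume le: "(l powr (1/y)) powr y \<le> s powr y"
          show "l powr (1/y) \<le> s"
          proof (rule ccontr)
            assume "\<not> l powr (1/y) \<le> s"
            then have "s powr y < (l powr (1/y)) powr y" using s y by (intro powr_less_mono2) auto
            with le show False by simp
          qed
        qed
        then show ?thesis using y that by (simp add: powr_powr)
      qed
      moreover have "s powr y < 1" using powr_less_mono2[of y s 1] s y by simp
      ultimately have "(\<lambda>l. indicator {(s,l). 0 < l \<and> l < 1 \<and> l powr (1/y) \<le> s} (s,l)) =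
          (indicator {0<..s powr y} :: real \<Rightarrow> ennreal)"
        by (intro ext) (auto simp: indicator_def)
      then show "ennreal (s powr y) = (\<integral>\<^sup>+l. indicator {(s,l). 0 < l \<and> l < 1 \<and> l powr (1/y) \<le> s} (s,l) \<partial>lborel)"
        by simp
    qed
  qed
  also have "\<dots> = (\<integral>\<^sup>+l. (\<integral>\<^sup>+s. indicator {(s,l). 0 < l \<and> l < 1 \<and> l powr (1/y) \<le> s} (s,l) \<partial>M) \<partial>lborel)"
    by (rule Fubini[symmetric]) measurable
  also have "\<dots> = (\<integral>\<^sup>+l. ennreal (upper_mass M (l powr (1 / y)) * indicator {0<..<1} l) \<partial>lborel)"
  proof (rule nn_integral_cong)
    fix l :: real
    have "(\<lambda>s. indicator {(s,l). 0 < l \<and> l < 1 \<and> l powr (1/y) \<le> s} (s,l)) =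
       (\<lambda>s. indicator {0<..<1} l * indicator {l powr (1/y)..} s :: ennreal)"
      by (auto simp: indicator_def)
    then show "(\<integral>\<^sup>+s. indicator {(s,l). 0 < l \<and> l < 1 \<and> l powr (1/y) \<le> s} (s,l) \<partial>M)
       = ennreal (upper_mass M (l powr (1 / y)) * indicator {0<..<1} l)"
      by (simp add: nn_integral_cmult upper_mass_def emeasure_eq_measure ennreal_mult'' ennreal_indicator mult.commute)
  qed
  finally show ?thesis .
qed

lemma doubling_power_moment:
  assumes "\<And>r. 0 < r \<Longrightarrow> r < 1 \<Longrightarrow> upper_mass M r \<le> C * upper_mass M (sqrt r)" "0 < C" "0 < y"
  shows "power_moment M y \<le> C * power_moment M (2 * y)"
proof -
  have "ennreal (power_moment M y) \<le>
     (\<integral>\<^sup>+l. ennreal C * ennreal (upper_mass M (l powr (1 / (2*y))) * indicator {0<..<1} l) \<partial>lborel)"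
    unfolding nn_integral_powr_layer_cake[OF \<open>0 < y\<close>]
  proof (rule nn_integral_mono)
    fix l :: real
    show "ennreal (upper_mass M (l powr (1 / y)) * indicator {0<..<1} l) \<le>
      ennreal C * ennreal (upper_mass M (l powr (1 / (2*y))) * indicator {0<..<1} l)"
    proof (cases "0 < l \<and> l < 1")
      case True
      have "sqrt (l powr (1/y)) = l powr (1 / (2*y))"
        using True by (simp add: powr_half_sqrt[symmetric] powr_powr mult.commute)
      moreover have "l powr (1/y) < 1"
        using powr_less_mono2[of "1/y" l 1] True \<open>0 < y\<close> by simp
      ultimately have "upper_mass M (l powr (1/y)) \<le> C * upper_mass M (l powr (1/(2*y)))"
        using assms(1)[of "l powr (1/y)"] True by simp
      then show ?thesis using assms(2) True by (simp flip: ennreal_mult)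
    qed auto
  qed
  also have "\<dots> = ennreal C * ennreal (power_moment M (2*y))"
    using nn_integral_powr_layer_cake[of "2*y"] assms
    by (subst nn_integral_cmult) auto
  finally show ?thesis using assms(2) by (simp flip: ennreal_mult)
qed

lemma doubling_power_moment_iterate:
  assumes "\<And>r. 0 < r \<Longrightarrow> r < 1 \<Longrightarrow> upper_mass M r \<le> C * upper_mass M (sqrt r)" "0 < C" "0 < y"
  shows "power_moment M y \<le> C ^ k * power_moment M (2 ^ k * y)"
proof (induction k)
  case (Suc k)
  have "power_moment M (2 ^ k * y) \<le> C * power_moment M (2 * (2 ^ k * y))"
    using assms by (intro doubling_power_moment) auto
  then have "C ^ k * power_moment M (2 ^ k * y) \<le> C ^ k * (C * power_moment M (2 * (2 ^ k * y)))"
    using assms by (intro mult_left_mono) auto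
  with Suc show ?case by (simp add: mult.assoc mult.left_commute)
qed auto

text \<open>Above r the power is at most 1; below r the surplus s^(z - x) is at most r^(z - x),
  which is negligible once z is much larger than x.\<close>

lemma power_moment_split:
  assumes "0 \<le> x" "x \<le> z" "0 < r"
  shows "power_moment M z \<le> upper_mass M r + r powr (z - x) * (\<integral>s. indicator {..<r} s * s powr x \<partial>M)"
proof -
  have int1: "integrable M (\<lambda>s. indicator {..<r} s * s powr x)"
    by (rule integrable_bounded_interval[where B = 1]) (use assms in \<open>auto simp: indicator_def powr_le1\<close>)
  have int2: "integrable M (\<lambda>s. indicator {r..} s :: real)"
    by (rule integrable_bounded_interval[where B = 1]) (auto simp: indicator_def)
  have "power_moment M z \<le> (\<integral>s. indicator {r..} s + r powr (z - x) * (indicator {..<r} s * s powr x) \<partial>M)"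
    unfolding power_moment_def
  proof (rule integral_mono_AE)
    show "AE s in M. s powr z \<le> indicator {r..} s + r powr (z - x) * (indicator {..<r} s * s powr x)"
      using AE_interval_measure
    proof eventually_elim
      fix s :: real assume s: "0 < s \<and> s < 1"
      show "s powr z \<le> indicator {r..} s + r powr (z - x) * (indicator {..<r} s * s powr x)"
      proof (cases "s < r")
        case True
        have "s powr z = s powr (z - x) * s powr x" using s by (simp flip: powr_add)
        also have "\<dots> \<le> r powr (z - x) * s powr x"
          using True s assms by (intro mult_right_mono powr_mono2) auto
        finally show ?thesis using True by simp
      next
        case False
        then show ?thesis using s assms by (simp add: powr_le1)
      qed
    qed
  qed (use assms int1 int2 in auto)
  also have "\<dots> = upper_mass M r + r powr (z - x) * (\<integral>s. indicator {..<r} s * s powr x \<partial>M)"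
    using int1 int2 by (subst Bochner_Integration.integral_add) (auto simp: upper_mass_def)
  finally show ?thesis .
qed

lemma integral_lower_part_le:
  assumes "0 \<le> x"
  shows "(\<integral>s. indicator {..<r} s * s powr x \<partial>M) \<le> power_moment M x"
  unfolding power_moment_def
  by (rule integral_mono_AE, rule integrable_bounded_interval[where B = 1])
     (use assms in \<open>auto simp: indicator_def powr_le1\<close>)

text \<open>Raising the order from y to 2^k y costs C0^k by doubling, but the part below
  \<open>exp (- 1 / y)\<close> shrinks to exp(1 - 2^k) times the moment of order y. For large k the
  second effect wins, and that part can be absorbed on the left.\<close>

lemma doubling_imp_moment_le_upper_mass:
  assumes "doubling M"
  shows "\<exists>C>0. \<forall>y>0. power_moment M y \<le> C * upper_mass M (exp (- 1 / y))"
proof -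
  obtain C0 where C0: "0 < C0" "\<And>r. 0 < r \<Longrightarrow> r < 1 \<Longrightarrow> upper_mass M r \<le> C0 * upper_mass M (sqrt r)"
    using assms by (auto simp: doubling_def)
  obtain N :: nat where N: "ln C0 \<le> real N" using real_arch_simple by blast
  \<comment> \<open>As 2 N = m - 1, this gives 2 m N + 2 \<le> (m + 1)^2 \<le> 4^m = 2^k, so 2^k is
    at least k ln C0 + 2.\<close>
  define m where "m = 2 * N + 1"
  define k where "k = 2 * m"
  have "real k * ln C0 \<le> real (2 * m * N)"
    using mult_left_mono[OF N, of "real k"] by (simp add: k_def)
  moreover have "2 * m * N + 2 \<le> 2 ^ k"
  proof -
    have "(m + 1) ^ 2 \<le> (2 ^ m) ^ 2" by (intro power_mono) (use less_exp[of m] in linarith)+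
    moreover have "2 * m * N + 2 \<le> (m + 1) ^ 2"
      unfolding m_def by (simp add: power2_eq_square algebra_simps)
    ultimately have "2 * m * N + 2 \<le> (2 ^ m) ^ 2" by (rule order_trans[rotated])
    then show ?thesis by (simp add: k_def power_mult mult.commute[of 2 m])
  qed
  then have "real (2 * m * N) + 2 \<le> 2 ^ k"
    by (metis of_nat_add of_nat_le_iff of_nat_numeral of_nat_power)
  ultimately have "real k * ln C0 + (1 - 2 ^ k) \<le> -1" by linarith
  then have "exp (real k * ln C0 + (1 - 2 ^ k)) \<le> exp (-1)" by simp
  also have "exp (-1 :: real) \<le> 1/2"
    using exp_ge_add_one_self[of 1] by (simp add: exp_minus field_simps)
  finally have k: "C0 ^ k * exp (1 - 2 ^ k) \<le> 1/2"
    using C0(1) by (simp add: exp_add exp_of_nat_mult)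
  have "power_moment M y \<le> 2 * C0 ^ k * upper_mass M (exp (- 1 / y))" if y: "0 < y" for y
  proof -
    let ?r = "exp (- 1 / y)"
    have "power_moment M (2 ^ k * y) \<le> upper_mass M ?r +
        ?r powr (2 ^ k * y - y) * (\<integral>s. indicator {..<?r} s * s powr y \<partial>M)"
      using y by (intro power_moment_split) auto
    also have "\<dots> \<le> upper_mass M ?r + ?r powr (2 ^ k * y - y) * power_moment M y"
      using y by (intro add_left_mono mult_left_mono integral_lower_part_le) auto
    also have "?r powr (2 ^ k * y - y) = exp (1 - 2 ^ k)"
      using y by (simp add: exp_powr_real field_simps)
    finally have "C0 ^ k * power_moment M (2 ^ k * y) \<le>
        C0 ^ k * (upper_mass M ?r + exp (1 - 2 ^ k) * power_moment M y)"
      using C0 by (intro mult_left_mono) auto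
    with doubling_power_moment_iterate[OF C0(2,1) y, of k]
    have "power_moment M y \<le> C0 ^ k * upper_mass M ?r + (C0 ^ k * exp (1 - 2 ^ k)) * power_moment M y"
      by (simp add: algebra_simps)
    also have "\<dots> \<le> C0 ^ k * upper_mass M ?r + 1/2 * power_moment M y"
      using k by (intro add_left_mono mult_right_mono) auto
    finally show ?thesis by simp
  qed
  then show ?thesis using C0(1) by (intro exI[of _ "2 * C0 ^ k"]) auto
qed

text \<open>Iterated doubling with 2^k above b. The layer-cake formula does not reach order 0, where
  the summand 1 in the constant takes over.\<close>

lemma doubling_imp_moment_scale:
  assumes "doubling M" "0 < b"
  shows "\<exists>C>0. \<forall>y\<ge>0. power_moment M y \<le> C * power_moment M (b * y)"
proof -
  obtain C0 where C0: "0 < C0" "\<And>r. 0 < r \<Longrightarrow> r < 1 \<Longrightarrow> upper_mass M r \<le> C0 * upper_mass M (sqrt r)"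
    using assms(1) by (auto simp: doubling_def)
  obtain k :: nat where k: "b < 2 ^ k" using real_arch_pow[of 2 b] by auto
  have "power_moment M y \<le> (C0 ^ k + 1) * power_moment M (b * y)" if y: "0 \<le> y" for y
  proof (cases "y = 0")
    case True
    then show ?thesis using C0 by (simp add: algebra_simps)
  next
    case False
    then have "power_moment M y \<le> C0 ^ k * power_moment M (2 ^ k * y)"
      using y doubling_power_moment_iterate[OF C0(2,1)] by auto
    also have "\<dots> \<le> C0 ^ k * power_moment M (b * y)"
      using False y k C0 \<open>0 < b\<close> by (intro mult_left_mono power_moment_antimono) auto
    finally show ?thesis using power_moment_nonneg[of "b * y"] unfolding distrib_right by linarith
  qed
  then show ?thesis using C0(1) by (intro exI[of _ "C0 ^ k + 1"]) (auto intro: add_pos_pos)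
qed

lemma moment_decay_iterate:
  assumes qK: "0 < q" "q < 1" "1 < K"
    "\<And>y. 0 \<le> y \<Longrightarrow> power_moment M (K * (y + 1) - 1) \<le> q * power_moment M y"
    and y: "0 \<le> y"
  shows "power_moment M (K ^ j * (y + 1) - 1) \<le> q ^ j * power_moment M y"
proof (induction j)
  case (Suc j)
  have "1 * 1 \<le> K ^ j * (y + 1)" using qK y by (intro mult_mono) auto
  then have "power_moment M (K * (K ^ j * (y + 1)) - 1) \<le> q * power_moment M (K ^ j * (y + 1) - 1)"
    using qK(4)[of "K ^ j * (y + 1) - 1"] by simp
  also have "\<dots> \<le> q * (q ^ j * power_moment M y)" using Suc qK by (intro mult_left_mono) auto
  finally show ?case by (simp add: mult.assoc)
qed auto

text \<open>A tail is at most e times a moment, and under doubling a moment is at most C times a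
  tail. Sufficiently many steps of decay between the two produce a factor q^j that beats e
  C.\<close>

lemma moment_decay_imp_reverse_doubling:
  assumes "doubling M" "moment_decay M"
  shows "reverse_doubling M"
proof -
  obtain C where C: "0 < C" "\<And>y. 0 < y \<Longrightarrow> power_moment M y \<le> C * upper_mass M (exp (- 1 / y))"
    using doubling_imp_moment_le_upper_mass[OF assms(1)] by auto
  obtain q K where qK: "0 < q" "q < 1" "1 < K"
    "\<And>y. 0 \<le> y \<Longrightarrow> power_moment M (K * (y + 1) - 1) \<le> q * power_moment M y"
    using assms(2) by (auto simp: moment_decay_def)
  have iter: "power_moment M (K ^ j * (y + 1) - 1) \<le> q ^ j * power_moment M y" if "0 \<le> y" for j y
    using moment_decay_iterate[OF qK that] .
  obtain j where "q ^ j < 1 / (2 * exp 1 * C)"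
    using real_arch_pow_inv[of "1 / (2 * exp 1 * C)" q] qK C by auto
  then have j: "exp 1 * (q ^ j * C) \<le> 1/2" using C by (simp add: field_simps)
  define L where "L = 2 * K ^ j"
  have K1: "1 \<le> K ^ j" using qK by simp
  have L: "1 < L" using K1 by (simp add: L_def)
  have "upper_mass M r \<le> 1/2 * upper_mass M (r powr L)" if r: "exp (- 1 / L) \<le> r" "r < 1" for r
  proof -
    have r0: "0 < r" using r by (meson exp_gt_zero less_le_trans)
    \<comment> \<open>The order matched with r^L, so that r is matched with L y. The lower bound on
      r says y \<ge> 1, whence K^j (y + 1) - 1 \<le> 2 K^j y = L y.\<close>
    define y where "y = 1 / (L * - ln r)"
    have lnr: "- 1 / L \<le> ln r" "ln r < 0"
      using r r0 by (auto simp: ln_ge_iff)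
    then have "L * - ln r \<le> 1" "0 < L * - ln r" using L
      by (auto simp: field_simps mult_pos_neg)
    then have y: "1 \<le> y" unfolding y_def by (subst le_divide_eq_1_pos) auto
    have req: "r = exp (- 1 / (L * y))"
      using L r0 lnr by (simp add: y_def)
    have rL: "r powr L = exp (- 1 / y)"
      using r0 L lnr by (simp add: powr_def y_def mult.commute)
    define Y where "Y = K ^ j * (y + 1) - 1"
    have "K ^ j * (y + 1) \<le> K ^ j * (2 * y)" using K1 y by (intro mult_left_mono) auto
    then have YL: "Y \<le> L * y" by (simp add: Y_def L_def)
    have "1 * 2 \<le> K ^ j * (y + 1)" using K1 y by (intro mult_mono) auto
    then have Y0: "0 < Y" by (simp add: Y_def)
    have "upper_mass M r \<le> upper_mass M (exp (- 1 / Y))"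
      unfolding req using YL Y0 by (intro upper_mass_antimono) (auto simp: field_simps)
    also have "\<dots> \<le> exp 1 * power_moment M Y" by (rule upper_mass_le_power_moment[OF Y0])
    also have "\<dots> \<le> exp 1 * (q ^ j * power_moment M y)"
      unfolding Y_def using y by (intro mult_left_mono iter) auto
    also have "\<dots> \<le> exp 1 * (q ^ j * (C * upper_mass M (exp (- 1 / y))))"
      using y qK C by (intro mult_left_mono) auto
    also have "\<dots> = (exp 1 * (q ^ j * C)) * upper_mass M (r powr L)" by (simp add: rL)
    also have "\<dots> \<le> 1/2 * upper_mass M (r powr L)" using j by (intro mult_right_mono) auto
    finally show ?thesis .
  qed
  then show ?thesis unfolding reverse_doubling_def
    using L by (intro exI[of _ "1/2"] exI[of _ L] exI[of _ "exp (- 1 / L)"]) auto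
qed

text \<open>If the infimum c of the set belongs to it, the tail at c does the job. Otherwise the set
  lies strictly above c, and the mass above c is a limit of tails at points c + 1/n, each lying
  beyond some element of the set. Atoms are allowed, so the two cases really differ.\<close>

lemma measure_upper_mass_le:
  assumes "0 \<le> x"
  shows "measure M {t. 0 < t \<and> t < 1 \<and> upper_mass M t \<le> x} \<le> x"
proof -
  define A where "A = {t. 0 < t \<and> t < 1 \<and> upper_mass M t \<le> x}"
  show ?thesis
  proof (cases "A = {}")
    case True
    then have "measure M A \<le> x" using assms by simp
    then show ?thesis by (simp add: A_def)
  next
    case False
    define c where "c = Inf A"
    have bdd: "bdd_below A" by (rule bdd_belowI[of _ 0]) (auto simp: A_def)
    show ?thesis
    proof (cases "c \<in> A")
      case True
      have "measure M A \<le> upper_mass M c"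
        unfolding upper_mass_def
        by (rule finite_measure_mono) (auto simp: c_def intro: cInf_lower bdd)
      also have "\<dots> \<le> x" using True by (simp add: A_def)
      finally show ?thesis by (simp add: A_def)
    next
      case F: False
      have le: "measure M A \<le> measure M {c<..}"
      proof (rule finite_measure_mono)
        show "A \<subseteq> {c<..}"
          using F cInf_lower[OF _ bdd] by (force simp: c_def order.strict_iff_order)
      qed auto
      have "(\<lambda>n. upper_mass M (c + 1 / real (Suc n))) \<longlonglongrightarrow> measure M (\<Union>n. {c + 1 / real (Suc n)..})"
        unfolding upper_mass_def
        by (rule finite_Lim_measure_incseq) (auto simp: incseq_def field_simps intro: order_trans[rotated])
      moreover have "(\<Union>n. {c + 1 / real (Suc n)..}) = {c<..}"
      proof (intro equalityI subsetI)
        fix s assume "s \<in> {c<..}"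
        then obtain n where "1 / real (Suc n) < s - c"
          using reals_Archimedean[of "s - c"] by (auto simp: inverse_eq_divide)
        then show "s \<in> (\<Union>n. {c + 1 / real (Suc n)..})"
          by (intro UN_I[of n]) auto
      qed (auto intro: less_le_trans[rotated])
      moreover have "upper_mass M (c + 1 / real (Suc n)) \<le> x" for n
      proof -
        have "Inf A < c + 1 / real (Suc n)" by (simp add: c_def)
        then obtain a where "a \<in> A" "a < c + 1 / real (Suc n)"
          using cInf_lessD[OF False] by blast
        then show ?thesis
          using upper_mass_antimono[of a "c + 1 / real (Suc n)"] by (auto simp: A_def)
      qed
      ultimately have "measure M {c<..} \<le> x"
        by (intro LIMSEQ_le_const2) auto
      with le show ?thesis by (simp add: A_def)
    qed
  qed
qed

text \<open>A measure version of integrating T^(-a) dT for the tail T: the level where T is about R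
  / 2^j has mass at most R / 2^j and contributes about (R / 2^j)^(1 - a), a convergent geometric
  series because a < 1.\<close>

lemma nn_integral_upper_mass_powr:
  assumes "thick M" and a: "0 < a" "a < 1"
  shows "\<exists>C>0. \<forall>r. r < 1 \<longrightarrow>
    (\<integral>\<^sup>+t. ennreal (indicator {r..} t * upper_mass M t powr (- a)) \<partial>M) \<le> ennreal (C * upper_mass M r powr (1 - a))"
proof -
  define b where "b = (1/2::real) powr (1 - a)"
  have b: "0 < b" "b < 1" using a powr_less_mono2[of "1 - a" "1/2" 1] by (auto simp: b_def)
  have summ: "summable (\<lambda>j. b ^ j)" using b by simp
  define C where "C = 2 powr a / (1 - b)"
  have "(\<integral>\<^sup>+t. ennreal (indicator {r..} t * upper_mass M t powr (- a)) \<partial>M) \<le> ennreal (C * upper_mass M r powr (1 - a))"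
    if r: "r < 1" for r
  proof -
    define R where "R = upper_mass M r"
    have R: "0 < R" using assms r by (auto simp: thick_def R_def)
    \<comment> \<open>Whole sublevel sets stand in for dyadic shells. This only enlarges the bound,
      and \<open>measure_upper_mass_le\<close> controls their masses.\<close>
    define E where "E j = {t. 0 < t \<and> t < 1 \<and> upper_mass M t \<le> R / 2 ^ j}" for j :: nat
    have [measurable]: "E j \<in> sets M" for j unfolding E_def by measurable
    have "(\<integral>\<^sup>+t. ennreal (indicator {r..} t * upper_mass M t powr (- a)) \<partial>M) \<le>
       (\<integral>\<^sup>+t. (\<Sum>j. ennreal ((R / 2 ^ Suc j) powr (- a)) * indicator (E j) t) \<partial>M)"
    proof (rule nn_integral_mono_AE)
      show "AE t in M. ennreal (indicator {r..} t * upper_mass M t powr (- a)) \<le>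
        (\<Sum>j. ennreal ((R / 2 ^ Suc j) powr (- a)) * indicator (E j) t)"
        using AE_interval_measure
      proof eventually_elim
        fix t :: real assume t: "0 < t \<and> t < 1"
        show "ennreal (indicator {r..} t * upper_mass M t powr (- a)) \<le>
          (\<Sum>j. ennreal ((R / 2 ^ Suc j) powr (- a)) * indicator (E j) t)"
        proof (cases "r \<le> t")
          case True
          have Tt: "0 < upper_mass M t" "upper_mass M t \<le> R"
            using assms t True by (auto simp: thick_def R_def intro: upper_mass_antimono)
          obtain n where n: "(1/2) ^ n < upper_mass M t / R"
            using real_arch_pow_inv[of "upper_mass M t / R" "1/2"] R Tt by auto
          \<comment> \<open>Minimality gives the opposite inequality one index earlier, which places
            t in the shell numbered j.\<close>
          define j where "j = (LEAST n. R / 2 ^ Suc n < upper_mass M t)"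
          have ex: "R / 2 ^ Suc n < upper_mass M t"
          proof -
            have "R / 2 ^ Suc n \<le> R * (1/2) ^ n" using R by (simp add: field_simps power_divide)
            also have "\<dots> < upper_mass M t" using n R by (simp add: field_simps)
            finally show ?thesis .
          qed
          have j1: "R / 2 ^ Suc j < upper_mass M t" unfolding j_def by (rule LeastI, rule ex)
          have j2: "upper_mass M t \<le> R / 2 ^ j"
          proof (cases j)
            case 0
            then show ?thesis using Tt by simp
          next
            case (Suc i)
            then show ?thesis using not_less_Least[of i "\<lambda>n. R / 2 ^ Suc n < upper_mass M t"]
              by (auto simp: j_def)
          qed
          have "ennreal (indicator {r..} t * upper_mass M t powr (- a)) \<le> ennreal ((R / 2 ^ Suc j) powr (- a)) * indicator (E j) t"
            using True t j1 j2 R a by (auto simp: E_def intro!: ennreal_leI powr_mono2')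
          also have "\<dots> \<le> (\<Sum>j. ennreal ((R / 2 ^ Suc j) powr (- a)) * indicator (E j) t)"
            by (rule ennreal_le_suminf)
          finally show ?thesis .
        qed auto
      qed
    qed
    also have "\<dots> = (\<Sum>j. ennreal ((R / 2 ^ Suc j) powr (- a)) * emeasure M (E j))"
      by (subst nn_integral_suminf) (auto simp: nn_integral_cmult)
    also have "\<dots> \<le> (\<Sum>j. ennreal (2 powr a * R powr (1 - a) * b ^ j))"
    proof (rule suminf_le)
      fix j
      have "ennreal ((R / 2 ^ Suc j) powr (- a)) * emeasure M (E j) \<le>
          ennreal ((R / 2 ^ Suc j) powr (- a)) * ennreal (R / 2 ^ j)"
        unfolding emeasure_eq_measure E_def using measure_upper_mass_le[of "R / 2 ^ j"] R
        by (intro mult_left_mono ennreal_leI) auto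
      also have "\<dots> = ennreal ((R / 2 ^ Suc j) powr (- a) * (R / 2 ^ j))"
        using R by (intro ennreal_mult[symmetric]) auto
      also have "(R / 2 ^ Suc j) powr (- a) * (R / 2 ^ j) = 2 powr a * R powr (1 - a) * b ^ j"
      proof -
        have "(R / 2 ^ Suc j) powr (- a) = (1/2) powr (- a) * (R / 2 ^ j) powr (- a)"
          using R by (simp flip: powr_mult)
        moreover have "(R / 2 ^ j) powr (- a) * (R / 2 ^ j) = (R / 2 ^ j) powr (1 - a)"
          using R powr_add[of "R / 2 ^ j" "- a" 1] by simp
        moreover have "(R / 2 ^ j) powr (1 - a) = R powr (1 - a) * ((1/2) ^ j) powr (1 - a)"
          using R by (simp flip: powr_mult add: power_divide)
        moreover have "((1/2::real) ^ j) powr (1 - a) = b ^ j"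
          unfolding b_def by (simp add: powr_powr powr_realpow[symmetric] mult.commute)
        moreover have "(1/2::real) powr (- a) = 2 powr a" by (simp add: powr_minus_divide powr_divide)
        ultimately show ?thesis by (simp only: mult.assoc)
      qed
      finally show "ennreal ((R / 2 ^ Suc j) powr (- a)) * emeasure M (E j) \<le> ennreal (2 powr a * R powr (1 - a) * b ^ j)" .
    qed auto
    also have "\<dots> = ennreal (\<Sum>j. 2 powr a * R powr (1 - a) * b ^ j)"
      using b summ by (intro suminf_ennreal2) auto
    also have "(\<Sum>j. 2 powr a * R powr (1 - a) * b ^ j) = C * R powr (1 - a)"
      using b summ by (subst suminf_mult) (auto simp: suminf_geometric C_def)
    finally show ?thesis by (simp add: R_def)
  qed
  moreover have "0 < C" using b by (simp add: C_def)
  ultimately show ?thesis by blast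
qed

end

text \<open>Along r, r^L, r^(L^2), ... the increments c H are dominated by a geometric series of
  ratio q, until the argument falls below r0 and the bound b applies. G has values in
  [0, \<infinity>] so that integrals not yet known to be finite are covered.\<close>

lemma recursion_bound:
  fixes G :: "real \<Rightarrow> ennreal" and H :: "real \<Rightarrow> real"
  assumes boundG: "\<And>r. 0 \<le> r \<Longrightarrow> r \<le> r0 \<Longrightarrow> G r \<le> ennreal b" and b: "0 \<le> b"
    and monoH: "\<And>r s. 0 \<le> r \<Longrightarrow> r \<le> s \<Longrightarrow> s < 1 \<Longrightarrow> H r \<le> H s"
    and pos: "0 < H 0"
    and cs: "0 < r0" "r0 < 1" "1 < L" "0 < q" "q < 1" "0 \<le> c"
    and step: "\<And>r. r0 \<le> r \<Longrightarrow> r < 1 \<Longrightarrow> G r \<le> G (r powr L) + ennreal (c * H r)"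
    and decay: "\<And>r. r0 \<le> r \<Longrightarrow> r < 1 \<Longrightarrow> H (r powr L) \<le> q * H r"
  shows "\<exists>C>0. \<forall>r. 0 \<le> r \<and> r < 1 \<longrightarrow> G r \<le> ennreal (C * H r)"
proof -
  \<comment> \<open>The first entry yields C q + c \<le> C for the inductive step, the second covers
    [0, r0], and the summand 1 makes C positive.\<close>
  define C where "C = max (c / (1 - q)) (b / H 0) + 1"
  have C: "0 < C" "c \<le> C * (1 - q)" "b \<le> C * H 0"
  proof -
    have "0 \<le> c / (1 - q)" using cs by simp
    then show "0 < C" by (auto simp: C_def max_def)
    have "c / (1 - q) \<le> C" by (simp add: C_def)
    then show "c \<le> C * (1 - q)" using cs by (simp add: field_simps)
    have "b / H 0 \<le> C" by (simp add: C_def)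
    then show "b \<le> C * H 0" using pos by (simp add: field_simps)
  qed
  have Hpos: "0 < H r" if "0 \<le> r" "r < 1" for r using monoH[of 0 r] pos that by simp
  have small: "G r \<le> ennreal (C * H r)" if "0 \<le> r" "r \<le> r0" for r
  proof -
    have "G r \<le> ennreal b" using that by (rule boundG)
    also have "\<dots> \<le> ennreal (C * H 0)" using C by (intro ennreal_leI) auto
    also have "\<dots> \<le> ennreal (C * H r)"
      using C that cs by (intro ennreal_leI mult_left_mono monoH) auto
    finally show ?thesis .
  qed
  have claim: "G r \<le> ennreal (C * H r)" if "0 \<le> r" "r < 1" "r powr (L ^ j) \<le> r0" for r j
    using that
  proof (induction j arbitrary: r)
    case 0
    then show ?case using small by simp
  next
    case (Suc j)
    show ?case
    proof (cases "r \<le> r0")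
      case False
      then have r: "r0 \<le> r" "r < 1" "0 < r" using Suc.prems cs by auto
      have rL: "r powr L < 1" using r cs powr_less_mono2[of L r 1] by simp
      have "(r powr L) powr (L ^ j) \<le> r0" using Suc.prems by (simp add: powr_powr mult.commute)
      then have "G (r powr L) \<le> ennreal (C * H (r powr L))" using rL by (intro Suc.IH) auto
      also have "\<dots> \<le> ennreal (C * (q * H r))"
        using C decay[OF r(1,2)] by (intro ennreal_leI mult_left_mono) auto
      finally have "G r \<le> ennreal (C * (q * H r)) + ennreal (c * H r)"
        using step[OF r(1,2)] by (meson add_right_mono order_trans)
      also have "\<dots> = ennreal (C * (q * H r) + c * H r)"
        using C cs Hpos[of r] r by (intro ennreal_plus[symmetric]) auto
      also have "\<dots> \<le> ennreal (C * H r)"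
      proof (rule ennreal_leI)
        have "c * H r \<le> C * (1 - q) * H r" using C Hpos[of r] r by (intro mult_right_mono) auto
        then show "C * (q * H r) + c * H r \<le> C * H r" by (simp add: algebra_simps)
      qed
      finally show ?thesis .
    qed (use small Suc.prems in auto)
  qed
  have "\<exists>j. r powr (L ^ j) \<le> r0" if r: "0 \<le> r" "r < 1" for r
  proof (cases "r = 0")
    case False
    then have lr: "ln r < 0" using r by simp
    obtain j where j: "ln r0 / ln r < L ^ j" using real_arch_pow cs by blast
    have "L ^ j * ln r \<le> ln r0" using j lr by (simp add: field_simps)
    then have "r powr (L ^ j) \<le> exp (ln r0)" using False by (simp add: powr_def)
    then show ?thesis using cs by auto
  qed (use cs in auto)
  with claim C(1) show ?thesis by blast
qed

text \<open>Iteration multiplies the factors q and the exponents L. The threshold rises to r0^(1 /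
  L^j) so that every intermediate point stays above r0.\<close>

lemma reverse_doubling_small:
  assumes "interval_measure M" "reverse_doubling M" "0 < e"
  shows "\<exists>L r0. 1 < L \<and> 0 < r0 \<and> r0 < 1 \<and>
    (\<forall>r. r0 \<le> r \<and> r < 1 \<longrightarrow> upper_mass M r \<le> e * upper_mass M (r powr L))"
proof -
  obtain q L r0 where q: "0 < q" "q < 1" "1 < L" "0 < r0" "r0 < 1"
    "\<And>r. r0 \<le> r \<Longrightarrow> r < 1 \<Longrightarrow> upper_mass M r \<le> q * upper_mass M (r powr L)"
    using assms(2) by (auto simp: reverse_doubling_def)
  have iter: "upper_mass M r \<le> q ^ j * upper_mass M (r powr (L ^ j))"
    if "r0 powr (1 / L ^ j) \<le> r" "r < 1" for r j
    using that
  proof (induction j arbitrary: r)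
    case (Suc j)
    have "0 < r0 powr (1 / L ^ Suc j)" using q by simp
    then have r: "0 < r" using Suc.prems(1) by (rule less_le_trans)
    have "(r0 powr (1 / L ^ Suc j)) powr L \<le> r powr L"
      using Suc.prems q by (intro powr_mono2) auto
    then have "r0 powr (1 / L ^ j) \<le> r powr L" using q by (simp add: powr_powr)
    moreover have "r powr L < 1" using powr_less_mono2[of L r 1] r Suc.prems q by simp
    ultimately have "upper_mass M (r powr L) \<le> q ^ j * upper_mass M ((r powr L) powr (L ^ j))"
      by (rule Suc.IH)
    then have IH: "upper_mass M (r powr L) \<le> q ^ j * upper_mass M (r powr (L ^ Suc j))"
      by (simp add: powr_powr)
    have "1 / L ^ Suc j \<le> 1" using one_le_power[of L "Suc j"] q by (intro divide_le_eq_1_pos[THEN iffD2]) auto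
    then have "r0 powr 1 \<le> r0 powr (1 / L ^ Suc j)" using q by (intro powr_mono') auto
    then have "r0 \<le> r" using Suc.prems q by simp
    then have "upper_mass M r \<le> q * upper_mass M (r powr L)" using q Suc.prems by auto
    also have "\<dots> \<le> q * (q ^ j * upper_mass M (r powr (L ^ Suc j)))"
      using IH q by (intro mult_left_mono) auto
    finally show ?case by (simp add: mult.assoc)
  qed (simp add: order.strict_implies_order)
  obtain j where j: "q ^ j < e" using real_arch_pow_inv assms(3) q by blast
  have "q ^ Suc j \<le> q ^ j" using q by (simp add: mult_left_le_one_le)
  with j have j: "q ^ Suc j < e" by linarith
  show ?thesis
  proof (intro exI conjI allI impI)
    show "1 < L ^ Suc j" using q one_less_power[of L "Suc j"] by simp
    show "0 < r0 powr (1 / L ^ Suc j)" using q by simp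
    show "r0 powr (1 / L ^ Suc j) < 1" using q powr_less_mono2[of "1 / L ^ Suc j" r0 1] by simp
    fix r assume "r0 powr (1 / L ^ Suc j) \<le> r \<and> r < 1"
    then have "upper_mass M r \<le> q ^ Suc j * upper_mass M (r powr (L ^ Suc j))" by (intro iter) auto
    also have "\<dots> \<le> e * upper_mass M (r powr (L ^ Suc j))"
      using j upper_mass_nonneg[OF assms(1)] by (intro mult_right_mono) auto
    finally show "upper_mass M r \<le> e * upper_mass M (r powr (L ^ Suc j))" .
  qed
qed

lemma doubling_powr:
  assumes "interval_measure M" "doubling M"
  shows "\<exists>C>0. \<forall>r. 0 < r \<and> r < 1 \<longrightarrow> upper_mass M (r powr L) \<le> C * upper_mass M r"
proof -
  obtain C where C: "0 < C" "\<And>r. 0 < r \<Longrightarrow> r < 1 \<Longrightarrow> upper_mass M r \<le> C * upper_mass M (sqrt r)"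
    using assms(2) by (auto simp: doubling_def)
  have iter: "upper_mass M (r powr (2 ^ k)) \<le> C ^ k * upper_mass M r" if r: "0 < r" "r < 1" for r k
  proof (induction k)
    case (Suc k)
    have "r powr (2 ^ Suc k) < 1" using powr_less_mono2[of "2 ^ Suc k" r 1] r by simp
    then have "upper_mass M (r powr (2 ^ Suc k)) \<le> C * upper_mass M (sqrt (r powr (2 ^ Suc k)))"
      using r by (intro C) auto
    also have "sqrt (r powr (2 ^ Suc k)) = r powr (2 ^ k)"
      using r by (simp add: powr_half_sqrt[symmetric] powr_powr)
    also have "C * upper_mass M (r powr (2 ^ k)) \<le> C * (C ^ k * upper_mass M r)"
      using Suc C by (intro mult_left_mono) auto
    finally show ?case by (simp add: mult.assoc)
  qed (use r in simp)
  obtain k :: nat where k: "L < 2 ^ k" using real_arch_pow[of 2 L] by auto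
  have "upper_mass M (r powr L) \<le> C ^ k * upper_mass M r" if r: "0 < r" "r < 1" for r
  proof -
    have "upper_mass M (r powr L) \<le> upper_mass M (r powr (2 ^ k))"
      using k r by (intro upper_mass_antimono assms powr_mono') auto
    with iter[OF r, of k] show ?thesis by linarith
  qed
  then show ?thesis using C by (intro exI[of _ "C ^ k"]) auto
qed

text \<open>On [r^L, r] the integrand is at most f r, and doubling bounds the mass by a multiple of
  the tail at r, so this piece costs a multiple of H r. What is left is the same integral up to r^L,
  ready for \<open>recursion_bound\<close>.\<close>

lemma nn_integral_lower_part_le:
  fixes f H :: "real \<Rightarrow> real"
  assumes M: "interval_measure M" "doubling M"
    and f: "\<And>r s. 0 \<le> r \<Longrightarrow> r \<le> s \<Longrightarrow> s < 1 \<Longrightarrow> f r \<le> f s" "\<And>r. 0 \<le> r \<Longrightarrow> r < 1 \<Longrightarrow> 0 \<le> f r"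
    and f_meas [measurable]: "f \<in> borel_measurable borel"
    and H: "\<And>r s. 0 \<le> r \<Longrightarrow> r \<le> s \<Longrightarrow> s < 1 \<Longrightarrow> H r \<le> H s" "0 < H 0"
    and fH: "0 \<le> c" "\<And>r. 0 \<le> r \<Longrightarrow> r < 1 \<Longrightarrow> f r * upper_mass M r \<le> c * H r"
    and cs: "0 < r0" "r0 < 1" "1 < L" "0 < q" "q < 1"
    and decay: "\<And>r. r0 \<le> r \<Longrightarrow> r < 1 \<Longrightarrow> H (r powr L) \<le> q * H r"
  shows "\<exists>C>0. \<forall>r. 0 \<le> r \<and> r < 1 \<longrightarrow>
    (\<integral>\<^sup>+t. ennreal (indicator {..r} t * f t) \<partial>M) \<le> ennreal (C * H r)"
proof -
  interpret finite_measure M using M by (simp add: interval_measure_def)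
  note [measurable_cong] = interval_measure_simps[OF M(1)]
  obtain C where C: "0 < C" "\<And>r. 0 < r \<Longrightarrow> r < 1 \<Longrightarrow> upper_mass M (r powr L) \<le> C * upper_mass M r"
    using doubling_powr[OF M, of L] by auto
  show ?thesis
  proof (rule recursion_bound[where b = "f r0 * measure M UNIV" and ?r0.0 = r0 and L = L and q = q and c = "C * c"])
    fix r :: real assume rs: "r \<le> r0"
    have "(\<integral>\<^sup>+t. ennreal (indicator {..r} t * f t) \<partial>M) \<le> (\<integral>\<^sup>+t. ennreal (f r0) \<partial>M)"
    proof (rule nn_integral_mono_AE)
      show "AE t in M. ennreal (indicator {..r} t * f t) \<le> ennreal (f r0)"
        using AE_interval_measure[OF M(1)]
        by eventually_elim (use rs cs f in \<open>auto simp: indicator_def intro!: ennreal_leI\<close>)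
    qed
    also have "\<dots> = ennreal (f r0 * measure M UNIV)"
      using f cs by (simp add: emeasure_eq_measure ennreal_mult space_interval_measure[OF M(1)])
    finally show "(\<integral>\<^sup>+t. ennreal (indicator {..r} t * f t) \<partial>M) \<le> ennreal (f r0 * measure M UNIV)" .
  next
    show "0 \<le> f r0 * measure M UNIV" using f cs by simp
  next
    fix r :: real assume r: "r0 \<le> r" "r < 1"
    then have r0: "0 < r" using cs by simp
    have "(\<integral>\<^sup>+t. ennreal (indicator {..r} t * f t) \<partial>M) \<le>
      (\<integral>\<^sup>+t. ennreal (indicator {..r powr L} t * f t) + ennreal (f r) * indicator {r powr L..} t \<partial>M)"
    proof (rule nn_integral_mono_AE)
      show "AE t in M. ennreal (indicator {..r} t * f t) \<le>
        ennreal (indicator {..r powr L} t * f t) + ennreal (f r) * indicator {r powr L..} t"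
        using AE_interval_measure[OF M(1)]
        by eventually_elim (use r f in \<open>auto simp: indicator_def intro!: ennreal_leI\<close>)
    qed
    also have "\<dots> = (\<integral>\<^sup>+t. ennreal (indicator {..r powr L} t * f t) \<partial>M) + ennreal (f r) * emeasure M {r powr L..}"
    proof (subst nn_integral_add)
      show "(\<lambda>t. ennreal (indicator {..r powr L} t * f t)) \<in> borel_measurable M"
        unfolding borel_measurable_interval_measure[OF M(1)] by measurable
      show "(\<lambda>t. ennreal (f r) * indicator {r powr L..} t) \<in> borel_measurable M"
        unfolding borel_measurable_interval_measure[OF M(1)] by measurable
    qed (simp add: nn_integral_cmult_indicator interval_measure_simps[OF M(1)])
    also have "ennreal (f r) * emeasure M {r powr L..} = ennreal (f r * upper_mass M (r powr L))"
      using f r r0 by (simp add: emeasure_eq_measure upper_mass_def ennreal_mult)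
    also have "\<dots> \<le> ennreal (C * c * H r)"
    proof (rule ennreal_leI)
      have "f r * upper_mass M (r powr L) \<le> f r * (C * upper_mass M r)"
        using f r r0 by (intro mult_left_mono C) auto
      also have "\<dots> = C * (f r * upper_mass M r)" by simp
      also have "\<dots> \<le> C * (c * H r)" using C r r0 fH by (intro mult_left_mono) auto
      finally show "f r * upper_mass M (r powr L) \<le> C * c * H r" by simp
    qed
    finally show "(\<integral>\<^sup>+t. ennreal (indicator {..r} t * f t) \<partial>M) \<le>
      (\<integral>\<^sup>+t. ennreal (indicator {..r powr L} t * f t) \<partial>M) + ennreal (C * c * H r)"
      by (simp add: add_left_mono)
  qed (use H cs C fH decay in auto)
qed

section \<open>Balanced triples of weights\<close>

lemma ennreal_lincomb:
  "0 \<le> a \<Longrightarrow> 0 \<le> x \<Longrightarrow> 0 \<le> b \<Longrightarrow> 0 \<le> y \<Longrightarrow>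
    ennreal (a * x + b * y) = ennreal a * ennreal x + ennreal b * ennreal y"
  by (simp add: ennreal_plus ennreal_mult)

text \<open>The only relation between the three measures is Hoelder's inequality, standing for the
  factorisation \<omega> = \<nu>^(1/p) \<sigma>^(1/p'). Restricting it to functions with values in
  [0, 1] makes every integral in it finite.\<close>

locale weight_triple =
  fixes p p' :: real and MO MN MS :: "real measure"
  assumes p: "1 < p" and conj_exponents: "1 / p + 1 / p' = 1"
    and interval: "interval_measure MO" "interval_measure MN" "interval_measure MS"
    and thick_O: "thick MO" and doubling_O: "doubling MO"
    and holder: "\<And>f g. f \<in> borel_measurable borel \<Longrightarrow> g \<in> borel_measurable borel \<Longrightarrow>
      (\<And>s. 0 < s \<Longrightarrow> s < 1 \<Longrightarrow> 0 \<le> f s \<and> f s \<le> 1) \<Longrightarrow>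
      (\<And>s. 0 < s \<Longrightarrow> s < 1 \<Longrightarrow> 0 \<le> g s \<and> g s \<le> 1) \<Longrightarrow>
      (\<integral>s. f s * g s \<partial>MO) \<le> (\<integral>s. f s powr p \<partial>MN) powr (1 / p) * (\<integral>s. g s powr p' \<partial>MS) powr (1 / p')"
begin

section \<open>Duality of \<nu> and \<sigma>, and Hoelder's inequality on tails\<close>

lemma p': "1 < p'"
proof -
  have "0 < 1 / p" "1 / p < 1" using p by simp_all
  then have "0 < 1 / p'" "1 / p' < 1" using conj_exponents by linarith+
  then show ?thesis by (simp add: divide_less_eq_1)
qed

text \<open>The hypotheses are symmetric, so a result about \<open>MN\<close> becomes one about
  \<open>MS\<close> with p and p' exchanged.\<close>

lemma weight_triple_swap: "weight_triple p' p MO MS MN"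
proof
  fix f g :: "real \<Rightarrow> real"
  assume "f \<in> borel_measurable borel" "g \<in> borel_measurable borel"
    "\<And>s. 0 < s \<Longrightarrow> s < 1 \<Longrightarrow> 0 \<le> f s \<and> f s \<le> 1" "\<And>s. 0 < s \<Longrightarrow> s < 1 \<Longrightarrow> 0 \<le> g s \<and> g s \<le> 1"
  then show "(\<integral>s. f s * g s \<partial>MO) \<le> (\<integral>s. f s powr p' \<partial>MS) powr (1 / p') * (\<integral>s. g s powr p \<partial>MN) powr (1 / p)"
    using holder[of g f] by (simp add: mult.commute)
qed (use p' conj_exponents interval thick_O doubling_O in \<open>auto simp: add.commute\<close>)

lemma interval_simps [simp]: "0 \<le> upper_mass MO r" "0 \<le> upper_mass MN r" "0 \<le> upper_mass MS r"
  using interval by (auto intro: upper_mass_nonneg)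

text \<open>The A condition with an explicit constant; it reverses
  \<open>upper_mass_holder\<close>.\<close>

definition balanced :: "real \<Rightarrow> bool" where
  "balanced A \<longleftrightarrow> 0 < A \<and> (\<forall>r. 0 \<le> r \<and> r < 1 \<longrightarrow>
     upper_mass MN r powr (1 / p) * upper_mass MS r powr (1 / p') \<le> A * upper_mass MO r)"

text \<open>Two different sets are allowed because \<open>balanced_reverse_doubling_N\<close> pairs
  an interval [u, r) with the whole tail at u.\<close>

lemma holder_sets:
  assumes "S \<in> sets borel" "T \<in> sets borel"
  shows "measure MO (S \<inter> T) \<le> measure MN S powr (1 / p) * measure MS T powr (1 / p')"
proof -
  have *: "indicator S s powr a = (indicator S s :: real)" if "0 < a" for S :: "real set" and s a :: real
    using that by (simp add: indicator_def)
  have "measure MO (S \<inter> T) = (\<integral>s. indicator S s * indicator T s \<partial>MO)"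
    using assms by (subst indicator_inter_arith[symmetric]) (simp add: interval)
  also have "\<dots> \<le> (\<integral>s. indicator S s powr p \<partial>MN) powr (1 / p) * (\<integral>s. indicator T s powr p' \<partial>MS) powr (1 / p')"
    using assms by (intro holder) (auto simp: indicator_def)
  also have "\<dots> = measure MN S powr (1 / p) * measure MS T powr (1 / p')"
    using p p' by (simp add: * interval)
  finally show ?thesis .
qed

lemma upper_mass_holder:
  "upper_mass MO r \<le> upper_mass MN r powr (1 / p) * upper_mass MS r powr (1 / p')"
  using holder_sets[of "{r..}" "{r..}"] by (simp add: upper_mass_def)

lemma upper_mass_O_pos: "r < 1 \<Longrightarrow> 0 < upper_mass MO r"
  using thick_O by (simp add: thick_def)

text \<open>A vanishing tail of \<nu> would make that of \<omega> vanish by Hoelder's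
  inequality.\<close>

lemma upper_mass_N_pos: "r < 1 \<Longrightarrow> 0 < upper_mass MN r"
  using upper_mass_O_pos[of r] upper_mass_holder[of r] interval_simps(2)[of r]
  by (metis less_le mult_zero_left not_le powr_0)

lemma thick_N: "thick MN"
  by (simp add: thick_def upper_mass_N_pos)

text \<open>Balance at r, doubling of \<omega> and Hoelder's inequality at \<open>sqrt r\<close> are
  chained. The \<sigma>-tail at \<open>sqrt r\<close> is at most the one at r, which then cancels
  and leaves only the tails of \<nu>.\<close>

lemma balanced_doubling_N:
  assumes "balanced A"
  shows "doubling MN"
proof -
  interpret swap: weight_triple p' p MO MS MN by (rule weight_triple_swap)
  obtain C where C: "0 < C" "\<And>r. 0 < r \<Longrightarrow> r < 1 \<Longrightarrow> upper_mass MO r \<le> C * upper_mass MO (sqrt r)"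
    using doubling_O by (auto simp: doubling_def)
  have A: "0 < A" using assms by (simp add: balanced_def)
  have "upper_mass MN r \<le> (A * C) powr p * upper_mass MN (sqrt r)" if r: "0 < r" "r < 1" for r
  proof -
    have rs: "r \<le> sqrt r"
      using r by (intro real_le_rsqrt) (simp add: power2_eq_square mult_left_le)
    have S: "0 < upper_mass MS r powr (1/p')" using swap.upper_mass_N_pos[of r] r by simp
    have "upper_mass MN r powr (1/p) * upper_mass MS r powr (1/p') \<le> A * upper_mass MO r"
      using assms r by (auto simp: balanced_def)
    also have "\<dots> \<le> A * (C * upper_mass MO (sqrt r))" using A C r by (intro mult_left_mono) auto
    also have "\<dots> \<le> A * (C * (upper_mass MN (sqrt r) powr (1 / p) * upper_mass MS (sqrt r) powr (1 / p')))"
      using A C by (intro mult_left_mono upper_mass_holder) auto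
    also have "\<dots> \<le> A * (C * (upper_mass MN (sqrt r) powr (1 / p) * upper_mass MS r powr (1 / p')))"
      using A C rs p' by (intro mult_left_mono powr_mono2 upper_mass_antimono interval) auto
    finally have "upper_mass MN r powr (1/p) * upper_mass MS r powr (1/p') \<le>
        (A * C * upper_mass MN (sqrt r) powr (1 / p)) * upper_mass MS r powr (1 / p')" by (simp add: mult.assoc)
    then have "upper_mass MN r powr (1/p) \<le> A * C * upper_mass MN (sqrt r) powr (1 / p)"
      using S by simp
    then have "(upper_mass MN r powr (1/p)) powr p \<le> (A * C * upper_mass MN (sqrt r) powr (1 / p)) powr p"
      using p by (intro powr_mono2) auto
    also have "\<dots> = (A * C) powr p * (upper_mass MN (sqrt r) powr (1 / p)) powr p"
      by (rule powr_mult)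
    finally show ?thesis using p by (simp add: powr_powr)
  qed
  moreover have "0 < (A * C) powr p" using A C by simp
  ultimately show ?thesis unfolding doubling_def by blast
qed

lemma balanced_swap: "weight_triple.balanced p' p MO MS MN A \<longleftrightarrow> balanced A"
proof -
  interpret swap: weight_triple p' p MO MS MN by (rule weight_triple_swap)
  show ?thesis by (simp add: balanced_def swap.balanced_def mult.commute)
qed

text \<open>Hoelder's inequality at r is followed by balance at r^L, the \<sigma>-tail being
  replaced by its larger value at r^L. A decay factor e for \<nu> becomes A e^(1/p) for \<omega>,
  and e is chosen to make this 1/2.\<close>

lemma balanced_reverse_doubling_O:
  assumes "balanced A" "reverse_doubling MN"
  shows "reverse_doubling MO"
proof -
  have A: "0 < A" using assms by (simp add: balanced_def)
  define e where "e = (1 / (2 * A)) powr p"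
  have "0 < e" using A by (simp add: e_def)
  then obtain L r0 where L: "1 < L" "0 < r0" "r0 < 1"
    "\<And>r. r0 \<le> r \<Longrightarrow> r < 1 \<Longrightarrow> upper_mass MN r \<le> e * upper_mass MN (r powr L)"
    using reverse_doubling_small[OF interval(2) assms(2)] by blast
  have "upper_mass MO r \<le> 1/2 * upper_mass MO (r powr L)" if r: "r0 \<le> r" "r < 1" for r
  proof -
    have rL: "r powr L \<le> r" "r powr L < 1"
      using powr_mono'[of 1 L r] powr_less_mono2[of L r 1] r L by auto
    have "upper_mass MO r \<le> upper_mass MN r powr (1 / p) * upper_mass MS r powr (1 / p')"
      by (rule upper_mass_holder)
    also have "\<dots> \<le> (e * upper_mass MN (r powr L)) powr (1 / p) * upper_mass MS (r powr L) powr (1 / p')"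
      using L r rL p p' by (intro mult_mono powr_mono2 upper_mass_antimono interval) auto
    also have "\<dots> = e powr (1 / p) * (upper_mass MN (r powr L) powr (1 / p) * upper_mass MS (r powr L) powr (1 / p'))"
      by (simp add: powr_mult)
    also have "\<dots> \<le> e powr (1 / p) * (A * upper_mass MO (r powr L))"
      using assms(1) rL by (intro mult_left_mono) (auto simp: balanced_def)
    also have "e powr (1 / p) = 1 / (2 * A)" using p A by (simp add: e_def powr_powr)
    finally show ?thesis using A by simp
  qed
  then show ?thesis unfolding reverse_doubling_def
    using L by (intro exI[of _ "1/2"] exI[of _ L] exI[of _ r0]) auto
qed

text \<open>The interval [u, r) with u = r^L carries at least the share 1 - q of the \<omega>-tail
  at u. Hoelder's inequality against the full \<sigma>-tail, combined with balance at u, forces it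
  to carry a fixed share d of the \<nu>-tail. For the swapped triple this passes reverse doubling
  from \<omega> to \<sigma>.\<close>

lemma balanced_reverse_doubling_N:
  assumes "balanced A" "reverse_doubling MO"
  shows "reverse_doubling MN"
proof -
  have A: "0 < A" using assms by (simp add: balanced_def)
  interpret swap: weight_triple p' p MO MS MN by (rule weight_triple_swap)
  obtain q L r0 where q: "0 < q" "q < 1" "1 < L" "0 < r0" "r0 < 1"
    "\<And>r. r0 \<le> r \<Longrightarrow> r < 1 \<Longrightarrow> upper_mass MO r \<le> q * upper_mass MO (r powr L)"
    using assms(2) by (auto simp: reverse_doubling_def)
  \<comment> \<open>The argument bounds the p-th root of the share from below by (1 - q) / A, hence
    the power p.\<close>
  define d where "d = ((1 - q) / A) powr p"
  have d: "0 < d" using q A by (simp add: d_def)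
  have "upper_mass MN r \<le> max (1 - d) (1/2) * upper_mass MN (r powr L)" if r: "r0 \<le> r" "r < 1" for r
  proof -
    define u where "u = r powr L"
    have u: "0 \<le> u" "u \<le> r" "u < 1"
      using powr_mono'[of 1 L r] powr_less_mono2[of L r 1] r q by (auto simp: u_def)
    have diff: "measure M {u..<r} = upper_mass M u - upper_mass M r" if M: "interval_measure M" for M
    proof -
      interpret finite_measure M using M by (simp add: interval_measure_def)
      have "measure M ({u..} - {r..}) = measure M {u..} - measure M {r..}"
        using u by (intro finite_measure_Diff) (auto simp: interval_measure_simps[OF M])
      moreover have "{u..} - {r..} = {u..<r}" by auto
      ultimately show ?thesis by (simp add: upper_mass_def)
    qed
    have N: "0 < upper_mass MN u" and S: "0 < upper_mass MS u powr (1/p')"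
      using u upper_mass_N_pos swap.upper_mass_N_pos[of u] by auto
    have "(1 - q) * (upper_mass MN u powr (1/p) * upper_mass MS u powr (1/p')) \<le> (1 - q) * (A * upper_mass MO u)"
      using assms(1) u q by (intro mult_left_mono) (auto simp: balanced_def)
    also have "\<dots> = A * ((1 - q) * upper_mass MO u)" by simp
    also have "(1 - q) * upper_mass MO u \<le> measure MO {u..<r}"
    proof -
      have "upper_mass MO r \<le> q * upper_mass MO u" using q(6)[OF r] by (simp add: u_def)
      then show ?thesis using diff[OF interval(1)] by (simp add: algebra_simps)
    qed
    also have "measure MO {u..<r} \<le> measure MN {u..<r} powr (1/p) * upper_mass MS u powr (1/p')"
      using holder_sets[of "{u..<r}" "{u..}"] by (simp add: upper_mass_def Int_absorb2 ivl_subset atLeastLessThan_def)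
    finally have "(1 - q) * (upper_mass MN u powr (1/p) * upper_mass MS u powr (1/p')) \<le>
      A * (measure MN {u..<r} powr (1/p) * upper_mass MS u powr (1/p'))" using A by simp
    then have "((1 - q) * upper_mass MN u powr (1/p)) * upper_mass MS u powr (1/p') \<le>
      (A * measure MN {u..<r} powr (1/p)) * upper_mass MS u powr (1/p')" by (simp only: mult.assoc)
    then have "(1 - q) * upper_mass MN u powr (1/p) \<le> A * measure MN {u..<r} powr (1/p)"
      using S by simp
    then have "(1 - q) / A * upper_mass MN u powr (1/p) \<le> measure MN {u..<r} powr (1/p)"
      using A by (simp add: field_simps)
    then have "((1 - q) / A * upper_mass MN u powr (1/p)) powr p \<le> (measure MN {u..<r} powr (1/p)) powr p"
      using p A q by (intro powr_mono2) auto
    also have "((1 - q) / A * upper_mass MN u powr (1/p)) powr p = d * upper_mass MN u"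
      using p A q N by (subst powr_mult) (auto simp: powr_powr d_def)
    also have "(measure MN {u..<r} powr (1/p)) powr p = upper_mass MN u - upper_mass MN r"
      using p by (simp add: powr_powr flip: diff[OF interval(2)])
    finally have "d * upper_mass MN u \<le> upper_mass MN u - upper_mass MN r" .
    then have "upper_mass MN r \<le> (1 - d) * upper_mass MN u" by (simp add: algebra_simps)
    \<comment> \<open>The maximum keeps the factor strictly positive, as
      \<open>reverse_doubling\<close> requires.\<close>
    also have "\<dots> \<le> max (1 - d) (1/2) * upper_mass MN u" using N by (intro mult_right_mono) auto
    finally show ?thesis by (simp add: u_def)
  qed
  then show ?thesis unfolding reverse_doubling_def
    using q d by (intro exI[of _ "max (1 - d) (1/2)"] exI[of _ L] exI[of _ r0]) auto
qed

text \<open>Decay of the tail towards the boundary is geometric growth of its negative powers, the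
  form in which \<open>recursion_bound\<close> wants H.\<close>

lemma powr_upper_mass_decay:
  assumes "interval_measure M" "thick M" "reverse_doubling M" "0 < a"
  shows "\<exists>q L r0. 0 < q \<and> q < 1 \<and> 1 < L \<and> 0 < r0 \<and> r0 < 1 \<and>
    (\<forall>r. r0 \<le> r \<and> r < 1 \<longrightarrow> upper_mass M (r powr L) powr (- a) \<le> q * upper_mass M r powr (- a))"
proof -
  obtain q L r0 where q: "0 < q" "q < 1" "1 < L" "0 < r0" "r0 < 1"
    "\<And>r. r0 \<le> r \<Longrightarrow> r < 1 \<Longrightarrow> upper_mass M r \<le> q * upper_mass M (r powr L)"
    using assms(3) by (auto simp: reverse_doubling_def)
  have "upper_mass M (r powr L) powr (- a) \<le> q powr a * upper_mass M r powr (- a)" if r: "r0 \<le> r" "r < 1" for r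
  proof -
    have pos: "0 < upper_mass M r" using assms r by (auto simp: thick_def)
    have "upper_mass M (r powr L) powr (- a) \<le> (upper_mass M r / q) powr (- a)"
      using q(6)[OF r] pos q assms(4) by (intro powr_mono2') (auto simp: field_simps)
    also have "\<dots> = q powr a * upper_mass M r powr (- a)"
      using q pos by (simp add: powr_divide powr_minus_divide)
    finally show ?thesis .
  qed
  moreover have "q powr a < 1" using powr_less_mono2[of a q 1] q assms(4) by simp
  ultimately show ?thesis using q by (intro exI[of _ "q powr a"] exI[of _ L] exI[of _ r0]) auto
qed

text \<open>Write T_O, T_N, T_S for the tails. Since r t \<le> min(r, t), the kernel is at most B /
  T_O(min(r, t)). For t \<ge> r what remains is the integral of T_S^(-1/p) over a tail; for t \<le>
  r the integral is summed along r, r^L, .... Balance converts both pieces into multiples of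
  T_N(r)^(-1/p).\<close>

lemma schur_bound:
  assumes bal: "balanced A" and rd: "reverse_doubling MN"
    and k: "\<And>\<rho>. 0 \<le> \<rho> \<Longrightarrow> \<rho> < 1 \<Longrightarrow> k \<rho> \<le> B / upper_mass MO \<rho>" "0 < B"
  shows "\<exists>C>0. \<forall>r. 0 \<le> r \<and> r < 1 \<longrightarrow>
    (\<integral>\<^sup>+t. ennreal (upper_mass MS t powr (- (1 / p)) * k (r * t)) \<partial>MS)
      \<le> ennreal (C * upper_mass MN r powr (- (1 / p)))"
proof -
  interpret swap: weight_triple p' p MO MS MN by (rule weight_triple_swap)
  have A: "0 < A" using bal by (simp add: balanced_def)
  note [measurable] = borel_measurable_upper_mass[OF interval(1)] borel_measurable_upper_mass[OF interval(2)]
    borel_measurable_upper_mass[OF interval(3)]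
  define f where "f t = upper_mass MS t powr (- (1/p)) / upper_mass MO t" for t
  have f_meas [measurable]: "f \<in> borel_measurable borel" unfolding f_def by measurable
  \<comment> \<open>Balance divided by T_O(r) T_N(r)^(1/p), using 1 - 1/p = 1/p'.\<close>
  have fle: "upper_mass MS r powr (1 - 1 / p) / upper_mass MO r \<le> A * upper_mass MN r powr (- (1 / p))"
    if "0 \<le> r" "r < 1" for r
  proof -
    have "upper_mass MN r powr (1/p) * upper_mass MS r powr (1/p') \<le> A * upper_mass MO r"
      using bal that by (auto simp: balanced_def)
    moreover have "1 - 1 / p = 1 / p'" using conj_exponents by linarith
    ultimately show ?thesis using upper_mass_O_pos[of r] upper_mass_N_pos[of r] that
      by (simp only: powr_minus_divide) (simp add: field_simps)
  qed
  have "\<exists>q L r0. 0 < q \<and> q < 1 \<and> 1 < L \<and> 0 < r0 \<and> r0 < 1 \<and>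
    (\<forall>r. r0 \<le> r \<and> r < 1 \<longrightarrow> upper_mass MN (r powr L) powr (- (1/p)) \<le> q * upper_mass MN r powr (- (1/p)))"
    using p by (intro powr_upper_mass_decay interval thick_N rd) auto
  then obtain q L r0 where q: "0 < q" "q < 1" "1 < L" "0 < r0" "r0 < 1"
    "\<And>r. r0 \<le> r \<Longrightarrow> r < 1 \<Longrightarrow> upper_mass MN (r powr L) powr (- (1/p)) \<le> q * upper_mass MN r powr (- (1/p))"
    by blast
  have "\<exists>C>0. \<forall>r. 0 \<le> r \<and> r < 1 \<longrightarrow>
    (\<integral>\<^sup>+t. ennreal (indicator {..r} t * f t) \<partial>MS) \<le> ennreal (C * upper_mass MN r powr (- (1/p)))"
  proof (rule nn_integral_lower_part_le[OF interval(3) _ _ _ f_meas _ _ _ _ q(4,5,3,1,2), where c = A])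
    show "doubling MS" using bal by (intro swap.balanced_doubling_N[of A]) (simp add: balanced_swap)
    fix r s :: real assume rs: "0 \<le> r" "r \<le> s" "s < 1"
    show "f r \<le> f s"
      unfolding f_def using rs p
      by (intro frac_le powr_mono2' upper_mass_antimono interval swap.upper_mass_N_pos upper_mass_O_pos) auto
    show "upper_mass MN r powr (- (1/p)) \<le> upper_mass MN s powr (- (1/p))"
      using rs p by (intro powr_mono2' upper_mass_antimono interval upper_mass_N_pos) auto
  next
    fix r :: real assume r: "0 \<le> r" "r < 1"
    show "0 \<le> f r" by (simp add: f_def)
    have "f r * upper_mass MS r = upper_mass MS r powr (1 - 1 / p) / upper_mass MO r"
      using swap.upper_mass_N_pos[of r] r powr_add[of "upper_mass MS r" "- (1/p)" 1] by (simp add: f_def)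
    with fle[OF r] show "f r * upper_mass MS r \<le> A * upper_mass MN r powr (- (1/p))" by simp
  next
    show "0 < upper_mass MN 0 powr (- (1/p))" using upper_mass_N_pos[of 0] by simp
  qed (use A q in auto)
  then obtain C1 where C1: "0 < C1" "\<And>r. 0 \<le> r \<Longrightarrow> r < 1 \<Longrightarrow>
    (\<integral>\<^sup>+t. ennreal (indicator {..r} t * f t) \<partial>MS) \<le> ennreal (C1 * upper_mass MN r powr (- (1/p)))" by blast
  obtain C2 where C2: "0 < C2" "\<And>r. r < 1 \<Longrightarrow>
    (\<integral>\<^sup>+t. ennreal (indicator {r..} t * upper_mass MS t powr (- (1/p))) \<partial>MS) \<le> ennreal (C2 * upper_mass MS r powr (1 - 1/p))"
    using nn_integral_upper_mass_powr[OF interval(3) swap.thick_N, of "1/p"] p by auto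
  have "(\<integral>\<^sup>+t. ennreal (upper_mass MS t powr (- (1 / p)) * k (r * t)) \<partial>MS)
      \<le> ennreal (B * (C1 + C2 * A) * upper_mass MN r powr (- (1 / p)))" if r: "0 \<le> r" "r < 1" for r
  proof -
    let ?g = "\<lambda>t. indicator {r..} t * upper_mass MS t powr (- (1/p))"
    have "(\<integral>\<^sup>+t. ennreal (upper_mass MS t powr (- (1 / p)) * k (r * t)) \<partial>MS) \<le>
      (\<integral>\<^sup>+t. ennreal B * ennreal (indicator {..r} t * f t) + ennreal (B / upper_mass MO r) * ennreal (?g t) \<partial>MS)"
    proof (rule nn_integral_mono_AE)
      show "AE t in MS. ennreal (upper_mass MS t powr (- (1 / p)) * k (r * t)) \<le>
        ennreal B * ennreal (indicator {..r} t * f t) + ennreal (B / upper_mass MO r) * ennreal (?g t)"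
        using AE_interval_measure[OF interval(3)]
      proof eventually_elim
        fix t :: real assume t: "0 < t \<and> t < 1"
        define m where "m = min r t"
        have "r * t \<le> r" "r * t \<le> t" "0 \<le> r * t" using r t by (auto simp: mult_left_le mult_right_le_one_le mult_le_cancel_right1)
        then have rt: "r * t \<le> m" "0 \<le> r * t" "m < 1" using r t by (auto simp: m_def)
        have "k (r * t) \<le> B / upper_mass MO (r * t)" using rt by (intro k) auto
        also have "\<dots> \<le> B / upper_mass MO m"
          using rt k(2) by (intro divide_left_mono upper_mass_antimono interval mult_pos_pos upper_mass_O_pos) auto
        finally have "upper_mass MS t powr (- (1 / p)) * k (r * t) \<le> upper_mass MS t powr (- (1 / p)) * (B / upper_mass MO m)"
          by (rule mult_left_mono) auto
        also have "\<dots> \<le> B * (indicator {..r} t * f t) + B / upper_mass MO r * ?g t"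
          using k(2) by (auto simp: m_def f_def indicator_def min_def field_simps)
        finally have "ennreal (upper_mass MS t powr (- (1 / p)) * k (r * t)) \<le>
           ennreal (B * (indicator {..r} t * f t) + B / upper_mass MO r * ?g t)" by (rule ennreal_leI)
        also have "\<dots> = ennreal B * ennreal (indicator {..r} t * f t) + ennreal (B / upper_mass MO r) * ennreal (?g t)"
          using k(2) by (intro ennreal_lincomb) (auto simp: f_def)
        finally show "ennreal (upper_mass MS t powr (- (1 / p)) * k (r * t)) \<le>
          ennreal B * ennreal (indicator {..r} t * f t) + ennreal (B / upper_mass MO r) * ennreal (?g t)" .
      qed
    qed
    also have "\<dots> = ennreal B * (\<integral>\<^sup>+t. ennreal (indicator {..r} t * f t) \<partial>MS) +
       ennreal (B / upper_mass MO r) * (\<integral>\<^sup>+t. ennreal (?g t) \<partial>MS)"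
      by (subst nn_integral_add) (auto simp: interval nn_integral_cmult)
    also have "\<dots> \<le> ennreal B * ennreal (C1 * upper_mass MN r powr (- (1/p))) +
       ennreal (B / upper_mass MO r) * ennreal (C2 * upper_mass MS r powr (1 - 1/p))"
      using r by (intro add_mono mult_left_mono C1 C2) auto
    also have "\<dots> = ennreal (B * (C1 * upper_mass MN r powr (- (1/p))) + B * C2 * (upper_mass MS r powr (1 - 1/p) / upper_mass MO r))"
      using k(2) C1(1) C2(1) by (simp add: ennreal_plus ennreal_mult[symmetric] mult_ac)
    also have "\<dots> \<le> ennreal (B * (C1 * upper_mass MN r powr (- (1/p))) + B * C2 * (A * upper_mass MN r powr (- (1 / p))))"
      using k(2) C2(1) r by (intro ennreal_leI add_left_mono mult_left_mono fle) auto
    finally show ?thesis by (simp add: algebra_simps)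
  qed
  moreover have "0 < B * (C1 + C2 * A)" using k(2) C1(1) C2(1) A by (intro mult_pos_pos add_pos_pos)
  ultimately show ?thesis by blast
qed

text \<open>The p-th power of balance reads T_O(r)^(-p) T_N(r) \<le> A^p T_S(r)^(-p/p'). This is the
  hypothesis of \<open>nn_integral_lower_part_le\<close> for f = T_O^(-p), and reverse doubling of
  \<sigma> provides the geometric growth of the right-hand side.\<close>

lemma balanced_imp_muckenhoupt:
  assumes bal: "balanced A" and rd: "reverse_doubling MS"
  shows "\<exists>C>0. \<forall>r. 0 \<le> r \<and> r < 1 \<longrightarrow>
    (\<integral>\<^sup>+t. ennreal (indicator {..r} t * upper_mass MO t powr (- p)) \<partial>MN)
      \<le> ennreal (C * upper_mass MS r powr (- (p / p')))"
proof -
  interpret swap: weight_triple p' p MO MS MN by (rule weight_triple_swap)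
  have A: "0 < A" using bal by (simp add: balanced_def)
  note [measurable] = borel_measurable_upper_mass[OF interval(1)]
  have "\<exists>q L r0. 0 < q \<and> q < 1 \<and> 1 < L \<and> 0 < r0 \<and> r0 < 1 \<and>
    (\<forall>r. r0 \<le> r \<and> r < 1 \<longrightarrow> upper_mass MS (r powr L) powr (- (p/p')) \<le> q * upper_mass MS r powr (- (p/p')))"
    using p p' by (intro powr_upper_mass_decay interval swap.thick_N rd) auto
  then obtain q L r0 where q: "0 < q" "q < 1" "1 < L" "0 < r0" "r0 < 1"
    "\<And>r. r0 \<le> r \<Longrightarrow> r < 1 \<Longrightarrow> upper_mass MS (r powr L) powr (- (p/p')) \<le> q * upper_mass MS r powr (- (p/p'))"
    by blast
  show ?thesis
  proof (rule nn_integral_lower_part_le[OF interval(2) _ _ _ _ _ _ _ _ q(4,5,3,1,2), where c = "A powr p"])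
    show "doubling MN" using bal by (rule balanced_doubling_N)
    fix r s :: real assume rs: "0 \<le> r" "r \<le> s" "s < 1"
    show "upper_mass MO r powr (- p) \<le> upper_mass MO s powr (- p)"
      using rs p by (intro powr_mono2' upper_mass_antimono interval upper_mass_O_pos) auto
    show "upper_mass MS r powr (- (p/p')) \<le> upper_mass MS s powr (- (p/p'))"
      using rs p p' by (intro powr_mono2' upper_mass_antimono interval swap.upper_mass_N_pos) auto
  next
    fix r :: real assume r: "0 \<le> r" "r < 1"
    have "(upper_mass MN r powr (1/p) * upper_mass MS r powr (1/p')) powr p \<le> (A * upper_mass MO r) powr p"
      using bal r p by (intro powr_mono2) (auto simp: balanced_def)
    then have "upper_mass MN r * upper_mass MS r powr (p/p') \<le> A powr p * upper_mass MO r powr p"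
      using p by (simp add: powr_mult powr_powr)
    then show "upper_mass MO r powr (- p) * upper_mass MN r \<le> A powr p * upper_mass MS r powr (- (p/p'))"
      using upper_mass_O_pos[of r] swap.upper_mass_N_pos[of r] r
      by (simp add: powr_minus_divide field_simps)
  next
    show "0 < upper_mass MS 0 powr (- (p/p'))" using swap.upper_mass_N_pos[of 0] by simp
  qed (use A q in auto)
qed

text \<open>It is enough to bound T_N(r) by a multiple of T_O(r)^p (J r + 1). Decay of the moments
  of \<nu> makes T_N(r) at most the integral of s^y over s < r, for an order y comparable to 1 / (-
  ln r). There doubling of \<omega> gives s^y \<le> C (T_O(r) / T_O(s))^p, which integrates to C
  T_O(r)^p J r.\<close>

lemma muckenhoupt_imp_balanced:
  assumes M: "\<And>r. 0 \<le> r \<Longrightarrow> r < 1 \<Longrightarrow>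
      ((\<integral>t. indicator {..r} t * upper_mass MO t powr (- p) \<partial>MN) + 1) powr (1/p) * upper_mass MS r powr (1/p') \<le> B"
    and decay: "moment_decay MN"
  shows "\<exists>A. balanced A"
proof -
  note [measurable] = borel_measurable_upper_mass[OF interval(1)]
  define J where "J r = (\<integral>t. indicator {..r} t * upper_mass MO t powr (- p) \<partial>MN)" for r
  have intJ: "integrable MN (\<lambda>t. indicator {..r} t * upper_mass MO t powr (- p))" if "r < 1" for r
    using that p upper_mass_O_pos
    by (intro integrable_bounded_interval[OF interval(2), where B = "upper_mass MO r powr (- p)"])
       (auto simp: indicator_def intro!: powr_mono2' upper_mass_antimono interval)
  have J0: "0 \<le> J r" for r unfolding J_def by (rule integral_nonneg_AE) (auto simp: indicator_def)
  obtain C where C: "0 < C" "\<And>y. 0 < y \<Longrightarrow> power_moment MO y \<le> C * upper_mass MO (exp (- 1 / y))"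
    using doubling_imp_moment_le_upper_mass[OF interval(1) doubling_O] by auto
  obtain q K where qK: "0 < q" "q < 1" "1 < K"
    "\<And>y. 0 \<le> y \<Longrightarrow> power_moment MN (K * (y + 1) - 1) \<le> q * power_moment MN y"
    using decay by (auto simp: moment_decay_def)
  \<comment> \<open>Enough steps of decay to pay for the factor e in
    \<open>upper_mass_le_power_moment\<close> and still leave 1/2.\<close>
  obtain j where "q ^ j < 1 / (2 * exp 1)"
    using real_arch_pow_inv[of "1 / (2 * exp 1)" q] qK by auto
  then have j: "exp 1 * q ^ j \<le> 1/2" by (simp add: field_simps)
  have Kj: "1 \<le> K ^ j" using qK by simp
  obtain C2 where C2: "0 < C2" "\<And>y. 0 \<le> y \<Longrightarrow> power_moment MO y \<le> C2 * power_moment MO ((2 * K ^ j * p) * y)"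
    using doubling_imp_moment_scale[OF interval(1) doubling_O, of "2 * K ^ j * p"] Kj p by auto
  define r0 where "r0 = exp (- 1 / (2 * K ^ j))"
  have r0: "0 < r0" "r0 < 1" using Kj by (auto simp: r0_def)
  have big: "upper_mass MN r \<le> (C2 * C) powr p * upper_mass MO r powr p * J r" if r: "r0 \<le> r" "r < 1" for r
  proof -
    have rpos: "0 < r" using r r0 by simp
    have lnr: "ln r < 0" "- 1 / (2 * K ^ j) \<le> ln r" using r rpos r0 by (auto simp: ln_ge_iff r0_def)
    define Y where "Y = 1 / (- ln r)"
    have Y: "2 * K ^ j \<le> Y" using lnr Kj by (simp add: Y_def field_simps)
    have rY: "exp (- 1 / Y) = r" using rpos lnr by (simp add: Y_def)
    \<comment> \<open>Solves Y = K^j (y + 1) - 1, so that j steps of decay lead from y to Y.\<close>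
    define y where "y = (Y + 1) / K ^ j - 1"
    have y0: "0 \<le> y" using Y Kj by (simp add: y_def field_simps)
    have yY: "Y \<le> (2 * K ^ j * p) * (y / p)"
    proof -
      have "(2 * K ^ j * p) * (y / p) = 2 * (Y + 1) - 2 * K ^ j" using Kj qK(3) p by (simp add: y_def field_simps)
      then show ?thesis using Y by simp
    qed
    \<comment> \<open>Chebyshev's inequality at order y / p; then doubling raises the order beyond
      Y, where the moment of \<omega> is controlled by its tail at r.\<close>
    have pw: "s powr y \<le> (C2 * C) powr p * upper_mass MO r powr p * upper_mass MO s powr (- p)"
      if s: "0 < s" "s < 1" for s
    proof -
      have "s powr (y / p) * upper_mass MO s \<le> power_moment MO (y / p)"
        using s y0 p by (intro power_moment_ge interval) auto
      also have "\<dots> \<le> C2 * power_moment MO ((2 * K ^ j * p) * (y / p))" using y0 p by (intro C2) auto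
      also have "\<dots> \<le> C2 * power_moment MO Y"
        using C2 yY Y Kj by (intro mult_left_mono power_moment_antimono interval) auto
      also have "\<dots> \<le> C2 * (C * upper_mass MO (exp (- 1 / Y)))"
        using C2 Y Kj by (intro mult_left_mono C) auto
      finally have "s powr (y / p) * upper_mass MO s \<le> (C2 * C) * upper_mass MO r" by (simp only: rY mult.assoc)
      then have "(s powr (y / p) * upper_mass MO s) powr p \<le> ((C2 * C) * upper_mass MO r) powr p"
        using p by (intro powr_mono2) auto
      then have "s powr y * upper_mass MO s powr p \<le> (C2 * C) powr p * upper_mass MO r powr p"
        using p by (simp add: powr_mult powr_powr)
      then show ?thesis using upper_mass_O_pos[of s] s by (simp add: powr_minus_divide field_simps)
    qed
    \<comment> \<open>With equal exponents the extra factor is 1, and the moment is merely cut at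
      r.\<close>
    have "power_moment MN y \<le> upper_mass MN r + r powr (y - y) * (\<integral>s. indicator {..<r} s * s powr y \<partial>MN)"
      using y0 rpos by (intro power_moment_split interval) auto
    then have split: "power_moment MN y \<le> upper_mass MN r + (\<integral>s. indicator {..<r} s * s powr y \<partial>MN)"
      using rpos by simp
    have "upper_mass MN r \<le> exp 1 * power_moment MN Y"
      using upper_mass_le_power_moment[OF interval(2), of Y] Y Kj unfolding rY by simp
    also have "Y = K ^ j * (y + 1) - 1" using Kj qK(3) by (simp add: y_def)
    also have "exp 1 * power_moment MN (K ^ j * (y + 1) - 1) \<le> exp 1 * (q ^ j * power_moment MN y)"
      using y0 by (intro mult_left_mono moment_decay_iterate interval qK) auto
    also have "\<dots> = (exp 1 * q ^ j) * power_moment MN y" by simp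
    also have "\<dots> \<le> 1/2 * (upper_mass MN r + (\<integral>s. indicator {..<r} s * s powr y \<partial>MN))"
      using j split qK power_moment_nonneg[OF interval(2)] by (intro mult_mono) auto
    \<comment> \<open>The tail itself stood on the right with factor 1/2 and has been
      absorbed.\<close>
    finally have "upper_mass MN r \<le> (\<integral>s. indicator {..<r} s * s powr y \<partial>MN)" by simp
    also have "\<dots> \<le> (\<integral>s. (C2 * C) powr p * upper_mass MO r powr p * (indicator {..r} s * upper_mass MO s powr (- p)) \<partial>MN)"
    proof (rule integral_mono_AE)
      show "integrable MN (\<lambda>s. indicator {..<r} s * s powr y)"
        by (rule integrable_bounded_interval[OF interval(2), where B = 1]) (use y0 in \<open>auto simp: indicator_def powr_le1\<close>)
      show "AE s in MN. indicator {..<r} s * s powr y \<le>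
        (C2 * C) powr p * upper_mass MO r powr p * (indicator {..r} s * upper_mass MO s powr (- p))"
        using AE_interval_measure[OF interval(2)] by eventually_elim (use pw in \<open>auto simp: indicator_def\<close>)
    qed (use intJ r in auto)
    also have "\<dots> = (C2 * C) powr p * upper_mass MO r powr p * J r"
      unfolding J_def by simp
    finally show ?thesis .
  qed
  \<comment> \<open>The second entry is for r < r0: there T_N(r) is at most T_N(0), and the 1 next
    to J r suffices.\<close>
  define c where "c = max ((C2 * C) powr p) (upper_mass MN 0 * upper_mass MO r0 powr (- p))"
  have c: "0 < c" using C C2 by (auto simp: c_def less_max_iff_disj)
  have main: "upper_mass MN r \<le> c * upper_mass MO r powr p * (J r + 1)" if r: "0 \<le> r" "r < 1" for r
  proof (cases "r0 \<le> r")
    case True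
    have "upper_mass MN r \<le> (C2 * C) powr p * upper_mass MO r powr p * J r" by (rule big[OF True r(2)])
    also have "\<dots> \<le> c * upper_mass MO r powr p * (J r + 1)"
    proof -
      have "(C2 * C) powr p \<le> c" by (simp add: c_def)
      then show ?thesis using J0[of r] c by (intro mult_mono mult_nonneg_nonneg) auto
    qed
    finally show ?thesis .
  next
    case False
    have "upper_mass MN r \<le> upper_mass MN 0" using r by (intro upper_mass_antimono interval)
    also have "\<dots> = upper_mass MN 0 * upper_mass MO r0 powr (- p) * upper_mass MO r0 powr p"
      using upper_mass_O_pos[of r0] r0 by (simp add: powr_minus_divide)
    also have "\<dots> \<le> c * upper_mass MO r powr p"
      using False r r0 p c by (intro mult_mono powr_mono2 upper_mass_antimono interval) (auto simp: c_def)
    also have "\<dots> \<le> c * upper_mass MO r powr p * (J r + 1)"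
      using J0[of r] c mult_left_mono[of 1 "J r + 1" "c * upper_mass MO r powr p"] by simp
    finally show ?thesis .
  qed
  have "balanced (max 1 (c powr (1/p) * B))"
    unfolding balanced_def
  proof (intro conjI allI impI)
    fix r :: real assume r: "0 \<le> r \<and> r < 1"
    have "upper_mass MN r powr (1/p) \<le> (c * upper_mass MO r powr p * (J r + 1)) powr (1/p)"
      using main[of r] r p by (intro powr_mono2) auto
    also have "\<dots> = c powr (1/p) * upper_mass MO r * (J r + 1) powr (1/p)"
      using p by (simp add: powr_mult powr_powr)
    finally have "upper_mass MN r powr (1/p) * upper_mass MS r powr (1/p') \<le>
       (c powr (1/p) * upper_mass MO r * (J r + 1) powr (1/p)) * upper_mass MS r powr (1/p')"
      by (rule mult_right_mono) auto
    also have "\<dots> = c powr (1/p) * upper_mass MO r * ((J r + 1) powr (1/p) * upper_mass MS r powr (1/p'))" by simp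
    also have "\<dots> \<le> c powr (1/p) * upper_mass MO r * B"
      using M[of r] r by (intro mult_left_mono) (auto simp: J_def)
    also have "\<dots> = (c powr (1/p) * B) * upper_mass MO r" by simp
    also have "\<dots> \<le> max 1 (c powr (1/p) * B) * upper_mass MO r" by (intro mult_right_mono) auto
    finally show "upper_mass MN r powr (1/p) * upper_mass MS r powr (1/p') \<le> max 1 (c powr (1/p) * B) * upper_mass MO r" .
  qed auto
  then show ?thesis by blast
qed

text \<open>For r near 1 let n be the integer part of 1 / (- ln r). Then r^n \<ge> 1 / e, so the
  moments of \<nu> and \<sigma> dominate their tails at r, while 2 n exceeds 1 / (- ln r), so the
  moment of \<omega> is at most a multiple of its tail. For r < 1 / e the choice n = 0
  works.\<close>

lemma moment_bound_imp_balanced: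
  assumes D: "\<And>n::nat. power_moment MN (real n * p) powr (1/p) * power_moment MS (real n * p') powr (1/p')
      \<le> D * power_moment MO (2 * real n)" and "0 \<le> D"
  shows "\<exists>A. balanced A"
proof -
  obtain C where C: "0 < C" "\<And>y. 0 < y \<Longrightarrow> power_moment MO y \<le> C * upper_mass MO (exp (- 1 / y))"
    using doubling_imp_moment_le_upper_mass[OF interval(1) doubling_O] by auto
  \<comment> \<open>The second entry compares the total mass with the tail at 1 / e, for the case n
    = 0.\<close>
  define c where "c = max C (upper_mass MO 0 / upper_mass MO (exp (-1)))"
  have c: "0 < c" using C by (auto simp: c_def less_max_iff_disj)
  have "upper_mass MN r powr (1/p) * upper_mass MS r powr (1/p') \<le> exp 2 * D * c * upper_mass MO r"
    if r: "0 \<le> r" "r < 1" for r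
  proof -
    have "\<exists>n::nat. exp (- 1) \<le> r ^ n \<and> power_moment MO (2 * real n) \<le> c * upper_mass MO r"
    proof (cases "r < exp (- 1)")
      case True
      have "power_moment MO 0 = upper_mass MO 0" by (simp add: power_moment_zero interval)
      also have "\<dots> = upper_mass MO 0 / upper_mass MO (exp (-1)) * upper_mass MO (exp (-1))"
        using upper_mass_O_pos[of "exp (-1)"] by simp
      also have "\<dots> \<le> c * upper_mass MO r"
        using True c by (intro mult_mono upper_mass_antimono interval) (auto simp: c_def)
      finally show ?thesis by (intro exI[of _ 0]) auto
    next
      case False
      then have rpos: "0 < r" using exp_gt_zero[of "-1::real"] by linarith
      have lnr: "ln r < 0" "-1 \<le> ln r" using False rpos r by (auto simp: ln_ge_iff)
      define Y where "Y = 1 / (- ln r)"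
      have Y: "1 \<le> Y" using lnr by (simp add: Y_def field_simps)
      have rY: "exp (- 1 / Y) = r" using rpos lnr by (simp add: Y_def)
      define n where "n = nat \<lfloor>Y\<rfloor>"
      have n: "real n \<le> Y" "Y < real n + 1" "1 \<le> real n" using Y by (auto simp: n_def)
      have "real n * ln r \<ge> Y * ln r" using n lnr by (intro mult_right_mono_neg) auto
      also have "Y * ln r = -1" using lnr by (simp add: Y_def)
      finally have "exp (-1) \<le> exp (real n * ln r)" by simp
      then have rn: "exp (-1) \<le> r ^ n" using rpos by (simp add: exp_of_nat_mult)
      have "power_moment MO (2 * real n) \<le> power_moment MO Y"
        using n Y by (intro power_moment_antimono interval; linarith)
      also have "\<dots> \<le> C * upper_mass MO r" using C(2)[of Y] Y unfolding rY by simp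
      also have "\<dots> \<le> c * upper_mass MO r" by (intro mult_right_mono) (auto simp: c_def)
      finally show ?thesis using rn by blast
    qed
    then obtain n :: nat where n: "exp (- 1) \<le> r ^ n" "power_moment MO (2 * real n) \<le> c * upper_mass MO r" by blast
    have one: "exp (-1) * upper_mass M r powr (1 / a) \<le> power_moment M (real n * a) powr (1 / a)"
      if "interval_measure M" "1 < a" for M a
    proof -
      have rn: "0 \<le> r ^ n" using r by simp
      have rna: "(r ^ n) powr a = r powr (real n * a)" if "0 < r"
        using that by (simp add: powr_realpow[symmetric] powr_powr)
      have "(r ^ n) powr a * upper_mass M r \<le> power_moment M (real n * a)"
      proof (cases "r = 0")
        \<comment> \<open>Since \<open>0 powr 0\<close> is 0, Chebyshev's inequality is empty at r =
          0; there n = 0 and the moment is the total mass.\<close>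
        case True
        then have "n = 0" using n(1) by (cases n) auto
        then show ?thesis using True by (simp add: power_moment_zero that)
      next
        case False
        then show ?thesis using r power_moment_ge[OF that(1), of r "real n * a"] that rna by simp
      qed
      then have "((r ^ n) powr a * upper_mass M r) powr (1 / a) \<le> power_moment M (real n * a) powr (1 / a)"
        using that by (intro powr_mono2) (auto simp: upper_mass_nonneg)
      then have "r ^ n * upper_mass M r powr (1 / a) \<le> power_moment M (real n * a) powr (1 / a)"
        using that rn by (simp add: powr_mult powr_powr)
      moreover have "exp (-1) * upper_mass M r powr (1 / a) \<le> r ^ n * upper_mass M r powr (1 / a)"
        using n by (intro mult_right_mono) auto
      ultimately show ?thesis by linarith
    qed
    have "upper_mass MN r powr (1/p) * upper_mass MS r powr (1/p') =
       exp 2 * ((exp (-1) * upper_mass MN r powr (1/p)) * (exp (-1) * upper_mass MS r powr (1/p')))"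
      by (simp add: mult_ac exp_minus field_simps flip: exp_add)
    also have "\<dots> \<le> exp 2 * (power_moment MN (real n * p) powr (1/p) * power_moment MS (real n * p') powr (1/p'))"
      using p p' interval by (intro mult_left_mono mult_mono one) auto
    also have "\<dots> \<le> exp 2 * (D * power_moment MO (2 * real n))" by (intro mult_left_mono D) auto
    also have "\<dots> \<le> exp 2 * (D * (c * upper_mass MO r))" using n assms(2) by (intro mult_left_mono) auto
    finally show ?thesis by (simp add: mult.assoc)
  qed
  then have *: "upper_mass MN r powr (1/p) * upper_mass MS r powr (1/p') \<le> max 1 (exp 2 * D * c) * upper_mass MO r"
    if "0 \<le> r" "r < 1" for r
    using that by (meson interval_simps(1) max.cobounded2 mult_right_mono order_trans)
  show ?thesis by (intro exI[of _ "max 1 (exp 2 * D * c)"]) (auto simp: balanced_def *)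
qed

text \<open>Hoelder's inequality for s^n (1 - s^a)^(1/p) and s^n (1 - s^a)^(1/p') bounds the drop of
  the \<omega>-moment from order 2 n to 2 \<kappa> n by a drop of the \<nu>-moment and a full
  \<sigma>-moment. The former drop is at least half the moment, so by the bound D at least a
  multiple of the full product. The \<sigma>-factor cancels and a drop for \<nu> remains.\<close>

lemma moment_bound_imp_moment_decay:
  assumes D: "\<And>n::nat. power_moment MN (real n * p) powr (1/p) * power_moment MS (real n * p') powr (1/p')
      \<le> D * power_moment MO (2 * real n)" and D0: "0 < D"
    and \<kappa>: "1 \<le> \<kappa>" "\<And>n. 1 \<le> n \<Longrightarrow> power_moment MO (2 * real (\<kappa> * n)) \<le> 1/2 * power_moment MO (2 * real n)"
  shows "moment_decay MN"
proof -
  define d where "d = (1 / (2 * D)) powr p"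
  have d: "0 < d" using D0 by (simp add: d_def)
  have pos: "0 < power_moment M y" if "interval_measure M" "thick M" "0 \<le> y" for M y
  proof -
    have "0 < (1/2) powr y * upper_mass M (1/2)" using that by (auto simp: thick_def)
    with power_moment_ge[OF that(1) _ that(3), of "1/2"] show ?thesis by simp
  qed
  interpret swap: weight_triple p' p MO MS MN by (rule weight_triple_swap)
  have step: "power_moment MN (real n * p + 2 * real (\<kappa> - 1) * real n) \<le> max (1 - d) (1/2) * power_moment MN (real n * p)"
    if n: "1 \<le> n" for n :: nat
  proof -
    define a where "a = 2 * real (\<kappa> - 1) * real n"
    have a0: "0 \<le> a" by (simp add: a_def)
    have an: "2 * real n + a = 2 * real (\<kappa> * n)" using \<kappa>(1) by (simp add: a_def of_nat_diff algebra_simps)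
    define f where "f s = s powr real n * (1 - s powr a) powr (1/p)" for s
    define g where "g s = s powr real n * (1 - s powr a) powr (1/p')" for s
    have sa: "0 \<le> 1 - s powr a" "1 - s powr a \<le> 1" if "0 < s" "s < 1" for s :: real
      using that a0 powr_le1[of a s] by auto
    have int: "integrable M (\<lambda>s. s powr y - s powr (y + a))" "integral\<^sup>L M (\<lambda>s. s powr y - s powr (y + a)) =
      power_moment M y - power_moment M (y + a)" if "interval_measure M" "0 \<le> y" for M y
      using that a0 by (auto simp: power_moment_def)
    have gle: "(\<integral>s. g s powr p' \<partial>MS) \<le> power_moment MS (real n * p')"
      unfolding power_moment_def
    proof (rule integral_mono_AE)
      have le: "AE s in MS. g s powr p' \<le> s powr (real n * p')"
        using AE_interval_measure[OF interval(3)]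
        by eventually_elim (use sa p' in \<open>auto simp: g_def powr_mult powr_powr mult_left_le\<close>)
      then show "AE s in MS. g s powr p' \<le> s powr (real n * p')" .
      show int2: "integrable MS (\<lambda>s. s powr (real n * p'))" using p' interval by auto
      show "integrable MS (\<lambda>s. g s powr p')"
        by (rule Bochner_Integration.integrable_bound[OF int2]) (use le in \<open>auto simp: g_def interval\<close>)
    qed
    have "power_moment MO (2 * real n) - power_moment MO (2 * real n + a) = (\<integral>s. f s * g s \<partial>MO)"
    proof -
      have "(\<integral>s. f s * g s \<partial>MO) = (\<integral>s. s powr (2 * real n) - s powr (2 * real n + a) \<partial>MO)"
      proof (rule integral_cong_AE)
        show "AE s in MO. f s * g s = s powr (2 * real n) - s powr (2 * real n + a)"
          using AE_interval_measure[OF interval(1)]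
        proof eventually_elim
          fix s :: real assume s: "0 < s \<and> s < 1"
          have "f s * g s = (s powr real n * s powr real n) * ((1 - s powr a) powr (1/p) * (1 - s powr a) powr (1/p'))"
            by (simp add: f_def g_def)
          also have "\<dots> = s powr (2 * real n) * (1 - s powr a)"
            using sa s conj_exponents by (simp flip: powr_add)
          finally show "f s * g s = s powr (2 * real n) - s powr (2 * real n + a)"
            by (simp add: powr_add algebra_simps)
        qed
      qed (auto simp: f_def g_def interval)
      with int[OF interval(1)] show ?thesis by simp
    qed
    also have "\<dots> \<le> (\<integral>s. f s powr p \<partial>MN) powr (1 / p) * (\<integral>s. g s powr p' \<partial>MS) powr (1 / p')"
    proof (rule holder)
      fix s :: real assume s: "0 < s" "s < 1"
      show "0 \<le> f s \<and> f s \<le> 1" "0 \<le> g s \<and> g s \<le> 1"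
        using s sa p p' by (auto simp: f_def g_def powr_le1 intro!: mult_le_one)
    qed (auto simp: f_def g_def)
    also have "(\<integral>s. f s powr p \<partial>MN) = (\<integral>s. s powr (real n * p) - s powr (real n * p + a) \<partial>MN)"
    proof (rule integral_cong_AE)
      show "AE s in MN. f s powr p = s powr (real n * p) - s powr (real n * p + a)"
        using AE_interval_measure[OF interval(2)]
        by eventually_elim (use sa p in \<open>auto simp: f_def powr_mult powr_powr powr_add algebra_simps\<close>)
    qed (auto simp: f_def interval)
    also have "\<dots> = power_moment MN (real n * p) - power_moment MN (real n * p + a)"
      using p by (intro int interval) auto
    also have "(power_moment MN (real n * p) - power_moment MN (real n * p + a)) powr (1 / p) * (\<integral>s. g s powr p' \<partial>MS) powr (1 / p')
      \<le> (power_moment MN (real n * p) - power_moment MN (real n * p + a)) powr (1 / p) * power_moment MS (real n * p') powr (1 / p')"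
      using p' gle by (intro mult_left_mono powr_mono2 integral_nonneg_AE) auto
    finally have "power_moment MO (2 * real n) - power_moment MO (2 * real n + a) \<le>
      (power_moment MN (real n * p) - power_moment MN (real n * p + a)) powr (1 / p) * power_moment MS (real n * p') powr (1 / p')" .
    moreover have "1/2 * power_moment MO (2 * real n) \<le> power_moment MO (2 * real n) - power_moment MO (2 * real n + a)"
      using \<kappa>(2)[OF n] by (simp add: an)
    moreover have "1 / (2 * D) * (power_moment MN (real n * p) powr (1/p) * power_moment MS (real n * p') powr (1/p'))
       \<le> 1/2 * power_moment MO (2 * real n)"
      using D[of n] D0 by (simp add: field_simps)
    ultimately have "(1 / (2 * D) * power_moment MN (real n * p) powr (1/p)) * power_moment MS (real n * p') powr (1/p') \<le>
      (power_moment MN (real n * p) - power_moment MN (real n * p + a)) powr (1 / p) * power_moment MS (real n * p') powr (1 / p')"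
      by (simp only: mult.assoc)
    moreover have "0 < power_moment MS (real n * p') powr (1/p')"
      using pos[OF interval(3) swap.thick_N, of "real n * p'"] p' by simp
    ultimately have "1 / (2 * D) * power_moment MN (real n * p) powr (1/p) \<le>
      (power_moment MN (real n * p) - power_moment MN (real n * p + a)) powr (1 / p)"
      by (simp only: mult_le_cancel_right_pos)
    then have "(1 / (2 * D) * power_moment MN (real n * p) powr (1/p)) powr p \<le>
      ((power_moment MN (real n * p) - power_moment MN (real n * p + a)) powr (1 / p)) powr p"
      using p D0 by (intro powr_mono2) auto
    moreover have "power_moment MN (real n * p + a) \<le> power_moment MN (real n * p)"
      using a0 p by (intro power_moment_antimono interval) auto
    moreover have "(1 / (2 * D) * power_moment MN (real n * p) powr (1/p)) powr p = d * power_moment MN (real n * p)"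
      unfolding powr_mult using p by (simp add: powr_powr d_def power_moment_nonneg interval)
    ultimately have "d * power_moment MN (real n * p) \<le> power_moment MN (real n * p) - power_moment MN (real n * p + a)"
      using p by (simp add: powr_powr)
    then have "power_moment MN (real n * p + a) \<le> (1 - d) * power_moment MN (real n * p)" by (simp add: algebra_simps)
    also have "\<dots> \<le> max (1 - d) (1/2) * power_moment MN (real n * p)"
      by (intro mult_right_mono) (auto simp: power_moment_nonneg interval)
    finally show ?thesis by (simp add: a_def)
  qed
  show ?thesis unfolding moment_decay_def
  proof (intro exI conjI allI impI)
    show "0 < max (1 - d) (1/2)" "max (1 - d) (1/2) < 1" using d by auto
    \<comment> \<open>From y / p \<le> n \<le> y + 1, the order n p + 2 (\<kappa> - 1) n reached in
      \<open>step\<close> is at most K (y + 1) - 1 for this K.\<close>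
    show "1 < p + 2 * real \<kappa> + 1" using p by simp
    fix y :: real assume y: "0 \<le> y"
    define n where "n = max 1 (nat \<lceil>y / p\<rceil>)"
    have n: "1 \<le> n" "y / p \<le> real n" "real n \<le> y / p + 1"
    proof -
      have "0 \<le> y / p" using y p by simp
      then have "y / p \<le> real (nat \<lceil>y / p\<rceil>)" "real (nat \<lceil>y / p\<rceil>) \<le> y / p + 1" by linarith+
      moreover have "real n = max 1 (real (nat \<lceil>y / p\<rceil>))" by (simp add: n_def of_nat_max)
      ultimately show "y / p \<le> real n" "real n \<le> y / p + 1"
        using \<open>0 \<le> y / p\<close> by linarith+
      show "1 \<le> n" by (simp add: n_def)
    qed
    have yn: "y \<le> real n * p" using n p by (simp add: field_simps)
    have "y / p \<le> y" using y p mult_right_mono[of 1 p y] by (simp add: field_simps)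
    then have ny: "real n \<le> y + 1" using n by linarith
    have "real n * p + 2 * real (\<kappa> - 1) * real n \<le> real n * (p + 2 * real \<kappa>)"
      using mult_left_mono[of "real (\<kappa> - 1)" "real \<kappa>" "real n"] by (simp add: algebra_simps)
    also have "\<dots> \<le> (y + 1) * (p + 2 * real \<kappa>)" using ny p by (intro mult_right_mono) auto
    also have "\<dots> \<le> (p + 2 * real \<kappa> + 1) * (y + 1) - 1" using y by (simp add: algebra_simps)
    finally have "power_moment MN ((p + 2 * real \<kappa> + 1) * (y + 1) - 1) \<le>
        power_moment MN (real n * p + 2 * real (\<kappa> - 1) * real n)"
      using p by (intro power_moment_antimono interval) auto
    also have "\<dots> \<le> max (1 - d) (1/2) * power_moment MN (real n * p)" by (rule step[OF n(1)])
    also have "\<dots> \<le> max (1 - d) (1/2) * power_moment MN y"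
      using yn y by (intro mult_left_mono power_moment_antimono interval) auto
    finally show "power_moment MN ((p + 2 * real \<kappa> + 1) * (y + 1) - 1) \<le> max (1 - d) (1/2) * power_moment MN y" .
  qed
qed

end

section \<open>Circle means of the kernel\<close>

definition circle_measure :: "real measure" where
  "circle_measure = density lborel (\<lambda>t. ennreal (indicator {0..2*pi} t / (2 * pi)))"

lemma sets_circle_measure [simp, measurable_cong]: "sets circle_measure = sets borel"
  by (simp add: circle_measure_def)

lemma space_circle_measure [simp]: "space circle_measure = UNIV"
  by (simp add: circle_measure_def)

lemma borel_measurable_circle_measure [simp]: "borel_measurable circle_measure = borel_measurable borel"
  by (rule measurable_cong_sets) simp_all

lemma emeasure_circle_measure_UNIV [simp]: "emeasure circle_measure UNIV = 1"
proof -
  have "emeasure circle_measure UNIV = (\<integral>\<^sup>+t. ennreal (1 / (2 * pi)) * indicator {0..2*pi} t \<partial>lborel)"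
    unfolding circle_measure_def
    by (subst emeasure_density) (auto intro!: nn_integral_cong simp: indicator_def)
  also have "\<dots> = 1"
    by (subst nn_integral_cmult) (auto simp: ennreal_mult[symmetric])
  finally show ?thesis .
qed

interpretation circle_measure: finite_measure circle_measure
  by (rule finite_measureI) simp

lemma measure_circle_measure_UNIV [simp]: "measure circle_measure UNIV = 1"
  by (simp add: measure_def)

lemma integrable_circle_bounded:
  fixes f :: "real \<Rightarrow> 'a :: {banach, second_countable_topology}"
  assumes "f \<in> borel_measurable borel" "\<And>t. norm (f t) \<le> B"
  shows "integrable circle_measure f"
  by (rule circle_measure.integrable_const_bound[where B = B]) (use assms in auto)

lemma integral_circle_FTC:
  fixes f F :: "real \<Rightarrow> complex"
  assumes "\<And>t. (F has_vector_derivative f t) (at t)" "continuous_on UNIV f"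
  shows "(\<integral>t. f t \<partial>circle_measure) = (F (2 * pi) - F 0) / (2 * pi)"
proof -
  have [measurable]: "f \<in> borel_measurable borel"
    using assms(2) by (rule borel_measurable_continuous_onI)
  have "(\<integral>t. f t \<partial>circle_measure) = (\<integral>t. (1 / (2 * pi)) *\<^sub>R (indicator {0..2*pi} t *\<^sub>R f t) \<partial>lborel)"
    unfolding circle_measure_def by (subst integral_density) (auto simp: field_simps)
  also have "\<dots> = (1 / (2 * pi)) *\<^sub>R (F (2 * pi) - F 0)"
    by (subst integral_scaleR_right, subst integral_FTC_Icc[where F = F])
       (use assms in \<open>auto intro: has_vector_derivative_at_within continuous_on_subset\<close>)
  finally show ?thesis by (simp add: scaleR_conv_of_real)
qed

lemma cis_mult_derivative: "((\<lambda>t. cis (a * t)) has_vector_derivative (\<i> * of_real a * cis (a * t))) (at t)"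
proof -
  have "((\<lambda>z. exp (\<i> * of_real a * z)) has_field_derivative \<i> * of_real a * exp (\<i> * of_real a * of_real t)) (at (of_real t))"
    by (auto intro!: derivative_eq_intros)
  then have "((\<lambda>t. exp (\<i> * of_real a * of_real t)) has_vector_derivative \<i> * of_real a * exp (\<i> * of_real a * of_real t)) (at t)"
    by (rule has_vector_derivative_real_field)
  then show ?thesis by (simp add: cis_conv_exp mult.assoc)
qed

lemma borel_measurable_cis [measurable (raw)]:
  assumes "f \<in> borel_measurable M"
  shows "(\<lambda>x. cis (f x)) \<in> borel_measurable M"
proof -
  have "cis \<in> borel_measurable borel" by (intro borel_measurable_continuous_onI continuous_intros)
  with assms show ?thesis by (rule measurable_compose)
qed

lemma borel_measurable_cnj [measurable (raw)]:
  assumes "f \<in> borel_measurable M"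
  shows "(\<lambda>x. cnj (f x)) \<in> borel_measurable M"
proof -
  have "cnj \<in> borel_measurable borel" by (intro borel_measurable_continuous_onI continuous_intros)
  with assms show ?thesis by (rule measurable_compose)
qed

lemma integral_cis: "(\<integral>t. cis (of_int k * t) \<partial>circle_measure) = (if k = 0 then 1 else 0)"
proof (cases "k = 0")
  case False
  have "(\<integral>t. cis (of_int k * t) \<partial>circle_measure) =
    (cis (of_int k * (2 * pi)) / (\<i> * of_int k) - cis (of_int k * 0) / (\<i> * of_int k)) / (2 * pi)"
  proof (rule integral_circle_FTC)
    show "((\<lambda>t. cis (of_int k * t) / (\<i> * of_int k)) has_vector_derivative cis (of_int k * t)) (at t)" for t
      using False by (auto intro!: derivative_eq_intros cis_mult_derivative)
  qed (intro continuous_intros)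
  also have "cis (of_int k * (2 * pi)) = 1"
    using cis_multiple_2pi[of "real_of_int k"] by (simp add: mult_ac)
  finally show ?thesis using False by simp
qed simp

text \<open>The point of the sawtooth pi - t: pairing with it turns coefficients b_n into the sum of
  b_n / n, up to the factor i.\<close>

lemma integral_cis_sawtooth:
  assumes "0 < n"
  shows "(\<integral>t. cis (real n * t) * of_real (pi - t) \<partial>circle_measure) = \<i> / of_nat n"
proof -
  define F where "F t = of_real (pi - t) * cis (real n * t) / (\<i> * of_nat n) + cis (real n * t) / (\<i> * of_nat n)\<^sup>2" for t
  have "(\<integral>t. cis (real n * t) * of_real (pi - t) \<partial>circle_measure) = (F (2 * pi) - F 0) / (2 * pi)"
  proof (rule integral_circle_FTC)
    fix t
    \<comment> \<open>The antiderivative is differentiated in a complex variable and then restricted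
      to real t.\<close>
    let ?G = "\<lambda>z. (of_real pi - z) * exp (\<i> * of_nat n * z) / (\<i> * of_nat n) + exp (\<i> * of_nat n * z) / (\<i> * of_nat n)\<^sup>2"
    have "(?G has_field_derivative exp (\<i> * of_nat n * of_real t) * (of_real pi - of_real t)) (at (of_real t))"
      using assms by (auto intro!: derivative_eq_intros simp: field_simps power2_eq_square)
    then have "((\<lambda>t. ?G (of_real t)) has_vector_derivative exp (\<i> * of_nat n * of_real t) * (of_real pi - of_real t)) (at t)"
      by (rule has_vector_derivative_real_field)
    then show "(F has_vector_derivative cis (real n * t) * of_real (pi - t)) (at t)"
      unfolding F_def by (simp add: cis_conv_exp mult.assoc)
  qed (intro continuous_intros)
  also have "cis (real n * (2 * pi)) = 1"
    using cis_multiple_2pi[of "real n"] by (simp add: mult_ac)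
  then have "(F (2 * pi) - F 0) / (2 * pi) = \<i> / of_nat n"
    using assms by (simp add: F_def field_simps)
  finally show ?thesis .
qed

section \<open>Fourier series with absolutely summable coefficients\<close>

lemma Fourier_series_norm_le:
  fixes b :: "nat \<Rightarrow> complex"
  assumes "summable (\<lambda>n. norm (b n))"
  shows "summable (\<lambda>n. norm (b n * cis (real n * t)))" "norm (\<Sum>n. b n * cis (real n * t)) \<le> (\<Sum>n. norm (b n))"
proof -
  show *: "summable (\<lambda>n. norm (b n * cis (real n * t)))" using assms by (simp add: norm_mult)
  show "norm (\<Sum>n. b n * cis (real n * t)) \<le> (\<Sum>n. norm (b n))"
    using summable_norm[OF *] by (simp add: norm_mult)
qed

text \<open>Summability of the coefficients dominates the series times any essentially bounded
  \<phi>. The \<phi> used are a character, the conjugate of the series itself, and the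
  sawtooth.\<close>

lemma integral_Fourier_series_mult:
  fixes b :: "nat \<Rightarrow> complex" and \<phi> :: "real \<Rightarrow> complex"
  assumes b: "summable (\<lambda>n. norm (b n))" and [measurable]: "\<phi> \<in> borel_measurable borel"
    and \<phi>: "AE t in circle_measure. norm (\<phi> t) \<le> B"
  shows "(\<lambda>n. b n * (\<integral>t. cis (real n * t) * \<phi> t \<partial>circle_measure)) sums
    (\<integral>t. (\<Sum>n. b n * cis (real n * t)) * \<phi> t \<partial>circle_measure)"
proof -
  have int: "integrable circle_measure (\<lambda>t. b n * cis (real n * t) * \<phi> t)" for n
  proof (rule circle_measure.integrable_const_bound[where B = "norm (b n) * B"])
    show "AE t in circle_measure. norm (b n * cis (real n * t) * \<phi> t) \<le> norm (b n) * B"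
      using \<phi> by eventually_elim (simp add: norm_mult mult_left_mono)
  qed simp
  have "(\<lambda>n. \<integral>t. b n * cis (real n * t) * \<phi> t \<partial>circle_measure) sums
    (\<integral>t. (\<Sum>n. b n * cis (real n * t) * \<phi> t) \<partial>circle_measure)"
  proof (rule sums_integral)
    show "AE t in circle_measure. summable (\<lambda>n. norm (b n * cis (real n * t) * \<phi> t))"
      using b by (simp add: norm_mult summable_mult2)
    have "(\<integral>t. norm (b n * cis (real n * t) * \<phi> t) \<partial>circle_measure) \<le> (\<integral>t. norm (b n) * B \<partial>circle_measure)" for n
    proof (rule integral_mono_AE)
      show "AE t in circle_measure. norm (b n * cis (real n * t) * \<phi> t) \<le> norm (b n) * B"
        using \<phi> by eventually_elim (simp add: norm_mult mult_left_mono)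
    qed (use int in auto)
    then show "summable (\<lambda>n. \<integral>t. norm (b n * cis (real n * t) * \<phi> t) \<partial>circle_measure)"
      by (intro summable_comparison_test'[OF summable_mult2[OF b, of B]]) simp
  qed (rule int)
  also have "(\<lambda>n. \<integral>t. b n * cis (real n * t) * \<phi> t \<partial>circle_measure) =
      (\<lambda>n. b n * (\<integral>t. cis (real n * t) * \<phi> t \<partial>circle_measure))"
    by (simp add: mult.assoc)
  also have "(\<integral>t. (\<Sum>n. b n * cis (real n * t) * \<phi> t) \<partial>circle_measure) =
    (\<integral>t. (\<Sum>n. b n * cis (real n * t)) * \<phi> t \<partial>circle_measure)"
    using summable_norm_cancel[OF Fourier_series_norm_le(1)[OF b]] by (simp add: suminf_mult2)
  finally show ?thesis .
qed

lemma Fourier_coefficient: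
  fixes b :: "nat \<Rightarrow> complex"
  assumes b: "summable (\<lambda>n. norm (b n))"
  shows "(\<integral>t. (\<Sum>n. b n * cis (real n * t)) * cis (- real m * t) \<partial>circle_measure) = b m"
proof -
  have "(\<lambda>n. b n * (\<integral>t. cis (real n * t) * cis (- real m * t) \<partial>circle_measure)) sums
    (\<integral>t. (\<Sum>n. b n * cis (real n * t)) * cis (- real m * t) \<partial>circle_measure)"
    by (rule integral_Fourier_series_mult[OF b, where B = 1]) auto
  moreover have "b n * (\<integral>t. cis (real n * t) * cis (- real m * t) \<partial>circle_measure) = (if n = m then b n else 0)" for n
  proof -
    have "(\<lambda>t. cis (real n * t) * cis (- real m * t)) = (\<lambda>t. cis (of_int (int n - int m) * t))"
      by (auto simp: cis_mult algebra_simps)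
    then show ?thesis using integral_cis[of "int n - int m"] by simp
  qed
  ultimately have "(\<lambda>n. if n = m then b n else 0) sums
    (\<integral>t. (\<Sum>n. b n * cis (real n * t)) * cis (- real m * t) \<partial>circle_measure)"
    by (simp only:)
  moreover have "(\<lambda>n. if n = m then b n else 0) sums b m" using sums_single[of m b] by simp
  ultimately show ?thesis by (rule sums_unique2)
qed

text \<open>The series is paired with its own conjugate, whose pairing with the n-th character is
  the conjugate of \<open>b n\<close>.\<close>

lemma Parseval:
  fixes b :: "nat \<Rightarrow> complex"
  assumes b: "summable (\<lambda>n. norm (b n))"
  shows "(\<lambda>n. (norm (b n))\<^sup>2) sums (\<integral>t. (norm (\<Sum>n. b n * cis (real n * t)))\<^sup>2 \<partial>circle_measure)"
proof -
  let ?g = "\<lambda>t. \<Sum>n. b n * cis (real n * t)"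
  have "(\<lambda>n. b n * (\<integral>t. cis (real n * t) * cnj (?g t) \<partial>circle_measure)) sums (\<integral>t. ?g t * cnj (?g t) \<partial>circle_measure)"
    by (rule integral_Fourier_series_mult[OF b, where B = "\<Sum>n. norm (b n)"])
       (use Fourier_series_norm_le(2)[OF b] in auto)
  moreover have "(\<integral>t. cis (real n * t) * cnj (?g t) \<partial>circle_measure) = cnj (b n)" for n
  proof -
    have "(\<integral>t. cis (real n * t) * cnj (?g t) \<partial>circle_measure) = (\<integral>t. cnj (?g t * cis (- real n * t)) \<partial>circle_measure)"
      by (intro Bochner_Integration.integral_cong) (auto simp: cis_cnj mult.commute)
    also have "\<dots> = cnj (\<integral>t. ?g t * cis (- real n * t) \<partial>circle_measure)"
      by (rule Bochner_Integration.integral_cnj)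
    also have "\<dots> = cnj (b n)" by (simp only: Fourier_coefficient[OF b])
    finally show ?thesis .
  qed
  ultimately have "(\<lambda>n. of_real ((norm (b n))\<^sup>2) :: complex) sums (\<integral>t. of_real ((norm (?g t))\<^sup>2) \<partial>circle_measure)"
    by (simp add: complex_norm_square[symmetric] flip: of_real_power)
  then show ?thesis by (simp only: integral_complex_of_real sums_of_real_iff)
qed

text \<open>The sawtooth is bounded by pi almost everywhere on the circle, and its mean is zero, so
  \<open>b 0\<close> drops out. For nonnegative coefficients this is Hardy's inequality.\<close>

lemma Hardy_sawtooth:
  fixes b :: "nat \<Rightarrow> complex"
  assumes b: "summable (\<lambda>n. norm (b n))"
  shows "norm (\<Sum>n. b (Suc n) / of_nat (Suc n)) \<le> pi * (\<integral>t. norm (\<Sum>n. b n * cis (real n * t)) \<partial>circle_measure)"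
proof -
  let ?g = "\<lambda>t. \<Sum>n. b n * cis (real n * t)"
  have bound: "AE t in circle_measure. norm (complex_of_real (pi - t)) \<le> pi"
    unfolding circle_measure_def
    by (subst AE_density) (auto simp: indicator_def simp flip: of_real_diff)
  have "(\<lambda>n. b n * (\<integral>t. cis (real n * t) * of_real (pi - t) \<partial>circle_measure)) sums (\<integral>t. ?g t * of_real (pi - t) \<partial>circle_measure)"
    by (rule integral_Fourier_series_mult[OF b _ bound]) measurable
  moreover have "(\<integral>t. cis (real 0 * t) * of_real (pi - t) \<partial>circle_measure) = 0"
  proof -
    have "(\<integral>t. complex_of_real (pi - t) \<partial>circle_measure) =
      (complex_of_real (pi * (2 * pi) - (2 * pi)\<^sup>2 / 2) - complex_of_real (pi * 0 - 0\<^sup>2 / 2)) / (2 * pi)"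
    proof (rule integral_circle_FTC)
      fix t
      have "((\<lambda>z. of_real pi * z - z\<^sup>2 / 2) has_field_derivative of_real pi - of_real t) (at (complex_of_real t))"
        by (auto intro!: derivative_eq_intros)
      then have "((\<lambda>t. of_real pi * of_real t - (of_real t)\<^sup>2 / 2) has_vector_derivative complex_of_real pi - of_real t) (at t)"
        by (rule has_vector_derivative_real_field)
      then show "((\<lambda>t. complex_of_real (pi * t - t\<^sup>2 / 2)) has_vector_derivative complex_of_real (pi - t)) (at t)"
        by simp
    qed (intro continuous_intros)
    then show ?thesis by (simp add: power2_eq_square)
  qed
  ultimately have "(\<lambda>n. b (Suc n) * (\<integral>t. cis (real (Suc n) * t) * of_real (pi - t) \<partial>circle_measure)) sums (\<integral>t. ?g t * of_real (pi - t) \<partial>circle_measure)"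
    by (subst sums_Suc_iff) simp
  then have "(\<lambda>n. \<i> * (b (Suc n) / of_nat (Suc n))) sums (\<integral>t. ?g t * of_real (pi - t) \<partial>circle_measure)"
    by (subst (asm) integral_cis_sawtooth) (auto simp: mult.commute)
  moreover have "summable (\<lambda>n. b (Suc n) / of_nat (Suc n))"
  proof (rule summable_norm_cancel, rule summable_comparison_test')
    show "summable (\<lambda>n. norm (b (Suc n)))" using b summable_Suc_iff[of "\<lambda>n. norm (b n)"] by simp
    show "norm (norm (b (Suc n) / of_nat (Suc n))) \<le> norm (b (Suc n))" for n
      by (simp add: norm_divide divide_le_eq mult_le_cancel_left1 del: of_nat_Suc)
  qed
  ultimately have "\<i> * (\<Sum>n. b (Suc n) / of_nat (Suc n)) = (\<integral>t. ?g t * of_real (pi - t) \<partial>circle_measure)"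
    by (simp only: sums_iff suminf_mult)
  then have "norm (\<Sum>n. b (Suc n) / of_nat (Suc n)) = norm (\<integral>t. ?g t * of_real (pi - t) \<partial>circle_measure)"
    by (metis norm_mult norm_ii mult_1)
  also have "\<dots> \<le> (\<integral>t. norm (?g t * of_real (pi - t)) \<partial>circle_measure)"
    by (rule integral_norm_bound)
  also have "\<dots> \<le> (\<integral>t. norm (?g t) * pi \<partial>circle_measure)"
  proof (rule integral_mono_AE)
    have "integrable circle_measure ?g"
      by (rule integrable_circle_bounded[OF _ Fourier_series_norm_le(2)[OF b]]) measurable
    then show int: "integrable circle_measure (\<lambda>t. norm (?g t) * pi)" by auto
    show le: "AE t in circle_measure. norm (?g t * of_real (pi - t)) \<le> norm (?g t) * pi"
      using bound by eventually_elim (simp add: norm_mult mult_left_mono)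
    show "integrable circle_measure (\<lambda>t. norm (?g t * of_real (pi - t)))"
      by (rule Bochner_Integration.integrable_bound[OF int]) (use le in auto)
  qed
  finally show ?thesis by (simp add: mult.commute)
qed

text \<open>With b = d * (t^n), the series of b is that of d times the geometric series of t e^(i theta), whose square mean is 1 / (1 - t^2).\<close>
lemma Fourier_L1_bound:
  fixes b :: "nat \<Rightarrow> real"
  assumes b: "summable (\<lambda>n. \<bar>b n\<bar>)" and t: "0 \<le> t" "t < 1" and l: "0 < l"
    and d: "d 0 = b 0" "\<And>n. d (Suc n) = b (Suc n) - t * b n" and sd: "(\<lambda>n. (d n)\<^sup>2) sums S"
  shows "(\<integral>\<theta>. norm (\<Sum>n. of_real (b n) * cis (real n * \<theta>)) \<partial>circle_measure) \<le> l * S + 1 / (l * (1 - t))"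
proof -
  let ?g = "\<lambda>\<theta>. \<Sum>n. of_real (b n) * cis (real n * \<theta>)"
  let ?h = "\<lambda>\<theta>. \<Sum>n. of_real (d n) * cis (real n * \<theta>)"
  let ?P = "\<lambda>\<theta>. \<Sum>n. of_real (t ^ n) * cis (real n * \<theta>)"
  have sb: "summable (\<lambda>n. norm (complex_of_real (b n)))" using b by simp
  have sdn: "summable (\<lambda>n. norm (complex_of_real (d n)))"
  proof -
    have "summable (\<lambda>n. \<bar>b (Suc n)\<bar> + t * \<bar>b n\<bar>)"
      using b by (intro summable_add summable_mult) (simp_all add: summable_Suc_iff[of "\<lambda>n. \<bar>b n\<bar>"])
    then have "summable (\<lambda>n. \<bar>d (Suc n)\<bar>)"
      by (rule summable_comparison_test') (use t d in \<open>auto simp: abs_mult intro: order_trans[OF abs_triangle_ineq4]\<close>)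
    then show ?thesis using summable_Suc_iff[of "\<lambda>n. \<bar>d n\<bar>"] by simp
  qed
  have st: "summable (\<lambda>n. norm (complex_of_real (t ^ n)))" using t by (simp add: norm_power summable_geometric)
  have geo: "?P \<theta> = 1 / (1 - of_real t * cis \<theta>)" for \<theta>
  proof -
    have "(\<lambda>n. (of_real t * cis \<theta>) ^ n) sums (1 / (1 - of_real t * cis \<theta>))"
      using t by (intro geometric_sums) (simp add: norm_mult)
    moreover have "(\<lambda>n. of_real (t ^ n) * cis (real n * \<theta>)) = (\<lambda>n. (of_real t * cis \<theta>) ^ n)"
      by (simp only: power_mult_distrib Complex.DeMoivre of_real_power)
    ultimately show ?thesis by (simp only: sums_iff)
  qed
  have prod: "?h \<theta> = (1 - of_real t * cis \<theta>) * ?g \<theta>" for \<theta>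
  proof -
    have sg: "summable (\<lambda>n. of_real (b n) * cis (real n * \<theta>))"
      using Fourier_series_norm_le(1)[OF sb] by (rule summable_norm_cancel)
    have sh: "summable (\<lambda>n. of_real (d n) * cis (real n * \<theta>))"
      using Fourier_series_norm_le(1)[OF sdn] by (rule summable_norm_cancel)
    have "?h \<theta> = of_real (d 0) + (\<Sum>n. of_real (d (Suc n)) * cis (real (Suc n) * \<theta>))"
      using suminf_split_head[OF sh] by simp
    also have "(\<lambda>n. of_real (d (Suc n)) * cis (real (Suc n) * \<theta>)) =
      (\<lambda>n. of_real (b (Suc n)) * cis (real (Suc n) * \<theta>) - of_real t * cis \<theta> * (of_real (b n) * cis (real n * \<theta>)))"
      by (auto simp: d algebra_simps cis_mult)
    also have "(\<Sum>n. of_real (b (Suc n)) * cis (real (Suc n) * \<theta>) - of_real t * cis \<theta> * (of_real (b n) * cis (real n * \<theta>))) =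
      (\<Sum>n. of_real (b (Suc n)) * cis (real (Suc n) * \<theta>)) - (\<Sum>n. of_real t * cis \<theta> * (of_real (b n) * cis (real n * \<theta>)))"
      using sg by (intro suminf_diff[symmetric] summable_mult) (subst summable_Suc_iff, auto)
    also have "(\<Sum>n. of_real t * cis \<theta> * (of_real (b n) * cis (real n * \<theta>))) = of_real t * cis \<theta> * ?g \<theta>"
      using sg by (rule suminf_mult)
    also have "(\<Sum>n. of_real (b (Suc n)) * cis (real (Suc n) * \<theta>)) = ?g \<theta> - of_real (b 0)"
      using suminf_split_head[OF sg] by simp
    finally show ?thesis by (simp add: d algebra_simps)
  qed
  have ne: "1 - of_real t * cis \<theta> \<noteq> 0" for \<theta>
  proof
    assume "1 - of_real t * cis \<theta> = 0"
    then have "norm (of_real t * cis \<theta>) = norm (1 :: complex)" by simp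
    then show False using t by (simp add: norm_mult)
  qed
  have bnd: "norm (?h \<theta>) \<le> (\<Sum>n. norm (complex_of_real (d n)))" "norm (?P \<theta>) \<le> (\<Sum>n. norm (complex_of_real (t ^ n)))"
    "norm (?g \<theta>) \<le> (\<Sum>n. norm (complex_of_real (b n)))" for \<theta>
    by (fact Fourier_series_norm_le(2)[OF sdn] Fourier_series_norm_le(2)[OF st] Fourier_series_norm_le(2)[OF sb])+
  have int: "integrable circle_measure (\<lambda>\<theta>. (norm (?h \<theta>))\<^sup>2)" "integrable circle_measure (\<lambda>\<theta>. (norm (?P \<theta>))\<^sup>2)"
    "integrable circle_measure (\<lambda>\<theta>. norm (?g \<theta>))"
    by (rule integrable_circle_bounded[where B = "(\<Sum>n. norm (complex_of_real (d n)))\<^sup>2"]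
          integrable_circle_bounded[where B = "(\<Sum>n. norm (complex_of_real (t ^ n)))\<^sup>2"]
          integrable_circle_bounded[where B = "(\<Sum>n. norm (complex_of_real (b n)))"],
        measurable, use bnd in \<open>simp add: power_mono del: norm_of_real\<close>)+
  have "(\<integral>\<theta>. norm (?g \<theta>) \<partial>circle_measure) \<le> (\<integral>\<theta>. l * (norm (?h \<theta>))\<^sup>2 + 1 / l * (norm (?P \<theta>))\<^sup>2 \<partial>circle_measure)"
  proof (rule integral_mono)
    fix \<theta>
    define x y where "x = norm (?h \<theta>)" and "y = norm (?P \<theta>)"
    have "norm (?g \<theta>) = x * y"
      unfolding x_def y_def geo prod using ne[of \<theta>] by (simp add: norm_mult norm_divide)
    also have "\<dots> \<le> l * x\<^sup>2 + 1 / l * y\<^sup>2"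
    proof -
      \<comment> \<open>A weighted mean inequality replaces Cauchy-Schwarz; the free l lets the
        caller balance the two terms.\<close>
      have "0 \<le> (l * x - y)\<^sup>2 + l * x * y" using l by (simp add: x_def y_def)
      then have "l * x * y \<le> l\<^sup>2 * x\<^sup>2 + y\<^sup>2" by (simp add: power2_eq_square algebra_simps)
      then show ?thesis using l by (simp add: field_simps power2_eq_square)
    qed
    finally show "norm (?g \<theta>) \<le> l * (norm (?h \<theta>))\<^sup>2 + 1 / l * (norm (?P \<theta>))\<^sup>2" by (simp add: x_def y_def)
  qed (use int in auto)
  also have "\<dots> = l * (\<integral>\<theta>. (norm (?h \<theta>))\<^sup>2 \<partial>circle_measure) + 1 / l * (\<integral>\<theta>. (norm (?P \<theta>))\<^sup>2 \<partial>circle_measure)"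
    using int by simp
  also have "(\<integral>\<theta>. (norm (?h \<theta>))\<^sup>2 \<partial>circle_measure) = S"
    using Parseval[OF sdn] sd by (simp add: sums_unique2)
  also have "(\<integral>\<theta>. (norm (?P \<theta>))\<^sup>2 \<partial>circle_measure) = 1 / (1 - t\<^sup>2)"
  proof -
    have "(\<lambda>n. (t\<^sup>2) ^ n) sums (1 / (1 - t\<^sup>2))"
      using t by (intro geometric_sums) (simp add: power_less_one_iff abs_square_less_1)
    then have "(\<lambda>n. (norm (complex_of_real (t ^ n)))\<^sup>2) sums (1 / (1 - t\<^sup>2))"
      using t by (simp add: power_mult[symmetric] mult.commute norm_power)
    with Parseval[OF st] show ?thesis by (rule sums_unique2)
  qed
  also have "1 / (1 - t\<^sup>2) \<le> 1 / (1 - t)"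
  proof -
    have "t\<^sup>2 \<le> t" using t by (simp add: power2_eq_square mult_left_le_one_le)
    then show ?thesis using t by (intro frac_le) auto
  qed
  finally show ?thesis using l by (simp add: divide_right_mono field_simps)
qed

text \<open>After the shift of the order this is 1 / (2 \<omega>_(2n+1)), the coefficient of the
  Bergman kernel.\<close>

definition kernel_coeff :: "real measure \<Rightarrow> nat \<Rightarrow> real" where
  "kernel_coeff M n = 1 / (2 * power_moment M (2 * real n))"

text \<open>The Bergman kernel at z is this function evaluated at the product of the conjugate of z
  with \<zeta>.\<close>

definition radial_kernel :: "real measure \<Rightarrow> complex \<Rightarrow> complex" where
  "radial_kernel M z = (\<Sum>n. of_real (kernel_coeff M n) * z ^ n)"

definition kernel_mean :: "real measure \<Rightarrow> real \<Rightarrow> real" where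
  "kernel_mean M \<rho> = (\<integral>t. norm (radial_kernel M (of_real \<rho> * cis t)) \<partial>circle_measure)"

section \<open>Coefficients and circle means of the kernel\<close>

context
  fixes M :: "real measure"
  assumes M: "interval_measure M" and thick: "thick M"
begin

lemma power_moment_pos: "0 \<le> y \<Longrightarrow> 0 < power_moment M y"
proof -
  assume "0 \<le> y"
  have "0 < (1/2) powr y * upper_mass M (1/2)" using thick by (auto simp: thick_def)
  with power_moment_ge[OF M _ \<open>0 \<le> y\<close>, of "1/2"] show ?thesis by simp
qed

lemma kernel_coeff_pos: "0 < kernel_coeff M n"
  using power_moment_pos[of "2 * real n"] by (simp add: kernel_coeff_def)

lemma kernel_coeff_mono: "m \<le> n \<Longrightarrow> kernel_coeff M m \<le> kernel_coeff M n"
  unfolding kernel_coeff_def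
  by (intro divide_left_mono mult_left_mono power_moment_antimono M mult_pos_pos power_moment_pos) auto

lemma kernel_coeff_le:
  assumes "0 < s" "s < 1"
  shows "kernel_coeff M n \<le> 1 / (2 * (s\<^sup>2 ^ n * upper_mass M s))"
proof -
  have "s powr (2 * real n) = s\<^sup>2 ^ n"
    using assms powr_realpow[of s "2 * n"] by (simp add: power_mult)
  then have "s\<^sup>2 ^ n * upper_mass M s \<le> power_moment M (2 * real n)"
    using power_moment_ge[OF M, of s "2 * real n"] assms by simp
  then show ?thesis unfolding kernel_coeff_def
    using assms thick by (intro divide_left_mono mult_left_mono mult_pos_pos power_moment_pos) (auto simp: thick_def)
qed

text \<open>With s^2 strictly between \<rho> and 1, Chebyshev's inequality bounds the coefficients
  by a multiple of s^(-2n), so the series is dominated by a geometric one.\<close>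

lemma summable_kernel_coeff:
  assumes "0 \<le> \<rho>" "\<rho> < 1"
  shows "summable (\<lambda>n. kernel_coeff M n * \<rho> ^ n)"
proof -
  define s where "s = sqrt ((1 + \<rho>) / 2)"
  have s2: "s\<^sup>2 = (1 + \<rho>) / 2" using assms by (simp add: s_def)
  have s: "0 < s" "s < 1" using assms by (auto simp: s_def)
  have q: "\<rho> / s\<^sup>2 < 1" "0 \<le> \<rho> / s\<^sup>2" using assms by (auto simp: s2 field_simps)
  have T: "0 < upper_mass M s" using thick s by (simp add: thick_def)
  show ?thesis
  proof (rule summable_comparison_test')
    show "summable (\<lambda>n. 1 / (2 * upper_mass M s) * (\<rho> / s\<^sup>2) ^ n)"
      using q by (intro summable_mult summable_geometric) auto
    fix n :: nat
    have "kernel_coeff M n * \<rho> ^ n \<le> 1 / (2 * (s\<^sup>2 ^ n * upper_mass M s)) * \<rho> ^ n"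
      using assms kernel_coeff_le[OF s] by (intro mult_right_mono) auto
    also have "\<dots> = 1 / (2 * upper_mass M s) * (\<rho> / s\<^sup>2) ^ n" by (simp add: power_divide)
    finally show "norm (kernel_coeff M n * \<rho> ^ n) \<le> 1 / (2 * upper_mass M s) * (\<rho> / s\<^sup>2) ^ n"
      using kernel_coeff_pos[of n] assms by simp
  qed
qed

lemma radial_kernel_sums:
  assumes "norm z < 1"
  shows "summable (\<lambda>n. norm (of_real (kernel_coeff M n) * z ^ n))"
    and "(\<lambda>n. of_real (kernel_coeff M n) * z ^ n) sums radial_kernel M z"
proof -
  show *: "summable (\<lambda>n. norm (of_real (kernel_coeff M n) * z ^ n))"
    using summable_kernel_coeff[of "norm z"] assms kernel_coeff_pos
    by (simp add: norm_mult norm_power abs_of_pos)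
  show "(\<lambda>n. of_real (kernel_coeff M n) * z ^ n) sums radial_kernel M z"
    unfolding radial_kernel_def using summable_norm_cancel[OF *] by (rule summable_sums)
qed

lemma norm_radial_kernel_le:
  assumes "norm z \<le> \<rho>" "\<rho> < 1"
  shows "norm (radial_kernel M z) \<le> (\<Sum>n. kernel_coeff M n * \<rho> ^ n)"
proof -
  have z: "norm z < 1" using assms by simp
  have \<rho>: "0 \<le> \<rho>" using assms norm_ge_zero[of z] by linarith
  have "norm (radial_kernel M z) \<le> (\<Sum>n. norm (of_real (kernel_coeff M n) * z ^ n))"
    unfolding radial_kernel_def by (rule summable_norm[OF radial_kernel_sums(1)[OF z]])
  also have "\<dots> \<le> (\<Sum>n. kernel_coeff M n * \<rho> ^ n)"
  proof (rule suminf_le[OF _ radial_kernel_sums(1)[OF z] summable_kernel_coeff])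
    fix n
    show "norm (of_real (kernel_coeff M n) * z ^ n) \<le> kernel_coeff M n * \<rho> ^ n"
      using assms kernel_coeff_pos[of n]
      by (simp add: norm_mult norm_power abs_of_pos mult_left_mono power_mono)
  qed (use assms \<rho> in auto)
  finally show ?thesis .
qed

lemma holomorphic_radial_kernel: "radial_kernel M holomorphic_on ball 0 1"
  by (rule power_series_holomorphic[where a = "\<lambda>n. of_real (kernel_coeff M n)"])
     (use radial_kernel_sums(2) in auto)

lemma cnj_radial_kernel:
  assumes "norm z < 1"
  shows "cnj (radial_kernel M z) = radial_kernel M (cnj z)"
proof -
  have "(\<lambda>n. cnj (of_real (kernel_coeff M n) * z ^ n)) sums cnj (radial_kernel M z)"
    using radial_kernel_sums(2)[OF assms] by (subst sums_cnj)
  moreover have "(\<lambda>n. of_real (kernel_coeff M n) * cnj z ^ n) sums radial_kernel M (cnj z)"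
    using assms by (intro radial_kernel_sums(2)) simp
  ultimately show ?thesis by (simp add: sums_iff)
qed

context
  fixes \<rho> :: real
  assumes \<rho>: "0 \<le> \<rho>" "\<rho> < 1"
begin

lemma summable_norm_kernel_coeff: "summable (\<lambda>n. norm (complex_of_real (kernel_coeff M n * \<rho> ^ n)))"
  using summable_kernel_coeff[OF \<rho>] kernel_coeff_pos \<rho> by (simp add: norm_mult norm_power abs_of_pos)

lemma radial_kernel_Fourier:
  "radial_kernel M (of_real \<rho> * cis t) = (\<Sum>n. of_real (kernel_coeff M n * \<rho> ^ n) * cis (real n * t))"
  unfolding radial_kernel_def by (simp only: power_mult_distrib Complex.DeMoivre of_real_power of_real_mult mult.assoc)

lemma kernel_mean_Fourier:
  "kernel_mean M \<rho> = (\<integral>t. norm (\<Sum>n. of_real (kernel_coeff M n * \<rho> ^ n) * cis (real n * t)) \<partial>circle_measure)"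
  unfolding kernel_mean_def radial_kernel_Fourier ..

lemma integrable_norm_radial_kernel:
  "integrable circle_measure (\<lambda>t. norm (radial_kernel M (of_real \<rho> * cis t)))"
  unfolding radial_kernel_Fourier
  by (rule integrable_circle_bounded[where B = "\<Sum>n. norm (complex_of_real (kernel_coeff M n * \<rho> ^ n))"])
     (use Fourier_series_norm_le(2)[OF summable_norm_kernel_coeff] in auto)

text \<open>A Fourier coefficient is at most the L^1 norm.\<close>

lemma kernel_mean_ge_coeff: "kernel_coeff M n * \<rho> ^ n \<le> kernel_mean M \<rho>"
proof -
  have "of_real (kernel_coeff M n * \<rho> ^ n) =
    (\<integral>t. (\<Sum>n. of_real (kernel_coeff M n * \<rho> ^ n) * cis (real n * t)) * cis (- real n * t) \<partial>circle_measure)"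
    by (rule Fourier_coefficient[OF summable_norm_kernel_coeff, symmetric])
  then have "norm (complex_of_real (kernel_coeff M n * \<rho> ^ n)) =
    norm (\<integral>t. (\<Sum>n. of_real (kernel_coeff M n * \<rho> ^ n) * cis (real n * t)) * cis (- real n * t) \<partial>circle_measure)"
    by (rule arg_cong)
  also have "\<dots> \<le>
    (\<integral>t. norm ((\<Sum>n. of_real (kernel_coeff M n * \<rho> ^ n) * cis (real n * t)) * cis (- real n * t)) \<partial>circle_measure)"
    by (rule integral_norm_bound)
  finally show ?thesis unfolding kernel_mean_Fourier
    using kernel_coeff_pos[of n] \<rho> by (simp add: norm_mult norm_power)
qed

text \<open>Hardy's inequality; all terms are nonnegative, so the sum may stop at N. This is the
  logarithmic gain over a single coefficient.\<close>

lemma kernel_mean_ge_log_sum: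
  "(\<Sum>n=1..N. kernel_coeff M n * \<rho> ^ n / real n) \<le> pi * kernel_mean M \<rho>"
proof -
  let ?c = "\<lambda>n. kernel_coeff M n * \<rho> ^ n"
  have nn: "0 \<le> ?c n" for n using kernel_coeff_pos[of n] \<rho> by simp
  have summ: "summable (\<lambda>n. ?c (Suc n) / real (Suc n))"
  proof (rule summable_comparison_test')
    show "summable (\<lambda>n. ?c (Suc n))" using summable_kernel_coeff[OF \<rho>] summable_Suc_iff[of ?c] by simp
    show "norm (?c (Suc n) / real (Suc n)) \<le> ?c (Suc n)" for n
      using nn[of "Suc n"] by (simp add: divide_le_eq mult_le_cancel_left1 abs_of_nonneg del: of_nat_Suc power_Suc)
  qed
  have "(\<Sum>n=1..N. ?c n / real n) = (\<Sum>n<N. ?c (Suc n) / real (Suc n))"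
    by (rule sum.reindex_bij_witness[of _ Suc "\<lambda>n. n - 1"]) auto
  also have "\<dots> \<le> (\<Sum>n. ?c (Suc n) / real (Suc n))"
    by (rule sum_le_suminf[OF summ]) (use nn in \<open>auto intro: divide_nonneg_nonneg simp del: power_Suc of_nat_Suc\<close>)
  also have "\<dots> \<le> norm (complex_of_real (\<Sum>n. ?c (Suc n) / real (Suc n)))"
    unfolding norm_of_real by (rule abs_ge_self)
  also have "complex_of_real (\<Sum>n. ?c (Suc n) / real (Suc n)) = (\<Sum>n. of_real (?c (Suc n)) / of_nat (Suc n))"
    using suminf_of_real[OF summ, where 'a = complex] by simp
  also have "norm \<dots> \<le> pi * kernel_mean M \<rho>"
    unfolding kernel_mean_Fourier by (rule Hardy_sawtooth[OF summable_norm_kernel_coeff])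
  finally show ?thesis .
qed

end

text \<open>The elementary bound (n + 1) s^n (1 - s) \<le> 1 makes n + 1 times the difference of the
  moments of orders 2 n and 2 n + 2 at most twice the moment of order n. Doubling replaces the
  latter by the moment of order 2 n.\<close>

lemma kernel_coeff_increment:
  assumes "doubling M"
  shows "\<exists>C>0. \<forall>n. real (Suc n) * (kernel_coeff M (Suc n) - kernel_coeff M n) \<le> C * kernel_coeff M (Suc n)"
proof -
  obtain C where C: "0 < C" "\<And>y. 0 \<le> y \<Longrightarrow> power_moment M y \<le> C * power_moment M (2 * y)"
    using doubling_imp_moment_scale[OF M assms, of 2] by auto
  have "real (Suc n) * (kernel_coeff M (Suc n) - kernel_coeff M n) \<le> 2 * C * kernel_coeff M (Suc n)" for n
  proof -
    define a b where "a = power_moment M (2 * real n)" and "b = power_moment M (2 * real (Suc n))"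
    have ab: "0 < a" "0 < b" unfolding a_def b_def by (intro power_moment_pos; simp)+
    have "real (Suc n) * (a - b) = (\<integral>s. real (Suc n) * (s powr (2 * real n) - s powr (2 * real (Suc n))) \<partial>M)"
      using M by (simp add: a_def b_def power_moment_def)
    also have "\<dots> \<le> (\<integral>s. 2 * s powr (real n) \<partial>M)"
    proof (rule integral_mono_AE)
      show "AE s in M. real (Suc n) * (s powr (2 * real n) - s powr (2 * real (Suc n))) \<le> 2 * s powr real n"
        using AE_interval_measure[OF M]
      proof eventually_elim
        fix s :: real assume s: "0 < s \<and> s < 1"
        have e: "s powr (2 * real n) = s ^ n * s ^ n" "s powr (2 * real (Suc n)) = s ^ n * s ^ n * s\<^sup>2" "s powr real n = s ^ n"
        proof -
          have "s powr real (2 * n) = s ^ (2 * n)" "s powr real (2 * Suc n) = s ^ (2 * Suc n)" "s powr real n = s ^ n"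
            using s by (simp_all only: powr_realpow)
          moreover have "s ^ (2 * n) = s ^ n * s ^ n" "s ^ (2 * Suc n) = s ^ n * s ^ n * s\<^sup>2"
            by (simp_all add: mult_2 power_add power2_eq_square)
          ultimately show "s powr (2 * real n) = s ^ n * s ^ n" "s powr (2 * real (Suc n)) = s ^ n * s ^ n * s\<^sup>2" "s powr real n = s ^ n"
            by (simp_all only: of_nat_mult of_nat_numeral)
        qed
        have "real (Suc n) * s ^ n * (1 - s) = (\<Sum>k<Suc n. s ^ n) * (1 - s)" by simp
        also have "\<dots> \<le> (\<Sum>k<Suc n. s ^ k) * (1 - s)"
          using s by (intro mult_right_mono sum_mono power_decreasing) auto
        also have "\<dots> = 1 - s ^ Suc n" using one_diff_power_eq[of s "Suc n"] by (simp add: mult.commute)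
        also have "\<dots> \<le> 1" using s by simp
        finally have k: "real (Suc n) * s ^ n * (1 - s) \<le> 1" .
        have "real (Suc n) * (s powr (2 * real n) - s powr (2 * real (Suc n))) =
          (real (Suc n) * s ^ n * (1 - s)) * (s ^ n * (1 + s))"
          unfolding e by (simp add: algebra_simps power2_eq_square)
        also have "\<dots> \<le> 1 * (s ^ n * 2)" using k s by (intro mult_mono) auto
        finally show "real (Suc n) * (s powr (2 * real n) - s powr (2 * real (Suc n))) \<le> 2 * s powr real n"
          by (simp add: e)
      qed
    qed (use M in auto)
    also have "\<dots> = 2 * power_moment M (real n)" by (simp add: power_moment_def)
    also have "\<dots> \<le> 2 * (C * a)" using C(2)[of "real n"] by (simp add: a_def)
    finally have *: "real (Suc n) * (a - b) \<le> 2 * C * a" by simp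
    have ka: "kernel_coeff M n = 1 / (2 * a)" "kernel_coeff M (Suc n) = 1 / (2 * b)"
      by (simp_all only: kernel_coeff_def a_def b_def)
    have "kernel_coeff M (Suc n) - kernel_coeff M n = (a - b) / (2 * a * b)"
      unfolding ka using ab by (simp add: field_simps)
    then have "real (Suc n) * (kernel_coeff M (Suc n) - kernel_coeff M n) = real (Suc n) * (a - b) / (2 * a * b)" by simp
    also have "\<dots> \<le> 2 * C * a / (2 * a * b)" using * ab by (intro divide_right_mono) auto
    also have "\<dots> = 2 * C * kernel_coeff M (Suc n)"
      unfolding ka using ab by simp
    finally show ?thesis .
  qed
  then show ?thesis using C(1) by (intro exI[of _ "2 * C"]) auto
qed

text \<open>The difference of the kernel on the circles of radii \<rho> and a has coefficients
  \<open>b n\<close>. Multiplied by 1 - \<rho> e^(i theta) they become \<open>d n\<close>, where the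
  slow growth of \<open>kernel_coeff\<close> yields a factor \<rho> - a. The square sum of d is then
  of order (\<rho> - a)^2 / (T^2 (1 - \<rho>)), with T the tail at \<rho>.\<close>

lemma kernel_mean_step:
  assumes "doubling M"
  shows "\<exists>Q>0. \<forall>\<rho> a. 1/2 \<le> \<rho> \<and> \<rho> < 1 \<and> 0 \<le> a \<and> a \<le> \<rho> \<longrightarrow>
    kernel_mean M \<rho> \<le> kernel_mean M a + (Q * ((\<rho> - a) / (1 - \<rho>))\<^sup>2 + 1) / upper_mass M \<rho>"
proof -
  obtain C where C: "0 < C" "\<And>n. real (Suc n) * (kernel_coeff M (Suc n) - kernel_coeff M n) \<le> C * kernel_coeff M (Suc n)"
    using kernel_coeff_increment[OF assms] by auto
  obtain C0 where C0: "0 < C0" "\<And>r. 0 < r \<Longrightarrow> r < 1 \<Longrightarrow> upper_mass M r \<le> C0 * upper_mass M (sqrt r)"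
    using assms by (auto simp: doubling_def)
  define Q where "Q = (C + 1)\<^sup>2 * (C0\<^sup>2)\<^sup>2"
  have "kernel_mean M \<rho> \<le> kernel_mean M a + (Q * ((\<rho> - a) / (1 - \<rho>))\<^sup>2 + 1) / upper_mass M \<rho>"
    if \<rho>: "1/2 \<le> \<rho>" "\<rho> < 1" and a: "0 \<le> a" "a \<le> \<rho>" for \<rho> a
  proof -
    \<comment> \<open>With the fourth root, the squared coefficient costs \<rho>^(-n) and leaves one
      of the two factors \<rho>^n for summation. Two doublings compare the tails at s and
      \<rho>.\<close>
    define s where "s = sqrt (sqrt \<rho>)"
    have s: "0 < s" "s < 1" "s\<^sup>2 * s\<^sup>2 = \<rho>" using \<rho> by (auto simp: s_def)
    define T where "T = upper_mass M \<rho>"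
    have T: "0 < T" "0 < upper_mass M s" using thick \<rho> s by (auto simp: thick_def T_def)
    have Ts: "T \<le> C0\<^sup>2 * upper_mass M s"
    proof -
      have "T \<le> C0 * upper_mass M (sqrt \<rho>)" unfolding T_def using \<rho> by (intro C0) auto
      also have "\<dots> \<le> C0 * (C0 * upper_mass M s)" unfolding s_def using \<rho> C0 by (intro mult_left_mono C0) auto
      finally show ?thesis by (simp add: power2_eq_square)
    qed
    let ?e = "kernel_coeff M"
    define b where "b n = ?e n * (\<rho> ^ n - a ^ n)" for n
    define d where "d n = (case n of 0 \<Rightarrow> b 0 | Suc m \<Rightarrow> b (Suc m) - \<rho> * b m)" for n
    have an: "a ^ n \<le> \<rho> ^ n" for n using a by (intro power_mono)
    have b0: "0 \<le> b n" for n using an[of n] kernel_coeff_pos[of n] by (simp add: b_def)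
    have sb: "summable (\<lambda>n. \<bar>b n\<bar>)"
    proof (rule summable_comparison_test'[OF summable_kernel_coeff[of \<rho>]])
      show "norm \<bar>b n\<bar> \<le> ?e n * \<rho> ^ n" for n
        using b0[of n] a kernel_coeff_pos[of n] by (simp add: b_def)
    qed (use \<rho> in auto)
    \<comment> \<open>Both terms are nonnegative; one has the increment of the coefficients, the
      other the factor \<rho> - a.\<close>
    have dS: "d (Suc n) = (?e (Suc n) - ?e n) * (\<rho> ^ Suc n - a ^ Suc n) + ?e n * a ^ n * (\<rho> - a)" for n
      by (simp add: d_def b_def algebra_simps)
    have d0: "0 \<le> d (Suc n)" for n
      unfolding dS using an[of "Suc n"] kernel_coeff_mono[of n "Suc n"] kernel_coeff_pos[of n] a
      by (intro add_nonneg_nonneg mult_nonneg_nonneg) auto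
    \<comment> \<open>The difference of powers is at most (n + 1) \<rho>^n (\<rho> - a), and the
      factor n + 1 is consumed by \<open>kernel_coeff_increment\<close>.\<close>
    have dle: "d (Suc n) \<le> (C + 1) * ?e (Suc n) * \<rho> ^ n * (\<rho> - a)" for n
    proof -
      have "\<rho> ^ Suc n - a ^ Suc n = (\<rho> - a) * (\<Sum>i<Suc n. a ^ (n - i) * \<rho> ^ i)"
        using power_diff_sumr2[of \<rho> "Suc n" a] by (simp only: diff_Suc_Suc)
      also have "\<dots> \<le> (\<rho> - a) * (\<Sum>i<Suc n. \<rho> ^ n)"
      proof (intro mult_left_mono sum_mono)
        fix i assume "i \<in> {..<Suc n}"
        then have "\<rho> ^ n = \<rho> ^ (n - i) * \<rho> ^ i" by (simp flip: power_add)
        then show "a ^ (n - i) * \<rho> ^ i \<le> \<rho> ^ n" using an[of "n - i"] \<rho> by (simp add: mult_right_mono)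
      qed (use a in auto)
      finally have "\<rho> ^ Suc n - a ^ Suc n \<le> (\<rho> - a) * (real (Suc n) * \<rho> ^ n)" by simp
      then have "(?e (Suc n) - ?e n) * (\<rho> ^ Suc n - a ^ Suc n) \<le> (?e (Suc n) - ?e n) * ((\<rho> - a) * (real (Suc n) * \<rho> ^ n))"
        using kernel_coeff_mono[of n "Suc n"] by (intro mult_left_mono) auto
      also have "\<dots> = (real (Suc n) * (?e (Suc n) - ?e n)) * (\<rho> ^ n * (\<rho> - a))" by (simp add: mult_ac)
      also have "\<dots> \<le> (C * ?e (Suc n)) * (\<rho> ^ n * (\<rho> - a))" using a \<rho> by (intro mult_right_mono C) auto
      finally have 1: "(?e (Suc n) - ?e n) * (\<rho> ^ Suc n - a ^ Suc n) \<le> C * ?e (Suc n) * \<rho> ^ n * (\<rho> - a)"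
        by (simp only: mult.assoc)
      have 2: "?e n * a ^ n * (\<rho> - a) \<le> ?e (Suc n) * \<rho> ^ n * (\<rho> - a)"
        using a an[of n] kernel_coeff_mono[of n "Suc n"] kernel_coeff_pos[of "Suc n"]
        by (intro mult_right_mono mult_mono) auto
      from 1 2 show ?thesis unfolding dS by (simp add: algebra_simps)
    qed
    define q where "q = (C + 1)\<^sup>2 * (\<rho> - a)\<^sup>2 * (C0\<^sup>2)\<^sup>2 / T\<^sup>2"
    have dsq: "(d (Suc n))\<^sup>2 \<le> q * \<rho> ^ n" for n
    proof -
      have "(d (Suc n))\<^sup>2 \<le> ((C + 1) * ?e (Suc n) * \<rho> ^ n * (\<rho> - a))\<^sup>2"
        using dle[of n] d0[of n] by (rule power_mono)
      also have "\<dots> = (C + 1)\<^sup>2 * (\<rho> - a)\<^sup>2 * ((?e (Suc n))\<^sup>2 * (\<rho> ^ n)\<^sup>2)" by (simp add: power_mult_distrib mult_ac)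
      also have "(?e (Suc n))\<^sup>2 * (\<rho> ^ n)\<^sup>2 \<le> (C0\<^sup>2)\<^sup>2 / T\<^sup>2 * \<rho> ^ n"
      proof -
        have "?e (Suc n) \<le> 1 / (2 * (s\<^sup>2 ^ Suc n * upper_mass M s))" using s by (intro kernel_coeff_le) auto
        also have "\<dots> \<le> 1 / (2 * (s\<^sup>2 ^ Suc n * (T / C0\<^sup>2)))"
          using Ts C0 s T by (intro divide_left_mono mult_left_mono mult_pos_pos) (auto simp: field_simps)
        finally have "(?e (Suc n))\<^sup>2 \<le> (1 / (2 * (s\<^sup>2 ^ Suc n * (T / C0\<^sup>2))))\<^sup>2"
          using kernel_coeff_pos[of "Suc n"] by (intro power_mono) auto
        also have "\<dots> = (C0\<^sup>2)\<^sup>2 / T\<^sup>2 * (1 / (4 * (s\<^sup>2 ^ Suc n * s\<^sup>2 ^ Suc n)))"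
        proof -
          have alg: "(1 / (2 * (X * (T / Y))))\<^sup>2 = Y\<^sup>2 / T\<^sup>2 * (1 / (4 * (X * X)))" if "0 < X" "0 < Y" for X Y
            using that T by (simp add: power2_eq_square)
          show ?thesis using s C0 by (intro alg) auto
        qed
        also have "s\<^sup>2 ^ Suc n * s\<^sup>2 ^ Suc n = \<rho> ^ Suc n" by (metis power_mult_distrib s(3))
        finally have "(?e (Suc n))\<^sup>2 * (\<rho> ^ n)\<^sup>2 \<le> (C0\<^sup>2)\<^sup>2 / T\<^sup>2 * (1 / (4 * \<rho> ^ Suc n)) * (\<rho> ^ n)\<^sup>2"
          by (rule mult_right_mono) simp
        also have "\<dots> = (C0\<^sup>2)\<^sup>2 / T\<^sup>2 * \<rho> ^ n * (1 / (4 * \<rho>))"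
          using \<rho> by (simp add: power2_eq_square)
        also have "\<dots> \<le> (C0\<^sup>2)\<^sup>2 / T\<^sup>2 * \<rho> ^ n * 1"
          using \<rho> C0 by (intro mult_left_mono) (auto simp: field_simps)
        finally show ?thesis by simp
      qed
      finally show ?thesis by (simp add: q_def mult_left_mono)
    qed
    have sdS: "summable (\<lambda>n. (d (Suc n))\<^sup>2)"
      by (rule summable_comparison_test'[of "\<lambda>n. q * \<rho> ^ n"]) (use dsq \<rho> in \<open>auto intro!: summable_mult summable_geometric\<close>)
    have dzero: "d 0 = 0" by (simp add: d_def b_def)
    define S where "S = (\<Sum>n. (d (Suc n))\<^sup>2)"
    have sd: "(\<lambda>n. (d n)\<^sup>2) sums S"
      using summable_sums[OF sdS] sums_Suc_iff[of "\<lambda>n. (d n)\<^sup>2" S] by (simp add: S_def dzero)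
    have "S \<le> (\<Sum>n. q * \<rho> ^ n)"
      unfolding S_def using dsq sdS \<rho> by (intro suminf_le summable_mult summable_geometric) auto
    also have "\<dots> = q / (1 - \<rho>)" using \<rho> by (subst suminf_mult) (auto simp: suminf_geometric summable_geometric)
    finally have S: "S \<le> q / (1 - \<rho>)" .
    \<comment> \<open>Makes both terms of the L^1 bound multiples of 1 / T, up to the ratio (\<rho>
      - a) / (1 - \<rho>).\<close>
    define l where "l = T / (1 - \<rho>)"
    have l: "0 < l" using T \<rho> by (simp add: l_def)
    have "(\<integral>\<theta>. norm (\<Sum>n. of_real (b n) * cis (real n * \<theta>)) \<partial>circle_measure) \<le> l * S + 1 / (l * (1 - \<rho>))"
      by (rule Fourier_L1_bound[OF sb _ _ l _ _ sd]) (use \<rho> in \<open>auto simp: d_def\<close>)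
    also have "\<dots> \<le> l * (q / (1 - \<rho>)) + 1 / T"
      using S l \<rho> by (intro add_mono mult_left_mono) (auto simp: l_def)
    also have "\<dots> = (Q * ((\<rho> - a) / (1 - \<rho>))\<^sup>2 + 1) / T"
    proof -
      have "T / (1 - \<rho>) * (c * x\<^sup>2 * y / T\<^sup>2 / (1 - \<rho>)) = c * y * (x / (1 - \<rho>))\<^sup>2 / T" for c x y
        using T by (simp add: power2_eq_square mult_ac)
      then show ?thesis by (simp add: l_def q_def Q_def add_divide_distrib)
    qed
    finally have diff: "(\<integral>\<theta>. norm (\<Sum>n. of_real (b n) * cis (real n * \<theta>)) \<partial>circle_measure) \<le> (Q * ((\<rho> - a) / (1 - \<rho>))\<^sup>2 + 1) / T" .
    have r1: "0 \<le> \<rho>" "a < 1" using \<rho> a by auto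
    have eq: "radial_kernel M (of_real \<rho> * cis t) - radial_kernel M (of_real a * cis t) = (\<Sum>n. of_real (b n) * cis (real n * t))" for t
    proof -
      note s1 = summable_norm_cancel[OF Fourier_series_norm_le(1)[OF summable_norm_kernel_coeff[OF r1(1) \<rho>(2)]], of t]
      note s2 = summable_norm_cancel[OF Fourier_series_norm_le(1)[OF summable_norm_kernel_coeff[OF a(1) r1(2)]], of t]
      show ?thesis
        unfolding radial_kernel_Fourier[OF r1(1) \<rho>(2)] radial_kernel_Fourier[OF a(1) r1(2)] suminf_diff[OF s1 s2]
        by (simp add: b_def algebra_simps)
    qed
    have int: "integrable circle_measure (\<lambda>t. norm (radial_kernel M (of_real \<rho> * cis t)))"
       "integrable circle_measure (\<lambda>t. norm (radial_kernel M (of_real a * cis t)))"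
      using integrable_norm_radial_kernel r1 \<rho> a by auto
    have intb: "integrable circle_measure (\<lambda>t. norm (\<Sum>n. of_real (b n) * cis (real n * t)))"
      by (rule integrable_circle_bounded[where B = "\<Sum>n. norm (complex_of_real (b n))"])
         (use Fourier_series_norm_le(2)[of "\<lambda>n. of_real (b n)"] sb in auto)
    have "kernel_mean M \<rho> \<le> (\<integral>t. norm (radial_kernel M (of_real a * cis t)) + norm (\<Sum>n. of_real (b n) * cis (real n * t)) \<partial>circle_measure)"
      unfolding kernel_mean_def
    proof (rule integral_mono)
      fix t
      show "norm (radial_kernel M (of_real \<rho> * cis t)) \<le> norm (radial_kernel M (of_real a * cis t)) + norm (\<Sum>n. of_real (b n) * cis (real n * t))"
        unfolding eq[symmetric] by (rule norm_triangle_sub)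
    qed (use int intb in auto)
    also have "\<dots> = kernel_mean M a + (\<integral>\<theta>. norm (\<Sum>n. of_real (b n) * cis (real n * \<theta>)) \<partial>circle_measure)"
      unfolding kernel_mean_def using int intb by simp
    finally show ?thesis using diff by (simp add: T_def)
  qed
  moreover have "0 < Q" using C C0 by (simp add: Q_def)
  ultimately show ?thesis by blast
qed

text \<open>Bounds the means on [0, R], where the recursion starts.\<close>

lemma kernel_mean_le:
  assumes "0 \<le> \<rho>" "\<rho> \<le> R" "R < 1"
  shows "kernel_mean M \<rho> \<le> (\<Sum>n. kernel_coeff M n * R ^ n)"
proof -
  have "kernel_mean M \<rho> \<le> (\<integral>t. (\<Sum>n. kernel_coeff M n * R ^ n) \<partial>circle_measure)"
    unfolding kernel_mean_def using assms integrable_norm_radial_kernel[of \<rho>]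
    by (intro integral_mono norm_radial_kernel_le) (auto simp: norm_mult)
  then show ?thesis by simp
qed

lemma kernel_mean_nonneg: "0 \<le> kernel_mean M \<rho>"
  unfolding kernel_mean_def by (rule integral_nonneg_AE) simp

text \<open>By Bernoulli's inequality (r - r^L) / (1 - r) is bounded, so each application of
  \<open>kernel_mean_step\<close> costs a multiple of 1 / T(r), with T the tail. Reverse doubling
  makes these costs geometric along r, r^L, ....\<close>

theorem kernel_mean_upper:
  assumes "doubling M" "reverse_doubling M"
  shows "\<exists>B>0. \<forall>\<rho>. 0 \<le> \<rho> \<and> \<rho> < 1 \<longrightarrow> kernel_mean M \<rho> \<le> B / upper_mass M \<rho>"
proof -
  obtain q L r0 where q: "0 < q" "q < 1" "1 < L" "0 < r0" "r0 < 1"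
    "\<And>r. r0 \<le> r \<Longrightarrow> r < 1 \<Longrightarrow> upper_mass M r \<le> q * upper_mass M (r powr L)"
    using assms(2) by (auto simp: reverse_doubling_def)
  obtain Q where Q: "0 < Q" "\<And>\<rho> a. 1/2 \<le> \<rho> \<Longrightarrow> \<rho> < 1 \<Longrightarrow> 0 \<le> a \<Longrightarrow> a \<le> \<rho> \<Longrightarrow>
    kernel_mean M \<rho> \<le> kernel_mean M a + (Q * ((\<rho> - a) / (1 - \<rho>))\<^sup>2 + 1) / upper_mass M \<rho>"
    using kernel_mean_step[OF assms(1)] by blast
  obtain n :: nat where n: "L \<le> real n" using real_arch_simple by blast
  define k where "k = real n"
  \<comment> \<open>\<open>kernel_mean_step\<close> needs radii of at least 1/2.\<close>
  define r1 where "r1 = max r0 (1/2)"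
  have Tpos: "0 < upper_mass M r" if "r < 1" for r using thick that by (simp add: thick_def)
  have "\<exists>C>0. \<forall>r. 0 \<le> r \<and> r < 1 \<longrightarrow> ennreal (kernel_mean M r) \<le> ennreal (C * (1 / upper_mass M r))"
  proof (rule recursion_bound[where ?r0.0 = r1 and L = L and q = q and c = "Q * k\<^sup>2 + 1" and b = "\<Sum>n. kernel_coeff M n * r1 ^ n"])
    fix r assume "0 \<le> r" "r \<le> r1"
    then show "ennreal (kernel_mean M r) \<le> ennreal (\<Sum>n. kernel_coeff M n * r1 ^ n)"
      using q(4,5) by (intro ennreal_leI kernel_mean_le) (auto simp: r1_def)
  next
    show "0 \<le> (\<Sum>n. kernel_coeff M n * r1 ^ n)"
    proof (intro suminf_nonneg summable_kernel_coeff)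
      show "0 \<le> kernel_coeff M n * r1 ^ n" for n
        using kernel_coeff_pos[of n] q(4) by (auto simp: r1_def)
    qed (use q(4,5) in \<open>auto simp: r1_def\<close>)
  next
    fix r s :: real assume "0 \<le> r" "r \<le> s" "s < 1"
    then show "1 / upper_mass M r \<le> 1 / upper_mass M s"
      by (intro divide_left_mono upper_mass_antimono M mult_pos_pos Tpos) auto
  next
    fix r assume r: "r1 \<le> r" "r < 1"
    then have r': "0 < r" "1/2 \<le> r" "r0 \<le> r" by (auto simp: r1_def)
    have rL: "r powr L \<le> r" using powr_mono'[of 1 L r] r r' q by auto
    have rL1: "r powr L < 1" using rL r by simp
    \<comment> \<open>Since n \<ge> L, r^n is at most r^L, and so r - r^L \<le> n (1 - r).\<close>
    have "1 - k * (1 - r) \<le> r ^ n"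
      using Bernoulli_inequality[of "r - 1" n] r' by (simp add: k_def algebra_simps)
    also have "\<dots> = r powr k" using r' by (simp add: k_def powr_realpow)
    also have "\<dots> \<le> r powr L" using n r r' by (intro powr_mono') (auto simp: k_def)
    finally have "r - r powr L \<le> k * (1 - r)" using r by simp
    then have "(r - r powr L) / (1 - r) \<le> k" using r by (simp add: field_simps)
    then have "((r - r powr L) / (1 - r))\<^sup>2 \<le> k\<^sup>2" using rL r by (intro power_mono) auto
    then have "(Q * ((r - r powr L) / (1 - r))\<^sup>2 + 1) / upper_mass M r \<le> (Q * k\<^sup>2 + 1) / upper_mass M r"
      using Q Tpos[OF r(2)] by (intro divide_right_mono) auto
    then have "kernel_mean M r \<le> kernel_mean M (r powr L) + (Q * k\<^sup>2 + 1) / upper_mass M r"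
      using Q(2)[of r "r powr L"] r r' rL by simp
    then have "ennreal (kernel_mean M r) \<le> ennreal (kernel_mean M (r powr L) + (Q * k\<^sup>2 + 1) * (1 / upper_mass M r))"
      by (intro ennreal_leI) simp
    also have "\<dots> = ennreal (kernel_mean M (r powr L)) + ennreal ((Q * k\<^sup>2 + 1) * (1 / upper_mass M r))"
      using kernel_mean_nonneg Q Tpos[OF r(2)] by (intro ennreal_plus) auto
    finally show "ennreal (kernel_mean M r) \<le> ennreal (kernel_mean M (r powr L)) + ennreal ((Q * k\<^sup>2 + 1) * (1 / upper_mass M r))" .
    show "1 / upper_mass M (r powr L) \<le> q * (1 / upper_mass M r)"
      using q(6)[OF r'(3) r(2)] Tpos[OF r(2)] Tpos[OF rL1] by (simp add: divide_simps mult.commute)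
  qed (use q(1-5) Q(1) Tpos[of 0] in \<open>auto simp: r1_def\<close>)
  then obtain C where C: "0 < C" "\<And>r. 0 \<le> r \<Longrightarrow> r < 1 \<Longrightarrow> ennreal (kernel_mean M r) \<le> ennreal (C * (1 / upper_mass M r))" by blast
  have "kernel_mean M r \<le> C / upper_mass M r" if "0 \<le> r" "r < 1" for r
    using C(2)[OF that] C(1) Tpos[OF that(2)] by (simp add: ennreal_le_iff)
  then show ?thesis using C(1) by blast
qed

end

section \<open>Polar coordinates\<close>

text \<open>Equality on boxes suffices: the preimage of a box is its image under the inverse
  isometry, which has the same volume.\<close>

lemma lborel_distr_isometry_vec:
  fixes T :: "real ^ 2 \<Rightarrow> real ^ 2"
  assumes T: "orthogonal_transformation T"
  shows "distr lborel borel T = lborel"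
proof (rule lborel_eqI[symmetric])
  have [measurable]: "T \<in> borel_measurable borel"
    using T by (intro borel_measurable_continuous_onI linear_continuous_on)
               (simp add: orthogonal_transformation_linear linear_conv_bounded_linear[symmetric])
  fix l u :: "real ^ 2"
  assume lu: "\<And>b. b \<in> Basis \<Longrightarrow> l \<bullet> b \<le> u \<bullet> b"
  define T' where "T' = inv T"
  have T': "orthogonal_transformation T'" unfolding T'_def by (rule orthogonal_transformation_inv[OF T])
  have pre: "T -` box l u = T' ` box l u"
    unfolding T'_def using orthogonal_transformation_bij[OF T] by (rule bij_vimage_eq_inv_image)
  have im: "T' ` box l u \<in> lmeasurable" "measure lebesgue (T' ` box l u) = measure lebesgue (box l u)"
    using measurable_orthogonal_image[OF T'] measure_orthogonal_image[OF T'] by auto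
  have "emeasure (distr lborel borel T) (box l u) = emeasure lborel (T -` box l u)"
    by (subst emeasure_distr) auto
  also have "\<dots> = emeasure lebesgue (T' ` box l u)"
    unfolding pre[symmetric] using measurable_sets_borel[OF \<open>T \<in> borel_measurable borel\<close>, of "box l u"]
    by simp
  also have "\<dots> = ennreal (measure lebesgue (box l u))"
    using im by (simp add: emeasure_eq_measure2)
  also have "\<dots> = (\<Prod>b\<in>Basis. (u - l) \<bullet> b)"
    using lu by (simp add: measure_lborel_box_eq measure_def)
  finally show "emeasure (distr lborel borel T) (box l u) = (\<Prod>b\<in>Basis. (u - l) \<bullet> b)" .
qed simp

text \<open>Transports the orthogonal invariance of Lebesgue measure from \<open>real ^ 2\<close> to
  the complex plane.\<close>

definition vec_complex :: "real ^ 2 \<Rightarrow> complex" where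
  "vec_complex v = Complex (v $ 1) (v $ 2)"

definition complex_vec :: "complex \<Rightarrow> real ^ 2" where
  "complex_vec z = (\<chi> i. if i = 1 then Re z else Im z)"

lemma complex_vec_inverse [simp]: "vec_complex (complex_vec z) = z" "complex_vec (vec_complex v) = v"
proof -
  have "(2::2) \<noteq> 1" by simp
  then show "vec_complex (complex_vec z) = z" "complex_vec (vec_complex v) = v"
    by (auto simp: vec_complex_def complex_vec_def vec_eq_iff forall_2)
qed

lemma linear_vec_complex: "linear vec_complex" "linear complex_vec"
  by (auto intro!: linearI simp: vec_complex_def complex_vec_def vec_eq_iff complex_eq_iff)

lemma norm_vec_complex: "norm (vec_complex v) = norm v"
  by (simp add: vec_complex_def norm_vec_def L2_set_def sum_2 cmod_def)

lemma borel_measurable_vec_complex [measurable]: "vec_complex \<in> borel_measurable borel" "complex_vec \<in> borel_measurable borel"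
  using linear_vec_complex
  by (auto intro!: borel_measurable_continuous_onI linear_continuous_on simp: linear_conv_bounded_linear)

lemma lborel_distr_vec_complex: "distr lborel borel vec_complex = lborel"
proof (rule lborel_eqI[symmetric])
  fix l u :: complex
  assume lu: "\<And>b. b \<in> Basis \<Longrightarrow> l \<bullet> b \<le> u \<bullet> b"
  then have lu': "Re l \<le> Re u" "Im l \<le> Im u"
    using lu[of 1] lu[of \<i>] by (auto simp: Basis_complex_def)
  have "vec_complex -` box l u = box (complex_vec l) (complex_vec u)"
    by (auto simp: mem_box_cart in_box_complex_iff vec_complex_def complex_vec_def forall_2)
  then have "emeasure (distr lborel borel vec_complex) (box l u) = emeasure lborel (box (complex_vec l) (complex_vec u))"
    by (subst emeasure_distr) auto
  also have "\<dots> = (\<Prod>b\<in>Basis. (complex_vec u - complex_vec l) \<bullet> b)"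
    using lu' by (intro emeasure_lborel_box) (auto simp: Basis_vec_def inner_axis complex_vec_def)
  also have "(\<Prod>b\<in>Basis. (complex_vec u - complex_vec l) \<bullet> b) = (Re u - Re l) * (Im u - Im l)"
  proof -
    have "(\<Prod>b\<in>Basis. (complex_vec u - complex_vec l) \<bullet> b) = (\<Prod>i\<in>UNIV. (complex_vec u - complex_vec l) $ i)"
      by (simp add: Basis_vec_def cart_eq_inner_axis axis_eq_axis prod.UNION_disjoint)
    also have "\<dots> = (Re u - Re l) * (Im u - Im l)" by (simp add: complex_vec_def UNIV_2)
    finally show ?thesis .
  qed
  also have "\<dots> = (\<Prod>b\<in>Basis. (u - l) \<bullet> b)" by (simp add: Basis_complex_def)
  finally show "emeasure (distr lborel borel vec_complex) (box l u) = (\<Prod>b\<in>Basis. (u - l) \<bullet> b)" .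
qed simp

lemma lborel_distr_rotation:
  assumes "norm c = 1"
  shows "distr lborel borel ((*) c) = (lborel :: complex measure)"
proof -
  define T where "T v = complex_vec (c * vec_complex v)" for v
  have nT: "norm (T v) = norm v" for v
    using norm_vec_complex[of "T v"] norm_vec_complex[of v] assms by (simp add: T_def norm_mult)
  have "linear T"
    using linear_vec_complex unfolding T_def
    by (auto intro!: linearI simp: linear_add linear_scale algebra_simps)
  then have "orthogonal_transformation T" unfolding orthogonal_transformation using nT by blast
  then have T: "distr lborel borel T = lborel" by (rule lborel_distr_isometry_vec)
  have [measurable]: "T \<in> borel_measurable borel" "(*) c \<in> borel_measurable borel" unfolding T_def by measurable
  have "distr lborel borel ((*) c) = distr (distr lborel borel vec_complex) borel ((*) c)"
    by (simp add: lborel_distr_vec_complex)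
  also have "\<dots> = distr lborel borel (\<lambda>v. c * vec_complex v)" by (subst distr_distr) (auto simp: comp_def)
  also have "\<dots> = distr lborel borel (\<lambda>v. vec_complex (T v))" by (simp add: T_def)
  also have "\<dots> = distr (distr lborel borel T) borel vec_complex" by (subst distr_distr) (auto simp: comp_def)
  also have "\<dots> = lborel" by (simp add: T lborel_distr_vec_complex)
  finally show ?thesis .
qed

text \<open>A Borel measure on the whole plane that stands in for \<open>dA\<close>, so that
  pushforwards and Fubini's theorem involve Borel sets only.\<close>

definition disc_measure :: "complex measure" where
  "disc_measure = density lborel (\<lambda>z. ennreal (indicator (ball 0 1) z / pi))"

text \<open>The distribution of the modulus under normalised area.\<close>

definition radial_measure :: "real measure" where
  "radial_measure = density lborel (\<lambda>r. ennreal (indicator {0..<1} r * (2 * r)))"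

section \<open>Rotation invariance and the distribution of the modulus\<close>

lemma ball_in_borel [measurable]: "ball (0::complex) 1 \<in> sets borel"
  by simp

lemma sets_disc_measure [simp, measurable_cong]: "sets disc_measure = sets borel"
  and sets_radial_measure [simp, measurable_cong]: "sets radial_measure = sets borel"
  by (simp_all add: disc_measure_def radial_measure_def)

lemma space_disc_measure [simp]: "space disc_measure = UNIV"
  and space_radial_measure [simp]: "space radial_measure = UNIV"
  by (simp_all add: disc_measure_def radial_measure_def)

lemma borel_measurable_disc_measure [simp]: "borel_measurable disc_measure = borel_measurable borel"
  and borel_measurable_radial_measure [simp]: "borel_measurable radial_measure = borel_measurable borel"
  by (rule measurable_cong_sets; simp)+

text \<open>With y the clamp of x to [0, 1], the half-line above x gets mass 1 - y^2 from both
  measures: from areas of discs and from the antiderivative r^2.\<close>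

lemma distr_norm_disc_measure: "distr disc_measure borel norm = radial_measure"
proof (rule measure_eqI_lessThan)
  have total: "emeasure (distr disc_measure borel norm) {x<..} = ennreal (1 - (max 0 (min x 1))\<^sup>2)" for x :: real
  proof -
    define y where "y = max 0 (min x 1)"
    have y: "0 \<le> y" "y \<le> 1" by (auto simp: y_def)
    have eq: "{z. x < norm z} \<inter> ball 0 1 = ball 0 1 - (if x < 0 then {} else cball (0::complex) y)"
      by (auto simp: y_def max_def min_def intro: less_le_trans[OF _ norm_ge_zero])
    have "emeasure (distr disc_measure borel norm) {x<..} = emeasure disc_measure {z. x < norm z}"
      by (subst emeasure_distr) (auto simp: vimage_def)
    also have "\<dots> = (\<integral>\<^sup>+z. ennreal (1 / pi) * indicator ({z. x < norm z} \<inter> ball 0 1) (z::complex) \<partial>lborel)"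
      unfolding disc_measure_def by (subst emeasure_density) (auto intro!: nn_integral_cong simp: indicator_def)
    also have "\<dots> = ennreal (1 / pi) * emeasure lborel ({z. x < norm z} \<inter> ball (0::complex) 1)"
      by (subst nn_integral_cmult_indicator) auto
    also have "emeasure lborel ({z. x < norm z} \<inter> ball (0::complex) 1) = ennreal (pi * (1 - y\<^sup>2))"
    proof -
      have b: "emeasure lborel (ball (0::complex) 1) = ennreal pi"
        by (subst emeasure_ball) (auto simp: unit_ball_vol_2)
      show ?thesis
      proof (cases "x < 0")
        case True
        then have "y = 0" by (simp add: y_def)
        then show ?thesis using True b eq by simp
      next
        case False
        have c: "emeasure lborel (cball (0::complex) y) = ennreal (pi * y\<^sup>2)"
          using y by (subst emeasure_cball) (auto simp: unit_ball_vol_2)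
        have "cball (0::complex) y \<inter> ball 0 1 = (if y < 1 then cball 0 y else ball 0 1)"
          using y by (auto simp: not_less)
        show ?thesis
        proof (cases "y < 1")
          case True
          have "emeasure lborel (ball (0::complex) 1 - cball 0 y) = emeasure lborel (ball (0::complex) 1) - emeasure lborel (cball (0::complex) y)"
            using True c by (intro emeasure_Diff) auto
          then show ?thesis using False b c y by (simp add: eq ennreal_minus algebra_simps)
        next
          case F: False
          then have "y = 1" using y by simp
          then have "{z. x < norm z} \<inter> ball 0 1 = ({} :: complex set)" using False eq by auto
          then show ?thesis using \<open>y = 1\<close> by simp
        qed
      qed
    qed
    finally show ?thesis using y by (simp add: y_def ennreal_mult[symmetric] power_le_one)
  qed
  fix x :: real
  show "emeasure (distr disc_measure borel norm) {x<..} < \<infinity>" unfolding total by simp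
  show "emeasure (distr disc_measure borel norm) {x<..} = emeasure radial_measure {x<..}"
  proof -
    define y where "y = max 0 (min x 1)"
    have y: "0 \<le> y" "y \<le> 1" by (auto simp: y_def)
    have "emeasure radial_measure {x<..} = (\<integral>\<^sup>+r. ennreal (2 * r) * indicator {y..1} r \<partial>lborel)"
      unfolding radial_measure_def
    proof (subst emeasure_density)
      show "(\<integral>\<^sup>+r. ennreal (indicator {0..<1} r * (2 * r)) * indicator {x<..} r \<partial>lborel) =
        (\<integral>\<^sup>+r. ennreal (2 * r) * indicator {y..1} r \<partial>lborel)"
      proof (rule nn_integral_cong_AE)
        show "AE r in lborel. ennreal (indicator {0..<1} r * (2 * r)) * indicator {x<..} r = ennreal (2 * r) * indicator {y..1} r"
          using AE_lborel_singleton[of y] AE_lborel_singleton[of 1] AE_lborel_singleton[of 0]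
          by eventually_elim (auto simp: indicator_def y_def max_def min_def split: if_splits)
      qed
    qed auto
    also have "\<dots> = ennreal (1\<^sup>2 - y\<^sup>2)"
    proof (rule nn_integral_FTC_Icc)
    qed (use y in \<open>auto intro!: derivative_eq_intros\<close>)
    finally show ?thesis unfolding total by (simp add: y_def)
  qed
qed simp_all

lemma disc_measure_rotation:
  assumes "norm c = 1"
  shows "distr disc_measure borel ((*) c) = disc_measure"
proof -
  have "c \<noteq> 0" using assms by auto
  have "disc_measure = density (distr lborel borel ((*) c)) (\<lambda>z. ennreal (indicator (ball 0 1) z / pi))"
    by (simp add: disc_measure_def lborel_distr_rotation[OF assms])
  also have "\<dots> = distr (density lborel (\<lambda>z. ennreal (indicator (ball 0 1) (c * z) / pi))) borel ((*) c)"
  proof (rule density_distr)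
    show "(\<lambda>z. ennreal (indicator (ball 0 1) z / pi)) \<in> borel_measurable (borel :: complex measure)" by measurable
  qed simp
  also have "(\<lambda>z. ennreal (indicator (ball 0 1) (c * z) / pi)) = (\<lambda>z. ennreal (indicator (ball 0 1) z / pi))"
    using assms by (auto simp: indicator_def norm_mult)
  finally show ?thesis by (simp add: disc_measure_def)
qed

lemma nn_integral_circle_measure:
  assumes [measurable]: "F \<in> borel_measurable borel"
  shows "(\<integral>\<^sup>+t. F t \<partial>circle_measure) = ennreal (1 / (2 * pi)) * (\<integral>\<^sup>+t. F t * indicator {0..<2*pi} t \<partial>lborel)"
proof -
  have "(\<integral>\<^sup>+t. F t \<partial>circle_measure) = (\<integral>\<^sup>+t. ennreal (indicator {0..2*pi} t / (2 * pi)) * F t \<partial>lborel)"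
    unfolding circle_measure_def by (subst nn_integral_density) auto
  also have "\<dots> = (\<integral>\<^sup>+t. ennreal (1 / (2 * pi)) * (F t * indicator {0..<2*pi} t) \<partial>lborel)"
  proof (rule nn_integral_cong_AE)
    show "AE t in lborel. ennreal (indicator {0..2*pi} t / (2 * pi)) * F t = ennreal (1 / (2 * pi)) * (F t * indicator {0..<2*pi} t)"
      using AE_lborel_singleton[of "2*pi"] by eventually_elim (auto simp: indicator_def)
  qed
  also have "\<dots> = ennreal (1 / (2 * pi)) * (\<integral>\<^sup>+t. F t * indicator {0..<2*pi} t \<partial>lborel)"
    by (subst nn_integral_cmult) auto
  finally show ?thesis .
qed

text \<open>The window [a, a + 2 pi) is cut at 2 pi and its end moved back by one period.\<close>

lemma nn_integral_circle_shift:
  fixes G :: "complex \<Rightarrow> ennreal"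
  assumes [measurable]: "G \<in> borel_measurable borel" and a: "0 \<le> a" "a < 2 * pi"
  shows "(\<integral>\<^sup>+t. G (cis (t + a)) \<partial>circle_measure) = (\<integral>\<^sup>+t. G (cis t) \<partial>circle_measure)"
proof -
  let ?F = "\<lambda>t. G (cis t)"
  have "(\<integral>\<^sup>+t. ?F (t + a) * indicator {0..<2*pi} t \<partial>lborel) = (\<integral>\<^sup>+t. ?F t * indicator {a..<a+2*pi} t \<partial>lborel)"
    by (subst (2) nn_integral_real_affine[where c = 1 and t = a])
       (auto intro!: nn_integral_cong simp: indicator_def add.commute)
  also have "\<dots> = (\<integral>\<^sup>+t. ?F t * indicator {a..<2*pi} t + ?F t * indicator {2*pi..<a+2*pi} t \<partial>lborel)"
    using a by (intro nn_integral_cong) (auto simp: indicator_def)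
  also have "\<dots> = (\<integral>\<^sup>+t. ?F t * indicator {a..<2*pi} t \<partial>lborel) + (\<integral>\<^sup>+t. ?F t * indicator {2*pi..<a+2*pi} t \<partial>lborel)"
    by (rule nn_integral_add) auto
  also have "(\<integral>\<^sup>+t. ?F t * indicator {2*pi..<a+2*pi} t \<partial>lborel) = (\<integral>\<^sup>+t. ?F t * indicator {0..<a} t \<partial>lborel)"
  proof (subst nn_integral_real_affine[where c = 1 and t = "2*pi"])
    have "cis (2 * pi + t) = cis t" for t by (simp flip: cis_mult)
    then show "ennreal \<bar>1\<bar> * (\<integral>\<^sup>+t. ?F (2*pi + 1 * t) * indicator {2*pi..<a+2*pi} (2*pi + 1 * t) \<partial>lborel) =
      (\<integral>\<^sup>+t. ?F t * indicator {0..<a} t \<partial>lborel)"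
      by (auto intro!: nn_integral_cong simp: indicator_def)
  qed auto
  also have "(\<integral>\<^sup>+t. ?F t * indicator {a..<2*pi} t \<partial>lborel) + (\<integral>\<^sup>+t. ?F t * indicator {0..<a} t \<partial>lborel)
     = (\<integral>\<^sup>+t. ?F t * indicator {a..<2*pi} t + ?F t * indicator {0..<a} t \<partial>lborel)"
    by (rule nn_integral_add[symmetric]) auto
  also have "\<dots> = (\<integral>\<^sup>+t. ?F t * indicator {0..<2*pi} t \<partial>lborel)"
    using a by (intro nn_integral_cong) (auto simp: indicator_def)
  finally show ?thesis
    by (subst (1 2) nn_integral_circle_measure) (auto simp: add.commute)
qed

text \<open>The argument of z only shifts the angle, so periodicity leaves its modulus.\<close>

lemma nn_integral_circle_rotation:
  fixes G :: "complex \<Rightarrow> ennreal"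
  assumes [measurable]: "G \<in> borel_measurable borel"
  shows "(\<integral>\<^sup>+t. G (cis t * z) \<partial>circle_measure) = (\<integral>\<^sup>+t. G (of_real (norm z) * cis t) \<partial>circle_measure)"
proof -
  have z: "z = of_real (norm z) * cis (Arg2pi z)"
    using complex_norm_eq_1_exp[of "z"] Arg2pi_eq[of z] by (simp add: cis_conv_exp)
  have "(\<integral>\<^sup>+t. G (cis t * z) \<partial>circle_measure) = (\<integral>\<^sup>+t. G (of_real (norm z) * cis (t + Arg2pi z)) \<partial>circle_measure)"
    by (subst z) (simp add: cis_mult[symmetric] mult_ac)
  also have "\<dots> = (\<integral>\<^sup>+t. G (of_real (norm z) * cis t) \<partial>circle_measure)"
    by (rule nn_integral_circle_shift[where G = "\<lambda>w. G (of_real (norm z) * w)"])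
       (auto simp: Arg2pi_ge_0 Arg2pi_lt_2pi)
  finally show ?thesis .
qed

lemma finite_measure_disc: "finite_measure disc_measure" "finite_measure radial_measure"
proof -
  have "emeasure radial_measure UNIV = (\<integral>\<^sup>+r. ennreal (indicator {0..<1} r * (2 * r)) \<partial>lborel)"
    by (simp add: radial_measure_def emeasure_density)
  also have "\<dots> \<le> (\<integral>\<^sup>+r. 2 * indicator {0..1::real} r \<partial>lborel)"
    by (intro nn_integral_mono) (auto simp: indicator_def intro!: ennreal_leI[of _ 2, simplified])
  also have "\<dots> < \<infinity>" by (subst nn_integral_cmult_indicator) auto
  finally have *: "emeasure radial_measure UNIV < \<infinity>" .
  then show "finite_measure radial_measure" by (intro finite_measureI) simp
  have "emeasure disc_measure UNIV = emeasure (distr disc_measure borel norm) UNIV"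
    by (subst emeasure_distr) auto
  with * show "finite_measure disc_measure" by (intro finite_measureI) (simp add: distr_norm_disc_measure)
qed

interpretation disc_measure: finite_measure disc_measure by (rule finite_measure_disc)
interpretation radial_measure: finite_measure radial_measure by (rule finite_measure_disc)

lemma measurable_radial_circle:
  "measurable (radial_measure \<Otimes>\<^sub>M circle_measure) N = measurable (borel \<Otimes>\<^sub>M borel) N"
  by (rule measurable_cong_sets[OF sets_pair_measure_cong refl]) simp_all

text \<open>No Jacobian is computed. By rotation invariance the area of A may be averaged over all
  rotations; after Fubini the inner average depends on the modulus alone, whose distribution is
  \<open>radial_measure\<close>.\<close>

theorem polar_coordinates:
  "distr (radial_measure \<Otimes>\<^sub>M circle_measure) borel (\<lambda>(r, t). of_real r * cis t) = disc_measure"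
proof (rule measure_eqI)
  interpret D: pair_sigma_finite disc_measure circle_measure ..
  interpret R: pair_sigma_finite radial_measure circle_measure ..
  fix A assume "A \<in> sets (distr (radial_measure \<Otimes>\<^sub>M circle_measure) borel (\<lambda>(r, t). of_real r * cis t))"
  then have A [measurable]: "A \<in> sets borel" by simp
  let ?G = "indicator A :: complex \<Rightarrow> ennreal"
  have h: "(\<lambda>r. \<integral>\<^sup>+t. ?G (of_real r * cis t) \<partial>circle_measure) \<in> borel_measurable borel"
  proof (rule circle_measure.borel_measurable_nn_integral)
    show "(\<lambda>(r, t). ?G (of_real r * cis t)) \<in> borel_measurable (borel \<Otimes>\<^sub>M circle_measure)"
      unfolding measurable_cong_sets[OF sets_pair_measure_cong[OF refl sets_circle_measure] refl]
      by measurable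
  qed
  have h2: "(\<lambda>x. ?G (of_real (fst x) * cis (snd x))) \<in> borel_measurable (radial_measure \<Otimes>\<^sub>M circle_measure)"
    unfolding measurable_radial_circle by measurable
  have h3: "(\<lambda>(r, t). of_real r * cis t) \<in> borel_measurable (radial_measure \<Otimes>\<^sub>M circle_measure)"
    unfolding measurable_radial_circle by measurable
  have "emeasure disc_measure A = (\<integral>\<^sup>+t. emeasure disc_measure A \<partial>circle_measure)"
    by simp
  also have "\<dots> = (\<integral>\<^sup>+t. (\<integral>\<^sup>+z. ?G (cis t * z) \<partial>disc_measure) \<partial>circle_measure)"
  proof (rule nn_integral_cong)
    fix t
    have "emeasure disc_measure A = emeasure (distr disc_measure borel ((*) (cis t))) A"
      by (subst disc_measure_rotation) auto
    also have "\<dots> = (\<integral>\<^sup>+z. ?G z \<partial>distr disc_measure borel ((*) (cis t)))" by simp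
    also have "\<dots> = (\<integral>\<^sup>+z. ?G (cis t * z) \<partial>disc_measure)" by (subst nn_integral_distr) auto
    finally show "emeasure disc_measure A = (\<integral>\<^sup>+z. ?G (cis t * z) \<partial>disc_measure)" .
  qed
  also have "\<dots> = (\<integral>\<^sup>+z. (\<integral>\<^sup>+t. ?G (cis t * z) \<partial>circle_measure) \<partial>disc_measure)"
  proof (rule D.Fubini')
    show "(\<lambda>(z, t). ?G (cis t * z)) \<in> borel_measurable (disc_measure \<Otimes>\<^sub>M circle_measure)"
      unfolding measurable_cong_sets[OF sets_pair_measure_cong[OF sets_disc_measure sets_circle_measure] refl]
      by measurable
  qed
  also have "\<dots> = (\<integral>\<^sup>+z. (\<integral>\<^sup>+t. ?G (of_real (norm z) * cis t) \<partial>circle_measure) \<partial>disc_measure)"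
    by (subst nn_integral_circle_rotation) auto
  also have "\<dots> = (\<integral>\<^sup>+r. (\<integral>\<^sup>+t. ?G (of_real r * cis t) \<partial>circle_measure) \<partial>distr disc_measure borel norm)"
    by (rule nn_integral_distr[symmetric]) (use h in auto)
  also have "\<dots> = (\<integral>\<^sup>+x. ?G (of_real (fst x) * cis (snd x)) \<partial>(radial_measure \<Otimes>\<^sub>M circle_measure))"
    unfolding distr_norm_disc_measure by (subst circle_measure.nn_integral_fst[symmetric]) (use h2 in auto)
  also have "\<dots> = emeasure (distr (radial_measure \<Otimes>\<^sub>M circle_measure) borel (\<lambda>(r, t). of_real r * cis t)) A"
    by (subst nn_integral_indicator[symmetric], simp, subst nn_integral_distr) (use h3 in \<open>auto simp: case_prod_beta\<close>)
  finally show "emeasure (distr (radial_measure \<Otimes>\<^sub>M circle_measure) borel (\<lambda>(r, t). of_real r * cis t)) A = emeasure disc_measure A"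
    by simp
qed simp

lemma polar_map_measurable:
  "(\<lambda>(r, t). of_real r * cis t) \<in> borel_measurable (radial_measure \<Otimes>\<^sub>M circle_measure)"
  unfolding measurable_radial_circle by measurable

lemma nn_integral_polar:
  assumes [measurable]: "f \<in> borel_measurable borel"
  shows "(\<integral>\<^sup>+z. f z \<partial>disc_measure) = (\<integral>\<^sup>+r. (\<integral>\<^sup>+t. f (of_real r * cis t) \<partial>circle_measure) \<partial>radial_measure)"
proof -
  interpret R: pair_sigma_finite radial_measure circle_measure ..
  have "(\<integral>\<^sup>+z. f z \<partial>disc_measure) = (\<integral>\<^sup>+x. f (of_real (fst x) * cis (snd x)) \<partial>(radial_measure \<Otimes>\<^sub>M circle_measure))"
    unfolding polar_coordinates[symmetric]
    by (subst nn_integral_distr[OF polar_map_measurable]) (auto simp: case_prod_beta)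
  also have "\<dots> = (\<integral>\<^sup>+r. (\<integral>\<^sup>+t. f (of_real r * cis t) \<partial>circle_measure) \<partial>radial_measure)"
    by (subst circle_measure.nn_integral_fst[symmetric]) (simp_all add: measurable_radial_circle)
  finally show ?thesis .
qed

lemma integral_polar:
  fixes f :: "complex \<Rightarrow> 'a :: {banach, second_countable_topology}"
  assumes "integrable disc_measure f"
  shows "(\<integral>z. f z \<partial>disc_measure) = (\<integral>r. (\<integral>t. f (of_real r * cis t) \<partial>circle_measure) \<partial>radial_measure)"
proof -
  interpret R: pair_sigma_finite radial_measure circle_measure ..
  have [measurable]: "f \<in> borel_measurable borel" using borel_measurable_integrable[OF assms] by simp
  have "integrable (distr (radial_measure \<Otimes>\<^sub>M circle_measure) borel (\<lambda>(r, t). of_real r * cis t)) f"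
    using assms by (simp add: polar_coordinates)
  then have int: "integrable (radial_measure \<Otimes>\<^sub>M circle_measure) (\<lambda>(r, t). f (of_real r * cis t))"
    by (subst (asm) integrable_distr_eq[OF polar_map_measurable]) (auto simp: case_prod_unfold)
  have "(\<integral>z. f z \<partial>disc_measure) = (\<integral>x. (case x of (r, t) \<Rightarrow> f (of_real r * cis t)) \<partial>(radial_measure \<Otimes>\<^sub>M circle_measure))"
    unfolding polar_coordinates[symmetric]
    by (subst integral_distr[OF polar_map_measurable]) (auto simp: case_prod_unfold)
  also have "\<dots> = (\<integral>r. (\<integral>t. f (of_real r * cis t) \<partial>circle_measure) \<partial>radial_measure)"
    by (rule R.integral_fst'[symmetric, OF int, simplified])
  finally show ?thesis .
qed

lemma AE_polar:
  assumes "AE z in disc_measure. P z"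
  shows "AE r in radial_measure. AE t in circle_measure. P (of_real r * cis t)"
proof -
  interpret R: pair_sigma_finite radial_measure circle_measure ..
  have "AE x in radial_measure \<Otimes>\<^sub>M circle_measure. P ((\<lambda>(r, t). of_real r * cis t) x)"
    by (rule AE_distrD[OF polar_map_measurable, unfolded polar_coordinates, OF assms])
  from R.AE_pair[OF this] show ?thesis by simp
qed

section \<open>From Lebesgue measurable to Borel functions on the disc\<close>

lemma space_dA [simp]: "space dA = ball 0 1"
  by (simp add: dA_def)

lemma id_measurable_dA: "(\<lambda>z. z) \<in> measurable dA borel"
  unfolding dA_def measurable_density_eq1
  by (intro measurable_restrict_space1 measurable_completion) simp

lemma distr_dA: "distr dA borel (\<lambda>z. z) = disc_measure"
proof (rule measure_eqI)
  fix A assume "A \<in> sets (distr dA borel (\<lambda>z. z))"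
  then have A: "A \<in> sets borel" by simp
  have "emeasure (distr dA borel (\<lambda>z. z)) A = emeasure dA (A \<inter> ball 0 1)"
    using A by (subst emeasure_distr[OF id_measurable_dA]) auto
  also have "\<dots> = ennreal (1 / pi) * emeasure (lebesgue_on (ball 0 1)) (A \<inter> ball 0 1)"
  proof -
    have "A \<inter> ball 0 1 \<in> sets (lebesgue_on (ball (0::complex) 1))"
      using A by (subst sets_restrict_space_iff) auto
    then show ?thesis unfolding dA_def
      by (subst emeasure_density) (auto intro!: nn_integral_cmult_indicator)
  qed
  also have "emeasure (lebesgue_on (ball 0 1)) (A \<inter> ball 0 1) = emeasure lborel (A \<inter> ball 0 1)"
    using A by (subst emeasure_restrict_space) auto
  also have "ennreal (1 / pi) * emeasure lborel (A \<inter> ball 0 1) = emeasure disc_measure A"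
    unfolding disc_measure_def using A
    by (subst emeasure_density)
       (auto simp: nn_integral_cmult_indicator[symmetric] indicator_def intro!: nn_integral_cong)
  finally show "emeasure (distr dA borel (\<lambda>z. z)) A = emeasure disc_measure A" .
qed simp

lemma AE_dA_iff: "(AE z in dA. P z) \<longleftrightarrow> (AE z in disc_measure. z \<in> ball 0 1 \<longrightarrow> P z)"
proof -
  have "(AE z in dA. P z) \<longleftrightarrow> (AE z in lebesgue_on (ball 0 1). P z)"
    unfolding dA_def by (subst AE_density) auto
  also have "\<dots> \<longleftrightarrow> (AE z in lebesgue. z \<in> ball 0 1 \<longrightarrow> P z)"
    by (subst AE_restrict_space_iff) auto
  also have "\<dots> \<longleftrightarrow> (AE z in lborel. z \<in> ball 0 1 \<longrightarrow> P z)"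
    by (rule AE_completion_iff)
  also have "\<dots> \<longleftrightarrow> (AE z in disc_measure. z \<in> ball 0 1 \<longrightarrow> P z)"
    unfolding disc_measure_def
    by (subst AE_density) (auto simp: indicator_def)
  finally show ?thesis .
qed

lemma nn_integral_dA: "f \<in> borel_measurable borel \<Longrightarrow> (\<integral>\<^sup>+z. f z \<partial>dA) = (\<integral>\<^sup>+z. f z \<partial>disc_measure)"
  unfolding distr_dA[symmetric] by (subst nn_integral_distr[OF id_measurable_dA]) auto

lemma integral_dA:
  fixes f :: "complex \<Rightarrow> 'a :: {banach, second_countable_topology}"
  assumes "f \<in> borel_measurable borel"
  shows "(\<integral>z. f z \<partial>dA) = (\<integral>z. f z \<partial>disc_measure)" "integrable dA f \<longleftrightarrow> integrable disc_measure f"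
  unfolding distr_dA[symmetric]
  using integral_distr[OF id_measurable_dA assms] integrable_distr_eq[OF id_measurable_dA assms] by auto

lemma borel_measurable_dA: "f \<in> borel_measurable borel \<Longrightarrow> f \<in> borel_measurable dA"
  using measurable_compose[OF id_measurable_dA] by auto

lemma AE_radial_measure_iff: "(AE r in radial_measure. P r) \<longleftrightarrow> (AE r in lborel. 0 < r \<and> r < 1 \<longrightarrow> P r)"
  unfolding radial_measure_def
  by (subst AE_density) (auto simp: indicator_def intro!: AE_cong)

text \<open>Measurability on the disc says nothing directly about values on a radius, a null set. A
  Borel version is therefore averaged over circles: on almost every circle it equals, almost
  everywhere, the constant value of the weight there.\<close>

lemma radial_borel_representative:
  fixes w :: "complex \<Rightarrow> real"
  assumes w: "radial_weight w"
  obtains W :: "real \<Rightarrow> real" where "W \<in> borel_measurable borel" "\<And>r. 0 \<le> W r"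
    "AE r in lborel. 0 < r \<and> r < 1 \<longrightarrow> w (of_real r) = W r" "AE z in dA. w z = W (norm z)"
proof -
  \<comment> \<open>Values of w outside the disc are arbitrary and are replaced by 0.\<close>
  define g where "g z = (if z \<in> ball 0 1 then w z else 0)" for z
  have "integrable dA w" using w by (simp only: radial_weight_def)
  then have "w \<in> borel_measurable (lebesgue_on (ball 0 1))"
    unfolding dA_def by (drule_tac borel_measurable_integrable) (simp only: measurable_density_eq1)
  then have "(\<lambda>z. indicator (ball 0 1) z *\<^sub>R w z) \<in> borel_measurable lebesgue"
    by (subst (asm) borel_measurable_restrict_space_iff) auto
  also have "(\<lambda>z. indicator (ball 0 1) z *\<^sub>R w z) = g" by (auto simp: g_def indicator_def)
  finally have "g \<in> borel_measurable lebesgue" .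
  then obtain g' where g': "g' \<in> borel_measurable borel" "AE z in lborel. g z = g' z"
    using completion_ex_borel_measurable_real[of g lborel] by auto
  note [measurable] = g'(1)
  have "AE z in disc_measure. g z = g' z"
    using g'(2) unfolding disc_measure_def by (subst AE_density) auto
  then have polar: "AE r in radial_measure. AE t in circle_measure. g (of_real r * cis t) = g' (of_real r * cis t)"
    by (rule AE_polar)
  define W where "W r = enn2real (\<integral>\<^sup>+t. ennreal (g' (of_real r * cis t)) \<partial>circle_measure)" for r
  have meas: "(\<lambda>r. \<integral>\<^sup>+t. ennreal (g' (of_real r * cis t)) \<partial>circle_measure) \<in> borel_measurable borel"
  proof (rule circle_measure.borel_measurable_nn_integral)
    show "(\<lambda>(r, t). ennreal (g' (of_real r * cis t))) \<in> borel_measurable (borel \<Otimes>\<^sub>M circle_measure)"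
      unfolding measurable_cong_sets[OF sets_pair_measure_cong[OF refl sets_circle_measure] refl]
      by measurable
  qed
  have W: "W \<in> borel_measurable borel" unfolding W_def using meas by measurable
  have wr: "w z = w (of_real (norm z))" "0 \<le> w z" if "norm z < 1" for z
  proof -
    have "z \<in> ball 0 1" using that by simp
    then show "w z = w (of_real (norm z))" "0 \<le> w z" using w unfolding radial_weight_def by blast+
  qed
  have AE_W: "AE r in radial_measure. 0 < r \<and> r < 1 \<longrightarrow> w (of_real r) = W r"
    using polar
  proof eventually_elim
    fix r assume r: "AE t in circle_measure. g (of_real r * cis t) = g' (of_real r * cis t)"
    show "0 < r \<and> r < 1 \<longrightarrow> w (of_real r) = W r"
    proof
      assume r01: "0 < r \<and> r < 1"
      have "(\<integral>\<^sup>+t. ennreal (g' (of_real r * cis t)) \<partial>circle_measure) = (\<integral>\<^sup>+t. ennreal (w (of_real r)) \<partial>circle_measure)"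
      proof (rule nn_integral_cong_AE)
        show "AE t in circle_measure. ennreal (g' (of_real r * cis t)) = ennreal (w (of_real r))"
          using r
        proof eventually_elim
          fix t assume "g (of_real r * cis t) = g' (of_real r * cis t)"
          moreover have "g (of_real r * cis t) = w (of_real r)"
            using wr(1)[of "of_real r * cis t"] r01 by (simp add: g_def norm_mult)
          ultimately show "ennreal (g' (of_real r * cis t)) = ennreal (w (of_real r))" by simp
        qed
      qed
      then show "w (of_real r) = W r" using wr(2)[of "of_real r"] r01 by (simp add: W_def)
    qed
  qed
  then have AE_lb: "AE r in lborel. 0 < r \<and> r < 1 \<longrightarrow> w (of_real r) = W r"
    unfolding AE_radial_measure_iff by eventually_elim auto
  have "AE z in disc_measure. 0 < norm z \<and> norm z < 1 \<longrightarrow> w (of_real (norm z)) = W (norm z)"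
    by (rule AE_distrD[where M' = borel and f = norm and M = disc_measure, unfolded distr_norm_disc_measure, OF _ AE_W]) simp
  moreover have "AE z in disc_measure. z \<noteq> 0"
    unfolding disc_measure_def by (subst AE_density) (use AE_lborel_singleton[of 0] in auto)
  ultimately have "AE z in disc_measure. z \<in> ball 0 1 \<longrightarrow> w z = W (norm z)"
  proof eventually_elim
    fix z :: complex assume *: "0 < norm z \<and> norm z < 1 \<longrightarrow> w (of_real (norm z)) = W (norm z)" "z \<noteq> 0"
    show "z \<in> ball 0 1 \<longrightarrow> w z = W (norm z)"
    proof
      assume "z \<in> ball 0 1"
      then have "norm z < 1" by simp
      with * wr(1)[of z] show "w z = W (norm z)" by simp
    qed
  qed
  then have "AE z in dA. w z = W (norm z)" by (simp only: AE_dA_iff)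
  moreover have "0 \<le> W r" for r by (simp add: W_def)
  ultimately show ?thesis using W AE_lb by (intro that)
qed

section \<open>The reproducing kernel of a radial weight\<close>

definition weight_measure :: "(real \<Rightarrow> ennreal) \<Rightarrow> real measure" where
  "weight_measure g = density lborel (\<lambda>s. indicator {0<..<1} s * (ennreal s * g s))"

lemma sets_weight_measure [simp, measurable_cong]: "sets (weight_measure g) = sets borel"
  by (simp add: weight_measure_def)

lemma space_weight_measure [simp]: "space (weight_measure g) = UNIV"
  by (simp add: weight_measure_def)

lemma borel_measurable_weight_measure [simp]: "borel_measurable (weight_measure g) = borel_measurable borel"
  by (rule measurable_cong_sets) simp_all

section \<open>Integrals, moments and tails against s g(s) ds\<close>

context
  fixes g :: "real \<Rightarrow> ennreal"
  assumes g [measurable]: "g \<in> borel_measurable borel"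
begin

lemma nn_integral_weight_measure:
  assumes [measurable]: "f \<in> borel_measurable borel"
  shows "(\<integral>\<^sup>+s. f s \<partial>weight_measure g) = (\<integral>\<^sup>+s. indicator {0<..<1} s * (ennreal s * g s) * f s \<partial>lborel)"
  unfolding weight_measure_def by (rule nn_integral_density) auto

lemma nn_integral_radial_measure:
  assumes [measurable]: "f \<in> borel_measurable borel"
  shows "(\<integral>\<^sup>+r. f r * g r \<partial>radial_measure) = 2 * (\<integral>\<^sup>+s. f s \<partial>weight_measure g)"
proof -
  have "(\<integral>\<^sup>+r. f r * g r \<partial>radial_measure) = (\<integral>\<^sup>+r. ennreal (indicator {0..<1} r * (2 * r)) * (f r * g r) \<partial>lborel)"
    unfolding radial_measure_def by (rule nn_integral_density) auto
  also have "\<dots> = (\<integral>\<^sup>+s. 2 * (indicator {0<..<1} s * (ennreal s * g s) * f s) \<partial>lborel)"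
    by (intro nn_integral_cong) (auto simp: indicator_def ennreal_mult mult_ac)
  also have "\<dots> = 2 * (\<integral>\<^sup>+s. f s \<partial>weight_measure g)"
    by (subst nn_integral_cmult) (simp_all add: nn_integral_weight_measure)
  finally show ?thesis .
qed

lemma AE_weight_measure: "AE s in weight_measure g. 0 < s \<and> s < 1"
  unfolding weight_measure_def by (subst AE_density) (auto simp: indicator_def)

lemma interval_measure_weight:
  assumes "emeasure (weight_measure g) UNIV < \<infinity>"
  shows "interval_measure (weight_measure g)"
  unfolding interval_measure_def using assms AE_weight_measure
  by (auto intro!: finite_measureI)

lemma moment_weight_measure:
  assumes "AE s in lborel. 0 < s \<and> s < 1 \<longrightarrow> f (of_real s) = g s"
  shows "moment f (y + 1) = (\<integral>\<^sup>+s. ennreal (s powr y) \<partial>weight_measure g)"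
proof -
  have "moment f (y + 1) = (\<integral>\<^sup>+s. ennreal (s powr (y + 1)) * f (of_real s) * indicator {0..<1} s \<partial>lborel)"
    unfolding moment_def by (rule nn_integral_completion)
  also have "\<dots> = (\<integral>\<^sup>+s. indicator {0<..<1} s * (ennreal s * g s) * ennreal (s powr y) \<partial>lborel)"
  proof (rule nn_integral_cong_AE)
    show "AE s in lborel. ennreal (s powr (y + 1)) * f (of_real s) * indicator {0..<1} s =
        indicator {0<..<1} s * (ennreal s * g s) * ennreal (s powr y)"
      using assms AE_lborel_singleton[of 0]
      by eventually_elim (auto simp: indicator_def powr_add ennreal_mult mult_ac)
  qed
  finally show ?thesis by (simp add: nn_integral_weight_measure)
qed

lemma tail_weight_measure:
  assumes "AE s in lborel. 0 < s \<and> s < 1 \<longrightarrow> f (of_real s) = g s" "0 \<le> r"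
  shows "tail f r = emeasure (weight_measure g) {r..}"
proof -
  have "tail f r = (\<integral>\<^sup>+s. f (of_real s) * ennreal s * indicator {r..<1} s \<partial>lborel)"
    unfolding tail_def by (rule nn_integral_completion)
  also have "\<dots> = (\<integral>\<^sup>+s. indicator {0<..<1} s * (ennreal s * g s) * indicator {r..} s \<partial>lborel)"
  proof (rule nn_integral_cong_AE)
    show "AE s in lborel. f (of_real s) * ennreal s * indicator {r..<1} s =
        indicator {0<..<1} s * (ennreal s * g s) * indicator {r..} s"
      using assms(1) AE_lborel_singleton[of 0]
      by eventually_elim (use assms(2) in \<open>auto simp: indicator_def mult_ac\<close>)
  qed
  finally show ?thesis by (simp add: nn_integral_weight_measure[symmetric])
qed

end

lemma nn_integral_disc_radial:
  "f \<in> borel_measurable borel \<Longrightarrow> (\<integral>\<^sup>+z. f (norm z) \<partial>disc_measure) = (\<integral>\<^sup>+r. f r \<partial>radial_measure)"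
  unfolding distr_norm_disc_measure[symmetric] by (subst nn_integral_distr) auto

lemma Lp_norm_finite_iff: "Lp_norm p w f < \<infinity> \<longleftrightarrow> (\<integral>\<^sup>+z. ennreal (norm (f z) powr p * w z) \<partial>dA) < \<infinity>"
  by (auto simp: Lp_norm_def ennpowr_def less_top)

lemma holomorphic_disc_power_series:
  assumes f: "f holomorphic_on ball 0 1"
  obtains a :: "nat \<Rightarrow> complex" where "\<And>z. norm z < 1 \<Longrightarrow> (\<lambda>n. a n * z ^ n) sums f z"
    "\<And>r. 0 \<le> r \<Longrightarrow> r < 1 \<Longrightarrow> summable (\<lambda>n. norm (a n * of_real r ^ n))"
proof -
  define a where "a n = (deriv ^^ n) f 0 / fact n" for n
  have sums: "(\<lambda>n. a n * z ^ n) sums f z" if "norm z < 1" for z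
    using holomorphic_power_series[OF f, of z] that by (simp add: a_def)
  have "summable (\<lambda>n. norm (a n * of_real r ^ n))" if r: "0 \<le> r" "r < 1" for r
  proof (rule powser_insidea)
    show "summable (\<lambda>n. a n * of_real ((1 + r) / 2) ^ n)"
      using r by (intro sums_summable[OF sums]) (simp only: norm_of_real; simp)
    show "norm (complex_of_real r) < norm (complex_of_real ((1 + r) / 2))"
      using r by (simp only: norm_of_real; simp)
  qed
  with sums that show ?thesis by blast
qed

text \<open>On a circle of radius r < 1 the power series is an absolutely convergent Fourier
  series.\<close>

lemma holomorphic_disc_Fourier:
  assumes a: "\<And>z. norm z < 1 \<Longrightarrow> (\<lambda>n. a n * z ^ n) sums f z"
    "\<And>r. 0 \<le> r \<Longrightarrow> r < 1 \<Longrightarrow> summable (\<lambda>n. norm (a n * of_real r ^ n))"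
    and r: "0 \<le> r" "r < 1"
  shows "(\<integral>t. f (of_real r * cis t) * cis (- real n * t) \<partial>circle_measure) = a n * of_real r ^ n"
proof -
  have "f (of_real r * cis t) = (\<Sum>n. (a n * of_real r ^ n) * cis (real n * t))" for t
  proof -
    have "(\<lambda>n. a n * (of_real r * cis t) ^ n) sums f (of_real r * cis t)"
      using r by (intro a) (simp add: norm_mult)
    then show ?thesis by (simp only: sums_iff power_mult_distrib Complex.DeMoivre mult.assoc)
  qed
  then show ?thesis using Fourier_coefficient[OF a(2)[OF r]] by simp
qed

text \<open>The weight and its Borel profile agree in two senses, one for integrals over (0, 1) and
  one for integrals over the disc.\<close>

locale radial_weight_rep =
  fixes w :: "complex \<Rightarrow> real" and W :: "real \<Rightarrow> real"
  assumes w: "radial_weight w" and W_meas [measurable]: "W \<in> borel_measurable borel"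
    and W_nonneg: "\<And>r. 0 \<le> W r"
    and AE_W: "AE r in lborel. 0 < r \<and> r < 1 \<longrightarrow> w (of_real r) = W r"
    and AE_w: "AE z in dA. w z = W (norm z)"
begin

abbreviation \<mu> :: "real measure" where
  "\<mu> \<equiv> weight_measure (\<lambda>s. ennreal (W s))"

lemma AE_W_ennreal: "AE s in lborel. 0 < s \<and> s < 1 \<longrightarrow> ennreal (w (of_real s)) = ennreal (W s)"
  using AE_W by eventually_elim auto

lemma integrable_dA_w: "integrable dA w"
  using w by (simp only: radial_weight_def)

lemma emeasure_\<mu>: "2 * emeasure \<mu> UNIV = (\<integral>\<^sup>+z. ennreal (W (norm z)) \<partial>disc_measure)"
proof -
  have "(\<integral>\<^sup>+z. ennreal (W (norm z)) \<partial>disc_measure) = (\<integral>\<^sup>+r. 1 * ennreal (W r) \<partial>radial_measure)"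
    by (subst nn_integral_disc_radial) auto
  also have "\<dots> = 2 * (\<integral>\<^sup>+s. 1 \<partial>\<mu>)" by (rule nn_integral_radial_measure) auto
  finally show ?thesis by simp
qed

lemma integrable_W: "integrable disc_measure (\<lambda>z. W (norm z))"
proof -
  have "integrable dA (\<lambda>z. W (norm z))"
  proof (rule integrable_cong_AE[THEN iffD1, OF _ _ _ integrable_dA_w])
    show "w \<in> borel_measurable dA" using integrable_dA_w by (rule borel_measurable_integrable)
    show "(\<lambda>z. W (norm z)) \<in> borel_measurable dA" by (rule borel_measurable_dA) measurable
  qed (rule AE_w)
  then show ?thesis by (subst (asm) integral_dA) auto
qed

lemma interval_\<mu>: "interval_measure \<mu>"
proof (rule interval_measure_weight)
  have "(\<integral>\<^sup>+z. ennreal (W (norm z)) \<partial>disc_measure) < \<infinity>"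
    using integrable_W W_nonneg by (subst nn_integral_eq_integral) auto
  then have "2 * emeasure \<mu> UNIV < \<infinity>" by (simp only: emeasure_\<mu>)
  then show "emeasure \<mu> UNIV < \<infinity>" by (auto simp: ennreal_mult_less_top)
qed measurable

lemma hat_eq:
  assumes "0 \<le> r" "r < 1"
  shows "hat w (of_real r) = (\<integral>\<^sup>+s. ennreal (W s) * indicator {r..<1} s \<partial>lborel)"
proof -
  have "hat w (of_real r) = (\<integral>\<^sup>+s. ennreal (w (of_real s)) * indicator {r..<1} s \<partial>lborel)"
    using assms unfolding hat_def by (subst nn_integral_completion) simp
  also have "\<dots> = (\<integral>\<^sup>+s. ennreal (W s) * indicator {r..<1} s \<partial>lborel)"
  proof (rule nn_integral_cong_AE)
    show "AE s in lborel. ennreal (w (of_real s)) * indicator {r..<1} s = ennreal (W s) * indicator {r..<1} s"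
      using AE_W AE_lborel_singleton[of 0]
      by eventually_elim (use assms in \<open>auto simp: indicator_def\<close>)
  qed
  finally show ?thesis .
qed

lemma hat_pos: "0 \<le> r \<Longrightarrow> r < 1 \<Longrightarrow> 0 < hat w (of_real r)"
proof -
  assume "0 \<le> r" "r < 1"
  then have "complex_of_real r \<in> ball 0 1" by simp
  then show ?thesis using w unfolding radial_weight_def by blast
qed

lemma emeasure_\<mu>_eq: "emeasure \<mu> {r..} = (\<integral>\<^sup>+s. ennreal (W s * s) * indicator ({0<..<1} \<inter> {r..}) s \<partial>lborel)"
proof -
  have "emeasure \<mu> {r..} = (\<integral>\<^sup>+s. indicator {r..} s \<partial>\<mu>)" by simp
  also have "\<dots> = (\<integral>\<^sup>+s. ennreal (W s * s) * indicator ({0<..<1} \<inter> {r..}) s \<partial>lborel)"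
    by (subst nn_integral_weight_measure) (auto intro!: nn_integral_cong simp: indicator_def ennreal_mult W_nonneg mult_ac)
  finally show ?thesis .
qed

lemma emeasure_\<mu>_upper: "emeasure \<mu> {r..} = ennreal (upper_mass \<mu> r)"
proof -
  interpret finite_measure \<mu> using interval_\<mu> by (simp add: interval_measure_def)
  show ?thesis by (simp add: upper_mass_def emeasure_eq_measure)
qed

text \<open>\<open>hat\<close> integrates W while the measure has density s W(s). Over a tail the
  two vanish together, so the standing positivity assumption carries over.\<close>

lemma thick_\<mu>: "thick \<mu>"
  unfolding thick_def
proof (intro allI impI)
  fix r :: real assume "r < 1"
  define r' where "r' = max r 0"
  have r': "0 \<le> r'" "r' < 1" "r \<le> r'" using \<open>r < 1\<close> by (auto simp: r'_def)
  have "emeasure \<mu> {r'..} \<noteq> 0"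
  proof
    assume "emeasure \<mu> {r'..} = 0"
    then have "AE s in lborel. ennreal (W s * s) * indicator ({0<..<1} \<inter> {r'..}) s = 0"
      unfolding emeasure_\<mu>_eq by (subst (asm) nn_integral_0_iff_AE) auto
    then have "AE s in lborel. ennreal (W s) * indicator {r'..<1} s = 0"
      using AE_lborel_singleton[of 0]
      by eventually_elim (use r' W_nonneg in \<open>auto simp: indicator_def ennreal_eq_0_iff mult_le_0_iff split: if_splits\<close>)
    then have "hat w (of_real r') = 0"
      unfolding hat_eq[OF r'(1,2)] by (subst nn_integral_0_iff_AE) auto
    with hat_pos[OF r'(1,2)] show False by simp
  qed
  then have "0 < upper_mass \<mu> r'" unfolding emeasure_\<mu>_upper by (simp add: ennreal_eq_0_iff)
  also have "\<dots> \<le> upper_mass \<mu> r" by (rule upper_mass_antimono[OF interval_\<mu> r'(3)])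
  finally show "0 < upper_mass \<mu> r" .
qed

lemma integral_radial_power:
  "(\<integral>r. r ^ (2 * n) * W r \<partial>radial_measure) = 2 * power_moment \<mu> (2 * real n)"
proof (rule integral_eq_nn_integral[THEN trans])
  have AE: "AE r in radial_measure. 0 < r \<and> r < 1"
    by (subst AE_radial_measure_iff) auto
  then show "AE r in radial_measure. 0 \<le> r ^ (2 * n) * W r"
    by eventually_elim (auto simp: W_nonneg)
  have pn: "ennreal (power_moment \<mu> (2 * real n)) = (\<integral>\<^sup>+s. ennreal (s powr (2 * real n)) \<partial>\<mu>)"
    unfolding power_moment_def using interval_\<mu> by (subst nn_integral_eq_integral) auto
  have "(\<integral>\<^sup>+r. ennreal (r ^ (2 * n) * W r) \<partial>radial_measure) = (\<integral>\<^sup>+r. ennreal (r powr (2 * real n)) * ennreal (W r) \<partial>radial_measure)"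
  proof (rule nn_integral_cong_AE)
    show "AE r in radial_measure. ennreal (r ^ (2 * n) * W r) = ennreal (r powr (2 * real n)) * ennreal (W r)"
      using AE
    proof eventually_elim
      fix r :: real assume "0 < r \<and> r < 1"
      then have "r powr (2 * real n) = r ^ (2 * n)" using powr_realpow[of r "2 * n"] by simp
      then show "ennreal (r ^ (2 * n) * W r) = ennreal (r powr (2 * real n)) * ennreal (W r)"
        using \<open>0 < r \<and> r < 1\<close> W_nonneg by (simp add: ennreal_mult)
    qed
  qed
  also have "\<dots> = 2 * ennreal (power_moment \<mu> (2 * real n))"
    unfolding pn by (rule nn_integral_radial_measure) auto
  finally show "enn2real (\<integral>\<^sup>+r. ennreal (r ^ (2 * n) * W r) \<partial>radial_measure) = 2 * power_moment \<mu> (2 * real n)"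
    using power_moment_nonneg[OF interval_\<mu>] by (simp add: enn2real_mult)
qed simp

text \<open>The kernel is expanded and integrated term by term. The angular integral picks out the
  Taylor coefficient times r^n, the radial one gives 2 \<omega>_(2n+1), and this cancels the kernel
  coefficient.\<close>

lemma reproducing_formula:
  assumes z: "norm z < 1" and f: "f \<in> Bergman_space 2 w"
  shows "f z = (\<integral>\<zeta>. f \<zeta> * cnj (radial_kernel \<mu> (cnj z * \<zeta>)) * of_real (w \<zeta>) \<partial>dA)"
proof -
  have hol: "f holomorphic_on ball 0 1" and fL: "f \<in> Lp 2 w" using f by (auto simp: Bergman_space_def)
  obtain a where a: "\<And>z. norm z < 1 \<Longrightarrow> (\<lambda>n. a n * z ^ n) sums f z"
    "\<And>r. 0 \<le> r \<Longrightarrow> r < 1 \<Longrightarrow> summable (\<lambda>n. norm (a n * of_real r ^ n))"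
    using holomorphic_disc_power_series[OF hol] by blast
  \<comment> \<open>Extension by 0 makes f Borel on the whole plane.\<close>
  define g where "g \<zeta> = (indicator (ball 0 1) \<zeta> :: real) *\<^sub>R f \<zeta>" for \<zeta>
  have g_meas [measurable]: "g \<in> borel_measurable borel"
    unfolding g_def using hol
    by (intro borel_measurable_continuous_on_indicator holomorphic_on_imp_continuous_on) auto
  have g_eq: "g \<zeta> = f \<zeta>" if "norm \<zeta> < 1" for \<zeta> using that by (simp add: g_def)
  have g_0: "g \<zeta> = 0" if "\<not> norm \<zeta> < 1" for \<zeta> using that by (simp add: g_def)
  have f_meas: "f \<in> borel_measurable dA" using fL by (simp add: Lp_def)
  have w_meas: "w \<in> borel_measurable dA" using integrable_dA_w by (rule borel_measurable_integrable)
  have [measurable]: "radial_kernel \<mu> \<in> borel_measurable borel"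
    unfolding radial_kernel_def[abs_def] by measurable
  let ?e = "kernel_coeff \<mu>"
  have AE_disc: "AE \<zeta> in dA. norm \<zeta> < 1" by (rule AE_I2) simp
  have "(\<integral>\<^sup>+\<zeta>. ennreal (norm (g \<zeta>) powr 2 * W (norm \<zeta>)) \<partial>disc_measure) < \<infinity>"
  proof -
    have "(\<integral>\<^sup>+\<zeta>. ennreal (norm (g \<zeta>) powr 2 * W (norm \<zeta>)) \<partial>disc_measure) = (\<integral>\<^sup>+\<zeta>. ennreal (norm (g \<zeta>) powr 2 * W (norm \<zeta>)) \<partial>dA)"
      by (rule nn_integral_dA[symmetric]) measurable
    also have "\<dots> = (\<integral>\<^sup>+\<zeta>. ennreal (norm (f \<zeta>) powr 2 * w \<zeta>) \<partial>dA)"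
    proof (rule nn_integral_cong_AE)
      show "AE \<zeta> in dA. ennreal (norm (g \<zeta>) powr 2 * W (norm \<zeta>)) = ennreal (norm (f \<zeta>) powr 2 * w \<zeta>)"
        using AE_w AE_disc by eventually_elim (simp add: g_eq)
    qed
    also have "\<dots> < \<infinity>" using fL Lp_norm_finite_iff by (auto simp: Lp_def)
    finally show ?thesis .
  qed
  then have int2: "integrable disc_measure (\<lambda>\<zeta>. norm (g \<zeta>) powr 2 * W (norm \<zeta>))"
    by (intro integrableI_nonneg) (auto simp: W_nonneg)
  have intg: "integrable disc_measure (\<lambda>\<zeta>. g \<zeta> * of_real (W (norm \<zeta>)))"
  proof (rule Bochner_Integration.integrable_bound)
    show "integrable disc_measure (\<lambda>\<zeta>. W (norm \<zeta>) + norm (g \<zeta>) powr 2 * W (norm \<zeta>))"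
      using int2 integrable_W by (rule Bochner_Integration.integrable_add[rotated])
    show "AE \<zeta> in disc_measure. norm (g \<zeta> * of_real (W (norm \<zeta>))) \<le> norm (W (norm \<zeta>) + norm (g \<zeta>) powr 2 * W (norm \<zeta>))"
    proof (rule AE_I2)
      fix \<zeta>
      \<comment> \<open>Hence square integrability and finite total mass make g times the weight
        integrable.\<close>
      have "x \<le> 1 + x\<^sup>2" for x :: real
        using zero_le_power2[of "x - 1/2"] by (simp add: power2_eq_square algebra_simps)
      then have "norm (g \<zeta>) * W (norm \<zeta>) \<le> (1 + norm (g \<zeta>) powr 2) * W (norm \<zeta>)"
        using W_nonneg by (intro mult_right_mono) (auto simp: powr_numeral)
      then show "norm (g \<zeta> * of_real (W (norm \<zeta>))) \<le> norm (W (norm \<zeta>) + norm (g \<zeta>) powr 2 * W (norm \<zeta>))"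
        using W_nonneg[of "norm \<zeta>"] by (simp add: norm_mult algebra_simps)
    qed
  qed simp
  define G where "G n \<zeta> = g \<zeta> * of_real (W (norm \<zeta>)) * (of_real (?e n) * (z * cnj \<zeta>) ^ n)" for n \<zeta>
  have G_meas [measurable]: "G n \<in> borel_measurable borel" for n unfolding G_def by measurable
  have normG: "norm (G n \<zeta>) \<le> (?e n * norm z ^ n) * norm (g \<zeta> * of_real (W (norm \<zeta>)))" for n \<zeta>
  proof (cases "norm \<zeta> < 1")
    case True
    have "norm (of_real (?e n) * (z * cnj \<zeta>) ^ n) = ?e n * (norm z ^ n * norm \<zeta> ^ n)"
      using kernel_coeff_pos[OF interval_\<mu> thick_\<mu>, of n] by (simp add: norm_mult norm_power power_mult_distrib)
    also have "\<dots> \<le> ?e n * (norm z ^ n * 1)"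
      using True kernel_coeff_pos[OF interval_\<mu> thick_\<mu>, of n] by (intro mult_left_mono power_le_one) auto
    finally show ?thesis unfolding G_def norm_mult[of "g \<zeta> * of_real (W (norm \<zeta>))"]
      by (subst mult.commute) (simp add: mult_right_mono)
  qed (simp add: G_def g_0)
  have intG: "integrable disc_measure (G n)" for n
  proof (rule Bochner_Integration.integrable_bound)
    show "integrable disc_measure (\<lambda>\<zeta>. (?e n * norm z ^ n) * norm (g \<zeta> * of_real (W (norm \<zeta>))))"
      using intg by (intro integrable_mult_right integrable_norm)
    show "AE \<zeta> in disc_measure. norm (G n \<zeta>) \<le> norm ((?e n * norm z ^ n) * norm (g \<zeta> * of_real (W (norm \<zeta>))))"
      unfolding real_norm_def by (intro AE_I2 order_trans[OF normG abs_ge_self])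
  qed simp
  have se: "summable (\<lambda>n. ?e n * norm z ^ n)"
    using z by (intro summable_kernel_coeff interval_\<mu> thick_\<mu>) auto
  have sumsG: "(\<lambda>n. \<integral>\<zeta>. G n \<zeta> \<partial>disc_measure) sums (\<integral>\<zeta>. (\<Sum>n. G n \<zeta>) \<partial>disc_measure)"
  proof (rule sums_integral[OF intG])
    show "AE \<zeta> in disc_measure. summable (\<lambda>n. norm (G n \<zeta>))"
    proof (rule AE_I2)
      fix \<zeta>
      show "summable (\<lambda>n. norm (G n \<zeta>))"
        by (rule summable_comparison_test'[OF summable_mult2[OF se, of "norm (g \<zeta> * of_real (W (norm \<zeta>)))"]])
           (simp only: real_norm_def abs_norm_cancel normG)
    qed
    have "(\<integral>\<zeta>. norm (G n \<zeta>) \<partial>disc_measure) \<le> (\<integral>\<zeta>. (?e n * norm z ^ n) * norm (g \<zeta> * of_real (W (norm \<zeta>))) \<partial>disc_measure)" for n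
      by (rule integral_mono[OF integrable_norm[OF intG] integrable_mult_right[OF integrable_norm[OF intg]] normG])
    then have le: "(\<integral>\<zeta>. norm (G n \<zeta>) \<partial>disc_measure) \<le> (?e n * norm z ^ n) * (\<integral>\<zeta>. norm (g \<zeta> * of_real (W (norm \<zeta>))) \<partial>disc_measure)" for n
      by (simp only: integral_mult_right_zero)
    show "summable (\<lambda>n. \<integral>\<zeta>. norm (G n \<zeta>) \<partial>disc_measure)"
      by (rule summable_comparison_test'[OF summable_mult2[OF se, of "\<integral>\<zeta>. norm (g \<zeta> * of_real (W (norm \<zeta>))) \<partial>disc_measure"]])
         (use le in \<open>simp only: real_norm_def abs_of_nonneg[OF Bochner_Integration.integral_nonneg] norm_ge_zero\<close>)
  qed
  have "(\<Sum>n. G n \<zeta>) = g \<zeta> * cnj (radial_kernel \<mu> (cnj z * \<zeta>)) * of_real (W (norm \<zeta>))" for \<zeta>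
  proof (cases "norm \<zeta> < 1")
    case True
    have lt: "norm (z * cnj \<zeta>) < 1"
      using mult_strict_mono'[of "norm z" 1 "norm \<zeta>" 1] z True by (simp add: norm_mult)
    then have lt2: "norm (cnj z * \<zeta>) < 1" by (simp add: norm_mult)
    have "(\<lambda>n. of_real (?e n) * (z * cnj \<zeta>) ^ n) sums radial_kernel \<mu> (z * cnj \<zeta>)"
      by (rule radial_kernel_sums(2)[OF interval_\<mu> thick_\<mu> lt])
    then have "(\<lambda>n. G n \<zeta>) sums (g \<zeta> * of_real (W (norm \<zeta>)) * radial_kernel \<mu> (z * cnj \<zeta>))"
      unfolding G_def by (rule sums_mult)
    then show ?thesis
      using cnj_radial_kernel[OF interval_\<mu> thick_\<mu> lt2] by (simp add: sums_iff mult_ac)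
  qed (simp add: G_def g_0)
  then have "(\<lambda>n. \<integral>\<zeta>. G n \<zeta> \<partial>disc_measure) sums (\<integral>\<zeta>. g \<zeta> * cnj (radial_kernel \<mu> (cnj z * \<zeta>)) * of_real (W (norm \<zeta>)) \<partial>disc_measure)"
    using sumsG by simp
  moreover have "(\<integral>\<zeta>. G n \<zeta> \<partial>disc_measure) = a n * z ^ n" for n
  proof -
    have "(\<integral>\<zeta>. G n \<zeta> \<partial>disc_measure) = (\<integral>r. (\<integral>t. G n (of_real r * cis t) \<partial>circle_measure) \<partial>radial_measure)"
      by (rule integral_polar[OF intG])
    also have "\<dots> = (\<integral>r. of_real (?e n) * z ^ n * a n * of_real (r ^ (2 * n) * W r) \<partial>radial_measure)"
    proof (rule integral_cong_AE)
      show "AE r in radial_measure. (\<integral>t. G n (of_real r * cis t) \<partial>circle_measure) = of_real (?e n) * z ^ n * a n * of_real (r ^ (2 * n) * W r)"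
      proof -
        have "AE r in radial_measure. 0 < r \<and> r < 1" by (subst AE_radial_measure_iff) auto
        then show ?thesis
        proof eventually_elim
          fix r :: real assume r: "0 < r \<and> r < 1"
          have "G n (of_real r * cis t) = (of_real (?e n * W r * r ^ n) * z ^ n) * (f (of_real r * cis t) * cis (- real n * t))" for t
            using r by (simp add: G_def g_eq norm_mult power_mult_distrib cis_cnj Complex.DeMoivre mult_ac)
          then have "(\<integral>t. G n (of_real r * cis t) \<partial>circle_measure) =
             (of_real (?e n * W r * r ^ n) * z ^ n) * (\<integral>t. f (of_real r * cis t) * cis (- real n * t) \<partial>circle_measure)"
            by simp
          also have "(\<integral>t. f (of_real r * cis t) * cis (- real n * t) \<partial>circle_measure) = a n * of_real r ^ n"
            using r by (intro holomorphic_disc_Fourier a) auto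
          also have "(of_real (?e n * W r * r ^ n) * z ^ n) * (a n * of_real r ^ n) = of_real (?e n) * z ^ n * a n * of_real (r ^ n * r ^ n * W r)"
            by (simp add: mult_ac)
          also have "r ^ n * r ^ n = r ^ (2 * n)" by (simp add: mult_2 power_add)
          finally show "(\<integral>t. G n (of_real r * cis t) \<partial>circle_measure) = of_real (?e n) * z ^ n * a n * of_real (r ^ (2 * n) * W r)" .
        qed
      qed
      have "(\<lambda>(r, t). G n (of_real r * cis t)) \<in> borel_measurable (borel \<Otimes>\<^sub>M circle_measure)"
        unfolding measurable_cong_sets[OF sets_pair_measure_cong[OF refl sets_circle_measure] refl]
        by measurable
      then show "(\<lambda>r. \<integral>t. G n (of_real r * cis t) \<partial>circle_measure) \<in> borel_measurable radial_measure"
        by (simp add: circle_measure.borel_measurable_lebesgue_integral)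
    qed simp
    also have "\<dots> = of_real (?e n) * z ^ n * a n * of_real (\<integral>r. r ^ (2 * n) * W r \<partial>radial_measure)"
      by (simp only: integral_mult_right_zero integral_complex_of_real)
    also have "\<dots> = a n * z ^ n * of_real (?e n * (2 * power_moment \<mu> (2 * real n)))"
      by (simp add: integral_radial_power)
    also have "?e n * (2 * power_moment \<mu> (2 * real n)) = 1"
      using power_moment_pos[OF interval_\<mu> thick_\<mu>, of "2 * real n"] by (simp add: kernel_coeff_def)
    finally show ?thesis by simp
  qed
  ultimately have "f z = (\<integral>\<zeta>. g \<zeta> * cnj (radial_kernel \<mu> (cnj z * \<zeta>)) * of_real (W (norm \<zeta>)) \<partial>disc_measure)"
    using a(1)[OF z] by (simp add: sums_unique2)
  also have "\<dots> = (\<integral>\<zeta>. g \<zeta> * cnj (radial_kernel \<mu> (cnj z * \<zeta>)) * of_real (W (norm \<zeta>)) \<partial>dA)"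
    by (rule integral_dA(1)[symmetric]) measurable
  also have "\<dots> = (\<integral>\<zeta>. f \<zeta> * cnj (radial_kernel \<mu> (cnj z * \<zeta>)) * of_real (w \<zeta>) \<partial>dA)"
  proof (rule integral_cong_AE)
    show "AE \<zeta> in dA. g \<zeta> * cnj (radial_kernel \<mu> (cnj z * \<zeta>)) * of_real (W (norm \<zeta>)) =
        f \<zeta> * cnj (radial_kernel \<mu> (cnj z * \<zeta>)) * of_real (w \<zeta>)"
      using AE_w AE_disc by eventually_elim (simp add: g_eq)
    show "(\<lambda>\<zeta>. g \<zeta> * cnj (radial_kernel \<mu> (cnj z * \<zeta>)) * of_real (W (norm \<zeta>))) \<in> borel_measurable dA"
      by (rule borel_measurable_dA) measurable
    have "(\<lambda>\<zeta>. cnj (radial_kernel \<mu> (cnj z * \<zeta>))) \<in> borel_measurable dA"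
      by (rule borel_measurable_dA) measurable
    then show "(\<lambda>\<zeta>. f \<zeta> * cnj (radial_kernel \<mu> (cnj z * \<zeta>)) * of_real (w \<zeta>)) \<in> borel_measurable dA"
      using f_meas w_meas by measurable
  qed
  finally show ?thesis .
qed

text \<open>For fixed z the argument stays in the disc of radius |z| < 1, where the kernel is
  bounded.\<close>

lemma radial_kernel_Bergman_space:
  assumes z: "norm z < 1"
  shows "(\<lambda>\<zeta>. radial_kernel \<mu> (cnj z * \<zeta>)) \<in> Bergman_space 2 w"
proof -
  have [measurable]: "radial_kernel \<mu> \<in> borel_measurable borel"
    unfolding radial_kernel_def[abs_def] by measurable
  have lt: "norm (cnj z * \<zeta>) \<le> norm z" if "norm \<zeta> < 1" for \<zeta>
    using that by (simp add: norm_mult mult_left_le)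
  have hol: "(\<lambda>\<zeta>. radial_kernel \<mu> (cnj z * \<zeta>)) holomorphic_on ball 0 1"
  proof -
    have "(radial_kernel \<mu> \<circ> (\<lambda>\<zeta>. cnj z * \<zeta>)) holomorphic_on ball 0 1"
    proof (rule holomorphic_on_compose_gen[OF _ holomorphic_radial_kernel[OF interval_\<mu> thick_\<mu>]])
      show "(\<lambda>\<zeta>. cnj z * \<zeta>) ` ball 0 1 \<subseteq> ball 0 1"
        using lt z by (force intro: le_less_trans)
    qed (intro holomorphic_intros)
    then show ?thesis by (simp add: comp_def)
  qed
  define S where "S = (\<Sum>n. kernel_coeff \<mu> n * norm z ^ n)"
  have bound: "norm (radial_kernel \<mu> (cnj z * \<zeta>)) \<le> S" if "norm \<zeta> < 1" for \<zeta>
    unfolding S_def using lt[OF that] z by (intro norm_radial_kernel_le interval_\<mu> thick_\<mu>)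
  have "(\<integral>\<^sup>+\<zeta>. ennreal (norm (radial_kernel \<mu> (cnj z * \<zeta>)) powr 2 * w \<zeta>) \<partial>dA) \<le> (\<integral>\<^sup>+\<zeta>. ennreal (S powr 2 * w \<zeta>) \<partial>dA)"
  proof (rule nn_integral_mono)
    fix \<zeta> assume "\<zeta> \<in> space dA"
    then have \<zeta>: "\<zeta> \<in> ball 0 1" by simp
    then have "0 \<le> w \<zeta>" using w unfolding radial_weight_def by blast
    then show "ennreal (norm (radial_kernel \<mu> (cnj z * \<zeta>)) powr 2 * w \<zeta>) \<le> ennreal (S powr 2 * w \<zeta>)"
      using bound[of \<zeta>] \<zeta> by (intro ennreal_leI mult_right_mono powr_mono2) auto
  qed
  also have "\<dots> \<le> (\<integral>\<^sup>+\<zeta>. ennreal (norm (S powr 2 * w \<zeta>)) \<partial>dA)"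
    by (intro nn_integral_mono ennreal_leI) simp
  also have "\<dots> < \<infinity>"
    using integrable_mult_right[OF integrable_dA_w, of "S powr 2"] by (simp only: integrable_iff_bounded)
  finally have "Lp_norm 2 w (\<lambda>\<zeta>. radial_kernel \<mu> (cnj z * \<zeta>)) < \<infinity>" by (simp only: Lp_norm_finite_iff)
  moreover have "(\<lambda>\<zeta>. radial_kernel \<mu> (cnj z * \<zeta>)) \<in> borel_measurable dA"
    by (rule borel_measurable_dA) measurable
  ultimately show ?thesis using hol by (simp only: Bergman_space_def Lp_def Int_iff mem_Collect_eq simp_thms)
qed

text \<open>Only the defining property of the kernel chosen by SOME is known. The reproducing
  formula of the explicit kernel applied to the chosen one, and the property of the chosen one
  applied to the explicit kernel, evaluate the same integral up to conjugation.\<close>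

theorem Bergman_kernel_eq:
  assumes z: "norm z < 1" and \<zeta>: "norm \<zeta> < 1"
  shows "Bergman_kernel w z \<zeta> = radial_kernel \<mu> (cnj z * \<zeta>)"
proof -
  let ?K = "\<lambda>z \<zeta>. radial_kernel \<mu> (cnj z * \<zeta>)"
  have "is_reproducing_kernel w z (?K z)"
    using reproducing_formula[OF z] radial_kernel_Bergman_space[OF z] by (simp add: is_reproducing_kernel_def)
  then have B: "is_reproducing_kernel w z (Bergman_kernel w z)"
    unfolding Bergman_kernel_def by (rule someI[where P = "is_reproducing_kernel w z"])
  let ?B = "Bergman_kernel w z"
  have lt: "norm (cnj \<zeta> * z) < 1"
    using mult_strict_mono'[of "norm \<zeta>" 1 "norm z" 1] z \<zeta> by (simp add: norm_mult)
  have "?B \<zeta> = (\<integral>\<xi>. ?B \<xi> * cnj (?K \<zeta> \<xi>) * of_real (w \<xi>) \<partial>dA)"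
    using B by (intro reproducing_formula \<zeta>) (simp add: is_reproducing_kernel_def)
  also have "\<dots> = (\<integral>\<xi>. cnj (?K \<zeta> \<xi> * cnj (?B \<xi>) * of_real (w \<xi>)) \<partial>dA)"
    by (intro Bochner_Integration.integral_cong) (auto simp: mult_ac)
  also have "\<dots> = cnj (\<integral>\<xi>. ?K \<zeta> \<xi> * cnj (?B \<xi>) * of_real (w \<xi>) \<partial>dA)"
    by (rule Bochner_Integration.integral_cnj)
  also have "(\<integral>\<xi>. ?K \<zeta> \<xi> * cnj (?B \<xi>) * of_real (w \<xi>) \<partial>dA) = ?K \<zeta> z"
    using B radial_kernel_Bergman_space[OF \<zeta>] by (simp add: is_reproducing_kernel_def)
  also have "cnj (?K \<zeta> z) = radial_kernel \<mu> (cnj z * \<zeta>)"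
    using cnj_radial_kernel[OF interval_\<mu> thick_\<mu> lt] by (simp add: mult.commute)
  finally show ?thesis .
qed

end

section \<open>Norms and weight classes\<close>

text \<open>Young's inequality after normalising by X + e and Y + e; the e > 0 avoids division by
  zero and is sent to 0 at the end.\<close>

lemma nn_integral_Hoelder:
  fixes u v :: "'a \<Rightarrow> real"
  assumes p: "1 < p" "1 / p + 1 / p' = 1"
    and [measurable]: "u \<in> borel_measurable M" "v \<in> borel_measurable M"
    and nn: "\<And>x. 0 \<le> u x" "\<And>x. 0 \<le> v x" "0 \<le> X" "0 \<le> Y"
    and u: "(\<integral>\<^sup>+x. ennreal (u x) \<partial>M) \<le> ennreal X" and v: "(\<integral>\<^sup>+x. ennreal (v x) \<partial>M) \<le> ennreal Y"
  shows "(\<integral>\<^sup>+x. ennreal (u x powr (1 / p) * v x powr (1 / p')) \<partial>M) \<le> ennreal (X powr (1 / p) * Y powr (1 / p'))"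
proof -
  have p': "1 < p'"
  proof -
    have "0 < 1 / p" "1 / p < 1" using p by simp_all
    then have "0 < 1 / p'" "1 / p' < 1" using p by linarith+
    then show ?thesis by (simp add: divide_less_eq_1)
  qed
  have bound: "(\<integral>\<^sup>+x. ennreal (u x powr (1 / p) * v x powr (1 / p')) \<partial>M) \<le> ennreal ((X + e) powr (1 / p) * (Y + e) powr (1 / p'))"
    if e: "0 < e" for e
  proof -
    define A B where "A = X + e" and "B = Y + e"
    have AB: "0 < A" "0 < B" "X \<le> A" "Y \<le> B" using nn e by (auto simp: A_def B_def)
    define c where "c = A powr (1 / p) * B powr (1 / p')"
    have c: "0 < c" using AB by (simp add: c_def)
    have "(\<integral>\<^sup>+x. ennreal (u x powr (1 / p) * v x powr (1 / p')) \<partial>M) \<le>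
      (\<integral>\<^sup>+x. ennreal (c / (p * A)) * ennreal (u x) + ennreal (c / (p' * B)) * ennreal (v x) \<partial>M)"
    proof (rule nn_integral_mono)
      fix x
      have "(u x / A) powr (1 / p) * (v x / B) powr (1 / p') \<le>
        ((u x / A) powr (1 / p)) powr p / p + ((v x / B) powr (1 / p')) powr p' / p'"
        using p p' nn(1,2)[of x] AB by (intro Youngs_inequality) auto
      also have "\<dots> = u x / A / p + v x / B / p'" using p p' nn(1,2)[of x] AB by (simp add: powr_powr)
      finally have "c * ((u x / A) powr (1 / p) * (v x / B) powr (1 / p')) \<le> c * (u x / A / p + v x / B / p')"
        using c by (intro mult_left_mono) auto
      also have "c * ((u x / A) powr (1 / p) * (v x / B) powr (1 / p')) = u x powr (1 / p) * v x powr (1 / p')"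
        using AB nn(1,2)[of x] by (simp add: c_def powr_divide)
      also have "c * (u x / A / p + v x / B / p') = c / (p * A) * u x + c / (p' * B) * v x"
        by (simp add: algebra_simps)
      finally have "ennreal (u x powr (1 / p) * v x powr (1 / p')) \<le> ennreal (c / (p * A) * u x + c / (p' * B) * v x)"
        by (rule ennreal_leI)
      also have "\<dots> = ennreal (c / (p * A)) * ennreal (u x) + ennreal (c / (p' * B)) * ennreal (v x)"
        using c p p' AB nn(1,2)[of x] by (intro ennreal_lincomb) auto
      finally show "ennreal (u x powr (1 / p) * v x powr (1 / p')) \<le> ennreal (c / (p * A)) * ennreal (u x) + ennreal (c / (p' * B)) * ennreal (v x)" .
    qed
    also have "\<dots> = ennreal (c / (p * A)) * (\<integral>\<^sup>+x. ennreal (u x) \<partial>M) + ennreal (c / (p' * B)) * (\<integral>\<^sup>+x. ennreal (v x) \<partial>M)"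
      by (simp add: nn_integral_add nn_integral_cmult)
    also have "\<dots> \<le> ennreal (c / (p * A)) * ennreal X + ennreal (c / (p' * B)) * ennreal Y"
      by (intro add_mono mult_left_mono u v) auto
    also have "\<dots> = ennreal (c / (p * A) * X + c / (p' * B) * Y)"
      using c p p' AB nn by (intro ennreal_lincomb[symmetric]) auto
    also have "\<dots> \<le> ennreal c"
    proof (rule ennreal_leI)
      have "c / (p * A) * X = c * (1 / p) * (X / A)" by simp
      also have "\<dots> \<le> c * (1 / p) * 1" using c p AB by (intro mult_left_mono) auto
      finally have 1: "c / (p * A) * X \<le> c * (1 / p)" by simp
      have "c / (p' * B) * Y = c * (1 / p') * (Y / B)" by simp
      also have "\<dots> \<le> c * (1 / p') * 1" using c p' AB by (intro mult_left_mono) auto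
      finally have 2: "c / (p' * B) * Y \<le> c * (1 / p')" by simp
      have "c * (1 / p) + c * (1 / p') = c" using p by (metis distrib_left mult.right_neutral)
      with 1 2 show "c / (p * A) * X + c / (p' * B) * Y \<le> c" by linarith
    qed
    finally show ?thesis by (simp add: c_def A_def B_def)
  qed
  have lim0: "(\<lambda>n. 1 / real (Suc n)) \<longlonglongrightarrow> 0" by (rule LIMSEQ_inverse_real_of_nat[unfolded inverse_eq_divide])
  have "(\<lambda>n. ennreal ((X + 1 / real (Suc n)) powr (1 / p) * (Y + 1 / real (Suc n)) powr (1 / p')))
      \<longlonglongrightarrow> ennreal ((X + 0) powr (1 / p) * (Y + 0) powr (1 / p'))"
    using p p' nn by (intro tendsto_ennrealI tendsto_mult tendsto_powr' tendsto_add tendsto_const lim0) auto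
  then show ?thesis
    using bound by (intro LIMSEQ_le_const[where X = "\<lambda>n. ennreal ((X + 1 / real (Suc n)) powr (1 / p) * (Y + 1 / real (Suc n)) powr (1 / p'))"]) auto
qed

lemma ennpowr_ennreal [simp]: "0 \<le> x \<Longrightarrow> ennpowr (ennreal x) a = ennreal (x powr a)"
  by (simp add: ennpowr_def)

lemma ennpowr_top [simp]: "ennpowr top a = top"
  by (simp add: ennpowr_def)

lemma Lp_norm_le_iff:
  assumes p: "1 < p" and fin: "(\<integral>\<^sup>+z. ennreal (norm (f z) powr p * w z) \<partial>dA) = ennreal X" "0 \<le> X" and c: "0 \<le> c"
  shows "Lp_norm p w g \<le> ennreal c * Lp_norm p w f \<longleftrightarrow>
    (\<integral>\<^sup>+z. ennreal (norm (g z) powr p * w z) \<partial>dA) \<le> ennreal (c powr p * X)"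
proof (cases "(\<integral>\<^sup>+z. ennreal (norm (g z) powr p * w z) \<partial>dA)")
  case (real Y)
  have "Y powr (1 / p) \<le> c * X powr (1 / p) \<longleftrightarrow> Y \<le> c powr p * X"
  proof
    assume "Y powr (1 / p) \<le> c * X powr (1 / p)"
    then have "(Y powr (1 / p)) powr p \<le> (c * X powr (1 / p)) powr p" using p by (intro powr_mono2) auto
    then show "Y \<le> c powr p * X" using p real(1) fin(2) by (simp add: powr_powr powr_mult)
  next
    assume "Y \<le> c powr p * X"
    then have "Y powr (1 / p) \<le> (c powr p * X) powr (1 / p)" using p real(1) by (intro powr_mono2) auto
    then show "Y powr (1 / p) \<le> c * X powr (1 / p)" using p c by (simp add: powr_powr powr_mult)
  qed
  then show ?thesis
    unfolding Lp_norm_def fin(1) real(2)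
    using real(1) fin(2) c by (simp add: ennreal_mult[symmetric] ennreal_le_iff)
next
  case top
  then show ?thesis unfolding Lp_norm_def fin(1) using fin(2) c by (simp add: ennreal_mult[symmetric] top_unique)
qed

section \<open>Radial integrals against the kernel\<close>

context
  fixes M :: "real measure"
  assumes M: "interval_measure M" "thick M"
begin

lemma borel_measurable_radial_kernel [measurable]: "radial_kernel M \<in> borel_measurable borel"
  unfolding radial_kernel_def[abs_def] by measurable

lemma borel_measurable_kernel_mean [measurable]: "kernel_mean M \<in> borel_measurable borel"
proof -
  have "(\<lambda>(r, t). norm (radial_kernel M (of_real r * cis t))) \<in> borel_measurable (borel \<Otimes>\<^sub>M circle_measure)"
    unfolding measurable_cong_sets[OF sets_pair_measure_cong[OF refl sets_circle_measure] refl]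
    by measurable
  then show ?thesis
    unfolding kernel_mean_def[abs_def] by (rule circle_measure.borel_measurable_lebesgue_integral)
qed

text \<open>In polar coordinates the direction of z is absorbed by a rotation, so a radial integrand
  sees only the circle mean of the kernel.\<close>

lemma nn_integral_disc_kernel:
  assumes z: "norm z < 1" and [measurable]: "F \<in> borel_measurable borel" "g \<in> borel_measurable borel"
  shows "(\<integral>\<^sup>+\<zeta>. F (norm \<zeta>) * g (norm \<zeta>) * ennreal (norm (radial_kernel M (cnj z * \<zeta>))) \<partial>disc_measure) =
    2 * (\<integral>\<^sup>+s. F s * ennreal (kernel_mean M (norm z * s)) \<partial>weight_measure g)"
proof -
  have "(\<integral>\<^sup>+\<zeta>. F (norm \<zeta>) * g (norm \<zeta>) * ennreal (norm (radial_kernel M (cnj z * \<zeta>))) \<partial>disc_measure) =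
    (\<integral>\<^sup>+r. (\<integral>\<^sup>+t. F (norm (of_real r * cis t)) * g (norm (of_real r * cis t)) * ennreal (norm (radial_kernel M (cnj z * (of_real r * cis t)))) \<partial>circle_measure) \<partial>radial_measure)"
    by (rule nn_integral_polar) measurable
  also have "\<dots> = (\<integral>\<^sup>+r. (F r * ennreal (kernel_mean M (norm z * r))) * g r \<partial>radial_measure)"
  proof (rule nn_integral_cong_AE)
    have "AE r in radial_measure. 0 < r \<and> r < 1" by (subst AE_radial_measure_iff) auto
    then show "AE r in radial_measure. (\<integral>\<^sup>+t. F (norm (of_real r * cis t)) * g (norm (of_real r * cis t)) * ennreal (norm (radial_kernel M (cnj z * (of_real r * cis t)))) \<partial>circle_measure) =
      (F r * ennreal (kernel_mean M (norm z * r))) * g r"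
    proof eventually_elim
      fix r :: real assume r: "0 < r \<and> r < 1"
      have zr: "0 \<le> norm z * r" "norm z * r < 1"
        using mult_strict_mono'[of "norm z" 1 r 1] z r by auto
      have "(\<integral>\<^sup>+t. F (norm (of_real r * cis t)) * g (norm (of_real r * cis t)) * ennreal (norm (radial_kernel M (cnj z * (of_real r * cis t)))) \<partial>circle_measure)
        = (\<integral>\<^sup>+t. (F r * g r) * ennreal (norm (radial_kernel M (cis t * (cnj z * of_real r)))) \<partial>circle_measure)"
        using r by (intro nn_integral_cong) (simp add: norm_mult mult_ac)
      also have "\<dots> = (F r * g r) * (\<integral>\<^sup>+t. ennreal (norm (radial_kernel M (cis t * (cnj z * of_real r)))) \<partial>circle_measure)"
        by (rule nn_integral_cmult) simp
      also have "(\<integral>\<^sup>+t. ennreal (norm (radial_kernel M (cis t * (cnj z * of_real r)))) \<partial>circle_measure) =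
        (\<integral>\<^sup>+t. ennreal (norm (radial_kernel M (of_real (norm (cnj z * of_real r)) * cis t))) \<partial>circle_measure)"
        by (rule nn_integral_circle_rotation[where G = "\<lambda>w. ennreal (norm (radial_kernel M w))"]) measurable
      also have "norm (cnj z * of_real r) = norm z * r" using r by (simp add: norm_mult)
      also have "(\<integral>\<^sup>+t. ennreal (norm (radial_kernel M (of_real (norm z * r) * cis t))) \<partial>circle_measure) = ennreal (kernel_mean M (norm z * r))"
        unfolding kernel_mean_def by (rule nn_integral_eq_integral) (use integrable_norm_radial_kernel[OF M zr] in auto)
      finally show "(\<integral>\<^sup>+t. F (norm (of_real r * cis t)) * g (norm (of_real r * cis t)) * ennreal (norm (radial_kernel M (cnj z * (of_real r * cis t)))) \<partial>circle_measure) =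
        (F r * ennreal (kernel_mean M (norm z * r))) * g r" by (simp only: mult_ac)
    qed
  qed
  also have "\<dots> = 2 * (\<integral>\<^sup>+s. F s * ennreal (kernel_mean M (norm z * s)) \<partial>weight_measure g)"
    by (rule nn_integral_radial_measure) measurable
  finally show ?thesis .
qed

end

text \<open>Brings different weights over the common base measure s ds, where integrands can be
  compared pointwise.\<close>

lemma nn_integral_weight_base:
  assumes [measurable]: "g \<in> borel_measurable borel" "f \<in> borel_measurable borel"
  shows "(\<integral>\<^sup>+s. f s \<partial>weight_measure g) = (\<integral>\<^sup>+s. g s * f s \<partial>weight_measure (\<lambda>_. 1))"
  by (subst (1 2) nn_integral_weight_measure) (auto intro!: nn_integral_cong simp: mult_ac)

lemma AE_weight_iff:
  assumes "g \<in> borel_measurable borel"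
  shows "(AE s in weight_measure g. P s) \<longleftrightarrow> (AE s in lborel. 0 < s \<and> s < 1 \<and> g s \<noteq> 0 \<longrightarrow> P s)"
  unfolding weight_measure_def using assms
  by (subst AE_density) (auto simp: indicator_def ennreal_zero_less_mult_iff zero_less_iff_neq_zero intro!: AE_cong)

text \<open>The mean inequality \<open>sqrt r\<close> \<le> (1 + r) / 2 relates the two kinds of
  halving, and for s \<ge> 1/2 the factor s in the measure costs at most 2. Radii away from 1 are
  handled by comparing the total mass with one fixed tail.\<close>

lemma Dhat_imp_doubling:
  assumes "radial_weight_rep w W" "w \<in> Dhat"
  shows "doubling (weight_measure (\<lambda>s. ennreal (W s)))"
proof -
  interpret radial_weight_rep w W by fact
  obtain C where C: "0 < C" "\<forall>\<^sub>F r in at_left (1::real). hat w (of_real r) \<le> ennreal C * hat w (of_real ((1 + r) / 2))"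
    using assms(2) by (auto simp: Dhat_def)
  then obtain r1 where r1: "r1 < 1" "\<And>r. r1 < r \<Longrightarrow> r < 1 \<Longrightarrow> hat w (of_real r) \<le> ennreal C * hat w (of_real ((1 + r) / 2))"
    unfolding eventually_at_left_field by (metis)
  \<comment> \<open>Above 1/4 the square root is at least 1/2.\<close>
  define r2 where "r2 = max r1 (1/4)"
  have r2: "0 < r2" "r2 < 1" using r1 by (auto simp: r2_def)
  have T2: "0 < upper_mass \<mu> (sqrt r2)" using thick_\<mu> r2 by (simp add: thick_def)
  define D where "D = max (2 * C) (upper_mass \<mu> 0 / upper_mass \<mu> (sqrt r2))"
  have D: "0 < D" "2 * C \<le> D" "upper_mass \<mu> 0 \<le> D * upper_mass \<mu> (sqrt r2)"
    using C T2 by (auto simp: D_def less_max_iff_disj pos_divide_le_eq[symmetric])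
  have "upper_mass \<mu> r \<le> D * upper_mass \<mu> (sqrt r)" if r: "0 < r" "r < 1" for r
  proof (cases "r2 < r")
    case True
    have rr: "r1 < r" "1/4 \<le> r" using True by (auto simp: r2_def)
    have s: "1/2 \<le> sqrt r" "sqrt r < 1"
      using rr r real_le_rsqrt[of "1/2" r] by (auto simp: power2_eq_square)
    have am: "sqrt r \<le> (1 + r) / 2"
      using arith_geo_mean_sqrt[of 1 r] r by simp
    have Wu: "W u * u \<le> W u" if "u < 1" for u
      using mult_left_mono[of u 1 "W u"] W_nonneg that by simp
    have "emeasure \<mu> {r..} \<le> hat w (of_real r)"
      unfolding emeasure_\<mu>_eq using r Wu
      by (subst hat_eq) (auto intro!: nn_integral_mono ennreal_leI simp: indicator_def)
    also have "\<dots> \<le> ennreal C * hat w (of_real ((1 + r) / 2))" by (rule r1(2)[OF rr(1) r(2)])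
    also have "\<dots> \<le> ennreal C * (2 * emeasure \<mu> {sqrt r..})"
    proof (rule mult_left_mono)
      have "hat w (of_real ((1 + r) / 2)) = (\<integral>\<^sup>+s. ennreal (W s) * indicator {(1 + r) / 2..<1} s \<partial>lborel)"
        using r by (intro hat_eq) auto
      also have "\<dots> \<le> (\<integral>\<^sup>+u. 2 * (ennreal (W u * u) * indicator ({0<..<1} \<inter> {sqrt r..}) u) \<partial>lborel)"
      proof (rule nn_integral_mono)
        fix u
        show "ennreal (W u) * indicator {(1 + r) / 2..<1} u \<le> 2 * (ennreal (W u * u) * indicator ({0<..<1} \<inter> {sqrt r..}) u)"
        proof (cases "u \<in> {(1 + r) / 2..<1}")
          case True
          then have u: "sqrt r \<le> u" "u < 1" "1/2 \<le> u" using am s by auto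
          have "W u \<le> 2 * (W u * u)" using u W_nonneg[of u] mult_left_mono[of 1 "2 * u" "W u"] by simp
          then have "ennreal (W u) \<le> ennreal (2 * (W u * u))" by (rule ennreal_leI)
          also have "\<dots> = 2 * ennreal (W u * u)" using u W_nonneg by (simp add: ennreal_mult)
          finally show ?thesis using True u by (simp add: indicator_def)
        qed auto
      qed
      also have "\<dots> = 2 * emeasure \<mu> {sqrt r..}" unfolding emeasure_\<mu>_eq by (rule nn_integral_cmult) simp
      finally show "hat w (of_real ((1 + r) / 2)) \<le> 2 * emeasure \<mu> {sqrt r..}" .
    qed simp
    also have "\<dots> = ennreal (2 * C * upper_mass \<mu> (sqrt r))"
      using C upper_mass_nonneg[OF interval_\<mu>] by (simp add: emeasure_\<mu>_upper ennreal_mult mult_ac)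
    finally have "upper_mass \<mu> r \<le> 2 * C * upper_mass \<mu> (sqrt r)"
      unfolding emeasure_\<mu>_upper using C upper_mass_nonneg[OF interval_\<mu>] by (simp add: ennreal_le_iff)
    also have "\<dots> \<le> D * upper_mass \<mu> (sqrt r)"
      using D upper_mass_nonneg[OF interval_\<mu>] by (intro mult_right_mono) auto
    finally show ?thesis .
  next
    case False
    have "upper_mass \<mu> r \<le> upper_mass \<mu> 0" using r by (intro upper_mass_antimono interval_\<mu>) auto
    also have "\<dots> \<le> D * upper_mass \<mu> (sqrt r2)" by (rule D)
    also have "\<dots> \<le> D * upper_mass \<mu> (sqrt r)"
      using D False by (intro mult_left_mono upper_mass_antimono interval_\<mu>) auto
    finally show ?thesis .
  qed
  with D(1) show ?thesis unfolding doubling_def by blast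
qed

text \<open>The substitution x = y + 1, with q and 1 / C exchanged.\<close>

lemma classM_iff_moment_decay:
  assumes "radial_weight_rep w W"
  shows "w \<in> classM \<longleftrightarrow> moment_decay (weight_measure (\<lambda>s. ennreal (W s)))"
proof -
  interpret radial_weight_rep w W by fact
  have mom: "moment (\<lambda>z. ennreal (w z)) x = ennreal (power_moment \<mu> (x - 1))" if "1 \<le> x" for x
  proof -
    have "moment (\<lambda>z. ennreal (w z)) ((x - 1) + 1) = (\<integral>\<^sup>+s. ennreal (s powr (x - 1)) \<partial>\<mu>)"
      using AE_W_ennreal by (intro moment_weight_measure) auto
    also have "\<dots> = ennreal (power_moment \<mu> (x - 1))"
      unfolding power_moment_def using interval_\<mu> that by (intro nn_integral_eq_integral) auto
    finally show ?thesis by simp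
  qed
  note nn = power_moment_nonneg[OF interval_\<mu>]
  show ?thesis
  proof
    assume "w \<in> classM"
    then obtain C K where CK: "1 < C" "1 < K" "\<And>x. 1 \<le> x \<Longrightarrow>
      ennreal C * moment (\<lambda>z. ennreal (w z)) (K * x) \<le> moment (\<lambda>z. ennreal (w z)) x"
      by (auto simp: classM_def)
    have "power_moment \<mu> (K * (y + 1) - 1) \<le> 1 / C * power_moment \<mu> y" if y: "0 \<le> y" for y
    proof -
      have "1 * 1 \<le> K * (y + 1)" using CK y by (intro mult_mono) auto
      then have "ennreal C * ennreal (power_moment \<mu> (K * (y + 1) - 1)) \<le> ennreal (power_moment \<mu> (y + 1 - 1))"
        using CK(3)[of "y + 1"] y by (simp add: mom)
      then have "C * power_moment \<mu> (K * (y + 1) - 1) \<le> power_moment \<mu> y"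
        using CK nn by (simp add: ennreal_mult[symmetric] ennreal_le_iff)
      then show ?thesis using CK by (simp add: field_simps)
    qed
    then show "moment_decay \<mu>" unfolding moment_decay_def
      using CK by (intro exI[of _ "1 / C"] exI[of _ K]) auto
  next
    assume "moment_decay \<mu>"
    then obtain q K where q: "0 < q" "q < 1" "1 < K"
      "\<And>y. 0 \<le> y \<Longrightarrow> power_moment \<mu> (K * (y + 1) - 1) \<le> q * power_moment \<mu> y"
      by (auto simp: moment_decay_def)
    have "ennreal (1 / q) * moment (\<lambda>z. ennreal (w z)) (K * x) \<le> moment (\<lambda>z. ennreal (w z)) x" if x: "1 \<le> x" for x
    proof -
      have "1 * 1 \<le> K * x" using q x by (intro mult_mono) auto
      moreover have "1 / q * power_moment \<mu> (K * x - 1) \<le> power_moment \<mu> (x - 1)"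
        using q(4)[of "x - 1"] x q(1) by (simp add: field_simps)
      ultimately show ?thesis using x q nn by (simp add: mom ennreal_mult[symmetric] ennreal_leI)
    qed
    moreover have "1 < 1 / q" using q by simp
    ultimately show "w \<in> classM" unfolding classM_def using w q(3) by blast
  qed
qed

section \<open>Translation to one dimension\<close>

text \<open>The weight \<sigma> formed from the Borel profiles, and therefore Borel itself.\<close>

definition sigma_radial :: "real \<Rightarrow> (real \<Rightarrow> real) \<Rightarrow> (real \<Rightarrow> real) \<Rightarrow> real \<Rightarrow> ennreal" where
  "sigma_radial p W V s =
     (if V s = 0 then (if W s = 0 then 0 else \<infinity>)
      else ennreal ((W s / V s powr (1 / p)) powr conj_exp p))"

locale two_weights =
  O: radial_weight_rep \<omega> W + N: radial_weight_rep \<nu> V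
  for \<omega> \<nu> :: "complex \<Rightarrow> real" and W V :: "real \<Rightarrow> real" +
  fixes p :: real
  assumes p: "1 < p" and Dhat: "\<omega> \<in> Dhat"
begin

abbreviation "p' \<equiv> conj_exp p"
abbreviation "S \<equiv> sigma_radial p W V"
abbreviation "SM \<equiv> weight_measure S"

lemma conj_exponents: "1 / p + 1 / p' = 1" and p'_gt_1: "1 < p'"
  using p by (auto simp: conj_exp_def field_simps)

lemma S_meas [measurable]: "S \<in> borel_measurable borel"
  unfolding sigma_radial_def[abs_def] by measurable

lemma AE_S: "AE s in lborel. 0 < s \<and> s < 1 \<longrightarrow> sigma_weight p \<omega> \<nu> (of_real s) = S s"
  using O.AE_W N.AE_W by eventually_elim (auto simp: sigma_weight_def sigma_radial_def)

lemma tail_O: "0 \<le> r \<Longrightarrow> tail (\<lambda>z. ennreal (\<omega> z)) r = ennreal (upper_mass O.\<mu> r)"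
  using O.AE_W_ennreal by (subst tail_weight_measure[where g = "\<lambda>s. ennreal (W s)"]) (auto simp: O.emeasure_\<mu>_upper)

lemma tail_N: "0 \<le> r \<Longrightarrow> tail (\<lambda>z. ennreal (\<nu> z)) r = ennreal (upper_mass N.\<mu> r)"
  using N.AE_W_ennreal by (subst tail_weight_measure[where g = "\<lambda>s. ennreal (V s)"]) (auto simp: N.emeasure_\<mu>_upper)

lemma tail_S: "0 \<le> r \<Longrightarrow> tail (sigma_weight p \<omega> \<nu>) r = emeasure SM {r..}"
  using AE_S by (intro tail_weight_measure) auto

lemma moment_S: "moment (sigma_weight p \<omega> \<nu>) (y + 1) = (\<integral>\<^sup>+s. ennreal (s powr y) \<partial>SM)"
  using AE_S by (intro moment_weight_measure) auto

lemma moment_weight: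
  assumes "radial_weight_rep w U" "0 \<le> y"
  shows "moment (\<lambda>z. ennreal (w z)) (y + 1) = ennreal (power_moment (weight_measure (\<lambda>s. ennreal (U s))) y)"
proof -
  interpret radial_weight_rep w U by fact
  have "moment (\<lambda>z. ennreal (w z)) (y + 1) = (\<integral>\<^sup>+s. ennreal (s powr y) \<partial>\<mu>)"
    using AE_W_ennreal by (intro moment_weight_measure) auto
  also have "\<dots> = ennreal (power_moment \<mu> y)"
    unfolding power_moment_def using interval_\<mu> assms(2) by (intro nn_integral_eq_integral) auto
  finally show ?thesis .
qed

lemma rep_O: "radial_weight_rep \<omega> W" and rep_N: "radial_weight_rep \<nu> V"
  by unfold_locales

lemma emeasure_SM_UNIV: "emeasure SM UNIV = emeasure SM {0..}"
proof (rule emeasure_eq_AE)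
  show "AE x in SM. (x \<in> UNIV) = (x \<in> {0..})"
    using AE_weight_measure[OF S_meas] by eventually_elim auto
qed auto

section \<open>The three measures once \<sigma> has finite mass\<close>

context
  assumes fin_S: "emeasure SM UNIV < \<infinity>"
begin

lemma interval_S: "interval_measure SM"
  using fin_S by (intro interval_measure_weight) auto

lemma AE_S_finite: "AE s in lborel. 0 < s \<and> s < 1 \<longrightarrow> S s \<noteq> \<infinity>"
proof -
  have "AE s in lborel. indicator {0<..<1} s * (ennreal s * S s) \<noteq> \<infinity>"
  proof (rule nn_integral_PInf_AE)
    have "(\<integral>\<^sup>+s. indicator {0<..<1} s * (ennreal s * S s) \<partial>lborel) = emeasure SM UNIV"
      using nn_integral_weight_measure[of S "\<lambda>_. 1"] by simp
    then show "(\<integral>\<^sup>+s. indicator {0<..<1} s * (ennreal s * S s) \<partial>lborel) \<noteq> \<infinity>" using fin_S by simp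
  qed auto
  then show ?thesis by eventually_elim (auto simp: ennreal_mult_eq_top_iff)
qed

definition S' :: "real \<Rightarrow> real" where "S' s = enn2real (S s)"

lemma S'_meas [measurable]: "S' \<in> borel_measurable borel"
  unfolding S'_def[abs_def] by measurable

lemma S'_nonneg: "0 \<le> S' s"
  by (simp add: S'_def)

lemma AE_S': "AE s in lborel. 0 < s \<and> s < 1 \<longrightarrow> S s = ennreal (S' s)"
  using AE_S_finite by eventually_elim (auto simp: S'_def less_top)

text \<open>Where V vanishes, finiteness of \<sigma> forces W to vanish; elsewhere the definition of
  \<sigma> is solved for W. Hoelder's inequality for the triple rests on this factorisation.\<close>

lemma AE_W_eq: "AE s in lborel. 0 < s \<and> s < 1 \<longrightarrow> W s = V s powr (1 / p) * S' s powr (1 / p')"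
  using AE_S_finite
proof eventually_elim
  fix s assume fin: "0 < s \<and> s < 1 \<longrightarrow> S s \<noteq> \<infinity>"
  show "0 < s \<and> s < 1 \<longrightarrow> W s = V s powr (1 / p) * S' s powr (1 / p')"
  proof
    assume s: "0 < s \<and> s < 1"
    show "W s = V s powr (1 / p) * S' s powr (1 / p')"
    proof (cases "V s = 0")
      case True
      then show ?thesis using fin s by (auto simp: sigma_radial_def split: if_splits)
    next
      case False
      then have V: "0 < V s" using N.W_nonneg[of s] by simp
      then have "S' s = (W s / V s powr (1 / p)) powr p'" by (simp add: S'_def sigma_radial_def)
      then show ?thesis using V O.W_nonneg[of s] p'_gt_1 by (simp add: powr_powr)
    qed
  qed
qed

lemma weight_measure_S': "SM = weight_measure (\<lambda>s. ennreal (S' s))"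
  unfolding weight_measure_def
proof (rule density_cong)
  show "AE s in lborel. indicator {0<..<1} s * (ennreal s * S s) = indicator {0<..<1} s * (ennreal s * ennreal (S' s))"
    using AE_S' by eventually_elim (auto simp: indicator_def)
qed auto

lemma holder_measures:
  fixes f g :: "real \<Rightarrow> real"
  assumes [measurable]: "f \<in> borel_measurable borel" "g \<in> borel_measurable borel"
    and f: "\<And>s. 0 < s \<Longrightarrow> s < 1 \<Longrightarrow> 0 \<le> f s \<and> f s \<le> 1"
    and g: "\<And>s. 0 < s \<Longrightarrow> s < 1 \<Longrightarrow> 0 \<le> g s \<and> g s \<le> 1"
  shows "(\<integral>s. f s * g s \<partial>O.\<mu>) \<le> (\<integral>s. f s powr p \<partial>N.\<mu>) powr (1 / p) * (\<integral>s. g s powr p' \<partial>SM) powr (1 / p')"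
proof -
  let ?B = "weight_measure (\<lambda>_. 1)"
  define X where "X = (\<integral>s. f s powr p \<partial>N.\<mu>)"
  define Y where "Y = (\<integral>s. g s powr p' \<partial>SM)"
  have XY: "0 \<le> X" "0 \<le> Y" unfolding X_def Y_def by (auto intro: integral_nonneg_AE)
  have pos: "(\<integral>\<^sup>+s. ennreal (h s) \<partial>M) = ennreal (\<integral>s. h s \<partial>M)"
    if "interval_measure M" "h \<in> borel_measurable borel" "\<And>s. 0 < s \<Longrightarrow> s < 1 \<Longrightarrow> 0 \<le> h s \<and> h s \<le> 1" for M h
  proof (rule nn_integral_eq_integral)
    show "integrable M h" using that by (intro integrable_bounded_interval[where B = 1]) auto
    show "AE s in M. 0 \<le> h s" using AE_interval_measure[OF that(1)] by eventually_elim (use that in auto)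
  qed
  have X: "(\<integral>\<^sup>+s. ennreal (f s powr p * V s) \<partial>?B) = ennreal X"
  proof -
    have "(\<integral>\<^sup>+s. ennreal (f s powr p * V s) \<partial>?B) = (\<integral>\<^sup>+s. ennreal (V s) * ennreal (f s powr p) \<partial>?B)"
      by (intro nn_integral_cong) (simp add: ennreal_mult N.W_nonneg mult.commute)
    also have "\<dots> = (\<integral>\<^sup>+s. ennreal (f s powr p) \<partial>N.\<mu>)" by (rule nn_integral_weight_base[symmetric]) measurable
    also have "\<dots> = ennreal X" unfolding X_def
      using f p by (intro pos N.interval_\<mu>) (auto simp: powr_le1)
    finally show ?thesis .
  qed
  have Y: "(\<integral>\<^sup>+s. ennreal (g s powr p' * S' s) \<partial>?B) = ennreal Y"
  proof -
    have "(\<integral>\<^sup>+s. ennreal (g s powr p' * S' s) \<partial>?B) = (\<integral>\<^sup>+s. ennreal (S' s) * ennreal (g s powr p') \<partial>?B)"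
      by (intro nn_integral_cong) (simp add: ennreal_mult S'_nonneg mult.commute)
    also have "\<dots> = (\<integral>\<^sup>+s. ennreal (g s powr p') \<partial>SM)"
      unfolding weight_measure_S' by (rule nn_integral_weight_base[symmetric]) measurable
    also have "\<dots> = ennreal Y" unfolding Y_def
      using g p'_gt_1 by (intro pos interval_S) (auto simp: powr_le1)
    finally show ?thesis .
  qed
  have "ennreal (\<integral>s. f s * g s \<partial>O.\<mu>) = (\<integral>\<^sup>+s. ennreal (f s * g s) \<partial>O.\<mu>)"
    using f g by (intro pos[symmetric] O.interval_\<mu>) (auto intro: mult_le_one)
  also have "\<dots> = (\<integral>\<^sup>+s. ennreal (W s) * ennreal (f s * g s) \<partial>?B)" by (rule nn_integral_weight_base) measurable
  also have "\<dots> = (\<integral>\<^sup>+s. ennreal ((f s powr p * V s) powr (1 / p) * (g s powr p' * S' s) powr (1 / p')) \<partial>?B)"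
  proof (rule nn_integral_cong_AE)
    have "AE s in ?B. 0 < s \<and> s < 1 \<longrightarrow> W s = V s powr (1 / p) * S' s powr (1 / p')"
      using AE_W_eq by (subst AE_weight_iff) auto
    then show "AE s in ?B. ennreal (W s) * ennreal (f s * g s) = ennreal ((f s powr p * V s) powr (1 / p) * (g s powr p' * S' s) powr (1 / p'))"
      using AE_weight_measure[OF borel_measurable_const[of 1]]
    proof eventually_elim
      fix s assume "0 < s \<and> s < 1 \<longrightarrow> W s = V s powr (1 / p) * S' s powr (1 / p')" and s: "0 < s \<and> s < 1"
      then have W: "W s = V s powr (1 / p) * S' s powr (1 / p')" by simp
      have "(f s powr p * V s) powr (1 / p) * (g s powr p' * S' s) powr (1 / p') = W s * (f s * g s)"
        unfolding W using f[of s] g[of s] s p p'_gt_1 by (simp add: powr_mult powr_powr mult_ac)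
      then show "ennreal (W s) * ennreal (f s * g s) = ennreal ((f s powr p * V s) powr (1 / p) * (g s powr p' * S' s) powr (1 / p'))"
        using f[of s] g[of s] s O.W_nonneg[of s] by (simp add: ennreal_mult)
    qed
  qed
  also have "\<dots> \<le> ennreal (X powr (1 / p) * Y powr (1 / p'))"
    using X Y XY N.W_nonneg S'_nonneg
    by (intro nn_integral_Hoelder p conj_exponents) auto
  finally show ?thesis unfolding X_def[symmetric] Y_def[symmetric] by (simp add: ennreal_le_iff)
qed

lemma triple: "weight_triple p p' O.\<mu> N.\<mu> SM"
  by unfold_locales
     (use p conj_exponents O.interval_\<mu> N.interval_\<mu> interval_S O.thick_\<mu> Dhat_imp_doubling[OF rep_O Dhat] holder_measures in auto)

lemma emeasure_SM: "emeasure SM {r..} = ennreal (upper_mass SM r)"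
proof -
  interpret finite_measure SM using interval_S by (simp add: interval_measure_def)
  show ?thesis by (simp add: upper_mass_def emeasure_eq_measure)
qed

lemma moment_S_eq: "0 \<le> y \<Longrightarrow> moment (sigma_weight p \<omega> \<nu>) (y + 1) = ennreal (power_moment SM y)"
  unfolding moment_S power_moment_def using interval_S by (intro nn_integral_eq_integral) auto

interpretation T: weight_triple p p' O.\<mu> N.\<mu> SM by (rule triple)

section \<open>The constants D, A and M in terms of the three measures\<close>

lemma D_const_term:
  "ennpowr (moment (\<lambda>z. ennreal (\<nu> z)) (real n * p + 1)) (1 / p) *
   ennpowr (moment (sigma_weight p \<omega> \<nu>) (real n * p' + 1)) (1 / p') /
   moment (\<lambda>z. ennreal (\<omega> z)) (2 * real n + 1) =
   ennreal (power_moment N.\<mu> (real n * p) powr (1 / p) * power_moment SM (real n * p') powr (1 / p') / power_moment O.\<mu> (2 * real n))"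
  using p p'_gt_1 power_moment_pos[OF O.interval_\<mu> O.thick_\<mu>, of "2 * real n"]
    power_moment_nonneg[OF N.interval_\<mu>] power_moment_nonneg[OF interval_S]
  by (simp add: moment_weight[OF rep_O] moment_weight[OF rep_N] moment_S_eq ennreal_mult[symmetric] divide_ennreal)

lemma D_const_finite_iff':
  "D_const p \<omega> \<nu> < \<infinity> \<longleftrightarrow> (\<exists>D>0. \<forall>n::nat. power_moment N.\<mu> (real n * p) powr (1/p) * power_moment SM (real n * p') powr (1/p')
      \<le> D * power_moment O.\<mu> (2 * real n))"
proof
  assume fin: "D_const p \<omega> \<nu> < \<infinity>"
  define D where "D = enn2real (D_const p \<omega> \<nu>) + 1"
  have D0: "0 < D" by (simp add: D_def add_nonneg_pos)
  have "power_moment N.\<mu> (real n * p) powr (1/p) * power_moment SM (real n * p') powr (1/p')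
      \<le> D * power_moment O.\<mu> (2 * real n)" for n :: nat
  proof -
    have "ennreal (power_moment N.\<mu> (real n * p) powr (1 / p) * power_moment SM (real n * p') powr (1 / p') / power_moment O.\<mu> (2 * real n)) \<le> D_const p \<omega> \<nu>"
      unfolding D_const_term[symmetric] D_const_def by (rule SUP_upper) simp
    also have "\<dots> = ennreal (enn2real (D_const p \<omega> \<nu>))" using fin by simp
    also have "\<dots> \<le> ennreal D" by (rule ennreal_leI) (simp add: D_def)
    finally have "power_moment N.\<mu> (real n * p) powr (1 / p) * power_moment SM (real n * p') powr (1 / p') / power_moment O.\<mu> (2 * real n) \<le> D"
      using D0 by (subst (asm) ennreal_le_iff) auto
    then show ?thesis using power_moment_pos[OF O.interval_\<mu> O.thick_\<mu>, of "2 * real n"]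
      by (simp add: divide_le_eq)
  qed
  with D0 show "\<exists>D>0. \<forall>n::nat. power_moment N.\<mu> (real n * p) powr (1/p) * power_moment SM (real n * p') powr (1/p')
      \<le> D * power_moment O.\<mu> (2 * real n)" by blast
next
  assume "\<exists>D>0. \<forall>n::nat. power_moment N.\<mu> (real n * p) powr (1/p) * power_moment SM (real n * p') powr (1/p')
      \<le> D * power_moment O.\<mu> (2 * real n)"
  then obtain D where D: "0 < D" "\<And>n::nat. power_moment N.\<mu> (real n * p) powr (1/p) * power_moment SM (real n * p') powr (1/p')
      \<le> D * power_moment O.\<mu> (2 * real n)" by blast
  have "D_const p \<omega> \<nu> \<le> ennreal D"
    unfolding D_const_def
  proof (rule SUP_least, subst D_const_term, rule ennreal_leI)
    fix n :: nat
    show "power_moment N.\<mu> (real n * p) powr (1/p) * power_moment SM (real n * p') powr (1/p') / power_moment O.\<mu> (2 * real n) \<le> D"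
      using D(2)[of n] power_moment_pos[OF O.interval_\<mu> O.thick_\<mu>, of "2 * real n"] by (simp add: divide_le_eq)
  qed
  then show "D_const p \<omega> \<nu> < \<infinity>" by (rule le_less_trans) simp
qed

lemma A_const_term:
  assumes "0 \<le> r" "r < 1"
  shows "ennpowr (tail (\<lambda>z. ennreal (\<nu> z)) r) (1 / p) * ennpowr (tail (sigma_weight p \<omega> \<nu>) r) (1 / p') /
     tail (\<lambda>z. ennreal (\<omega> z)) r =
   ennreal (upper_mass N.\<mu> r powr (1 / p) * upper_mass SM r powr (1 / p') / upper_mass O.\<mu> r)"
  using assms T.upper_mass_O_pos[of r]
  by (simp add: tail_O tail_N tail_S emeasure_SM ennreal_mult[symmetric] divide_ennreal)

lemma A_const_finite_iff': "A_const p \<omega> \<nu> < \<infinity> \<longleftrightarrow> (\<exists>A. T.balanced A)"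
proof
  assume fin: "A_const p \<omega> \<nu> < \<infinity>"
  define A where "A = enn2real (A_const p \<omega> \<nu>) + 1"
  have "T.balanced A"
    unfolding T.balanced_def
  proof (intro conjI allI impI)
    show A0: "0 < A" by (simp add: A_def add_nonneg_pos)
    fix r :: real assume r: "0 \<le> r \<and> r < 1"
    have "ennreal (upper_mass N.\<mu> r powr (1 / p) * upper_mass SM r powr (1 / p') / upper_mass O.\<mu> r) \<le> A_const p \<omega> \<nu>"
      using r by (subst A_const_term[symmetric]) (auto simp: A_const_def intro!: SUP_upper)
    also have "\<dots> = ennreal (enn2real (A_const p \<omega> \<nu>))" using fin by simp
    also have "\<dots> \<le> ennreal A" by (rule ennreal_leI) (simp add: A_def)
    finally have "upper_mass N.\<mu> r powr (1 / p) * upper_mass SM r powr (1 / p') / upper_mass O.\<mu> r \<le> A"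
      using A0 by (subst (asm) ennreal_le_iff) auto
    then show "upper_mass N.\<mu> r powr (1 / p) * upper_mass SM r powr (1 / p') \<le> A * upper_mass O.\<mu> r"
      using T.upper_mass_O_pos[of r] r by (simp add: divide_le_eq)
  qed
  then show "\<exists>A. T.balanced A" ..
next
  assume "\<exists>A. T.balanced A"
  then obtain A where A: "T.balanced A" ..
  have "A_const p \<omega> \<nu> \<le> ennreal A"
    unfolding A_const_def
  proof (rule SUP_least)
    fix r :: real assume r: "r \<in> {0..<1}"
    then show "ennpowr (tail (\<lambda>z. ennreal (\<nu> z)) r) (1 / p) * ennpowr (tail (sigma_weight p \<omega> \<nu>) r) (1 / p') /
       tail (\<lambda>z. ennreal (\<omega> z)) r \<le> ennreal A"
      using A T.upper_mass_O_pos[of r]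
      by (subst A_const_term) (auto intro!: ennreal_leI simp: T.balanced_def divide_le_eq)
  qed
  then show "A_const p \<omega> \<nu> < \<infinity>" by (rule le_less_trans) simp
qed

text \<open>The measure \<open>N.\<mu>\<close> already contains \<nu>(s) s, so only the negative
  power of the \<omega>-tail remains as integrand, and it is bounded on [0, r].\<close>

lemma M_const_integral:
  assumes r: "0 \<le> r" "r < 1"
  shows "(\<integral>\<^sup>+s\<in>{0..r}. ennreal (\<nu> (of_real s) * s) / ennpowr (tail (\<lambda>z. ennreal (\<omega> z)) s) p \<partial>lebesgue) =
    ennreal (\<integral>t. indicator {..r} t * upper_mass O.\<mu> t powr (- p) \<partial>N.\<mu>)"
proof -
  note [measurable] = borel_measurable_upper_mass[OF O.interval_\<mu>]
  have "(\<integral>\<^sup>+s\<in>{0..r}. ennreal (\<nu> (of_real s) * s) / ennpowr (tail (\<lambda>z. ennreal (\<omega> z)) s) p \<partial>lebesgue) =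
    (\<integral>\<^sup>+s. ennreal (\<nu> (of_real s) * s) / ennpowr (tail (\<lambda>z. ennreal (\<omega> z)) s) p * indicator {0..r} s \<partial>lborel)"
    by (rule nn_integral_completion)
  also have "\<dots> = (\<integral>\<^sup>+s. indicator {0<..<1} s * (ennreal s * ennreal (V s)) * ennreal (indicator {..r} s * upper_mass O.\<mu> s powr (- p)) \<partial>lborel)"
  proof (rule nn_integral_cong_AE)
    show "AE s in lborel. ennreal (\<nu> (of_real s) * s) / ennpowr (tail (\<lambda>z. ennreal (\<omega> z)) s) p * indicator {0..r} s =
      indicator {0<..<1} s * (ennreal s * ennreal (V s)) * ennreal (indicator {..r} s * upper_mass O.\<mu> s powr (- p))"
      using N.AE_W AE_lborel_singleton[of 0]
    proof eventually_elim
      fix s :: real assume s: "0 < s \<and> s < 1 \<longrightarrow> \<nu> (of_real s) = V s" "s \<noteq> 0"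
      show "ennreal (\<nu> (of_real s) * s) / ennpowr (tail (\<lambda>z. ennreal (\<omega> z)) s) p * indicator {0..r} s =
        indicator {0<..<1} s * (ennreal s * ennreal (V s)) * ennreal (indicator {..r} s * upper_mass O.\<mu> s powr (- p))"
      proof (cases "0 < s \<and> s \<le> r")
        case True
        then have s1: "0 < s" "s < 1" "s \<le> r" using r by auto
        have T: "0 < upper_mass O.\<mu> s" using s1 by (intro T.upper_mass_O_pos)
        have "ennreal (\<nu> (of_real s) * s) / ennpowr (tail (\<lambda>z. ennreal (\<omega> z)) s) p = ennreal (V s * s / upper_mass O.\<mu> s powr p)"
          using s s1 T N.W_nonneg[of s] by (simp add: tail_O divide_ennreal)
        also have "\<dots> = ennreal s * ennreal (V s) * ennreal (upper_mass O.\<mu> s powr (- p))"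
          using s1 N.W_nonneg[of s] T by (simp add: ennreal_mult[symmetric] powr_minus_divide mult_ac)
        finally show ?thesis using s1 by (simp add: indicator_def)
      qed (use s in \<open>auto simp: indicator_def\<close>)
    qed
  qed
  also have "\<dots> = (\<integral>\<^sup>+t. ennreal (indicator {..r} t * upper_mass O.\<mu> t powr (- p)) \<partial>N.\<mu>)"
    by (rule nn_integral_weight_measure[symmetric]) measurable
  also have "\<dots> = ennreal (\<integral>t. indicator {..r} t * upper_mass O.\<mu> t powr (- p) \<partial>N.\<mu>)"
  proof (rule nn_integral_eq_integral)
    show "integrable N.\<mu> (\<lambda>t. indicator {..r} t * upper_mass O.\<mu> t powr (- p))"
      using r p T.upper_mass_O_pos
      by (intro integrable_bounded_interval[OF N.interval_\<mu>, where B = "upper_mass O.\<mu> r powr (- p)"])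
         (auto simp: indicator_def intro!: powr_mono2' upper_mass_antimono O.interval_\<mu>)
  qed (auto simp: indicator_def)
  finally show ?thesis .
qed

lemma M_const_term:
  assumes r: "0 \<le> r" "r < 1"
  shows "ennpowr ((\<integral>\<^sup>+s\<in>{0..r}. ennreal (\<nu> (of_real s) * s) /
              ennpowr (tail (\<lambda>z. ennreal (\<omega> z)) s) p \<partial>lebesgue) + 1) (1 / p) *
        ennpowr (tail (sigma_weight p \<omega> \<nu>) r) (1 / p') =
   ennreal (((\<integral>t. indicator {..r} t * upper_mass O.\<mu> t powr (- p) \<partial>N.\<mu>) + 1) powr (1/p) * upper_mass SM r powr (1/p'))"
proof -
  have nn: "0 \<le> (\<integral>t. indicator {..r} t * upper_mass O.\<mu> t powr (- p) \<partial>N.\<mu>)"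
    by (rule integral_nonneg_AE) (auto simp: indicator_def)
  have eq: "ennreal (\<integral>t. indicator {..r} t * upper_mass O.\<mu> t powr (- p) \<partial>N.\<mu>) + 1 =
    ennreal ((\<integral>t. indicator {..r} t * upper_mass O.\<mu> t powr (- p) \<partial>N.\<mu>) + 1)"
    using nn by (simp add: ennreal_plus)
  have "ennpowr (ennreal ((\<integral>t. indicator {..r} t * upper_mass O.\<mu> t powr (- p) \<partial>N.\<mu>) + 1)) (1 / p) =
    ennreal (((\<integral>t. indicator {..r} t * upper_mass O.\<mu> t powr (- p) \<partial>N.\<mu>) + 1) powr (1/p))"
    using nn by (intro ennpowr_ennreal) simp
  then show ?thesis
    unfolding M_const_integral[OF r] eq tail_S[OF r(1)] emeasure_SM
    by (simp only: ennpowr_ennreal[OF upper_mass_nonneg[OF interval_S]] ennreal_mult powr_ge_zero)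
qed

end

end

section \<open>Necessity\<close>

text \<open>Each doubling of the upper end m adds m terms of size at least 1 / (2 m).\<close>

lemma harmonic_block_ge:
  assumes "1 \<le> J"
  shows "real i / 2 \<le> (\<Sum>n=J..2 ^ i * J. 1 / real n)"
proof (induction i)
  case (Suc i)
  define m where "m = 2 ^ i * J"
  have m: "J \<le> m" "1 \<le> m" using assms by (auto simp: m_def)
  have "{J..2 * m} = {J..m} \<union> {m<..2 * m}" using m by auto
  then have "(\<Sum>n=J..2 * m. 1 / real n) = (\<Sum>n=J..m. 1 / real n) + (\<Sum>n\<in>{m<..2 * m}. 1 / real n)"
    by (simp only:) (rule sum.union_disjoint, auto)
  moreover have "(\<Sum>n\<in>{m<..2 * m}. 1 / real n) \<ge> (\<Sum>n\<in>{m<..2 * m}. 1 / real (2 * m))"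
    using m by (intro sum_mono frac_le) auto
  moreover have "(\<Sum>n\<in>{m<..2 * m}. 1 / real (2 * m)) = 1 / 2" using m by simp
  ultimately show ?case using Suc by (simp add: m_def mult.assoc)
qed (auto intro: sum_nonneg)

context radial_weight_rep
begin

lemma nn_integral_dA_radial:
  assumes [measurable]: "G \<in> borel_measurable borel"
  shows "(\<integral>\<^sup>+z. G (norm z) * ennreal (w z) \<partial>dA) = 2 * (\<integral>\<^sup>+s. G s \<partial>\<mu>)"
proof -
  have "(\<integral>\<^sup>+z. G (norm z) * ennreal (w z) \<partial>dA) = (\<integral>\<^sup>+z. G (norm z) * ennreal (W (norm z)) \<partial>dA)"
    by (rule nn_integral_cong_AE) (use AE_w in eventually_elim, simp)
  also have "\<dots> = (\<integral>\<^sup>+z. G (norm z) * ennreal (W (norm z)) \<partial>disc_measure)"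
    by (rule nn_integral_dA) measurable
  also have "\<dots> = (\<integral>\<^sup>+r. G r * ennreal (W r) \<partial>radial_measure)"
    by (rule nn_integral_disc_radial[where f = "\<lambda>r. G r * ennreal (W r)"]) measurable
  also have "\<dots> = 2 * (\<integral>\<^sup>+s. G s \<partial>\<mu>)" by (rule nn_integral_radial_measure) measurable
  finally show ?thesis .
qed

lemma Pplus_integrand_AE:
  assumes "norm z < 1"
  shows "AE \<zeta> in dA. Pplus_integrand w f z \<zeta> = f \<zeta> * of_real (norm (radial_kernel \<mu> (cnj z * \<zeta>))) * of_real (W (norm \<zeta>))"
proof -
  have "AE \<zeta> in dA. norm \<zeta> < 1" by (rule AE_I2) simp
  with AE_w show ?thesis
    by eventually_elim (simp add: Pplus_integrand_def Bergman_kernel_eq[OF assms])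
qed

text \<open>Only the circle mean of the kernel acts on a radial function, so the image is radial
  again; the 2 is that of 2 r dr.\<close>

lemma Pplus_radial:
  fixes F :: "real \<Rightarrow> real"
  assumes [measurable]: "F \<in> borel_measurable borel" and F: "\<And>s. 0 \<le> F s" and z: "norm z < 1"
    and int: "integrable dA (Pplus_integrand w (\<lambda>\<zeta>. of_real (F (norm \<zeta>))) z)"
  shows "(\<integral>\<^sup>+s. ennreal (F s * kernel_mean \<mu> (norm z * s)) \<partial>\<mu>) < \<infinity>"
    and "Pplus w (\<lambda>\<zeta>. of_real (F (norm \<zeta>))) z =
      of_real (2 * enn2real (\<integral>\<^sup>+s. ennreal (F s * kernel_mean \<mu> (norm z * s)) \<partial>\<mu>))"
proof -
  let ?f = "\<lambda>\<zeta>. complex_of_real (F (norm \<zeta>))"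
  let ?Q = "\<integral>\<^sup>+s. ennreal (F s * kernel_mean \<mu> (norm z * s)) \<partial>\<mu>"
  note [measurable] = borel_measurable_radial_kernel[OF interval_\<mu> thick_\<mu>]
  define g where "g \<zeta> = F (norm \<zeta>) * norm (radial_kernel \<mu> (cnj z * \<zeta>)) * W (norm \<zeta>)" for \<zeta>
  have [measurable]: "g \<in> borel_measurable borel" unfolding g_def by measurable
  have g0: "0 \<le> g \<zeta>" for \<zeta> using F W_nonneg by (simp add: g_def)
  have AEg: "AE \<zeta> in dA. Pplus_integrand w ?f z \<zeta> = of_real (g \<zeta>)"
    using Pplus_integrand_AE[OF z, of ?f] by eventually_elim (simp add: g_def)
  have nng: "(\<integral>\<^sup>+\<zeta>. ennreal (g \<zeta>) \<partial>dA) = 2 * ?Q"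
  proof -
    have "(\<integral>\<^sup>+\<zeta>. ennreal (g \<zeta>) \<partial>dA) = (\<integral>\<^sup>+\<zeta>. ennreal (g \<zeta>) \<partial>disc_measure)" by (rule nn_integral_dA) measurable
    also have "\<dots> = (\<integral>\<^sup>+\<zeta>. ennreal (F (norm \<zeta>)) * ennreal (W (norm \<zeta>)) * ennreal (norm (radial_kernel \<mu> (cnj z * \<zeta>))) \<partial>disc_measure)"
      by (intro nn_integral_cong) (simp add: g_def ennreal_mult F W_nonneg mult_ac)
    also have "\<dots> = 2 * (\<integral>\<^sup>+s. ennreal (F s) * ennreal (kernel_mean \<mu> (norm z * s)) \<partial>\<mu>)"
      by (rule nn_integral_disc_kernel[OF interval_\<mu> thick_\<mu> z]) measurable
    also have "\<dots> = 2 * ?Q" by (simp add: ennreal_mult F kernel_mean_nonneg[OF interval_\<mu> thick_\<mu>])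
    finally show ?thesis .
  qed
  have intg: "integrable dA g"
  proof -
    have Re: "integrable dA (\<lambda>\<zeta>. Re (Pplus_integrand w ?f z \<zeta>))" using int by (rule integrable_Re)
    show ?thesis
    proof (rule integrable_cong_AE[THEN iffD1, OF _ _ _ Re])
      show "g \<in> borel_measurable dA" by (rule borel_measurable_dA) measurable
      show "AE \<zeta> in dA. Re (Pplus_integrand w ?f z \<zeta>) = g \<zeta>" using AEg by eventually_elim simp
    qed (rule borel_measurable_integrable[OF Re])
  qed
  have "(\<integral>\<^sup>+\<zeta>. ennreal (g \<zeta>) \<partial>dA) = ennreal (\<integral>\<zeta>. g \<zeta> \<partial>dA)"
    using intg g0 by (intro nn_integral_eq_integral) auto
  then have Q: "2 * ?Q = ennreal (\<integral>\<zeta>. g \<zeta> \<partial>dA)" by (simp only: nng)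
  then have "2 * ?Q < \<infinity>" by simp
  then show fin: "?Q < \<infinity>" by (auto simp: ennreal_mult_less_top)
  have g_int: "0 \<le> (\<integral>\<zeta>. g \<zeta> \<partial>dA)" using g0 by (intro integral_nonneg_AE) auto
  then have Qr: "(\<integral>\<zeta>. g \<zeta> \<partial>dA) = 2 * enn2real ?Q"
  proof -
    have "enn2real (2 * ?Q) = (\<integral>\<zeta>. g \<zeta> \<partial>dA)" unfolding Q using g_int by (rule enn2real_ennreal)
    then show ?thesis by (simp add: enn2real_mult)
  qed
  have "Pplus w ?f z = (\<integral>\<zeta>. complex_of_real (g \<zeta>) \<partial>dA)"
    unfolding Pplus_def
  proof (rule integral_cong_AE)
    show "(\<lambda>\<zeta>. complex_of_real (g \<zeta>)) \<in> borel_measurable dA" by (rule borel_measurable_dA) measurable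
  qed (rule borel_measurable_integrable[OF int], rule AEg)
  also have "\<dots> = of_real (\<integral>\<zeta>. g \<zeta> \<partial>dA)" by (rule integral_complex_of_real)
  finally show "Pplus w ?f z = of_real (2 * enn2real ?Q)" by (simp only: Qr)
qed

end

section \<open>Testing boundedness on radial functions\<close>

context two_weights
begin

text \<open>Norms are compared through p-th powers, which gives C^p; 1 is added to have a positive
  constant. The 2 in front of the integrals cancels, and the one inside the operator is
  dropped.\<close>

lemma Pplus_bounded_radial:
  assumes "Pplus_bounded p \<omega> \<nu>"
  obtains C where "0 < C"
    "\<And>F r. F \<in> borel_measurable borel \<Longrightarrow> (\<And>s. 0 \<le> F s) \<Longrightarrow> (\<integral>\<^sup>+s. ennreal (F s powr p) \<partial>N.\<mu>) < \<infinity> \<Longrightarrow>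
      0 \<le> r \<Longrightarrow> r < 1 \<Longrightarrow> (\<integral>\<^sup>+s. ennreal (F s * kernel_mean O.\<mu> (r * s)) \<partial>O.\<mu>) < \<infinity>"
    "\<And>F. F \<in> borel_measurable borel \<Longrightarrow> (\<And>s. 0 \<le> F s) \<Longrightarrow> (\<integral>\<^sup>+s. ennreal (F s powr p) \<partial>N.\<mu>) < \<infinity> \<Longrightarrow>
      (\<integral>\<^sup>+r. ennreal (enn2real (\<integral>\<^sup>+s. ennreal (F s * kernel_mean O.\<mu> (r * s)) \<partial>O.\<mu>) powr p) \<partial>N.\<mu>)
        \<le> ennreal C * (\<integral>\<^sup>+s. ennreal (F s powr p) \<partial>N.\<mu>)"
proof -
  obtain C0 where C0: "\<And>f. f \<in> Lp p \<nu> \<Longrightarrow> (\<forall>z\<in>ball 0 1. integrable dA (Pplus_integrand \<omega> f z)) \<and>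
      Pplus \<omega> f \<in> Lp p \<nu> \<and> Lp_norm p \<nu> (Pplus \<omega> f) \<le> ennreal C0 * Lp_norm p \<nu> f"
    using assms unfolding Pplus_bounded_def by blast
  \<comment> \<open>A negative C0 acts as 0 under \<open>ennreal\<close>, so it may be replaced by a
    nonnegative constant.\<close>
  define C where "C = max C0 0"
  have CC: "ennreal C0 = ennreal C" "0 \<le> C" by (auto simp: C_def max_def ennreal_neg)
  have main: "(0 \<le> r \<and> r < 1 \<longrightarrow> (\<integral>\<^sup>+s. ennreal (F s * kernel_mean O.\<mu> (r * s)) \<partial>O.\<mu>) < \<infinity>) \<and>
      (\<integral>\<^sup>+r. ennreal (enn2real (\<integral>\<^sup>+s. ennreal (F s * kernel_mean O.\<mu> (r * s)) \<partial>O.\<mu>) powr p) \<partial>N.\<mu>)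
        \<le> ennreal (C powr p + 1) * (\<integral>\<^sup>+s. ennreal (F s powr p) \<partial>N.\<mu>)"
    if F [measurable]: "F \<in> borel_measurable borel" and F0: "\<And>s. 0 \<le> F s" and fin: "(\<integral>\<^sup>+s. ennreal (F s powr p) \<partial>N.\<mu>) < \<infinity>" for F r
  proof -
    let ?f = "\<lambda>\<zeta>. complex_of_real (F (norm \<zeta>))"
    define Q where "Q r = (\<integral>\<^sup>+s. ennreal (F s * kernel_mean O.\<mu> (r * s)) \<partial>O.\<mu>)" for r
    note [measurable] = borel_measurable_kernel_mean[OF O.interval_\<mu> O.thick_\<mu>]
    have Q_meas [measurable]: "Q \<in> borel_measurable borel"
    proof -
      interpret mu: finite_measure O.\<mu> using O.interval_\<mu> by (simp add: interval_measure_def)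
      have "(\<lambda>(r, s). ennreal (F s * kernel_mean O.\<mu> (r * s))) \<in> borel_measurable (borel \<Otimes>\<^sub>M O.\<mu>)"
        unfolding measurable_cong_sets[OF sets_pair_measure_cong[OF refl sets_weight_measure] refl]
        by measurable
      then show ?thesis unfolding Q_def[abs_def] by (rule mu.borel_measurable_nn_integral)
    qed
    define X where "X = enn2real (\<integral>\<^sup>+s. ennreal (F s powr p) \<partial>N.\<mu>)"
    have X: "(\<integral>\<^sup>+s. ennreal (F s powr p) \<partial>N.\<mu>) = ennreal X" "0 \<le> X" using fin by (auto simp: X_def)
    have normp: "(\<integral>\<^sup>+z. ennreal (norm (complex_of_real (G (norm z))) powr p * \<nu> z) \<partial>dA) = 2 * (\<integral>\<^sup>+s. ennreal (G s powr p) \<partial>N.\<mu>)"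
      if [measurable]: "G \<in> borel_measurable borel" and "\<And>s. 0 \<le> G s" for G :: "real \<Rightarrow> real"
      using that(2) by (subst N.nn_integral_dA_radial[symmetric]) (auto simp: ennreal_mult' intro!: nn_integral_cong)
    have X2: "(\<integral>\<^sup>+z. ennreal (norm (?f z) powr p * \<nu> z) \<partial>dA) = ennreal (2 * X)"
      using normp[OF F F0] X by (simp add: ennreal_mult)
    have fLp: "?f \<in> Lp p \<nu>"
    proof -
      have "?f \<in> borel_measurable dA" by (rule borel_measurable_dA) measurable
      moreover have "Lp_norm p \<nu> ?f < \<infinity>" unfolding Lp_norm_finite_iff X2 by simp
      ultimately show ?thesis by (simp only: Lp_def mem_Collect_eq simp_thms)
    qed
    note bd = C0[OF fLp]
    have Qfin: "Q r < \<infinity>" if "0 \<le> r" "r < 1" for r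
      using O.Pplus_radial(1)[OF F F0, of "of_real r"] bd that unfolding Q_def by auto
    have Peq: "Pplus \<omega> ?f z = of_real (2 * enn2real (Q (norm z)))" if "norm z < 1" for z
      using O.Pplus_radial(2)[OF F F0 that] bd that unfolding Q_def by auto
    have "Lp_norm p \<nu> (Pplus \<omega> ?f) \<le> ennreal C * Lp_norm p \<nu> ?f" using bd CC by simp
    then have "(\<integral>\<^sup>+z. ennreal (norm (Pplus \<omega> ?f z) powr p * \<nu> z) \<partial>dA) \<le> ennreal (C powr p * (2 * X))"
      using Lp_norm_le_iff[OF p X2 _ CC(2)] X by simp
    also have "(\<integral>\<^sup>+z. ennreal (norm (Pplus \<omega> ?f z) powr p * \<nu> z) \<partial>dA) =
      (\<integral>\<^sup>+z. ennreal (norm (complex_of_real (2 * enn2real (Q (norm z)))) powr p * \<nu> z) \<partial>dA)"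
      by (rule nn_integral_cong) (simp add: Peq)
    also have "\<dots> = 2 * (\<integral>\<^sup>+s. ennreal ((2 * enn2real (Q s)) powr p) \<partial>N.\<mu>)"
      by (rule normp) auto
    finally have "2 * (\<integral>\<^sup>+s. ennreal ((2 * enn2real (Q s)) powr p) \<partial>N.\<mu>) \<le> 2 * ennreal (C powr p * X)"
      using X by (simp add: ennreal_mult mult_ac)
    then have "(\<integral>\<^sup>+s. ennreal ((2 * enn2real (Q s)) powr p) \<partial>N.\<mu>) \<le> ennreal (C powr p * X)"
      by (simp add: ennreal_mult_le_mult_iff)
    moreover have "(\<integral>\<^sup>+s. ennreal (enn2real (Q s) powr p) \<partial>N.\<mu>) \<le> (\<integral>\<^sup>+s. ennreal ((2 * enn2real (Q s)) powr p) \<partial>N.\<mu>)"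
      using p by (intro nn_integral_mono ennreal_leI powr_mono2) auto
    moreover have "ennreal (C powr p * X) \<le> ennreal (C powr p + 1) * ennreal X"
      using X(2) by (simp add: ennreal_mult[symmetric] algebra_simps)
    ultimately have "(\<integral>\<^sup>+s. ennreal (enn2real (Q s) powr p) \<partial>N.\<mu>) \<le> ennreal (C powr p + 1) * (\<integral>\<^sup>+s. ennreal (F s powr p) \<partial>N.\<mu>)"
      unfolding X(1) by (meson order_trans)
    then show ?thesis using Qfin unfolding Q_def by blast
  qed
  show ?thesis
  proof (rule that)
    show "0 < C powr p + 1" by (simp add: add_nonneg_pos)
  qed (use main in blast)+
qed

text \<open>The case of equality in Hoelder's inequality for the pairing with s^n: both F^p \<nu>
  and F s^n \<omega> become s^(n p') \<sigma>, as \<open>extremal_eq\<close> verifies.\<close>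

definition extremal :: "nat \<Rightarrow> real \<Rightarrow> real" where
  "extremal n s = (if V s = 0 then 0 else s powr (real n * (p' - 1)) * (W s / V s) powr (1 / (p - 1)))"

lemma extremal_meas [measurable]: "extremal n \<in> borel_measurable borel"
  unfolding extremal_def[abs_def] by measurable

lemma extremal_nonneg: "0 \<le> extremal n s"
  by (simp add: extremal_def)

lemma extremal_eq:
  assumes s: "0 < s" and V: "V s \<noteq> 0"
  shows "extremal n s powr p * V s = s powr (real n * p') * (W s / V s powr (1 / p)) powr p'"
    and "extremal n s * s powr real n * W s = s powr (real n * p') * (W s / V s powr (1 / p)) powr p'"
proof -
  have V0: "0 < V s" using V N.W_nonneg[of s] by simp
  have e1: "p * (1 / (p - 1)) = p'" "1 / (p - 1) + 1 = p'" "p' * (1 / p) = p' - 1" "p' - 1 = 1 / (p - 1)" "p * (p' - 1) = p'"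
    using p by (auto simp: conj_exp_def field_simps)
  show "extremal n s powr p * V s = s powr (real n * p') * (W s / V s powr (1 / p)) powr p'"
  proof (cases "W s = 0")
    case False
    then have W0: "0 < W s" using O.W_nonneg[of s] by simp
    have "extremal n s powr p * V s = s powr (real n * (p * (p' - 1))) * (W s powr (p * (1 / (p - 1))) / V s powr (p * (1 / (p - 1)))) * V s"
      using V0 W0 s by (simp add: extremal_def powr_mult powr_divide powr_powr mult_ac)
    also have "\<dots> = s powr (real n * p') * (W s powr p' * (V s / V s powr p'))"
      unfolding e1 by simp
    also have "V s / V s powr p' = 1 / V s powr (p' - 1)"
      using V0 powr_diff[of "V s" p' 1] by simp
    also have "s powr (real n * p') * (W s powr p' * (1 / V s powr (p' - 1))) = s powr (real n * p') * (W s / V s powr (1 / p)) powr p'"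
    proof -
      have "(V s powr (1 / p)) powr p' = V s powr (p' - 1)" unfolding powr_powr using e1(3) by (simp add: mult.commute)
      then show ?thesis using V0 W0 by (simp add: powr_divide)
    qed
    finally show ?thesis .
  qed (use V p p'_gt_1 in \<open>simp add: extremal_def\<close>)
  show "extremal n s * s powr real n * W s = s powr (real n * p') * (W s / V s powr (1 / p)) powr p'"
  proof (cases "W s = 0")
    case False
    then have W0: "0 < W s" using O.W_nonneg[of s] by simp
    have "extremal n s * s powr real n * W s = (s powr (real n * (p' - 1)) * s powr real n) * ((W s powr (1 / (p - 1)) * W s powr 1) / V s powr (1 / (p - 1)))"
      using V0 W0 V by (simp add: extremal_def powr_divide mult_ac)
    also have "\<dots> = s powr (real n * p') * (W s powr p' / V s powr (p' - 1))"
      unfolding powr_add[symmetric] using e1 by (simp add: algebra_simps)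
    also have "\<dots> = s powr (real n * p') * (W s / V s powr (1 / p)) powr p'"
    proof -
      have "(V s powr (1 / p)) powr p' = V s powr (p' - 1)" unfolding powr_powr using e1(3) by (simp add: mult.commute)
      then show ?thesis using V0 W0 by (simp add: powr_divide)
    qed
    finally show ?thesis .
  qed (use V p p'_gt_1 in \<open>simp add: extremal_def\<close>)
qed

section \<open>Consequences of the bound on radial functions\<close>

context
  fixes C :: real
  assumes C: "0 < C"
    and fin: "\<And>F r. F \<in> borel_measurable borel \<Longrightarrow> (\<And>s. 0 \<le> F s) \<Longrightarrow> (\<integral>\<^sup>+s. ennreal (F s powr p) \<partial>N.\<mu>) < \<infinity> \<Longrightarrow>
      0 \<le> r \<Longrightarrow> r < 1 \<Longrightarrow> (\<integral>\<^sup>+s. ennreal (F s * kernel_mean O.\<mu> (r * s)) \<partial>O.\<mu>) < \<infinity>"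
    and bound: "\<And>F. F \<in> borel_measurable borel \<Longrightarrow> (\<And>s. 0 \<le> F s) \<Longrightarrow> (\<integral>\<^sup>+s. ennreal (F s powr p) \<partial>N.\<mu>) < \<infinity> \<Longrightarrow>
      (\<integral>\<^sup>+r. ennreal (enn2real (\<integral>\<^sup>+s. ennreal (F s * kernel_mean O.\<mu> (r * s)) \<partial>O.\<mu>) powr p) \<partial>N.\<mu>)
        \<le> ennreal C * (\<integral>\<^sup>+s. ennreal (F s powr p) \<partial>N.\<mu>)"
begin

text \<open>A lower bound c r^n s^n separates the variables: the image of F is at least c I r^n, and
  its p-th power integrates to a moment of \<nu> of order n p.\<close>

lemma test_bound:
  assumes c: "0 < c" "\<And>r s. 0 < r \<Longrightarrow> r < 1 \<Longrightarrow> 0 < s \<Longrightarrow> s < 1 \<Longrightarrow> c * r powr real n * s powr real n \<le> kernel_mean O.\<mu> (r * s)"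
    and F [measurable]: "F \<in> borel_measurable borel" and F0: "\<And>s. 0 \<le> F s" and finF: "(\<integral>\<^sup>+s. ennreal (F s powr p) \<partial>N.\<mu>) < \<infinity>"
  defines "I \<equiv> \<integral>\<^sup>+s. ennreal (F s * s powr real n) \<partial>O.\<mu>"
  shows "I < \<infinity>" "ennreal ((c * enn2real I) powr p * power_moment N.\<mu> (real n * p)) \<le> ennreal C * (\<integral>\<^sup>+s. ennreal (F s powr p) \<partial>N.\<mu>)"
proof -
  define Q where "Q r = (\<integral>\<^sup>+s. ennreal (F s * kernel_mean O.\<mu> (r * s)) \<partial>O.\<mu>)" for r
  have QI: "ennreal (c * r powr real n) * I \<le> Q r" if r: "0 < r" "r < 1" for r
  proof -
    have "ennreal (c * r powr real n) * I = (\<integral>\<^sup>+s. ennreal (c * r powr real n) * ennreal (F s * s powr real n) \<partial>O.\<mu>)"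
      unfolding I_def by (rule nn_integral_cmult[symmetric]) simp
    also have "\<dots> \<le> Q r"
      unfolding Q_def
    proof (rule nn_integral_mono_AE)
      show "AE s in O.\<mu>. ennreal (c * r powr real n) * ennreal (F s * s powr real n) \<le> ennreal (F s * kernel_mean O.\<mu> (r * s))"
        using AE_interval_measure[OF O.interval_\<mu>]
      proof eventually_elim
        fix s :: real assume s: "0 < s \<and> s < 1"
        have "F s * (c * r powr real n * s powr real n) \<le> F s * kernel_mean O.\<mu> (r * s)"
          using c(2)[of r s] r s F0 by (intro mult_left_mono) auto
        then show "ennreal (c * r powr real n) * ennreal (F s * s powr real n) \<le> ennreal (F s * kernel_mean O.\<mu> (r * s))"
          using c F0[of s] by (simp add: ennreal_mult[symmetric] mult_ac ennreal_leI)
      qed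
    qed
    finally show ?thesis .
  qed
  have Qfin: "Q r < \<infinity>" if "0 < r" "r < 1" for r unfolding Q_def using that F0 finF by (intro fin) auto
  \<comment> \<open>A single radius already shows that I is finite.\<close>
  have "ennreal (c * (1/2) powr real n) * I < \<infinity>" using QI[of "1/2"] Qfin[of "1/2"] by (auto intro: le_less_trans)
  moreover have "0 < c * (1/2) powr real n" using c by simp
  ultimately show Ifin: "I < \<infinity>" by (auto simp: ennreal_mult_less_top)
  have "ennreal ((c * enn2real I) powr p * power_moment N.\<mu> (real n * p)) =
    ennreal ((c * enn2real I) powr p) * (\<integral>\<^sup>+r. ennreal (r powr (real n * p)) \<partial>N.\<mu>)"
    unfolding power_moment_def using N.interval_\<mu> p
    by (subst nn_integral_eq_integral) (auto simp: ennreal_mult integral_nonneg_AE)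
  also have "\<dots> = (\<integral>\<^sup>+r. ennreal ((c * enn2real I) powr p) * ennreal (r powr (real n * p)) \<partial>N.\<mu>)"
    by (rule nn_integral_cmult[symmetric]) simp
  also have "\<dots> \<le> (\<integral>\<^sup>+r. ennreal (enn2real (Q r) powr p) \<partial>N.\<mu>)"
  proof (rule nn_integral_mono_AE)
    show "AE r in N.\<mu>. ennreal ((c * enn2real I) powr p) * ennreal (r powr (real n * p)) \<le> ennreal (enn2real (Q r) powr p)"
      using AE_interval_measure[OF N.interval_\<mu>]
    proof eventually_elim
      fix r :: real assume r: "0 < r \<and> r < 1"
      have "enn2real (ennreal (c * r powr real n) * I) \<le> enn2real (Q r)"
        using QI[of r] Qfin[of r] r by (intro enn2real_mono) auto
      then have "c * r powr real n * enn2real I \<le> enn2real (Q r)" using c by (simp add: enn2real_mult)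
      then have "(c * r powr real n * enn2real I) powr p \<le> enn2real (Q r) powr p"
        using c p by (intro powr_mono2) auto
      also have "(c * r powr real n * enn2real I) powr p = (c * enn2real I) powr p * r powr (real n * p)"
        by (simp add: powr_mult powr_powr mult_ac)
      finally show "ennreal ((c * enn2real I) powr p) * ennreal (r powr (real n * p)) \<le> ennreal (enn2real (Q r) powr p)"
        by (simp add: ennreal_mult[symmetric] ennreal_leI)
    qed
  qed
  also have "\<dots> \<le> ennreal C * (\<integral>\<^sup>+s. ennreal (F s powr p) \<partial>N.\<mu>)"
    unfolding Q_def using F0 finF by (intro bound) auto
  finally show "ennreal ((c * enn2real I) powr p * power_moment N.\<mu> (real n * p)) \<le> ennreal C * (\<integral>\<^sup>+s. ennreal (F s powr p) \<partial>N.\<mu>)" .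
qed

lemma kernel_mean_ge_power:
  assumes "0 < r" "r < 1" "0 < s" "s < 1"
  shows "kernel_coeff O.\<mu> n * r powr real n * s powr real n \<le> kernel_mean O.\<mu> (r * s)"
proof -
  have "0 \<le> r * s" "r * s < 1" using assms mult_strict_mono'[of r 1 s 1] by auto
  then have "kernel_coeff O.\<mu> n * (r * s) ^ n \<le> kernel_mean O.\<mu> (r * s)"
    by (rule kernel_mean_ge_coeff[OF O.interval_\<mu> O.thick_\<mu>])
  then show ?thesis using assms by (simp add: powr_realpow power_mult_distrib mult.assoc)
qed

text \<open>For J \<le> n \<le> m the coefficients are at least the J-th and the powers at least
  \<rho>^m with \<rho> = r s, so the logarithmic sum gains the harmonic sum of the block.\<close>

lemma kernel_mean_ge_block:
  assumes "0 < r" "r < 1" "0 < s" "s < 1" and J: "1 \<le> J" "J \<le> m"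
  shows "(kernel_coeff O.\<mu> J * (\<Sum>n=J..m. 1 / real n) / pi) * r powr real m * s powr real m \<le> kernel_mean O.\<mu> (r * s)"
proof -
  define \<rho> where "\<rho> = r * s"
  have \<rho>: "0 < \<rho>" "\<rho> < 1" using assms mult_strict_mono'[of r 1 s 1] by (auto simp: \<rho>_def)
  note e = kernel_coeff_pos[OF O.interval_\<mu> O.thick_\<mu>]
  have "kernel_coeff O.\<mu> J * \<rho> ^ m * (\<Sum>n=J..m. 1 / real n) = (\<Sum>n=J..m. kernel_coeff O.\<mu> J * \<rho> ^ m / real n)"
    by (simp add: sum_distrib_left)
  also have "\<dots> \<le> (\<Sum>n=J..m. kernel_coeff O.\<mu> n * \<rho> ^ n / real n)"
  proof (rule sum_mono)
    fix n assume n: "n \<in> {J..m}"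
    have "kernel_coeff O.\<mu> J * \<rho> ^ m \<le> kernel_coeff O.\<mu> n * \<rho> ^ n"
      using n \<rho> e[of n] kernel_coeff_mono[OF O.interval_\<mu> O.thick_\<mu>, of J n]
      by (intro mult_mono power_decreasing) auto
    then show "kernel_coeff O.\<mu> J * \<rho> ^ m / real n \<le> kernel_coeff O.\<mu> n * \<rho> ^ n / real n" by (rule divide_right_mono) simp
  qed
  also have "\<dots> \<le> (\<Sum>n=1..m. kernel_coeff O.\<mu> n * \<rho> ^ n / real n)"
    using J e \<rho> by (intro sum_mono2) (auto intro!: divide_nonneg_nonneg mult_nonneg_nonneg simp: less_imp_le)
  also have "\<dots> \<le> pi * kernel_mean O.\<mu> \<rho>"
    using \<rho> by (intro kernel_mean_ge_log_sum[OF O.interval_\<mu> O.thick_\<mu>]) auto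
  finally have "kernel_coeff O.\<mu> J * \<rho> ^ m * (\<Sum>n=J..m. 1 / real n) / pi \<le> kernel_mean O.\<mu> \<rho>"
    by (simp add: divide_le_eq mult.commute)
  moreover have "\<rho> ^ m = r powr real m * s powr real m"
    using assms by (simp add: \<rho>_def powr_realpow power_mult_distrib)
  ultimately show ?thesis by (simp add: \<rho>_def mult_ac)
qed

text \<open>The indicator of {V = 0} has norm 0 for the weight \<nu>, hence so has its image; the
  test with n = 0 then shows that \<omega> has no mass on this set.\<close>

lemma AE_V_zero: "AE s in lborel. 0 < s \<and> s < 1 \<and> W s \<noteq> 0 \<longrightarrow> V s \<noteq> 0"
proof -
  define F where "F s = (indicator {s. V s = 0} s :: real)" for s
  have F [measurable]: "F \<in> borel_measurable borel" unfolding F_def by measurable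
  have F0: "0 \<le> F s" for s by (simp add: F_def)
  have zero: "(\<integral>\<^sup>+s. ennreal (F s powr p) \<partial>N.\<mu>) = 0"
  proof -
    have "(\<integral>\<^sup>+s. ennreal (F s powr p) \<partial>N.\<mu>) = (\<integral>\<^sup>+s. ennreal (V s) * ennreal (F s powr p) \<partial>weight_measure (\<lambda>_. 1))"
      by (rule nn_integral_weight_base) measurable
    also have "\<dots> = (\<integral>\<^sup>+s. 0 \<partial>weight_measure (\<lambda>_. 1))"
      by (rule nn_integral_cong) (auto simp: F_def indicator_def)
    finally show ?thesis by simp
  qed
  let ?I = "\<integral>\<^sup>+s. ennreal (F s * s powr real 0) \<partial>O.\<mu>"
  have tb: "?I < \<infinity>" "ennreal ((kernel_coeff O.\<mu> 0 * enn2real ?I) powr p * power_moment N.\<mu> (real 0 * p)) \<le> ennreal C * 0"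
    using test_bound[OF kernel_coeff_pos[OF O.interval_\<mu> O.thick_\<mu>, of 0] kernel_mean_ge_power F F0]
    unfolding zero by auto
  have "(kernel_coeff O.\<mu> 0 * enn2real ?I) powr p * power_moment N.\<mu> (real 0 * p) \<le> 0"
    using tb(2) by (simp add: ennreal_eq_0_iff)
  then have "(kernel_coeff O.\<mu> 0 * enn2real ?I) powr p \<le> 0"
    using power_moment_pos[OF N.interval_\<mu> N.thick_\<mu>, of 0] by (simp add: mult_le_0_iff)
  then have "(kernel_coeff O.\<mu> 0 * enn2real ?I) powr p = 0"
    by (intro antisym powr_ge_zero)
  then have "enn2real ?I = 0"
    using kernel_coeff_pos[OF O.interval_\<mu> O.thick_\<mu>, of 0] by simp
  then have "?I = 0" using tb(1) by (auto simp: enn2real_eq_0_iff)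
  then have "AE s in O.\<mu>. ennreal (F s * s powr real 0) = 0" by (subst (asm) nn_integral_0_iff_AE) auto
  then have "AE s in O.\<mu>. 0 < s \<and> s < 1 \<longrightarrow> V s \<noteq> 0"
    by eventually_elim (auto simp: F_def indicator_def)
  then have "AE s in lborel. 0 < s \<and> s < 1 \<and> ennreal (W s) \<noteq> 0 \<longrightarrow> 0 < s \<and> s < 1 \<longrightarrow> V s \<noteq> 0"
    by (subst (asm) AE_weight_iff) auto
  then show ?thesis
  proof eventually_elim
    fix s assume "0 < s \<and> s < 1 \<and> ennreal (W s) \<noteq> 0 \<longrightarrow> 0 < s \<and> s < 1 \<longrightarrow> V s \<noteq> 0"
    then show "0 < s \<and> s < 1 \<and> W s \<noteq> 0 \<longrightarrow> V s \<noteq> 0"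
      using O.W_nonneg[of s] by (auto simp: ennreal_eq_0_iff)
  qed
qed

text \<open>On {V = 0} the profile W vanishes almost everywhere, so \<sigma> does as well and
  nothing is contributed; elsewhere this is \<open>extremal_eq\<close> integrated.\<close>

lemma nn_integral_extremal:
  assumes [measurable]: "A \<in> sets borel"
  shows "(\<integral>\<^sup>+s. ennreal ((extremal n s * indicator A s) powr p) \<partial>N.\<mu>) = (\<integral>\<^sup>+s. indicator A s * ennreal (s powr (real n * p')) \<partial>SM)"
    and "(\<integral>\<^sup>+s. ennreal (extremal n s * indicator A s * s powr real n) \<partial>O.\<mu>) = (\<integral>\<^sup>+s. indicator A s * ennreal (s powr (real n * p')) \<partial>SM)"
proof -
  let ?B = "weight_measure (\<lambda>_. 1)"
  have V: "AE s in ?B. W s \<noteq> 0 \<longrightarrow> V s \<noteq> 0"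
    using AE_V_zero by (subst AE_weight_iff) (auto elim!: eventually_mono)
  have pos: "AE s in ?B. 0 < s \<and> s < 1" by (rule AE_weight_measure) simp
  have SM: "(\<integral>\<^sup>+s. indicator A s * ennreal (s powr (real n * p')) \<partial>SM) = (\<integral>\<^sup>+s. S s * (indicator A s * ennreal (s powr (real n * p'))) \<partial>?B)"
    by (rule nn_integral_weight_base) measurable
  have "(\<integral>\<^sup>+s. ennreal ((extremal n s * indicator A s) powr p) \<partial>N.\<mu>) = (\<integral>\<^sup>+s. ennreal (V s) * ennreal ((extremal n s * indicator A s) powr p) \<partial>?B)"
    by (rule nn_integral_weight_base) measurable
  also have "\<dots> = (\<integral>\<^sup>+s. S s * (indicator A s * ennreal (s powr (real n * p'))) \<partial>?B)"
  proof (rule nn_integral_cong_AE)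
    show "AE s in ?B. ennreal (V s) * ennreal ((extremal n s * indicator A s) powr p) = S s * (indicator A s * ennreal (s powr (real n * p')))"
      using V pos
    proof eventually_elim
      fix s assume V: "W s \<noteq> 0 \<longrightarrow> V s \<noteq> 0" and s: "0 < s \<and> s < 1"
      show "ennreal (V s) * ennreal ((extremal n s * indicator A s) powr p) = S s * (indicator A s * ennreal (s powr (real n * p')))"
      proof (cases "V s = 0 \<or> s \<notin> A")
        case True
        then show ?thesis using V p by (auto simp: sigma_radial_def)
      next
        case False
        then have "ennreal (V s) * ennreal ((extremal n s * indicator A s) powr p) = ennreal (extremal n s powr p * V s)"
          by (simp add: ennreal_mult N.W_nonneg mult.commute)
        also have "\<dots> = ennreal (s powr (real n * p') * (W s / V s powr (1 / p)) powr p')"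
          using extremal_eq(1)[of s n] s False by simp
        also have "\<dots> = S s * (indicator A s * ennreal (s powr (real n * p')))"
          using False by (simp add: sigma_radial_def ennreal_mult mult.commute)
        finally show ?thesis .
      qed
    qed
  qed
  finally show "(\<integral>\<^sup>+s. ennreal ((extremal n s * indicator A s) powr p) \<partial>N.\<mu>) = (\<integral>\<^sup>+s. indicator A s * ennreal (s powr (real n * p')) \<partial>SM)"
    by (simp only: SM)
  have "(\<integral>\<^sup>+s. ennreal (extremal n s * indicator A s * s powr real n) \<partial>O.\<mu>) = (\<integral>\<^sup>+s. ennreal (W s) * ennreal (extremal n s * indicator A s * s powr real n) \<partial>?B)"
    by (rule nn_integral_weight_base) measurable
  also have "\<dots> = (\<integral>\<^sup>+s. S s * (indicator A s * ennreal (s powr (real n * p'))) \<partial>?B)"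
  proof (rule nn_integral_cong_AE)
    show "AE s in ?B. ennreal (W s) * ennreal (extremal n s * indicator A s * s powr real n) = S s * (indicator A s * ennreal (s powr (real n * p')))"
      using V pos
    proof eventually_elim
      fix s assume V: "W s \<noteq> 0 \<longrightarrow> V s \<noteq> 0" and s: "0 < s \<and> s < 1"
      show "ennreal (W s) * ennreal (extremal n s * indicator A s * s powr real n) = S s * (indicator A s * ennreal (s powr (real n * p')))"
      proof (cases "V s = 0 \<or> s \<notin> A")
        case True
        then show ?thesis using V p by (auto simp: sigma_radial_def)
      next
        case False
        then have "ennreal (W s) * ennreal (extremal n s * indicator A s * s powr real n) = ennreal (extremal n s * s powr real n * W s)"
          by (simp add: ennreal_mult O.W_nonneg extremal_nonneg mult_ac)
        also have "\<dots> = ennreal (s powr (real n * p') * (W s / V s powr (1 / p)) powr p')"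
          using extremal_eq(2)[of s n] s False by simp
        also have "\<dots> = S s * (indicator A s * ennreal (s powr (real n * p')))"
          using False by (simp add: sigma_radial_def ennreal_mult mult.commute)
        finally show ?thesis .
      qed
    qed
  qed
  finally show "(\<integral>\<^sup>+s. ennreal (extremal n s * indicator A s * s powr real n) \<partial>O.\<mu>) = (\<integral>\<^sup>+s. indicator A s * ennreal (s powr (real n * p')) \<partial>SM)"
    by (simp only: SM)
qed

text \<open>Testing with the extremal function gives (c x)^p m \<le> C x for the moment x of
  \<sigma>, hence x^(p-1) \<le> C / (c^p m). Dividing by x requires x finite, so the function is
  first cut off where it exceeds N, and monotone convergence removes the cut.\<close>

lemma moment_SM_bound:
  assumes c: "0 < c" "\<And>r s. 0 < r \<Longrightarrow> r < 1 \<Longrightarrow> 0 < s \<Longrightarrow> s < 1 \<Longrightarrow> c * r powr real n * s powr real n \<le> kernel_mean O.\<mu> (r * s)"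
  shows "(\<integral>\<^sup>+s. ennreal (s powr (real n * p')) \<partial>SM) \<le> ennreal ((C / (c powr p * power_moment N.\<mu> (real n * p))) powr (1 / (p - 1)))"
proof -
  define m where "m = power_moment N.\<mu> (real n * p)"
  have m: "0 < m" unfolding m_def using p by (intro power_moment_pos N.interval_\<mu> N.thick_\<mu>) auto
  define K where "K = (C / (c powr p * m)) powr (1 / (p - 1))"
  \<comment> \<open>On this set the extremal function is bounded, hence p-integrable, since \<nu>
    has finite mass.\<close>
  define A where "A N = {s. extremal n s \<le> real N}" for N :: nat
  have [measurable]: "A N \<in> sets borel" for N unfolding A_def by measurable
  define f where "f N s = indicator (A N) s * ennreal (s powr (real n * p'))" for N s
  have fN: "(\<integral>\<^sup>+s. f N s \<partial>SM) \<le> ennreal K" for N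
  proof -
    define F where "F s = extremal n s * indicator (A N) s" for s
    have [measurable]: "F \<in> borel_measurable borel" unfolding F_def by measurable
    have F0: "0 \<le> F s" for s by (simp add: F_def extremal_nonneg)
    have "F s \<le> real N" for s by (simp add: F_def A_def indicator_def)
    then have "(\<integral>\<^sup>+s. ennreal (F s powr p) \<partial>N.\<mu>) \<le> (\<integral>\<^sup>+s. ennreal (real N powr p) \<partial>N.\<mu>)"
      using F0 p by (intro nn_integral_mono ennreal_leI powr_mono2) auto
    also have "\<dots> < \<infinity>"
    proof -
      have "emeasure N.\<mu> UNIV < \<infinity>"
        using N.interval_\<mu> by (auto simp: interval_measure_def finite_measure_def finite_measure_axioms_def less_top)
      then show ?thesis by (simp add: ennreal_mult_less_top)
    qed
    finally have finF: "(\<integral>\<^sup>+s. ennreal (F s powr p) \<partial>N.\<mu>) < \<infinity>" .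
    have eqs: "(\<integral>\<^sup>+s. ennreal (F s powr p) \<partial>N.\<mu>) = (\<integral>\<^sup>+s. f N s \<partial>SM)"
      "(\<integral>\<^sup>+s. ennreal (F s * s powr real n) \<partial>O.\<mu>) = (\<integral>\<^sup>+s. f N s \<partial>SM)"
      unfolding F_def f_def by (rule nn_integral_extremal; measurable)+
    define x where "x = enn2real (\<integral>\<^sup>+s. f N s \<partial>SM)"
    have x: "(\<integral>\<^sup>+s. f N s \<partial>SM) = ennreal x" "0 \<le> x" using finF by (auto simp: x_def eqs)
    have "ennreal ((c * x) powr p * m) \<le> ennreal C * ennreal x"
      using test_bound(2)[OF c, of F] F0 finF by (simp add: eqs x(1) m_def x(2))
    then have le: "(c * x) powr p * m \<le> C * x"
      using C x(2) by (simp add: ennreal_mult[symmetric] ennreal_le_iff)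
    have "x \<le> K"
    proof (cases "x = 0")
      case False
      then have x0: "0 < x" using x by simp
      have "(c * x) powr p = c powr p * (x * x powr (p - 1))"
        using x0 c powr_add[of x 1 "p - 1"] by (simp add: powr_mult)
      with le have "x * (c powr p * m * x powr (p - 1)) \<le> x * C" by (simp add: mult_ac)
      then have "c powr p * m * x powr (p - 1) \<le> C" using x0 by simp
      then have "x powr (p - 1) \<le> C / (c powr p * m)" using c m by (simp add: pos_le_divide_eq mult_ac)
      then have "(x powr (p - 1)) powr (1 / (p - 1)) \<le> K"
        unfolding K_def using p by (intro powr_mono2) auto
      then show ?thesis using x0 p by (simp add: powr_powr)
    qed (simp add: K_def)
    then show ?thesis unfolding x(1) by (rule ennreal_leI)
  qed
  have "(\<integral>\<^sup>+s. ennreal (s powr (real n * p')) \<partial>SM) = (\<integral>\<^sup>+s. (SUP N. f N s) \<partial>SM)"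
  proof (rule nn_integral_cong)
    fix s
    obtain N :: nat where N: "extremal n s \<le> real N" using real_arch_simple by blast
    show "ennreal (s powr (real n * p')) = (SUP N. f N s)"
    proof (rule antisym)
      show "ennreal (s powr (real n * p')) \<le> (SUP N. f N s)"
        by (rule SUP_upper2[of N]) (use N in \<open>auto simp: f_def A_def\<close>)
      show "(SUP N. f N s) \<le> ennreal (s powr (real n * p'))"
        by (rule SUP_least) (auto simp: f_def indicator_def)
    qed
  qed
  also have "\<dots> = (SUP N. \<integral>\<^sup>+s. f N s \<partial>SM)"
  proof (rule nn_integral_monotone_convergence_SUP)
    show "incseq f"
      by (auto simp: incseq_def le_fun_def f_def A_def indicator_def)
  qed (auto simp: f_def)
  also have "\<dots> \<le> ennreal K" by (rule SUP_least) (rule fN)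
  finally show ?thesis by (simp add: K_def m_def)
qed

text \<open>The test with n = 0, where the circle mean is at least the constant coefficient.\<close>

lemma fin_SM: "emeasure SM UNIV < \<infinity>"
proof -
  have "emeasure SM UNIV = (\<integral>\<^sup>+s. 1 \<partial>SM)" by simp
  also have "\<dots> = (\<integral>\<^sup>+s. ennreal (s powr (real 0 * p')) \<partial>SM)"
    by (rule nn_integral_cong_AE) (use AE_weight_measure[OF S_meas] in eventually_elim, simp)
  also have "\<dots> \<le> ennreal ((C / (kernel_coeff O.\<mu> 0 powr p * power_moment N.\<mu> (real 0 * p))) powr (1 / (p - 1)))"
    by (rule moment_SM_bound[OF kernel_coeff_pos[OF O.interval_\<mu> O.thick_\<mu>] kernel_mean_ge_power])
  finally show ?thesis by (rule le_less_trans) simp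
qed

text \<open>The bound on the \<sigma>-moment raised to 1 / p', since (1 / (p - 1)) (1 / p') = 1 /
  p.\<close>

lemma moments_bound:
  assumes c: "0 < c" "\<And>r s. 0 < r \<Longrightarrow> r < 1 \<Longrightarrow> 0 < s \<Longrightarrow> s < 1 \<Longrightarrow> c * r powr real n * s powr real n \<le> kernel_mean O.\<mu> (r * s)"
  shows "c * (power_moment N.\<mu> (real n * p) powr (1 / p) * power_moment SM (real n * p') powr (1 / p')) \<le> C powr (1 / p)"
proof -
  define m where "m = power_moment N.\<mu> (real n * p)"
  define x where "x = power_moment SM (real n * p')"
  have m: "0 < m" unfolding m_def using p by (intro power_moment_pos N.interval_\<mu> N.thick_\<mu>) auto
  have x: "0 \<le> x" unfolding x_def using interval_S[OF fin_SM] by (rule power_moment_nonneg)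
  have "ennreal x = (\<integral>\<^sup>+s. ennreal (s powr (real n * p')) \<partial>SM)"
    unfolding x_def power_moment_def using interval_S[OF fin_SM] p'_gt_1 by (intro nn_integral_eq_integral[symmetric]) auto
  also have "\<dots> \<le> ennreal ((C / (c powr p * m)) powr (1 / (p - 1)))"
    unfolding m_def by (rule moment_SM_bound[OF c])
  finally have "x \<le> (C / (c powr p * m)) powr (1 / (p - 1))" by (simp add: ennreal_le_iff)
  then have "x powr (1 / p') \<le> ((C / (c powr p * m)) powr (1 / (p - 1))) powr (1 / p')"
    using x p'_gt_1 by (intro powr_mono2) auto
  also have "\<dots> = (C / (c powr p * m)) powr (1 / p)"
  proof -
    have "1 / (p - 1) * (1 / p') = 1 / p" using p by (simp add: conj_exp_def)
    then show ?thesis by (simp only: powr_powr)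
  qed
  also have "\<dots> = C powr (1 / p) / (c * m powr (1 / p))"
    using C c m p by (simp add: powr_divide powr_mult powr_powr)
  finally have "x powr (1 / p') * (c * m powr (1 / p)) \<le> C powr (1 / p)"
    using c m by (simp add: pos_le_divide_eq)
  then show ?thesis by (simp add: m_def x_def mult_ac)
qed

text \<open>Testing against the single coefficient c = 1 / (2 \<omega>_(2n+1)).\<close>

lemma D_const_finite: "D_const p \<omega> \<nu> < \<infinity>"
proof (rule D_const_finite_iff'[OF fin_SM, THEN iffD2], intro exI conjI allI)
  show "0 < 2 * C powr (1 / p)" using C by simp
  fix n :: nat
  define m where "m = power_moment O.\<mu> (2 * real n)"
  have m: "0 < m" unfolding m_def by (intro power_moment_pos O.interval_\<mu> O.thick_\<mu>) auto
  have "kernel_coeff O.\<mu> n * (power_moment N.\<mu> (real n * p) powr (1 / p) * power_moment SM (real n * p') powr (1 / p')) \<le> C powr (1 / p)"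
    by (rule moments_bound[OF kernel_coeff_pos[OF O.interval_\<mu> O.thick_\<mu>] kernel_mean_ge_power])
  then have "power_moment N.\<mu> (real n * p) powr (1 / p) * power_moment SM (real n * p') powr (1 / p') / (2 * m) \<le> C powr (1 / p)"
    by (simp add: kernel_coeff_def m_def)
  then show "power_moment N.\<mu> (real n * p) powr (1 / p) * power_moment SM (real n * p') powr (1 / p') \<le> 2 * C powr (1 / p) * power_moment O.\<mu> (2 * real n)"
  proof -
    assume "power_moment N.\<mu> (real n * p) powr (1 / p) * power_moment SM (real n * p') powr (1 / p') / (2 * m) \<le> C powr (1 / p)"
    then have "power_moment N.\<mu> (real n * p) powr (1 / p) * power_moment SM (real n * p') powr (1 / p') \<le> C powr (1 / p) * (2 * m)"
      using m by (subst (asm) pos_divide_le_eq) auto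
    then show ?thesis unfolding m_def by (simp only: mult_ac)
  qed
qed

text \<open>With the block bound, c contains the harmonic sum L over J \<le> n \<le> m = 2^i J.
  Hoelder's inequality bounds the product of moments at m from below by the \<omega>-moment b of
  order 2 m, while c is L over a multiple of the \<omega>-moment a of order 2 J. Thus b / a is at
  most a constant over L, and duality hands the decay on to \<nu>.\<close>

lemma moment_decay_N: "moment_decay N.\<mu>"
proof -
  interpret T: weight_triple p p' O.\<mu> N.\<mu> SM by (rule triple[OF fin_SM])
  obtain D where D: "0 < D" "\<And>n::nat. power_moment N.\<mu> (real n * p) powr (1/p) * power_moment SM (real n * p') powr (1/p')
      \<le> D * power_moment O.\<mu> (2 * real n)"
    using D_const_finite D_const_finite_iff'[OF fin_SM] by blast
  \<comment> \<open>From L \<ge> i / 2 and L b \<le> 2 pi C^(1/p) a, this i gives b \<le> a /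
    2.\<close>
  obtain i :: nat where i: "8 * pi * C powr (1 / p) \<le> real i" using real_arch_simple by blast
  define c0 where "c0 = C powr (1 / p)"
  have c0: "0 < c0" using C by (simp add: c0_def)
  have ipos: "0 < real i" using i C by (intro less_le_trans[OF _ i]) auto
  have "power_moment O.\<mu> (2 * real (2 ^ i * J)) \<le> 1/2 * power_moment O.\<mu> (2 * real J)" if J: "1 \<le> J" for J
  proof -
    define m where "m = 2 ^ i * J"
    have Jm: "J \<le> m" by (simp add: m_def)
    define L where "L = (\<Sum>n=J..m. 1 / real n)"
    have L: "real i / 2 \<le> L" unfolding L_def m_def by (rule harmonic_block_ge[OF J])
    then have L0: "0 < L" using ipos by simp
    define a where "a = power_moment O.\<mu> (2 * real J)"
    define b where "b = power_moment O.\<mu> (2 * real m)"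
    have a: "0 < a" "0 < b" unfolding a_def b_def by (intro power_moment_pos O.interval_\<mu> O.thick_\<mu>; simp)+
    define c where "c = kernel_coeff O.\<mu> J * L / pi"
    have c: "0 < c" unfolding c_def using L0 kernel_coeff_pos[OF O.interval_\<mu> O.thick_\<mu>, of J] by simp
    have c_eq: "c = L / (2 * pi * a)" by (simp add: c_def kernel_coeff_def a_def)
    have "b \<le> power_moment N.\<mu> (real m * p) powr (1 / p) * power_moment SM (real m * p') powr (1 / p')"
    proof -
      have "b = (\<integral>s. s powr real m * s powr real m \<partial>O.\<mu>)"
        unfolding b_def power_moment_def by (simp flip: powr_add)
      also have "\<dots> \<le> (\<integral>s. (s powr real m) powr p \<partial>N.\<mu>) powr (1 / p) * (\<integral>s. (s powr real m) powr p' \<partial>SM) powr (1 / p')"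
        by (rule holder_measures[OF fin_SM]) (auto simp: powr_le1)
      also have "\<dots> = power_moment N.\<mu> (real m * p) powr (1 / p) * power_moment SM (real m * p') powr (1 / p')"
        by (simp add: power_moment_def powr_powr)
      finally show ?thesis .
    qed
    then have "c * b \<le> c * (power_moment N.\<mu> (real m * p) powr (1 / p) * power_moment SM (real m * p') powr (1 / p'))"
      using c by (intro mult_left_mono) auto
    also have "\<dots> \<le> c0"
      unfolding c0_def
    proof (rule moments_bound[OF c])
      show "c * r powr real m * s powr real m \<le> kernel_mean O.\<mu> (r * s)" if "0 < r" "r < 1" "0 < s" "s < 1" for r s
        unfolding c_def L_def using kernel_mean_ge_block[OF that J Jm] .
    qed
    finally have "L * b / (2 * pi * a) \<le> c0" by (simp add: c_eq)
    then have "L * b \<le> c0 * (2 * pi * a)" using a by (subst (asm) pos_divide_le_eq) auto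
    moreover have "real i / 2 * b \<le> L * b" using L a by (intro mult_right_mono) auto
    moreover have "8 * pi * c0 * a \<le> real i * a" using i a by (intro mult_right_mono) (auto simp: c0_def)
    moreover have "c0 * (2 * pi * a) = 8 * pi * c0 * a / 4" by simp
    ultimately have "real i * b \<le> real i * (a / 2)" by linarith
    then have "b \<le> a / 2" using ipos by simp
    then show ?thesis by (simp add: a_def b_def m_def)
  qed
  then show ?thesis
    by (intro T.moment_bound_imp_moment_decay[where D = D and \<kappa> = "2 ^ i"] D) auto
qed

end

lemma Pplus_bounded_imp:
  assumes "Pplus_bounded p \<omega> \<nu>"
  shows "D_const p \<omega> \<nu> < \<infinity>" "\<nu> \<in> classM"
proof -
  obtain C where C: "0 < C"
    "\<And>F r. F \<in> borel_measurable borel \<Longrightarrow> (\<And>s. 0 \<le> F s) \<Longrightarrow> (\<integral>\<^sup>+s. ennreal (F s powr p) \<partial>N.\<mu>) < \<infinity> \<Longrightarrow>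
      0 \<le> r \<Longrightarrow> r < 1 \<Longrightarrow> (\<integral>\<^sup>+s. ennreal (F s * kernel_mean O.\<mu> (r * s)) \<partial>O.\<mu>) < \<infinity>"
    "\<And>F. F \<in> borel_measurable borel \<Longrightarrow> (\<And>s. 0 \<le> F s) \<Longrightarrow> (\<integral>\<^sup>+s. ennreal (F s powr p) \<partial>N.\<mu>) < \<infinity> \<Longrightarrow>
      (\<integral>\<^sup>+r. ennreal (enn2real (\<integral>\<^sup>+s. ennreal (F s * kernel_mean O.\<mu> (r * s)) \<partial>O.\<mu>) powr p) \<partial>N.\<mu>)
        \<le> ennreal C * (\<integral>\<^sup>+s. ennreal (F s powr p) \<partial>N.\<mu>)"
    using Pplus_bounded_radial[OF assms] by blast
  show "D_const p \<omega> \<nu> < \<infinity>" by (rule D_const_finite[OF C])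
  show "\<nu> \<in> classM" unfolding classM_iff_moment_decay[OF rep_N] by (rule moment_decay_N[OF C])
qed

end

section \<open>Sufficiency\<close>

lemma dA_borel_representative:
  fixes f :: "complex \<Rightarrow> complex"
  assumes "f \<in> borel_measurable dA"
  obtains f' where "f' \<in> borel_measurable borel" "AE z in dA. f z = f' z"
proof -
  have "f \<in> borel_measurable (lebesgue_on (ball 0 1))"
    using assms unfolding dA_def by (simp only: measurable_density_eq1)
  then have g: "(\<lambda>z. indicator (ball 0 1) z *\<^sub>R f z) \<in> borel_measurable lebesgue"
    by (subst (asm) borel_measurable_restrict_space_iff) auto
  have "(\<lambda>z. Re (indicator (ball 0 1) z *\<^sub>R f z)) \<in> borel_measurable lebesgue"
    using g by measurable
  from completion_ex_borel_measurable_real[OF this]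
  obtain u where u: "u \<in> borel_measurable borel" "AE z in lborel. Re (indicator (ball 0 1) z *\<^sub>R f z) = u z"
    by auto
  have "(\<lambda>z. Im (indicator (ball 0 1) z *\<^sub>R f z)) \<in> borel_measurable lebesgue"
    using g by measurable
  from completion_ex_borel_measurable_real[OF this]
  obtain v where v: "v \<in> borel_measurable borel" "AE z in lborel. Im (indicator (ball 0 1) z *\<^sub>R f z) = v z"
    by auto
  define f' where "f' z = Complex (u z) (v z)" for z
  have [measurable]: "u \<in> borel_measurable borel" "v \<in> borel_measurable borel" by fact+
  have "f' = (\<lambda>z. of_real (u z) + \<i> * of_real (v z))" by (auto simp: f'_def complex_eq_iff)
  then have "f' \<in> borel_measurable borel" by (simp only:) measurable
  moreover have "AE z in dA. f z = f' z"
    unfolding AE_dA_iff disc_measure_def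
  proof (subst AE_density)
    show "AE z in lborel. 0 < ennreal (indicator (ball 0 1) z / pi) \<longrightarrow> z \<in> ball 0 1 \<longrightarrow> f z = f' z"
      using u(2) v(2) by eventually_elim (auto simp: f'_def complex_eq_iff)
  qed simp
  ultimately show ?thesis by (rule that)
qed

lemma AE_disc_norm:
  assumes "AE s in lborel. 0 < s \<and> s < 1 \<longrightarrow> P s"
  shows "AE z in disc_measure. P (norm z)"
proof -
  have "AE r in radial_measure. P r" using assms by (simp only: AE_radial_measure_iff)
  then show ?thesis
    by (rule AE_distrD[where M' = borel and f = norm and M = disc_measure, unfolded distr_norm_disc_measure, rotated]) simp
qed

lemma norm_radial_kernel_swap:
  assumes "interval_measure M" "thick M" "norm z < 1" "norm \<zeta> < 1"
  shows "norm (radial_kernel M (cnj z * \<zeta>)) = norm (radial_kernel M (cnj \<zeta> * z))"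
proof -
  have "norm (cnj z * \<zeta>) < 1"
    using mult_strict_mono'[of "norm z" 1 "norm \<zeta>" 1] assms by (simp add: norm_mult)
  then have "cnj (radial_kernel M (cnj z * \<zeta>)) = radial_kernel M (cnj (cnj z * \<zeta>))"
    by (rule cnj_radial_kernel[OF assms(1,2)])
  then have "cnj (radial_kernel M (cnj z * \<zeta>)) = radial_kernel M (cnj \<zeta> * z)" by (simp add: mult.commute)
  then show ?thesis by (metis complex_mod_cnj)
qed

context two_weights
begin

text \<open>Reverse doubling travels from \<nu> to \<omega> by balance and from \<omega> to \<sigma>
  by duality. This makes the upper kernel bound available, and with it the Schur integrals for the
  triple and for its swap.\<close>

lemma balanced_imp_Pplus_bounded:
  assumes fin_S: "emeasure SM UNIV < \<infinity>" and bal: "weight_triple.balanced p p' O.\<mu> N.\<mu> SM A"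
    and md: "moment_decay N.\<mu>"
  shows "Pplus_bounded p \<omega> \<nu>"
proof -
  interpret T: weight_triple p p' O.\<mu> N.\<mu> SM by (rule triple[OF fin_S])
  interpret swap: weight_triple p' p O.\<mu> SM N.\<mu> by (rule T.weight_triple_swap)
  have bal': "swap.balanced A" using bal by (simp only: T.balanced_swap)
  have rdN: "reverse_doubling N.\<mu>"
    by (rule moment_decay_imp_reverse_doubling[OF N.interval_\<mu> T.balanced_doubling_N[OF bal] md])
  have rdO: "reverse_doubling O.\<mu>" by (rule T.balanced_reverse_doubling_O[OF bal rdN])
  have rdS: "reverse_doubling SM" by (rule swap.balanced_reverse_doubling_N[OF bal' rdO])
  obtain B where B: "0 < B" "\<And>\<rho>. 0 \<le> \<rho> \<Longrightarrow> \<rho> < 1 \<Longrightarrow> kernel_mean O.\<mu> \<rho> \<le> B / upper_mass O.\<mu> \<rho>"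
    using kernel_mean_upper[OF O.interval_\<mu> O.thick_\<mu> T.doubling_O rdO] by blast
  obtain C1 where C1: "0 < C1" "\<And>r. 0 \<le> r \<Longrightarrow> r < 1 \<Longrightarrow>
    (\<integral>\<^sup>+t. ennreal (upper_mass SM t powr (- (1 / p)) * kernel_mean O.\<mu> (r * t)) \<partial>SM) \<le> ennreal (C1 * upper_mass N.\<mu> r powr (- (1 / p)))"
    using T.schur_bound[OF bal rdN B(2,1)] by blast
  obtain C2 where C2: "0 < C2" "\<And>r. 0 \<le> r \<Longrightarrow> r < 1 \<Longrightarrow>
    (\<integral>\<^sup>+t. ennreal (upper_mass N.\<mu> t powr (- (1 / p')) * kernel_mean O.\<mu> (r * t)) \<partial>N.\<mu>) \<le> ennreal (C2 * upper_mass SM r powr (- (1 / p')))"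
    using swap.schur_bound[OF bal' rdS B(2,1)] by blast
  note [measurable] = borel_measurable_radial_kernel[OF O.interval_\<mu> O.thick_\<mu>]
    borel_measurable_upper_mass[OF N.interval_\<mu>] borel_measurable_upper_mass[OF interval_S[OF fin_S]]
    borel_measurable_kernel_mean[OF O.interval_\<mu> O.thick_\<mu>]
  note S'_nn = S'_nonneg[OF fin_S]
  have S'_m [measurable]: "S' \<in> borel_measurable borel" by (rule S'_meas[OF fin_S])
  let ?TS = "upper_mass SM" and ?TN = "upper_mass N.\<mu>"
  define a where "a z \<zeta> = norm (radial_kernel O.\<mu> (cnj z * \<zeta>))" for z \<zeta>
  have a_meas [measurable]: "(\<lambda>x. a (f x) (g x)) \<in> borel_measurable M"
    if [measurable]: "f \<in> borel_measurable M" "g \<in> borel_measurable M" for f g and M :: "'z measure"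
    unfolding a_def by measurable
  have a0: "0 \<le> a z \<zeta>" for z \<zeta> by (simp add: a_def)
  \<comment> \<open>The exponent p / p' appears on the integral of v when p-th powers are taken; the
    2 is from polar coordinates.\<close>
  define c where "c = (2 * C1) powr (p / p')"
  have c: "0 < c" using C1 by (simp add: c_def)
  define K where "K = 2 * c * C2"
  have K: "0 < K" using c C2 by (simp add: K_def)
  have AE_ball: "AE z in disc_measure. norm z < 1"
    by (rule AE_disc_norm) auto
  have AE_W: "AE z in disc_measure. W (norm z) = V (norm z) powr (1 / p) * S' (norm z) powr (1 / p')"
    by (rule AE_disc_norm[OF AE_W_eq[OF fin_S]])
  have goal: "(\<forall>z\<in>ball 0 1. integrable dA (Pplus_integrand \<omega> f z)) \<and> Pplus \<omega> f \<in> Lp p \<nu> \<and>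
      Lp_norm p \<nu> (Pplus \<omega> f) \<le> ennreal (K powr (1 / p)) * Lp_norm p \<nu> f" if f: "f \<in> Lp p \<nu>" for f
  proof -
    have "f \<in> borel_measurable dA" using f by (simp add: Lp_def)
    then obtain f' where f' [measurable]: "f' \<in> borel_measurable borel" and AE_f: "AE z in dA. f z = f' z"
      by (rule dA_borel_representative)
    define x0 where "x0 = enn2real (\<integral>\<^sup>+z. ennreal (norm (f z) powr p * \<nu> z) \<partial>dA)"
    have x0: "(\<integral>\<^sup>+z. ennreal (norm (f z) powr p * \<nu> z) \<partial>dA) = ennreal x0" "0 \<le> x0"
      using f Lp_norm_finite_iff[of p \<nu> f] unfolding x0_def Lp_def by simp_all
    define h where "h \<zeta> = norm (f' \<zeta>) powr p * V (norm \<zeta>)" for \<zeta>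
    have h_meas [measurable]: "h \<in> borel_measurable borel" unfolding h_def by measurable
    have h0: "0 \<le> h \<zeta>" for \<zeta> by (simp add: h_def N.W_nonneg)
    have hx: "(\<integral>\<^sup>+\<zeta>. ennreal (h \<zeta>) \<partial>disc_measure) = ennreal x0"
    proof -
      have "(\<integral>\<^sup>+\<zeta>. ennreal (h \<zeta>) \<partial>disc_measure) = (\<integral>\<^sup>+\<zeta>. ennreal (h \<zeta>) \<partial>dA)"
        by (rule nn_integral_dA[symmetric]) measurable
      also have "\<dots> = (\<integral>\<^sup>+z. ennreal (norm (f z) powr p * \<nu> z) \<partial>dA)"
        by (rule nn_integral_cong_AE) (use AE_f N.AE_w in \<open>eventually_elim, simp add: h_def\<close>)
      finally show ?thesis by (simp only: x0)
    qed
    define q where "q z \<zeta> = norm (f' \<zeta>) * a z \<zeta> * W (norm \<zeta>)" for z \<zeta>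
    have q0: "0 \<le> q z \<zeta>" for z \<zeta> by (simp add: q_def a0 O.W_nonneg)
    define Q where "Q z = (\<integral>\<^sup>+\<zeta>. ennreal (q z \<zeta>) \<partial>disc_measure)" for z
    \<comment> \<open>\<open>enn2real\<close> sends \<infinity> to 0, so finiteness has to be known
      first. For fixed z the kernel is bounded, and Hoelder's inequality applies because \<sigma>
      has finite mass.\<close>
    have Qfin: "Q z < \<infinity>" if z: "norm z < 1" for z
    proof -
      define M where "M = (\<Sum>n. kernel_coeff O.\<mu> n * norm z ^ n)"
      have aM: "a z \<zeta> \<le> M" if "norm \<zeta> < 1" for \<zeta>
        unfolding a_def M_def using that z
        by (intro norm_radial_kernel_le O.interval_\<mu> O.thick_\<mu>) (auto simp: norm_mult mult_left_le)
      define Y where "Y = 2 * measure SM UNIV"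
      have Y: "(\<integral>\<^sup>+\<zeta>. ennreal (S' (norm \<zeta>)) \<partial>disc_measure) \<le> ennreal Y"
      proof -
        interpret sm: finite_measure SM using interval_S[OF fin_S] by (simp add: interval_measure_def)
        have "(\<integral>\<^sup>+\<zeta>. ennreal (S' (norm \<zeta>)) \<partial>disc_measure) = (\<integral>\<^sup>+r. 1 * ennreal (S' r) \<partial>radial_measure)"
          by (subst nn_integral_disc_radial) auto
        also have "\<dots> = 2 * (\<integral>\<^sup>+s. 1 \<partial>SM)"
          unfolding weight_measure_S'[OF fin_S] by (rule nn_integral_radial_measure) auto
        also have "\<dots> = ennreal Y" by (simp add: Y_def sm.emeasure_eq_measure ennreal_mult)
        finally show ?thesis by simp
      qed
      have "Q z \<le> (\<integral>\<^sup>+\<zeta>. ennreal M * ennreal (h \<zeta> powr (1 / p) * S' (norm \<zeta>) powr (1 / p')) \<partial>disc_measure)"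
        unfolding Q_def
      proof (rule nn_integral_mono_AE)
        show "AE \<zeta> in disc_measure. ennreal (q z \<zeta>) \<le> ennreal M * ennreal (h \<zeta> powr (1 / p) * S' (norm \<zeta>) powr (1 / p'))"
          using AE_W AE_ball
        proof eventually_elim
          fix \<zeta> :: complex assume W: "W (norm \<zeta>) = V (norm \<zeta>) powr (1 / p) * S' (norm \<zeta>) powr (1 / p')" and \<zeta>: "norm \<zeta> < 1"
          have M0: "0 \<le> M" using aM[OF \<zeta>] a0[of z \<zeta>] by linarith
          have "q z \<zeta> \<le> norm (f' \<zeta>) * M * W (norm \<zeta>)"
            unfolding q_def using aM[OF \<zeta>] O.W_nonneg by (intro mult_right_mono mult_left_mono) auto
          also have "\<dots> = M * (h \<zeta> powr (1 / p) * S' (norm \<zeta>) powr (1 / p'))"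
            unfolding W h_def using p by (simp add: powr_mult powr_powr)
          finally show "ennreal (q z \<zeta>) \<le> ennreal M * ennreal (h \<zeta> powr (1 / p) * S' (norm \<zeta>) powr (1 / p'))"
            using M0 by (simp add: ennreal_mult[symmetric] ennreal_leI)
        qed
      qed
      also have "\<dots> = ennreal M * (\<integral>\<^sup>+\<zeta>. ennreal (h \<zeta> powr (1 / p) * S' (norm \<zeta>) powr (1 / p')) \<partial>disc_measure)"
        by (rule nn_integral_cmult) simp
      also have "\<dots> \<le> ennreal M * ennreal (x0 powr (1 / p) * Y powr (1 / p'))"
        using hx Y h0 S'_nn x0 by (intro mult_left_mono nn_integral_Hoelder p conj_exponents) (auto simp: Y_def)
      also have "\<dots> < \<infinity>" by (simp add: ennreal_mult_less_top)
      finally show ?thesis .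
    qed
    \<comment> \<open>The \<sigma>-tail enters u with exponent 1 / p' and v with - 1 / p, so it
      cancels in u^(1/p) v^(1/p'), which is the integrand q.\<close>
    define u where "u z \<zeta> = h \<zeta> * ?TS (norm \<zeta>) powr (1 / p') * a z \<zeta>" for z \<zeta>
    define v where "v z \<zeta> = S' (norm \<zeta>) * ?TS (norm \<zeta>) powr (- (1 / p)) * a z \<zeta>" for z \<zeta>
    have uv0: "0 \<le> u z \<zeta>" "0 \<le> v z \<zeta>" for z \<zeta> by (auto simp: u_def v_def h0 S'_nn a0)
    define X where "X z = (\<integral>\<^sup>+\<zeta>. ennreal (u z \<zeta>) \<partial>disc_measure)" for z
    have step: "ennreal (enn2real (Q z) powr p * V (norm z)) \<le> X z * ennreal (c * ?TN (norm z) powr (- (1 / p')) * V (norm z))"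
      if z: "norm z < 1" for z
    proof -
      define r where "r = norm z"
      have r: "0 \<le> r" "r < 1" using z by (auto simp: r_def)
      have TN: "0 < ?TN r" using r by (intro T.upper_mass_N_pos)
      define Y where "Y = 2 * C1 * ?TN r powr (- (1 / p))"
      have Y0: "0 \<le> Y" using C1 by (simp add: Y_def)
      have vY: "(\<integral>\<^sup>+\<zeta>. ennreal (v z \<zeta>) \<partial>disc_measure) \<le> ennreal Y"
      proof -
        have "(\<integral>\<^sup>+\<zeta>. ennreal (v z \<zeta>) \<partial>disc_measure) =
          (\<integral>\<^sup>+\<zeta>. ennreal (?TS (norm \<zeta>) powr (- (1 / p))) * ennreal (S' (norm \<zeta>)) * ennreal (norm (radial_kernel O.\<mu> (cnj z * \<zeta>))) \<partial>disc_measure)"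
          by (intro nn_integral_cong) (simp add: v_def a_def ennreal_mult S'_nn mult_ac)
        also have "\<dots> = 2 * (\<integral>\<^sup>+s. ennreal (?TS s powr (- (1 / p))) * ennreal (kernel_mean O.\<mu> (norm z * s)) \<partial>SM)"
          unfolding weight_measure_S'[OF fin_S, THEN arg_cong, of "\<lambda>M. \<integral>\<^sup>+s. ennreal (?TS s powr (- (1 / p))) * ennreal (kernel_mean O.\<mu> (norm z * s)) \<partial>M"]
          by (rule nn_integral_disc_kernel[OF O.interval_\<mu> O.thick_\<mu> z]) measurable
        also have "\<dots> \<le> 2 * ennreal (C1 * ?TN r powr (- (1 / p)))"
          using C1(2)[OF r] kernel_mean_nonneg[OF O.interval_\<mu> O.thick_\<mu>]
          by (intro mult_left_mono) (auto simp: r_def ennreal_mult)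
        also have "\<dots> = ennreal Y" using C1 by (simp add: Y_def ennreal_mult mult.assoc)
        finally show ?thesis .
      qed
      show ?thesis
      proof (cases "X z")
        case (real x)
        have "Q z \<le> (\<integral>\<^sup>+\<zeta>. ennreal (u z \<zeta> powr (1 / p) * v z \<zeta> powr (1 / p')) \<partial>disc_measure)"
          unfolding Q_def
        proof (rule nn_integral_mono_AE)
          show "AE \<zeta> in disc_measure. ennreal (q z \<zeta>) \<le> ennreal (u z \<zeta> powr (1 / p) * v z \<zeta> powr (1 / p'))"
            using AE_W AE_ball
          proof eventually_elim
            fix \<zeta> :: complex assume W: "W (norm \<zeta>) = V (norm \<zeta>) powr (1 / p) * S' (norm \<zeta>) powr (1 / p')" and \<zeta>: "norm \<zeta> < 1"
            define t where "t = ?TS (norm \<zeta>)"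
            have t: "0 < t" unfolding t_def using \<zeta> by (intro swap.upper_mass_N_pos)
            have "t powr (1 / p' * (1 / p)) * t powr (- (1 / p) * (1 / p')) = 1"
              using t by (simp flip: powr_add)
            moreover have "a z \<zeta> powr (1 / p) * a z \<zeta> powr (1 / p') = a z \<zeta>"
              using conj_exponents a0[of z \<zeta>] by (simp flip: powr_add)
            moreover have "u z \<zeta> powr (1 / p) * v z \<zeta> powr (1 / p') =
              norm (f' \<zeta>) * (V (norm \<zeta>) powr (1 / p) * S' (norm \<zeta>) powr (1 / p')) *
              (t powr (1 / p' * (1 / p)) * t powr (- (1 / p) * (1 / p'))) * (a z \<zeta> powr (1 / p) * a z \<zeta> powr (1 / p'))"
              unfolding u_def v_def h_def t_def[symmetric] using p by (simp add: powr_mult powr_powr mult_ac)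
            ultimately have "u z \<zeta> powr (1 / p) * v z \<zeta> powr (1 / p') = q z \<zeta>" by (simp add: q_def W mult_ac)
            then show "ennreal (q z \<zeta>) \<le> ennreal (u z \<zeta> powr (1 / p) * v z \<zeta> powr (1 / p'))" by simp
          qed
        qed
        also have "\<dots> \<le> ennreal (x powr (1 / p) * Y powr (1 / p'))"
          using real vY uv0 Y0
          by (intro nn_integral_Hoelder p conj_exponents) (auto simp: X_def u_def v_def)
        finally have "enn2real (Q z) \<le> x powr (1 / p) * Y powr (1 / p')"
          using Y0 real(1) by (simp add: enn2real_leI)
        then have "enn2real (Q z) powr p \<le> (x powr (1 / p) * Y powr (1 / p')) powr p"
          using p by (intro powr_mono2) auto
        also have "\<dots> = x * Y powr (p / p')" using p real(1) by (simp add: powr_mult powr_powr)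
        also have "Y powr (p / p') = c * ?TN r powr (- (1 / p'))"
          unfolding Y_def powr_mult c_def using p by (simp add: powr_powr)
        finally have "enn2real (Q z) powr p * V r \<le> (x * (c * ?TN r powr (- (1 / p')))) * V r"
          using N.W_nonneg by (intro mult_right_mono)
        then show ?thesis
          using real(1) c N.W_nonneg[of r] unfolding real(2) r_def[symmetric]
          by (simp add: ennreal_mult[symmetric] ennreal_leI mult.assoc)
      next
        \<comment> \<open>An infinite \<open>X z\<close> makes the right side infinite, unless V
          vanishes at |z| and the left side is 0.\<close>
        case top
        show ?thesis
        proof (cases "V r = 0")
          case False
          then have "0 < c * ?TN r powr (- (1 / p')) * V r" using c TN N.W_nonneg[of r] by (simp add: less_le)
          then show ?thesis using c TN unfolding top r_def[symmetric] by (auto simp: ennreal_top_mult)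
        qed (simp add: r_def)
      qed
    qed
    have main: "(\<integral>\<^sup>+z. ennreal (enn2real (Q z) powr p * V (norm z)) \<partial>disc_measure) \<le> ennreal (K * x0)"
    proof -
      interpret DD: pair_sigma_finite disc_measure disc_measure ..
      define G where "G z = c * ?TN (norm z) powr (- (1 / p')) * V (norm z)" for z :: complex
      have G_meas [measurable]: "G \<in> borel_measurable borel" unfolding G_def by measurable
      have G0: "0 \<le> G z" for z using c N.W_nonneg by (simp add: G_def)
      have mp: "measurable (disc_measure \<Otimes>\<^sub>M disc_measure) N = measurable (borel \<Otimes>\<^sub>M borel) N" for N :: "ennreal measure"
        by (rule measurable_cong_sets[OF sets_pair_measure_cong refl]) simp_all
      have "(\<integral>\<^sup>+z. ennreal (enn2real (Q z) powr p * V (norm z)) \<partial>disc_measure) \<le> (\<integral>\<^sup>+z. X z * ennreal (G z) \<partial>disc_measure)"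
        by (rule nn_integral_mono_AE) (use AE_ball in \<open>eventually_elim, simp add: step G_def\<close>)
      also have "\<dots> = (\<integral>\<^sup>+z. (\<integral>\<^sup>+\<zeta>. ennreal (u z \<zeta>) * ennreal (G z) \<partial>disc_measure) \<partial>disc_measure)"
        unfolding X_def by (intro nn_integral_cong nn_integral_multc[symmetric]) (simp add: u_def)
      also have "\<dots> = (\<integral>\<^sup>+\<zeta>. (\<integral>\<^sup>+z. ennreal (u z \<zeta>) * ennreal (G z) \<partial>disc_measure) \<partial>disc_measure)"
      proof (rule DD.Fubini'[symmetric])
        show "(\<lambda>(z, \<zeta>). ennreal (u z \<zeta>) * ennreal (G z)) \<in> borel_measurable (disc_measure \<Otimes>\<^sub>M disc_measure)"
          unfolding mp u_def by measurable
      qed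
      also have "\<dots> \<le> (\<integral>\<^sup>+\<zeta>. ennreal K * ennreal (h \<zeta>) \<partial>disc_measure)"
      proof (rule nn_integral_mono_AE)
        show "AE \<zeta> in disc_measure. (\<integral>\<^sup>+z. ennreal (u z \<zeta>) * ennreal (G z) \<partial>disc_measure) \<le> ennreal K * ennreal (h \<zeta>)"
          using AE_ball
        proof eventually_elim
          fix \<zeta> :: complex assume \<zeta>: "norm \<zeta> < 1"
          \<comment> \<open>With the order of integration exchanged, the second Schur bound acts in
            z; its factor t^(-1/p') cancels t^(1/p') from u.\<close>
          define t where "t = ?TS (norm \<zeta>)"
          have t: "0 < t" unfolding t_def using \<zeta> by (intro swap.upper_mass_N_pos)
          have "(\<integral>\<^sup>+z. ennreal (u z \<zeta>) * ennreal (G z) \<partial>disc_measure) =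
            (\<integral>\<^sup>+z. ennreal (h \<zeta> * t powr (1 / p') * c) * (ennreal (?TN (norm z) powr (- (1 / p'))) * ennreal (V (norm z)) * ennreal (norm (radial_kernel O.\<mu> (cnj \<zeta> * z)))) \<partial>disc_measure)"
          proof (rule nn_integral_cong_AE)
            show "AE z in disc_measure. ennreal (u z \<zeta>) * ennreal (G z) =
               ennreal (h \<zeta> * t powr (1 / p') * c) * (ennreal (?TN (norm z) powr (- (1 / p'))) * ennreal (V (norm z)) * ennreal (norm (radial_kernel O.\<mu> (cnj \<zeta> * z))))"
              using AE_ball
            proof eventually_elim
              fix z :: complex assume z: "norm z < 1"
              have "a z \<zeta> = norm (radial_kernel O.\<mu> (cnj \<zeta> * z))"
                unfolding a_def by (rule norm_radial_kernel_swap[OF O.interval_\<mu> O.thick_\<mu> z \<zeta>])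
              then show "ennreal (u z \<zeta>) * ennreal (G z) =
                 ennreal (h \<zeta> * t powr (1 / p') * c) * (ennreal (?TN (norm z) powr (- (1 / p'))) * ennreal (V (norm z)) * ennreal (norm (radial_kernel O.\<mu> (cnj \<zeta> * z))))"
                using h0 c N.W_nonneg by (simp add: u_def G_def t_def ennreal_mult mult_ac)
            qed
          qed
          also have "\<dots> = ennreal (h \<zeta> * t powr (1 / p') * c) * (\<integral>\<^sup>+z. ennreal (?TN (norm z) powr (- (1 / p'))) * ennreal (V (norm z)) * ennreal (norm (radial_kernel O.\<mu> (cnj \<zeta> * z))) \<partial>disc_measure)"
            by (rule nn_integral_cmult) simp
          also have "(\<integral>\<^sup>+z. ennreal (?TN (norm z) powr (- (1 / p'))) * ennreal (V (norm z)) * ennreal (norm (radial_kernel O.\<mu> (cnj \<zeta> * z))) \<partial>disc_measure)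
            = 2 * (\<integral>\<^sup>+s. ennreal (?TN s powr (- (1 / p'))) * ennreal (kernel_mean O.\<mu> (norm \<zeta> * s)) \<partial>N.\<mu>)"
            by (rule nn_integral_disc_kernel[OF O.interval_\<mu> O.thick_\<mu> \<zeta>]) measurable
          also have "\<dots> \<le> 2 * ennreal (C2 * t powr (- (1 / p')))"
            using C2(2)[of "norm \<zeta>"] \<zeta> kernel_mean_nonneg[OF O.interval_\<mu> O.thick_\<mu>]
            by (intro mult_left_mono) (auto simp: t_def ennreal_mult)
          also have "ennreal (h \<zeta> * t powr (1 / p') * c) * (2 * ennreal (C2 * t powr (- (1 / p')))) = ennreal K * ennreal (h \<zeta>)"
          proof -
            have "h \<zeta> * t powr (1 / p') * c * (2 * (C2 * t powr (- (1 / p')))) = K * h \<zeta> * (t powr (1 / p') * t powr (- (1 / p')))"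
              by (simp add: K_def mult_ac)
            also have "t powr (1 / p') * t powr (- (1 / p')) = 1" using t by (simp flip: powr_add)
            finally have eq: "h \<zeta> * t powr (1 / p') * c * (2 * (C2 * t powr (- (1 / p')))) = K * h \<zeta>" by simp
            have "ennreal (h \<zeta> * t powr (1 / p') * c) * (2 * ennreal (C2 * t powr (- (1 / p')))) =
              ennreal (h \<zeta> * t powr (1 / p') * c * (2 * (C2 * t powr (- (1 / p')))))"
              using h0 c C2(1) by (simp add: ennreal_mult)
            then show ?thesis unfolding eq using K h0 by (simp add: ennreal_mult)
          qed
          finally show "(\<integral>\<^sup>+z. ennreal (u z \<zeta>) * ennreal (G z) \<partial>disc_measure) \<le> ennreal K * ennreal (h \<zeta>)"
            by (simp add: mult_left_mono)
        qed
      qed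
      also have "\<dots> = ennreal K * ennreal x0" by (simp add: nn_integral_cmult hx)
      also have "\<dots> = ennreal (K * x0)" using K x0 by (simp add: ennreal_mult)
      finally show ?thesis .
    qed
    \<comment> \<open>A Borel function on the plane that agrees with \<open>Pplus\<close> on the
      disc, which settles measurability.\<close>
    define P' where "P' z = (\<integral>\<zeta>. f' \<zeta> * of_real (a z \<zeta>) * of_real (W (norm \<zeta>)) \<partial>disc_measure)" for z
    have P'_meas [measurable]: "P' \<in> borel_measurable borel"
    proof -
      have "(\<lambda>(z, \<zeta>). f' \<zeta> * of_real (a z \<zeta>) * of_real (W (norm \<zeta>))) \<in> borel_measurable (borel \<Otimes>\<^sub>M disc_measure)"
        unfolding measurable_cong_sets[OF sets_pair_measure_cong[OF refl sets_disc_measure] refl]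
        by measurable
      then show ?thesis unfolding P'_def[abs_def] by (rule disc_measure.borel_measurable_lebesgue_integral)
    qed
    have normq: "norm (f' \<zeta> * of_real (a z \<zeta>) * of_real (W (norm \<zeta>))) = q z \<zeta>" for z \<zeta>
      by (simp add: q_def norm_mult a0 O.W_nonneg)
    have int': "integrable disc_measure (\<lambda>\<zeta>. f' \<zeta> * of_real (a z \<zeta>) * of_real (W (norm \<zeta>)))" if "norm z < 1" for z
    proof (rule integrableI_bounded)
      show "(\<integral>\<^sup>+\<zeta>. ennreal (norm (f' \<zeta> * of_real (a z \<zeta>) * of_real (W (norm \<zeta>)))) \<partial>disc_measure) < \<infinity>"
        unfolding normq using Qfin[OF that] by (simp add: Q_def)
    qed simp
    have AE_int: "AE \<zeta> in dA. Pplus_integrand \<omega> f z \<zeta> = f' \<zeta> * of_real (a z \<zeta>) * of_real (W (norm \<zeta>))" if "norm z < 1" for z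
      using O.Pplus_integrand_AE[OF that, of f] AE_f by eventually_elim (simp add: a_def)
    have integrand_meas: "Pplus_integrand \<omega> f z \<in> borel_measurable dA" if z: "norm z < 1" for z
    proof -
      have "f \<in> borel_measurable dA" using f by (simp add: Lp_def)
      moreover have "\<omega> \<in> borel_measurable dA" using O.integrable_dA_w by (rule borel_measurable_integrable)
      moreover have "(\<lambda>\<zeta>. a z \<zeta>) \<in> borel_measurable dA" by (rule borel_measurable_dA) measurable
      ultimately have "(\<lambda>\<zeta>. f \<zeta> * of_real (a z \<zeta>) * of_real (\<omega> \<zeta>)) \<in> borel_measurable dA" by measurable
      moreover have "Pplus_integrand \<omega> f z \<zeta> = f \<zeta> * of_real (a z \<zeta>) * of_real (\<omega> \<zeta>)" if "\<zeta> \<in> space dA" for \<zeta>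
        using that by (simp add: Pplus_integrand_def O.Bergman_kernel_eq[OF z] a_def)
      ultimately show ?thesis by (subst measurable_cong)
    qed
    have int: "integrable dA (Pplus_integrand \<omega> f z)" if z: "norm z < 1" for z
    proof (rule integrable_cong_AE[THEN iffD2, OF integrand_meas[OF z] _ AE_int[OF z]])
      show "(\<lambda>\<zeta>. f' \<zeta> * of_real (a z \<zeta>) * of_real (W (norm \<zeta>))) \<in> borel_measurable dA"
        by (rule borel_measurable_dA) measurable
      show "integrable dA (\<lambda>\<zeta>. f' \<zeta> * of_real (a z \<zeta>) * of_real (W (norm \<zeta>)))"
        using int'[OF z] by (subst integral_dA(2)) auto
    qed
    have P_eq: "Pplus \<omega> f z = P' z" if z: "norm z < 1" for z
    proof -
      have "Pplus \<omega> f z = (\<integral>\<zeta>. f' \<zeta> * of_real (a z \<zeta>) * of_real (W (norm \<zeta>)) \<partial>dA)"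
        unfolding Pplus_def
      proof (rule integral_cong_AE[OF integrand_meas[OF z] _ AE_int[OF z]])
        show "(\<lambda>\<zeta>. f' \<zeta> * of_real (a z \<zeta>) * of_real (W (norm \<zeta>))) \<in> borel_measurable dA"
          by (rule borel_measurable_dA) measurable
      qed
      then show ?thesis unfolding P'_def by (subst (asm) integral_dA(1)) auto
    qed
    have P_le: "norm (P' z) \<le> enn2real (Q z)" if z: "norm z < 1" for z
    proof -
      have "norm (P' z) \<le> (\<integral>\<zeta>. norm (f' \<zeta> * of_real (a z \<zeta>) * of_real (W (norm \<zeta>))) \<partial>disc_measure)"
        unfolding P'_def by (rule integral_norm_bound)
      also have "\<dots> = enn2real (Q z)"
        unfolding normq Q_def by (rule integral_eq_nn_integral) (simp add: q_def, rule AE_I2, rule q0)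
      finally show ?thesis .
    qed
    have "(\<integral>\<^sup>+z. ennreal (norm (Pplus \<omega> f z) powr p * \<nu> z) \<partial>dA) = (\<integral>\<^sup>+z. ennreal (norm (P' z) powr p * V (norm z)) \<partial>dA)"
    proof (rule nn_integral_cong_AE)
      have "AE z in dA. norm z < 1" by (rule AE_I2) simp
      with N.AE_w show "AE z in dA. ennreal (norm (Pplus \<omega> f z) powr p * \<nu> z) = ennreal (norm (P' z) powr p * V (norm z))"
        by eventually_elim (simp add: P_eq)
    qed
    also have "\<dots> = (\<integral>\<^sup>+z. ennreal (norm (P' z) powr p * V (norm z)) \<partial>disc_measure)"
      by (rule nn_integral_dA) measurable
    also have "\<dots> \<le> (\<integral>\<^sup>+z. ennreal (enn2real (Q z) powr p * V (norm z)) \<partial>disc_measure)"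
    proof (rule nn_integral_mono_AE)
      show "AE z in disc_measure. ennreal (norm (P' z) powr p * V (norm z)) \<le> ennreal (enn2real (Q z) powr p * V (norm z))"
        using AE_ball
        by eventually_elim (use P_le N.W_nonneg p in \<open>auto intro!: ennreal_leI mult_right_mono powr_mono2\<close>)
    qed
    also note main
    finally have final: "(\<integral>\<^sup>+z. ennreal (norm (Pplus \<omega> f z) powr p * \<nu> z) \<partial>dA) \<le> ennreal (K * x0)" .
    have "Pplus \<omega> f \<in> borel_measurable dA"
      using borel_measurable_dA[OF P'_meas] by (subst measurable_cong[where g = P']) (auto simp: P_eq)
    moreover have "Lp_norm p \<nu> (Pplus \<omega> f) < \<infinity>"
      unfolding Lp_norm_finite_iff using final by (rule le_less_trans) simp
    moreover have "Lp_norm p \<nu> (Pplus \<omega> f) \<le> ennreal (K powr (1 / p)) * Lp_norm p \<nu> f"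
      using Lp_norm_le_iff[OF p x0, of "K powr (1 / p)" "Pplus \<omega> f"] final K p by (simp add: powr_powr)
    ultimately show ?thesis using int by (auto simp: Lp_def)
  qed
  show ?thesis unfolding Pplus_bounded_def
  proof (intro exI ballI)
    fix f assume "f \<in> Lp p \<nu>"
    then show "(\<forall>z\<in>ball 0 1. integrable dA (Pplus_integrand \<omega> f z)) \<and> Pplus \<omega> f \<in> Lp p \<nu> \<and>
      Lp_norm p \<nu> (Pplus \<omega> f) \<le> ennreal (K powr (1 / p)) * Lp_norm p \<nu> f" by (rule goal)
  qed
qed

text \<open>One term of a supremum suffices to exclude an infinite mass of \<sigma>, as a positive
  factor and a finite denominator cannot compensate for it.\<close>

lemma ennreal_term_finite:
  assumes "ennreal a * ennpowr X b / ennreal d < \<infinity>" "0 < a"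
  shows "X < \<infinity>"
proof (rule ccontr)
  assume "\<not> X < \<infinity>"
  then have "X = top" by (simp add: less_top[symmetric])
  with assms show False by (simp add: ennreal_mult_top ennreal_top_divide)
qed

lemma A_const_finite_imp: "A_const p \<omega> \<nu> < \<infinity> \<Longrightarrow> emeasure SM UNIV < \<infinity>"
proof -
  assume fin: "A_const p \<omega> \<nu> < \<infinity>"
  have N: "0 < upper_mass N.\<mu> 0" using N.thick_\<mu> by (simp add: thick_def)
  have "ennreal (upper_mass N.\<mu> 0 powr (1 / p)) * ennpowr (emeasure SM UNIV) (1 / p') / ennreal (upper_mass O.\<mu> 0) =
    ennpowr (tail (\<lambda>z. ennreal (\<nu> z)) 0) (1 / p) * ennpowr (tail (sigma_weight p \<omega> \<nu>) 0) (1 / p') / tail (\<lambda>z. ennreal (\<omega> z)) 0"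
    using N by (simp add: tail_O tail_N tail_S emeasure_SM_UNIV)
  also have "\<dots> \<le> A_const p \<omega> \<nu>" unfolding A_const_def by (rule SUP_upper) simp
  also note fin
  finally show ?thesis by (rule ennreal_term_finite) (use N in simp)
qed

lemma D_const_finite_imp: "D_const p \<omega> \<nu> < \<infinity> \<Longrightarrow> emeasure SM UNIV < \<infinity>"
proof -
  assume fin: "D_const p \<omega> \<nu> < \<infinity>"
  have N: "0 < power_moment N.\<mu> 0" by (intro power_moment_pos N.interval_\<mu> N.thick_\<mu>) simp
  have SM: "(\<integral>\<^sup>+s. ennreal (s powr 0) \<partial>SM) = emeasure SM UNIV"
  proof -
    have "(\<integral>\<^sup>+s. ennreal (s powr 0) \<partial>SM) = (\<integral>\<^sup>+s. 1 \<partial>SM)"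
      by (rule nn_integral_cong_AE) (use AE_weight_measure[OF S_meas] in eventually_elim, simp)
    then show ?thesis by simp
  qed
  have "ennreal (power_moment N.\<mu> 0 powr (1 / p)) * ennpowr (emeasure SM UNIV) (1 / p') / ennreal (power_moment O.\<mu> 0) =
    ennpowr (moment (\<lambda>z. ennreal (\<nu> z)) (real 0 * p + 1)) (1 / p) *
        ennpowr (moment (sigma_weight p \<omega> \<nu>) (real 0 * p' + 1)) (1 / p') / moment (\<lambda>z. ennreal (\<omega> z)) (2 * real 0 + 1)"
    using N moment_weight[OF rep_O, of 0] moment_weight[OF rep_N, of 0] moment_S[of 0, unfolded SM] by simp
  also have "\<dots> \<le> D_const p \<omega> \<nu>" unfolding D_const_def by (rule SUP_upper) simp
  also note fin
  finally show ?thesis by (rule ennreal_term_finite) (use N in simp)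
qed

text \<open>At r = 0 the summand 1 keeps the first factor away from 0, so the \<sigma>-factor must
  be finite.\<close>

lemma M_const_finite_imp: "M_const p \<omega> \<nu> < \<infinity> \<Longrightarrow> emeasure SM UNIV < \<infinity>"
proof -
  assume fin: "M_const p \<omega> \<nu> < \<infinity>"
  let ?I = "\<integral>\<^sup>+s\<in>{0..0}. ennreal (\<nu> (of_real s) * s) / ennpowr (tail (\<lambda>z. ennreal (\<omega> z)) s) p \<partial>lebesgue"
  have "ennpowr (?I + 1) (1 / p) * ennpowr (tail (sigma_weight p \<omega> \<nu>) 0) (1 / p') \<le> M_const p \<omega> \<nu>"
    unfolding M_const_def by (rule SUP_upper) simp
  also note fin
  finally have lt: "ennpowr (?I + 1) (1 / p) * ennpowr (emeasure SM UNIV) (1 / p') < \<infinity>"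
    by (simp add: tail_S emeasure_SM_UNIV)
  have "ennpowr (?I + 1) (1 / p) \<noteq> 0"
  proof (cases "?I")
    case (real x)
    have "ennreal x + 1 = ennreal (x + 1)" using real by (simp add: ennreal_plus)
    then show ?thesis using real by (simp only: ennpowr_ennreal) simp
  qed simp
  show ?thesis
  proof (rule ccontr)
    assume "\<not> emeasure SM UNIV < \<infinity>"
    then have "emeasure SM UNIV = top" by (simp add: less_top[symmetric])
    with lt \<open>ennpowr (?I + 1) (1 / p) \<noteq> 0\<close> show False by (simp only: ennpowr_top) (simp add: ennreal_mult_eq_top_iff)
  qed
qed

text \<open>The implications are: boundedness gives D and the class M; D gives A; A with the class M
  gives boundedness; under the class M, A and M are equivalent. Each depends on the finite mass of
  \<sigma>, without which there is no triple.\<close>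

theorem equivalences:
  "(Pplus_bounded p \<omega> \<nu> \<longleftrightarrow> D_const p \<omega> \<nu> < \<infinity> \<and> \<nu> \<in> classM) \<and>
   (Pplus_bounded p \<omega> \<nu> \<longleftrightarrow> A_const p \<omega> \<nu> < \<infinity> \<and> \<nu> \<in> classM) \<and>
   (Pplus_bounded p \<omega> \<nu> \<longleftrightarrow> M_const p \<omega> \<nu> < \<infinity> \<and> \<nu> \<in> classM)"
proof -
  have DA: "A_const p \<omega> \<nu> < \<infinity>" if D: "D_const p \<omega> \<nu> < \<infinity>"
  proof -
    note fS = D_const_finite_imp[OF D]
    interpret T: weight_triple p p' O.\<mu> N.\<mu> SM by (rule triple[OF fS])
    obtain c where "0 < c" "\<And>n::nat. power_moment N.\<mu> (real n * p) powr (1/p) * power_moment SM (real n * p') powr (1/p')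
      \<le> c * power_moment O.\<mu> (2 * real n)"
      using D D_const_finite_iff'[OF fS] by blast
    then have "\<exists>A. T.balanced A" by (intro T.moment_bound_imp_balanced[of c]) auto
    then show ?thesis by (simp only: A_const_finite_iff'[OF fS])
  qed
  have A_P: "Pplus_bounded p \<omega> \<nu>" if A: "A_const p \<omega> \<nu> < \<infinity>" and M: "\<nu> \<in> classM"
  proof -
    note fS = A_const_finite_imp[OF A]
    obtain B where "weight_triple.balanced p p' O.\<mu> N.\<mu> SM B"
      using A A_const_finite_iff'[OF fS] by blast
    then show ?thesis
      using M unfolding classM_iff_moment_decay[OF rep_N] by (intro balanced_imp_Pplus_bounded[OF fS])
  qed
  have AM: "M_const p \<omega> \<nu> < \<infinity>" if A: "A_const p \<omega> \<nu> < \<infinity>" and M: "\<nu> \<in> classM"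
  proof -
    note fS = A_const_finite_imp[OF A]
    interpret T: weight_triple p p' O.\<mu> N.\<mu> SM by (rule triple[OF fS])
    interpret swap: weight_triple p' p O.\<mu> SM N.\<mu> by (rule T.weight_triple_swap)
    obtain B where B: "T.balanced B" using A A_const_finite_iff'[OF fS] by blast
    then have B': "swap.balanced B" by (simp only: T.balanced_swap)
    have rdN: "reverse_doubling N.\<mu>"
      using M unfolding classM_iff_moment_decay[OF rep_N]
      by (rule moment_decay_imp_reverse_doubling[OF N.interval_\<mu> T.balanced_doubling_N[OF B]])
    have rdS: "reverse_doubling SM"
      by (rule swap.balanced_reverse_doubling_N[OF B' T.balanced_reverse_doubling_O[OF B rdN]])
    obtain C where C: "0 < C" "\<And>r. 0 \<le> r \<Longrightarrow> r < 1 \<Longrightarrow>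
      (\<integral>\<^sup>+t. ennreal (indicator {..r} t * upper_mass O.\<mu> t powr (- p)) \<partial>N.\<mu>) \<le> ennreal (C * upper_mass SM r powr (- (p / p')))"
      using T.balanced_imp_muckenhoupt[OF B rdS] by blast
    \<comment> \<open>The second summand absorbs the + 1 in M, since the \<sigma>-tail at 0 is at
      least the one at r.\<close>
    define c where "c = C + upper_mass SM 0 powr (p / p')"
    have c0: "0 < c" using C by (simp add: c_def add_pos_nonneg)
    have "M_const p \<omega> \<nu> \<le> ennreal (c powr (1 / p))"
      unfolding M_const_def
    proof (rule SUP_least)
      fix r :: real assume "r \<in> {0..<1}"
      then have r: "0 \<le> r" "r < 1" by auto
      define I where "I = (\<integral>t. indicator {..r} t * upper_mass O.\<mu> t powr (- p) \<partial>N.\<mu>)"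
      have I0: "0 \<le> I" unfolding I_def by (rule integral_nonneg_AE) (auto simp: indicator_def)
      define t where "t = upper_mass SM r"
      have t: "0 < t" unfolding t_def using r by (intro swap.upper_mass_N_pos)
      have "ennreal I = (\<integral>\<^sup>+t. ennreal (indicator {..r} t * upper_mass O.\<mu> t powr (- p)) \<partial>N.\<mu>)"
        unfolding I_def
      proof (rule nn_integral_eq_integral[symmetric])
        show "integrable N.\<mu> (\<lambda>t. indicator {..r} t * upper_mass O.\<mu> t powr (- p))"
          using borel_measurable_upper_mass[OF O.interval_\<mu>] r p T.upper_mass_O_pos
          by (intro integrable_bounded_interval[OF N.interval_\<mu>, where B = "upper_mass O.\<mu> r powr (- p)"])
             (auto simp: indicator_def intro!: powr_mono2' upper_mass_antimono O.interval_\<mu>)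
      qed (auto simp: indicator_def)
      then have "ennreal I \<le> ennreal (C * t powr (- (p / p')))" using C(2)[OF r] by (simp add: t_def)
      then have I: "I \<le> C * t powr (- (p / p'))" using C by (simp add: ennreal_le_iff)
      have "1 = t powr (p / p') * t powr (- (p / p'))" using t by (simp flip: powr_add)
      also have "\<dots> \<le> upper_mass SM 0 powr (p / p') * t powr (- (p / p'))"
        using t r p p'_gt_1 by (intro mult_right_mono powr_mono2) (auto simp: t_def intro!: upper_mass_antimono interval_S[OF fS])
      finally have "I + 1 \<le> c * t powr (- (p / p'))" using I by (simp add: c_def algebra_simps)
      then have "(I + 1) powr (1 / p) \<le> (c * t powr (- (p / p'))) powr (1 / p)"
        using I0 p by (intro powr_mono2) auto
      also have "\<dots> = c powr (1 / p) * t powr (- (1 / p'))"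
        using p by (simp add: powr_mult powr_powr)
      finally have "(I + 1) powr (1 / p) * t powr (1 / p') \<le> c powr (1 / p) * t powr (- (1 / p')) * t powr (1 / p')"
        by (rule mult_right_mono) simp
      also have "\<dots> = c powr (1 / p)" using t by (simp add: mult.assoc flip: powr_add)
      finally show "ennpowr ((\<integral>\<^sup>+s\<in>{0..r}. ennreal (\<nu> (of_real s) * s) /
              ennpowr (tail (\<lambda>z. ennreal (\<omega> z)) s) p \<partial>lebesgue) + 1) (1 / p) *
        ennpowr (tail (sigma_weight p \<omega> \<nu>) r) (1 / p') \<le> ennreal (c powr (1 / p))"
        unfolding M_const_term[OF fS r] I_def t_def by (rule ennreal_leI)
    qed
    then show ?thesis by (rule le_less_trans) simp
  qed
  have MA: "A_const p \<omega> \<nu> < \<infinity>" if Mc: "M_const p \<omega> \<nu> < \<infinity>" and M: "\<nu> \<in> classM"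
  proof -
    note fS = M_const_finite_imp[OF Mc]
    interpret T: weight_triple p p' O.\<mu> N.\<mu> SM by (rule triple[OF fS])
    have "\<exists>A. T.balanced A"
    proof (rule T.muckenhoupt_imp_balanced)
      show "moment_decay N.\<mu>" using M by (simp only: classM_iff_moment_decay[OF rep_N])
      fix r :: real assume r: "0 \<le> r" "r < 1"
      have "ennreal (((\<integral>t. indicator {..r} t * upper_mass O.\<mu> t powr (- p) \<partial>N.\<mu>) + 1) powr (1/p) * upper_mass SM r powr (1/p')) \<le> M_const p \<omega> \<nu>"
        unfolding M_const_term[OF fS r, symmetric] M_const_def using r by (intro SUP_upper) auto
      also have "\<dots> = ennreal (enn2real (M_const p \<omega> \<nu>))" using Mc by simp
      finally show "((\<integral>t. indicator {..r} t * upper_mass O.\<mu> t powr (- p) \<partial>N.\<mu>) + 1) powr (1/p) * upper_mass SM r powr (1/p') \<le> enn2real (M_const p \<omega> \<nu>)"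
        by (subst (asm) ennreal_le_iff) auto
    qed
    then show ?thesis by (simp only: A_const_finite_iff'[OF fS])
  qed
  show ?thesis using Pplus_bounded_imp DA A_P AM MA by blast
qed

end

theorem theorem3:
  fixes p :: real and \<omega> \<nu> :: "complex \<Rightarrow> real"
  assumes "1 < p" and "\<omega> \<in> Dhat" and "radial_weight \<nu>"
  shows "(Pplus_bounded p \<omega> \<nu> \<longleftrightarrow> D_const p \<omega> \<nu> < \<infinity> \<and> \<nu> \<in> classM) \<and>
         (Pplus_bounded p \<omega> \<nu> \<longleftrightarrow> A_const p \<omega> \<nu> < \<infinity> \<and> \<nu> \<in> classM) \<and>
         (Pplus_bounded p \<omega> \<nu> \<longleftrightarrow> M_const p \<omega> \<nu> < \<infinity> \<and> \<nu> \<in> classM)"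
proof -
  have \<omega>: "radial_weight \<omega>" using assms(2) by (simp add: Dhat_def)
  obtain W where W: "W \<in> borel_measurable borel" "\<And>r. 0 \<le> W r"
    "AE r in lborel. 0 < r \<and> r < 1 \<longrightarrow> \<omega> (of_real r) = W r" "AE z in dA. \<omega> z = W (norm z)"
    using radial_borel_representative[OF \<omega>] by blast
  obtain V where V: "V \<in> borel_measurable borel" "\<And>r. 0 \<le> V r"
    "AE r in lborel. 0 < r \<and> r < 1 \<longrightarrow> \<nu> (of_real r) = V r" "AE z in dA. \<nu> z = V (norm z)"
    using radial_borel_representative[OF assms(3)] by blast
  interpret two_weights \<omega> \<nu> W V p
    by unfold_locales (use \<omega> W V assms in blast)+
  show ?thesis by (rule equivalences)
qed

end
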